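(* Let $X_1,\dots,X_q$ be $C^1$ vector fields on a $C^2$ manifold $\mathfrak M$, let $p\in\mathfrak M$, let $Z=\{y\in\mathfrak M:\rho(p,y)<\infty\}$ with the topology induced by the metric $\rho$ (the sub-Riemannian distance of $X_1,\dots,X_q$), and let $M\subseteq Z$ be a connected open subset of $Z$ containing $p$. Assume that $[X_i,X_j]=\sum_{k=1}^q a_{i,j}^kX_k$ on $M$ for some locally bounded functions $a_{i,j}^k:M\to\mathbb R$, so that $M$ carries its canonical $C^2$ manifold structure, for which $X_1,\dots,X_q$ are $C^1$ vector fields on $M$ spanning the tangent space at every point. Let $n=\dim M$. Then the following two conditions are equivalent: (i) There is a real analytic atlas on $M$, compatible with its $C^2$ structure, such that $X_1,\dots,X_q$ are real analytic with respect to this atlas. (ii) For each $x_0\in M$, any of the following three (mutually equivalent) conditions holds: (ii.1) there exist an open neighborhood $V\subseteq M$ of $x_0$ and a $C^2$ diffeomorphism $\Phi:U\to V$, $U\subseteq\mathbb R^n$ open, with $\Phi^*X_1,\dots,\Phi^*X_q\in C^\omega(U;\mathbb R^n)$; (ii.2) after reordering the vector fields so that $X_1(x_0),\dots,X_n(x_0)$ are linearly independent, there is an open neighborhood $V\subseteq M$ of $x_0$ such that $[X_i,X_j]=\sum_{k=1}^n\hat c_{i,j}^kX_k$ on $V$ for $1\le i,j\le n$ with $\hat c_{i,j}^k\in C_X^\omega(V)$, and $X_j=\sum_{k=1}^nb_j^kX_k$ on $V$ for $n+1\le j\le q$ with $b_j^k\in C_X^\omega(V)$; (ii.3) there is an open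 neighborhood $V\subseteq M$ of $x_0$ such that $[X_i,X_j]=\sum_{k=1}^qc_{i,j}^kX_k$ on $V$ for $1\le i,j\le q$ with $c_{i,j}^k\in C_X^\omega(V)$. Furthermore, under these conditions, the real analytic manifold structure on $M$ induced by the atlas in (i) is unique, in the sense that if there is another real analytic atlas on $M$, compatible with its $C^2$ structure and such that $X_1,\dots,X_q$ are real analytic with respect to this second atlas, then the identity map $M\to M$ is a real analytic diffeomorphism between these two real analytic structures on $M$.
   Context: **Sub-Riemannian distance.** For $C^1$ vector fields $X_1,\dots,X_q$ on a $C^2$ manifold $\mathfrak M$, $x\in \mathfrak M$, $\delta>0$, let $B_X(x,\delta)$ be the set of $y\in \mathfrak M$ for which there is $\gamma:[0,1]\to \mathfrak M$ with $\gamma(0)=x$, $\gamma(1)=y$, $\gamma'(t)=\sum_{j=1}^q a_j(t)\,\delta X_j(\gamma(t))$, $a_j\in L^\infty([0,1])$, $\big\|\sum_j|a_j|^2\big\|_{L^\infty}<1$ (here $\gamma$ is absolutely continuous in local $C^2$ charts and the equation holds for almost every $t$). Put $\rho(x,y)=\inf\{\delta>0:y\in B_X(x,\delta)\}$ ($=\infty$ if there is no such $\delta$). **The $C^2$ structure on $M$.** It is a known fact that, under the stated assumption (commutators are combinations of $X_1,\dots,X_q$ with locally bounded coefficients on $M$), there is a $C^2$ manifold structure on $M$, compatible with its topology, such that the inclusion $M\hookrightarrow\mathfrak M$ is a $C^2$ injective immersion and $X_1,\dots,X_q$ are $C^1$ vector fields tangent to $M$ which span the tangent space at every point of $M$; this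 structure is unique. $M$ is given this structure. **Function spaces on $\mathbb R^n$.** For $U\subseteq\mathbb R^n$ open, $r>0$ and a Banach space $E$, $C^{\omega,r}(U;E)$ is the space of $f\in C^\infty(U;E)$ with $\sum_{\alpha\in\mathbb N^n}\frac{r^{|\alpha|}}{\alpha!}\sup_{x\in U}\|\partial_x^\alpha f(x)\|_E<\infty$, and $C^\omega(U;E)=\bigcup_{r>0}C^{\omega,r}(U;E)$. A vector field $\sum_ja_j\partial_{x_j}$ on $U$ is identified with the function $(a_1,\dots,a_n):U\to\mathbb R^n$. **Function spaces with respect to $X$.** For a $C^1$ vector field $W$, $Wf(x):=\frac{d}{dt}\big|_{t=0}f(e^{tW}x)$ (classical derivative, required to exist at each point), and compositions are defined iteratively. For an ordered multi-index $\alpha$ (a finite list of elements of $\{1,\dots,q\}$ of length $|\alpha|$), $X^\alpha$ denotes the corresponding composition, e.g. $X^{(2,1,3)}=X_2X_1X_3$. For $V\subseteq M$ open and $r>0$, $C^{\omega,r}_X(V)$ is the space of bounded continuous $f$ on $V$ such that $X^\alpha f$ exists and is continuous on $V$ for every ordered multi-index $\alpha$ and $\sum_{m=0}^\infty\frac{r^m}{m!}\sum_{|\alpha|=m}\sup_V|X^\alpha f|<\infty$. $C^\omega_X(V)=\bigcup_{r>0}C_X^{\omega,r}(V)$. *)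

theory Defs
  imports "HOL-Analysis.Analysis" "HOL-Probability.Essential_Supremum"
begin

text \<open>
  Since the dimension of the leaf is not known in advance and may be zero, \<open>\<real>\<^sup>n\<close> is the library's
  \<^term>\<open>Euclidean_space n\<close>: functions \<open>nat \<Rightarrow> real\<close> vanishing at all indices \<open>\<ge> n\<close>, with the product
  topology. Indices are zero-based throughout: coordinates are \<open>i < n\<close>, vector fields are \<open>X j\<close>
  with \<open>j < q\<close>.
\<close>

section \<open>Calculus on open subsets of \<open>\<real>\<^sup>n\<close>\<close>

type_synonym rn = "nat \<Rightarrow> real"

definition partial :: "nat \<Rightarrow> (rn \<Rightarrow> real) \<Rightarrow> rn \<Rightarrow> real" where
  "partial i f x = deriv (\<lambda>t. f (x(i := t))) (x i)"

text \<open>All partial derivatives of order \<open>\<le> k\<close> exist and are continuous (\<open>U\<close> open in \<^term>\<open>Euclidean_space n\<close>).\<close>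

primrec C_k_on :: "nat \<Rightarrow> nat \<Rightarrow> rn set \<Rightarrow> (rn \<Rightarrow> real) \<Rightarrow> bool" where
  "C_k_on 0 n U f \<longleftrightarrow> continuous_on U f"
| "C_k_on (Suc k) n U f \<longleftrightarrow> continuous_on U f \<and>
     (\<forall>i<n. (\<forall>x\<in>U. (\<lambda>t. f (x(i := t))) field_differentiable at (x i)) \<and>
            C_k_on k n U (partial i f))"

definition multiindices :: "nat \<Rightarrow> (nat \<Rightarrow> nat) set" where
  "multiindices n = {\<alpha>. \<forall>i\<ge>n. \<alpha> i = 0}"

definition partial_multi :: "nat \<Rightarrow> (nat \<Rightarrow> nat) \<Rightarrow> (rn \<Rightarrow> real) \<Rightarrow> rn \<Rightarrow> real" where
  "partial_multi n \<alpha> f = fold (\<lambda>i. partial i ^^ \<alpha> i) [0..<n] f"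

definition real_analytic_on :: "nat \<Rightarrow> rn set \<Rightarrow> (rn \<Rightarrow> real) \<Rightarrow> bool" where
  "real_analytic_on n U f \<longleftrightarrow>
     (\<forall>x\<in>U. \<exists>c. \<exists>e>0. \<forall>y\<in>topspace (Euclidean_space n). (\<forall>i<n. \<bar>y i - x i\<bar> < e) \<longrightarrow>
        ((\<lambda>\<alpha>. c \<alpha> * (\<Prod>i<n. (y i - x i) ^ \<alpha> i)) has_sum f y) (multiindices n))"

text \<open>\<open>C\<^sup>\<omega>\<^sup>,\<^sup>r(U; \<real>\<^sup>m)\<close> and \<open>C\<^sup>\<omega>(U; \<real>\<^sup>m)\<close>, where \<open>U \<subseteq> \<real>\<^sup>n\<close> is open and \<open>\<real>\<^sup>m\<close> has the Euclidean norm.\<close>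

definition C_omega_r :: "nat \<Rightarrow> nat \<Rightarrow> real \<Rightarrow> rn set \<Rightarrow> (rn \<Rightarrow> rn) \<Rightarrow> bool" where
  "C_omega_r n m r U F \<longleftrightarrow>
     (\<forall>i<m. \<forall>k. C_k_on k n U (\<lambda>x. F x i)) \<and>
     (\<Sum>\<^sub>\<infinity>\<alpha>\<in>multiindices n. ennreal (r ^ (\<Sum>i<n. \<alpha> i) / (\<Prod>i<n. fact (\<alpha> i))) *
        (SUP x\<in>U. ennreal (L2_set (\<lambda>i. partial_multi n \<alpha> (\<lambda>z. F z i) x) {..<m}))) < \<infinity>"

definition C_omega :: "nat \<Rightarrow> nat \<Rightarrow> rn set \<Rightarrow> (rn \<Rightarrow> rn) \<Rightarrow> bool" where
  "C_omega n m U F \<longleftrightarrow> (\<exists>r>0. C_omega_r n m r U F)"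

section \<open>Charts, atlases, manifolds\<close>

text \<open>
  A chart is a pair of its domain and its coordinate map; values of the coordinate map
  outside the domain carry no meaning. A regularity class \<open>R n U f\<close> (for example \<^term>\<open>C_k_on 2\<close> or
  \<^term>\<open>real_analytic_on\<close>) is a condition on \<open>f : U \<rightarrow> \<real>\<close> for \<open>U \<subseteq> \<real>\<^sup>n\<close> open.
\<close>

type_synonym 'a chart = "'a set \<times> ('a \<Rightarrow> rn)"
type_synonym regularity = "nat \<Rightarrow> rn set \<Rightarrow> (rn \<Rightarrow> real) \<Rightarrow> bool"

definition chart_inv :: "'a chart \<Rightarrow> rn \<Rightarrow> 'a" where
  "chart_inv c = inv_into (fst c) (snd c)"

definition is_chart :: "nat \<Rightarrow> 'a topology \<Rightarrow> 'a chart \<Rightarrow> bool" where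
  "is_chart n T c \<longleftrightarrow> openin T (fst c) \<and> openin (Euclidean_space n) (snd c ` fst c) \<and>
     homeomorphic_map (subtopology T (fst c)) (subtopology (Euclidean_space n) (snd c ` fst c)) (snd c)"

definition in_coords :: "'a chart \<Rightarrow> 'b chart \<Rightarrow> ('a \<Rightarrow> 'b) \<Rightarrow> rn \<Rightarrow> rn" where
  "in_coords c d F = snd d \<circ> F \<circ> chart_inv c"

definition compatible_charts :: "regularity \<Rightarrow> nat \<Rightarrow> 'a chart \<Rightarrow> 'a chart \<Rightarrow> bool" where
  "compatible_charts R n c d \<longleftrightarrow>
     (\<forall>i<n. R n (snd c ` (fst c \<inter> fst d)) (\<lambda>x. in_coords c d id x i) \<and>
            R n (snd d ` (fst c \<inter> fst d)) (\<lambda>x. in_coords d c id x i))"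

definition is_atlas :: "regularity \<Rightarrow> nat \<Rightarrow> 'a topology \<Rightarrow> 'a chart set \<Rightarrow> bool" where
  "is_atlas R n T A \<longleftrightarrow> (\<forall>c\<in>A. is_chart n T c) \<and> \<Union> (fst ` A) = topspace T \<and>
     (\<forall>c\<in>A. \<forall>d\<in>A. compatible_charts R n c d)"

text \<open>A differentiable structure is a maximal atlas.\<close>

definition is_manifold :: "regularity \<Rightarrow> nat \<Rightarrow> 'a topology \<Rightarrow> 'a chart set \<Rightarrow> bool" where
  "is_manifold R n T A \<longleftrightarrow> Hausdorff_space T \<and> second_countable T \<and> is_atlas R n T A \<and>
     (\<forall>c. is_chart n T c \<and> (\<forall>d\<in>A. compatible_charts R n c d) \<longrightarrow> c \<in> A)"

text \<open>
  \<open>F\<close> maps \<open>T\<close> (dimension \<open>n\<close>, atlas \<open>A\<close>) to \<open>S\<close> (dimension \<open>m\<close>, atlas \<open>B\<close>). An open subset of a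
  manifold is treated by shrinking the topology and keeping the atlas, hence the
  intersections with \<^term>\<open>topspace T\<close>.
\<close>

definition regular_map ::
  "regularity \<Rightarrow> 'a topology \<Rightarrow> nat \<Rightarrow> 'a chart set \<Rightarrow> 'b topology \<Rightarrow> nat \<Rightarrow> 'b chart set \<Rightarrow>
   ('a \<Rightarrow> 'b) \<Rightarrow> bool" where
  "regular_map R T n A S m B F \<longleftrightarrow> continuous_map T S F \<and>
     (\<forall>c\<in>A. \<forall>d\<in>B. \<forall>i<m.
        R n (snd c ` {y \<in> topspace T \<inter> fst c. F y \<in> fst d}) (\<lambda>x. in_coords c d F x i))"

definition diffeo ::
  "regularity \<Rightarrow> 'a topology \<Rightarrow> nat \<Rightarrow> 'a chart set \<Rightarrow> 'b topology \<Rightarrow> nat \<Rightarrow> 'b chart set \<Rightarrow>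
   ('a \<Rightarrow> 'b) \<Rightarrow> ('b \<Rightarrow> 'a) \<Rightarrow> bool" where
  "diffeo R T n A S m B F G \<longleftrightarrow> homeomorphic_maps T S F G \<and>
     regular_map R T n A S m B F \<and> regular_map R S m B T n A G"

section \<open>Vector fields\<close>

text \<open>
  A vector field is given by its components in every chart of the manifold: \<open>X c y i\<close> is the
  \<open>i\<close>-th component at the point \<open>y\<close> with respect to the chart \<open>c\<close>. Only the values for \<open>c\<close> in the
  atlas, \<open>y\<close> in the domain of \<open>c\<close> and \<open>i\<close> below the dimension carry meaning.
\<close>

type_synonym 'a vfield = "'a chart \<Rightarrow> 'a \<Rightarrow> rn"

definition differential :: "nat \<Rightarrow> 'a chart \<Rightarrow> 'b chart \<Rightarrow> ('a \<Rightarrow> 'b) \<Rightarrow> 'a \<Rightarrow> rn \<Rightarrow> rn" where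
  "differential n c d F y v = (\<lambda>i. \<Sum>j<n. partial j (\<lambda>x. in_coords c d F x i) (snd c y) * v j)"

text \<open>\<open>dF(y) X(y) = Y(F y)\<close> for all \<open>y\<close>. For \<open>F = id\<close> and one atlas this is the transformation law
  of the components of a vector field; for a diffeomorphism \<open>F\<close> it says \<open>X = F\<^sup>* Y\<close>.\<close>

definition F_related ::
  "'a topology \<Rightarrow> nat \<Rightarrow> 'a chart set \<Rightarrow> nat \<Rightarrow> 'b chart set \<Rightarrow> ('a \<Rightarrow> 'b) \<Rightarrow>
   'a vfield \<Rightarrow> 'b vfield \<Rightarrow> bool" where
  "F_related T n A m B F X Y \<longleftrightarrow>
     (\<forall>c\<in>A. \<forall>d\<in>B. \<forall>y \<in> topspace T \<inter> fst c. F y \<in> fst d \<longrightarrow>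
        (\<forall>i<m. Y d (F y) i = differential n c d F y (X c y) i))"

definition regular_components :: "regularity \<Rightarrow> nat \<Rightarrow> 'a chart set \<Rightarrow> 'a vfield \<Rightarrow> bool" where
  "regular_components R n A X \<longleftrightarrow>
     (\<forall>c\<in>A. \<forall>i<n. R n (snd c ` fst c) (\<lambda>x. X c (chart_inv c x) i))"

definition vector_field ::
  "regularity \<Rightarrow> 'a topology \<Rightarrow> nat \<Rightarrow> 'a chart set \<Rightarrow> 'a vfield \<Rightarrow> bool" where
  "vector_field R T n A X \<longleftrightarrow> F_related T n A n A id X X \<and> regular_components R n A X"

definition lie_bracket :: "nat \<Rightarrow> 'a vfield \<Rightarrow> 'a vfield \<Rightarrow> 'a vfield" where
  "lie_bracket n X Y = (\<lambda>c y k. \<Sum>l<n.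
      X c y l * partial l (\<lambda>x. Y c (chart_inv c x) k) (snd c y) -
      Y c y l * partial l (\<lambda>x. X c (chart_inv c x) k) (snd c y))"

text \<open>\<open>W = \<Sum>\<^sub>k\<^sub><\<^sub>N f\<^sub>k X\<^sub>k\<close> on \<open>V\<close>.\<close>

definition combination_on ::
  "nat \<Rightarrow> 'a chart set \<Rightarrow> 'a set \<Rightarrow> 'a vfield \<Rightarrow> nat \<Rightarrow> (nat \<Rightarrow> 'a \<Rightarrow> real) \<Rightarrow> (nat \<Rightarrow> 'a vfield) \<Rightarrow> bool" where
  "combination_on n A V W N f X \<longleftrightarrow>
     (\<forall>c\<in>A. \<forall>y \<in> V \<inter> fst c. \<forall>i<n. W c y i = (\<Sum>k<N. f k y * X k c y i))"

definition spanning_on :: "nat \<Rightarrow> 'a chart set \<Rightarrow> 'a set \<Rightarrow> nat \<Rightarrow> (nat \<Rightarrow> 'a vfield) \<Rightarrow> bool" where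
  "spanning_on n A V N X \<longleftrightarrow>
     (\<forall>c\<in>A. \<forall>y \<in> V \<inter> fst c. \<forall>v. \<exists>a. \<forall>i<n. v i = (\<Sum>k<N. a k * X k c y i))"

definition independent_at :: "nat \<Rightarrow> 'a chart set \<Rightarrow> 'a \<Rightarrow> nat \<Rightarrow> (nat \<Rightarrow> 'a vfield) \<Rightarrow> bool" where
  "independent_at n A y N X \<longleftrightarrow>
     (\<forall>c\<in>A. y \<in> fst c \<longrightarrow>
        (\<forall>a. (\<forall>i<n. (\<Sum>k<N. a k * X k c y i) = 0) \<longrightarrow> (\<forall>k<N. a k = 0)))"

definition immersion ::
  "'a topology \<Rightarrow> nat \<Rightarrow> 'a chart set \<Rightarrow> nat \<Rightarrow> 'b chart set \<Rightarrow> ('a \<Rightarrow> 'b) \<Rightarrow> bool" where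
  "immersion T n A m B F \<longleftrightarrow>
     (\<forall>c\<in>A. \<forall>d\<in>B. \<forall>y \<in> topspace T \<inter> fst c. F y \<in> fst d \<longrightarrow>
        (\<forall>v. (\<forall>i<m. differential n c d F y v i = 0) \<longrightarrow> (\<forall>j<n. v j = 0)))"

section \<open>The sub-Riemannian distance\<close>

definition abs_continuous_on_interval :: "real \<Rightarrow> real \<Rightarrow> (real \<Rightarrow> real) \<Rightarrow> bool" where
  "abs_continuous_on_interval a b f \<longleftrightarrow>
     (\<forall>e>0. \<exists>d>0. \<forall>I. finite I \<and> (\<forall>(u,v)\<in>I. a \<le> u \<and> u \<le> v \<and> v \<le> b) \<and>
        pairwise (\<lambda>(u,v) (u',v'). {u<..<v} \<inter> {u'<..<v'} = {}) I \<and>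
        (\<Sum>(u,v)\<in>I. v - u) < d \<longrightarrow> (\<Sum>(u,v)\<in>I. \<bar>f v - f u\<bar>) < e)"

definition abs_continuous_curve ::
  "'a topology \<Rightarrow> nat \<Rightarrow> 'a chart set \<Rightarrow> (real \<Rightarrow> 'a) \<Rightarrow> bool" where
  "abs_continuous_curve T m A g \<longleftrightarrow> continuous_map (top_of_set {0..1}) T g \<and>
     (\<forall>c\<in>A. \<forall>s t. 0 \<le> s \<and> s \<le> t \<and> t \<le> 1 \<and> g ` {s..t} \<subseteq> fst c \<longrightarrow>
        (\<forall>i<m. abs_continuous_on_interval s t (\<lambda>r. snd c (g r) i)))"

definition sR_ball ::
  "'a topology \<Rightarrow> nat \<Rightarrow> 'a chart set \<Rightarrow> nat \<Rightarrow> (nat \<Rightarrow> 'a vfield) \<Rightarrow> 'a \<Rightarrow> real \<Rightarrow> 'a set" where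
  "sR_ball T m A q X x \<delta> = {y. \<exists>g a.
     abs_continuous_curve T m A g \<and> g 0 = x \<and> g 1 = y \<and>
     (\<forall>j<q. a j \<in> borel_measurable (lebesgue_on {0..1}) \<and>
            esssup (lebesgue_on {0..1}) (\<lambda>t. ereal \<bar>a j t\<bar>) < \<infinity>) \<and>
     esssup (lebesgue_on {0..1}) (\<lambda>t. ereal (\<Sum>j<q. \<bar>a j t\<bar>\<^sup>2)) < 1 \<and>
     (AE t in lebesgue_on {0..1}. \<forall>c\<in>A. g t \<in> fst c \<longrightarrow>
        (\<forall>i<m. ((\<lambda>s. snd c (g s) i) has_real_derivative
                  (\<Sum>j<q. a j t * (\<delta> * X j c (g t) i))) (at t within {0..1})))}"

definition sR_dist ::
  "'a topology \<Rightarrow> nat \<Rightarrow> 'a chart set \<Rightarrow> nat \<Rightarrow> (nat \<Rightarrow> 'a vfield) \<Rightarrow> 'a \<Rightarrow> 'a \<Rightarrow> ereal" where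
  "sR_dist T m A q X x y = Inf {ereal \<delta> |\<delta>. \<delta> > 0 \<and> y \<in> sR_ball T m A q X x \<delta>}"

definition sR_component ::
  "'a topology \<Rightarrow> nat \<Rightarrow> 'a chart set \<Rightarrow> nat \<Rightarrow> (nat \<Rightarrow> 'a vfield) \<Rightarrow> 'a \<Rightarrow> 'a set" where
  "sR_component T m A q X p = {y \<in> topspace T. sR_dist T m A q X p y < \<infinity>}"

definition sR_topology ::
  "'a topology \<Rightarrow> nat \<Rightarrow> 'a chart set \<Rightarrow> nat \<Rightarrow> (nat \<Rightarrow> 'a vfield) \<Rightarrow> 'a \<Rightarrow> 'a topology" where
  "sR_topology T m A q X p =
     Metric_space.mtopology (sR_component T m A q X p) (\<lambda>x y. real_of_ereal (sR_dist T m A q X x y))"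

section \<open>The canonical \<open>C\<^sup>2\<close> structure on \<open>M\<close>\<close>

definition locally_bounded :: "'a topology \<Rightarrow> ('a \<Rightarrow> real) \<Rightarrow> bool" where
  "locally_bounded T f \<longleftrightarrow>
     (\<forall>x\<in>topspace T. \<exists>V. openin T V \<and> x \<in> V \<and> bounded (f ` V))"

text \<open>
  \<open>B\<close> is a \<open>C\<^sup>2\<close> structure of dimension \<open>n\<close> on \<open>S\<close> (whose points are points of \<open>T\<close>) for which the
  inclusion into \<open>(T, A)\<close> is a \<open>C\<^sup>2\<close> immersion and the \<open>X j\<close> are tangent to \<open>S\<close>; the \<open>Y j\<close> are the
  fields \<open>X j\<close> viewed as vector fields on \<open>(S, B)\<close>, and they are \<open>C\<^sup>1\<close> and spanning.
\<close>

definition canonical_C2_structure ::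
  "'a topology \<Rightarrow> nat \<Rightarrow> 'a chart set \<Rightarrow> nat \<Rightarrow> (nat \<Rightarrow> 'a vfield) \<Rightarrow>
   'a topology \<Rightarrow> nat \<Rightarrow> 'a chart set \<Rightarrow> (nat \<Rightarrow> 'a vfield) \<Rightarrow> bool" where
  "canonical_C2_structure T m A q X S n B Y \<longleftrightarrow>
     is_manifold (C_k_on 2) n S B \<and>
     regular_map (C_k_on 2) S n B T m A id \<and>
     immersion S n B m A id \<and>
     (\<forall>j<q. vector_field (C_k_on 1) S n B (Y j) \<and> F_related S n B m A id (Y j) (X j)) \<and>
     spanning_on n B (topspace S) q Y"

section \<open>Function spaces with respect to \<open>X\<close>\<close>

definition integral_curve ::
  "'a topology \<Rightarrow> nat \<Rightarrow> 'a chart set \<Rightarrow> 'a vfield \<Rightarrow> real set \<Rightarrow> (real \<Rightarrow> 'a) \<Rightarrow> bool" where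
  "integral_curve T n A W I g \<longleftrightarrow> continuous_map (top_of_set I) T g \<and>
     (\<forall>t\<in>I. \<forall>c\<in>A. g t \<in> fst c \<longrightarrow>
        (\<forall>i<n. ((\<lambda>s. snd c (g s) i) has_real_derivative W c (g t) i) (at t)))"

text \<open>\<open>e\<^sup>t\<^sup>W x\<close>, meaningful for \<open>t\<close> in the maximal interval of existence.\<close>

definition flow :: "'a topology \<Rightarrow> nat \<Rightarrow> 'a chart set \<Rightarrow> 'a vfield \<Rightarrow> real \<Rightarrow> 'a \<Rightarrow> 'a" where
  "flow T n A W t x = (THE y. \<exists>I g. open I \<and> is_interval I \<and> 0 \<in> I \<and> t \<in> I \<and>
     integral_curve T n A W I g \<and> g 0 = x \<and> g t = y)"

definition flow_deriv ::
  "'a topology \<Rightarrow> nat \<Rightarrow> 'a chart set \<Rightarrow> 'a vfield \<Rightarrow> ('a \<Rightarrow> real) \<Rightarrow> 'a \<Rightarrow> real" where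
  "flow_deriv T n A W f x = deriv (\<lambda>t. f (flow T n A W t x)) 0"

primrec word_deriv ::
  "'a topology \<Rightarrow> nat \<Rightarrow> 'a chart set \<Rightarrow> (nat \<Rightarrow> 'a vfield) \<Rightarrow> nat list \<Rightarrow> ('a \<Rightarrow> real) \<Rightarrow> 'a \<Rightarrow> real" where
  "word_deriv T n A X [] f = f"
| "word_deriv T n A X (j # \<alpha>) f = flow_deriv T n A (X j) (word_deriv T n A X \<alpha> f)"

definition C_X_omega_r ::
  "'a topology \<Rightarrow> nat \<Rightarrow> 'a chart set \<Rightarrow> nat \<Rightarrow> (nat \<Rightarrow> 'a vfield) \<Rightarrow> real \<Rightarrow> 'a set \<Rightarrow>
   ('a \<Rightarrow> real) \<Rightarrow> bool" where
  "C_X_omega_r T n A q X r V f \<longleftrightarrow>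
     bounded (f ` V) \<and>
     (\<forall>\<alpha>\<in>lists {..<q}. continuous_map (subtopology T V) euclideanreal (word_deriv T n A X \<alpha> f) \<and>
        (\<forall>j<q. \<forall>x\<in>V.
           (\<lambda>t. word_deriv T n A X \<alpha> f (flow T n A (X j) t x)) field_differentiable at 0)) \<and>
     (\<Sum>k. ennreal (r ^ k / fact k) *
        (\<Sum>\<alpha> | \<alpha> \<in> lists {..<q} \<and> length \<alpha> = k. (SUP x\<in>V. ennreal \<bar>word_deriv T n A X \<alpha> f x\<bar>))) < \<infinity>"

definition C_X_omega ::
  "'a topology \<Rightarrow> nat \<Rightarrow> 'a chart set \<Rightarrow> nat \<Rightarrow> (nat \<Rightarrow> 'a vfield) \<Rightarrow> 'a set \<Rightarrow> ('a \<Rightarrow> real) \<Rightarrow> bool" where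
  "C_X_omega T n A q X V f \<longleftrightarrow> (\<exists>r>0. C_X_omega_r T n A q X r V f)"

section \<open>The conditions of the theorem\<close>

text \<open>In the following \<open>(S, A)\<close> is the \<open>n\<close>-dimensional \<open>C\<^sup>2\<close> manifold \<open>M\<close>, \<open>A\<close> being its maximal atlas; an
  atlas is compatible with the \<open>C\<^sup>2\<close> structure iff all its charts belong to \<open>A\<close>.\<close>

definition analytic_atlas_for ::
  "'a topology \<Rightarrow> nat \<Rightarrow> 'a chart set \<Rightarrow> nat \<Rightarrow> (nat \<Rightarrow> 'a vfield) \<Rightarrow> 'a chart set \<Rightarrow> bool" where
  "analytic_atlas_for S n A q X B \<longleftrightarrow>
     is_atlas real_analytic_on n S B \<and> B \<subseteq> A \<and>
     (\<forall>j<q. regular_components real_analytic_on n B (X j))"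

definition analytic_coordinates_near ::
  "'a topology \<Rightarrow> nat \<Rightarrow> 'a chart set \<Rightarrow> nat \<Rightarrow> (nat \<Rightarrow> 'a vfield) \<Rightarrow> 'a \<Rightarrow> bool" where
  "analytic_coordinates_near S n A q X x0 \<longleftrightarrow>
     (\<exists>V U \<Phi> \<Psi>. openin S V \<and> x0 \<in> V \<and> openin (Euclidean_space n) U \<and>
        diffeo (C_k_on 2) (subtopology (Euclidean_space n) U) n {(U, id)} (subtopology S V) n A \<Phi> \<Psi> \<and>
        (\<forall>j<q. \<exists>W. F_related (subtopology (Euclidean_space n) U) n {(U, id)} n A \<Phi> (\<lambda>_. W) (X j) \<and>
                   C_omega n n U W))"

definition analytic_basis_near ::
  "'a topology \<Rightarrow> nat \<Rightarrow> 'a chart set \<Rightarrow> nat \<Rightarrow> (nat \<Rightarrow> 'a vfield) \<Rightarrow> 'a \<Rightarrow> bool" where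
  "analytic_basis_near S n A q X x0 \<longleftrightarrow>
     (\<exists>V c b. openin S V \<and> x0 \<in> V \<and>
        (\<forall>i<n. \<forall>j<n. combination_on n A V (lie_bracket n (X i) (X j)) n (c i j) X \<and>
                       (\<forall>k<n. C_X_omega S n A q X V (c i j k))) \<and>
        (\<forall>j. n \<le> j \<and> j < q \<longrightarrow> combination_on n A V (X j) n (b j) X \<and>
                       (\<forall>k<n. C_X_omega S n A q X V (b j k))))"

definition analytic_brackets_near ::
  "'a topology \<Rightarrow> nat \<Rightarrow> 'a chart set \<Rightarrow> nat \<Rightarrow> (nat \<Rightarrow> 'a vfield) \<Rightarrow> 'a \<Rightarrow> bool" where
  "analytic_brackets_near S n A q X x0 \<longleftrightarrow>
     (\<exists>V c. openin S V \<and> x0 \<in> V \<and>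
        (\<forall>i<q. \<forall>j<q. combination_on n A V (lie_bracket n (X i) (X j)) q (c i j) X \<and>
                       (\<forall>k<q. C_X_omega S n A q X V (c i j k))))"

text \<open>Orderings of the vector fields for which the first \<open>n\<close> are linearly independent at \<open>x0\<close>.\<close>

definition good_orderings ::
  "nat \<Rightarrow> 'a chart set \<Rightarrow> nat \<Rightarrow> (nat \<Rightarrow> 'a vfield) \<Rightarrow> 'a \<Rightarrow> (nat \<Rightarrow> 'a vfield) set" where
  "good_orderings n A q X x0 =
     {X \<circ> \<sigma> |\<sigma>. bij_betw \<sigma> {..<q} {..<q} \<and> n \<le> q \<and> independent_at n A x0 n (X \<circ> \<sigma>)}"

end

theory Submission
  imports Defs "HOL-Computational_Algebra.Formal_Power_Series" "Jordan_Normal_Form.Determinant"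
    "HOL-Homology.Invariance_of_Domain"
begin

text \<open>
 All regularity classes are expressed by majorants: a function is analytic with respect to a family
 of derivations iff its iterated derivatives of order \<open>m\<close> are bounded by \<open>K R\<^sup>m m!\<close>. This property
 survives a change of frame with analytic coefficients, so in a chart in which the fields are
 analytic it is equivalent for the coordinate fields and for the fields themselves. Transition maps
 between two such charts have coordinates that are analytic with respect to the fields, hence are
 real analytic; this gives (i) from (ii.1) and the uniqueness.

 Conversely, let the brackets have analytic coefficients with respect to the fields, and put
 \<open>\<Phi>(t) = exp(t\<^sub>1 X\<^sub>1 + ... + t\<^sub>n X\<^sub>n)(x\<^sub>0)\<close>, where \<open>X\<^sub>1, ..., X\<^sub>n\<close> is a basis at \<open>x\<^sub>0\<close>. Functions analytic
 with respect to the fields have a convergent Taylor series along \<open>\<Phi>\<close>. The derivatives of \<open>\<Phi>\<close> are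
 combinations of the fields whose coefficients, as functions of \<open>t\<close>, solve a singular linear equation
 along rays with analytic coefficients, and are therefore power series. Inverting their matrix shows that the
 fields are analytic in the coordinates \<open>t\<close>.\<close>

text \<open>\<open>C_X_omega\<close> is defined by derivatives along flows of fields that are merely
  C^1, and says nothing about coordinates. \<open>flow_derivatives_imp_C1\<close> is the bridge:
  continuous derivatives along the flows of a spanning family make a function C^1, and from then on
  derivatives along the fields are computed from its gradient. The second obstacle is the regularity
  of \<open>\<Phi>\<close>. C^1 fields promise only a C^1 exponential map, whereas a chart of the
  maximal atlas must be C^2. The expansion of the Jacobian gains the missing order: its entries are
  power series times the fields composed with \<open>\<Phi>\<close>, hence C^1. The construction is
  carried out for N >= n fields. A linear relation among them at \<open>x0\<close> is transported
  along the rays by the same equation without its source term; thus all N fields at a point of the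
  image of \<open>\<Phi>\<close> are recovered from the n partial derivatives of
  \<open>\<Phi>\<close>, even if the fields are dependent. N = n serves condition (ii.2), and N = q
  serves (ii.3) directly, without a detour through a basis.\<close>

abbreviation openE where "openE n U == openin (Euclidean_space n) U"

abbreviation spaceE where "spaceE n == topspace (Euclidean_space n)"

section \<open>Majorant series and abstract derivations\<close>

definition geom :: "real => real => real fps" where
 "geom K R = Abs_fps (%m. K * R ^ m)"

definition fps_le :: "real fps => real fps => bool" where
 "fps_le \<phi> \<psi> \<longleftrightarrow> (ALL m. fps_nth \<phi> m <= fps_nth \<psi> m)"

lemma geom_nth [simp]: "fps_nth (geom K R) m = K * R ^ m"
 by (simp add: geom_def)

lemma fps_le_deriv: "fps_le \<phi> \<psi> ==> fps_le (fps_deriv \<phi>) (fps_deriv \<psi>)"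
 by (auto simp: fps_le_def intro!: mult_left_mono)

lemma geom_mono: "0 <= K ==> K <= K' ==> 0 <= R ==> R <= R' ==> fps_le (geom K R) (geom K' R')"
 by (auto simp: fps_le_def intro!: mult_mono power_mono)

lemma geom_times_linear: "geom K R*(1 - fps_const R * fps_X) = fps_const K"
proof (rule fps_ext)
 fix m show "fps_nth (geom K R*(1 - fps_const R * fps_X)) m = fps_nth (fps_const K) m"
  by (cases m) (auto simp: right_diff_distrib mult.assoc[symmetric] mult.commute[of _ "fps_X"] fps_mult_right_const_nth)
qed

lemma geom_conv: "geom K R = fps_const K * geom 1 R"
 by (simp add: fps_eq_iff)

lemma geom_square_nth: "fps_nth (geom K R * geom K' R) m = K * K' * of_nat (Suc m) * R ^ m"
proof -
 have "fps_nth (geom K R * geom K' R) m = (\<Sum>i=0..m. K * K' * R ^ m)"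
  unfolding fps_mult_nth by (intro sum.cong) (auto simp: power_add[symmetric])
 thus ?thesis by simp
qed

lemma geom_deriv: "fps_deriv (geom 1 R) = fps_const R*(geom 1 R)\<^sup>2"
 by (rule fps_ext) (simp add: power2_eq_square geom_square_nth del: fps_mult_nth_1)

lemma Suc_le_two_power: "real (Suc m) <= 2 ^ m"
 by (induction m) auto

text \<open>The formal power series \<open>\<phi>\<close> is an exponential generating function: \<open>m! \<phi>\<^sub>m\<close> bounds all
 iterated derivatives of order \<open>m\<close>. Products and derivations of functions are then
 majorised by products and derivatives of series.\<close>

primrec maj :: "'a set => nat => (('a => real) => (nat => 'a => real) => bool) => nat =>
  real fps => ('a => real) => bool" where
 "maj V q der 0 \<phi> f \<longleftrightarrow> (ALL x:V. abs (f x) <= fps_nth \<phi> 0)"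
| "maj V q der (Suc k) \<phi> f \<longleftrightarrow> (ALL x:V. abs (f x) <= fps_nth \<phi> 0) &
   (EX G. der f G & (ALL j<q. maj V q der k (fps_deriv \<phi>) (G j)))"

text \<open>The constants are fixed before the depth \<open>k\<close>. Each \<open>maj\<close>
  inspects only finitely many orders, and its gradient witnesses may change with
  \<open>k\<close>.\<close>

definition analytic_wrt :: "'a set => nat => (('a => real) => (nat => 'a => real) => bool) =>
  ('a => real) => bool" where
 "analytic_wrt V q der f \<longleftrightarrow> (EX K R. 0 <= K & 0<R & (ALL k. maj V q der k (geom K R) f))"

lemma maj_bound: "maj V q der k \<phi> f ==> x : V ==> abs (f x) <= fps_nth \<phi> 0"
 by (cases k) auto

lemma maj_le: "maj V q der k \<phi> f ==> fps_le \<phi> \<psi> ==> maj V q der k \<psi> f"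
proof (induction k arbitrary: \<phi> \<psi> f)
 case 0
 thus ?case by (fastforce simp: fps_le_def intro: order_trans)
next
 case (Suc k)
 then obtain G where G: "der f G" "ALL j<q. maj V q der k (fps_deriv \<phi>) (G j)" by auto
 have "ALL j<q. maj V q der k (fps_deriv \<psi>) (G j)"
  using Suc.IH G(2) fps_le_deriv[OF Suc.prems(2)] by blast
 moreover have "ALL x:V. abs (f x) <= fps_nth \<psi> 0"
  using Suc.prems by (fastforce simp: fps_le_def intro: order_trans)
 ultimately show ?case using G(1) by auto
qed

lemma maj_Suc_imp: "maj V q der (Suc k) \<phi> f ==> maj V q der k \<phi> f"
proof (induction k arbitrary: \<phi> f)
 case (Suc k)
 then obtain G where "der f G" "ALL j<q. maj V q der (Suc k) (fps_deriv \<phi>) (G j)"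
  "ALL x:V. abs (f x) <= fps_nth \<phi> 0" by auto
 thus ?case using Suc.IH by auto
qed auto

text \<open>One pullback covers restriction (\<open>h\<close> the identity), selection or reordering
  of fields (through \<open>\<sigma>\<close>) and change of coordinates.\<close>

lemma maj_transport:
 assumes "!!f G. der f G ==> der' (f o h) (%j. G (\<sigma> j) o h)"
  and "h ` V' \<subseteq> V" and "!!j. j<q' ==> \<sigma> j<q"
 shows "maj V q der k \<phi> f ==> maj V' q' der' k \<phi> (f o h)"
proof (induction k arbitrary: \<phi> f)
 case 0
 thus ?case using assms(2) by auto
next
 case (Suc k)
 then obtain G where G: "der f G" "ALL j<q. maj V q der k (fps_deriv \<phi>) (G j)"
  "ALL x:V. abs (f x) <= fps_nth \<phi> 0" by auto
 have "ALL j<q'. maj V' q' der' k (fps_deriv \<phi>) (G (\<sigma> j) o h)"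
  using G(2) Suc.IH assms(3) by blast
 moreover have "ALL x:V'. abs ((f o h) x) <= fps_nth \<phi> 0" using G(3) assms(2) by auto
 ultimately show ?case unfolding maj.simps using assms(1)[OF G(1)] by blast
qed

lemma analytic_wrt_transport:
 assumes "analytic_wrt V q der f"
  and "!!f G. der f G ==> der' (f o h) (%j. G (\<sigma> j) o h)"
  and "h ` V' \<subseteq> V" and "!!j. j<q' ==> \<sigma> j<q"
 shows "analytic_wrt V' q' der' (f o h)"
proof -
 obtain K R where "0 <= K" "0<R" "!!k. maj V q der k (geom K R) f"
  using assms(1) unfolding analytic_wrt_def by auto
 thus ?thesis unfolding analytic_wrt_def
  using maj_transport[where der'=der' and der=der and \<sigma>=\<sigma>, OF assms(2-4)] by blast
qed

lemma analytic_wrtI: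
 assumes "!!k. maj V q der k \<phi> f" "0 <= K" "0<R" "!!m. fps_nth \<phi> m <= K * R ^ m"
 shows "analytic_wrt V q der f"
proof -
 have "fps_le \<phi> (geom K R)" using assms(4) by (simp add: fps_le_def)
 thus ?thesis unfolding analytic_wrt_def using maj_le assms by metis
qed

text \<open>A derivation is a relation because a function need not be differentiable. Coordinate
  derivatives \<open>pd\<close> and derivatives along fields \<open>dw\<close> are the two
  instances, so the majorant calculus is done once for both.\<close>

locale derivation_system =
 fixes V :: "'a set" and q :: nat and der :: "('a => real) => (nat => 'a => real) => bool"
 assumes der_cong: "der f G ==> (!!x. x : V ==> f' x = f x) ==>
   (!!j x. j<q ==> x : V ==> G' j x = G j x) ==> der f' G'"
  and der_const: "der (%_. c) (%_ _. 0)"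
  and der_add: "der f G ==> der f' G' ==> der (%x. f x + f' x) (%j x. G j x + G' j x)"
  and der_mult: "der f G ==> der f' G' ==> der (%x. f x * f' x) (%j x. f x * G' j x + G j x * f' x)"
  and der_inverse: "der f G ==> (!!x. x : V ==> f x ~= 0) ==>
   der (%x. inverse (f x)) (%j x. - G j x * inverse (f x) * inverse (f x))"
begin

abbreviation "mj \<equiv> maj V q der"
abbreviation "an \<equiv> analytic_wrt V q der"

lemma mj_cong: "mj k \<phi> f ==> (!!x. x : V ==> f' x = f x) ==> mj k \<phi> f'"
proof (induction k)
 case (Suc k)
 then obtain G where G: "der f G" "ALL j<q. mj k (fps_deriv \<phi>) (G j)" by auto
 have "der f' G" by (rule der_cong[OF G(1)]) (use Suc in auto)
 thus ?case using G Suc.prems by auto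
qed auto

lemma an_cong: "an f ==> (!!x. x : V ==> f' x = f x) ==> an f'"
 unfolding analytic_wrt_def by (meson mj_cong)

lemma mj_zero: "mj k 0 (%_. 0)"
proof (induction k)
 case (Suc k)
 thus ?case using der_const[of 0] by auto
qed auto

lemma mj_const: "mj k (fps_const (abs c)) (%_. c)"
 using der_const[of c] mj_zero by (cases k) auto

lemma mj_add: "mj k \<phi> f ==> mj k \<psi> g ==> mj k (\<phi> + \<psi>) (%x. f x + g x)"
proof (induction k arbitrary: \<phi> \<psi> f g)
 case 0
 thus ?case by (auto intro: order_trans[OF abs_triangle_ineq] add_mono)
next
 case (Suc k)
 then obtain G G' where G: "der f G" "ALL j<q. mj k (fps_deriv \<phi>) (G j)"
  "der g G'" "ALL j<q. mj k (fps_deriv \<psi>) (G' j)" by auto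
 have "ALL j<q. mj k (fps_deriv (\<phi> + \<psi>)) (%x. G j x + G' j x)"
  using Suc.IH G by simp
 moreover have "ALL x:V. abs (f x + g x) <= fps_nth (\<phi> + \<psi>) 0"
  using Suc.prems by (auto intro: order_trans[OF abs_triangle_ineq] add_mono)
 ultimately show ?case using der_add[OF G(1,3)] by auto
qed

lemma mj_mult: "mj k \<phi> f ==> mj k \<psi> g ==> mj k (\<phi> * \<psi>) (%x. f x * g x)"
proof (induction k arbitrary: \<phi> \<psi> f g)
 case 0
 have "abs (f x * g x) <= fps_nth (\<phi> * \<psi>) 0" if "x : V" for x
  using mult_mono[OF maj_bound[OF 0(1) that] maj_bound[OF 0(2) that]]
   order_trans[OF abs_ge_zero maj_bound[OF 0(1) that]] by (simp add: abs_mult)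
 thus ?case by simp
next
 case (Suc k)
 then obtain G G' where G: "der f G" "ALL j<q. mj k (fps_deriv \<phi>) (G j)"
  "der g G'" "ALL j<q. mj k (fps_deriv \<psi>) (G' j)" by auto
 have fg: "mj k \<phi> f" "mj k \<psi> g" using Suc.prems maj_Suc_imp by blast+
 have "ALL j<q. mj k (fps_deriv (\<phi> * \<psi>)) (%x. f x * G' j x + G j x * g x)"
  using Suc.IH[of \<phi> f] Suc.IH[of "fps_deriv \<phi>" _ \<psi> g] G fg mj_add
  by (simp add: fps_deriv_mult)
 moreover have "abs (f x * g x) <= fps_nth (\<phi> * \<psi>) 0" if "x : V" for x
  using mult_mono[OF maj_bound[OF Suc.prems(1) that] maj_bound[OF Suc.prems(2) that]]
   order_trans[OF abs_ge_zero maj_bound[OF Suc.prems(1) that]] by (simp add: abs_mult)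
 ultimately show ?case using der_mult[OF G(1,3)] by auto
qed

lemma mj_cmult: "mj k \<phi> f ==> mj k (fps_const (abs c) * \<phi>) (%x. c * f x)"
 using mj_mult[OF mj_const] by simp

lemma mj_sum: "(!!j. j<p ==> mj k \<phi> (F j)) ==> mj k (fps_const (of_nat p) * \<phi>) (%x. \<Sum>j<p. F j x)"
proof (induction p)
 case 0
 thus ?case using mj_zero by simp
next
 case (Suc p)
 have "fps_const (of_nat (Suc p)) * \<phi> = fps_const (of_nat p) * \<phi> + \<phi>"
  by (simp add: fps_eq_iff algebra_simps)
 thus ?case using mj_add[OF Suc.IH] Suc.prems by (simp del: of_nat_Suc)
qed

text \<open>\<open>\<psi>\<close> plays the role of 1/(a - \<phi>) for a constant a: its
  differential equation is the rule for the derivative of an inverse with all signs made positive,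
  so the bound reproduces itself at the next depth.\<close>

lemma mj_inverse:
 assumes "!!k. mj k \<phi> f" "!!x. x : V ==> \<delta> <= abs (f x)" "0<\<delta>"
  and "1 / \<delta> <= fps_nth \<psi> 0" "fps_deriv \<psi> = fps_deriv \<phi> * \<psi> * \<psi>"
 shows "mj k \<psi> (%x. inverse (f x))"
proof (induction k)
 case 0
 have "abs (inverse (f x)) <= 1 / \<delta>" if "x : V" for x
  using assms(2)[OF that] assms(3) by (simp add: abs_inverse divide_inverse le_imp_inverse_le)
 thus ?case using assms(4) by (auto intro: order_trans)
next
 case (Suc k)
 obtain G where G: "der f G" "ALL j<q. mj k (fps_deriv \<phi>) (G j)"
  using assms(1)[of "Suc k"] by auto
 have nz: "f x ~= 0" if "x : V" for x using assms(2)[OF that] assms(3) by auto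
 have "mj k (fps_deriv \<psi>) (%x. - G j x * inverse (f x) * inverse (f x))" if "j<q" for j
 proof -
  have "mj k (fps_deriv \<phi>) (%x. - G j x)" using mj_cmult[of k "fps_deriv \<phi>" "G j" "-1"] G(2) that by simp
  thus ?thesis unfolding assms(5) using mj_mult Suc by blast
 qed
 moreover have "ALL x:V. abs (inverse (f x)) <= fps_nth \<psi> 0" using maj_bound[OF Suc] by auto
 ultimately show ?case using der_inverse[OF G(1) nz] by auto
qed

lemma an_common:
 assumes "an f" "an g"
 obtains K R where "0 <= K" "0<R" "!!k. mj k (geom K R) f" "!!k. mj k (geom K R) g"
proof -
 obtain K R where 1: "0 <= K" "0<R" "!!k. mj k (geom K R) f" using assms(1) unfolding analytic_wrt_def by auto
 obtain K' R' where 2: "0 <= K'" "0<R'" "!!k. mj k (geom K' R') g" using assms(2) unfolding analytic_wrt_def by auto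
 show ?thesis
 proof (rule that[of "max K K'" "max R R'"])
  show "mj k (geom (max K K') (max R R')) f" for k
   by (rule maj_le[OF 1(3)]) (use 1 2 in \<open>auto intro!: geom_mono\<close>)
  show "mj k (geom (max K K') (max R R')) g" for k
   by (rule maj_le[OF 2(3)]) (use 1 2 in \<open>auto intro!: geom_mono\<close>)
 qed (use 1 2 in auto)
qed

lemma an_const: "an (%_. c)"
 by (rule analytic_wrtI[OF mj_const, where K="abs c" and R=1]) auto

lemma an_add: "an f ==> an g ==> an (%x. f x + g x)"
proof -
 assume "an f" "an g"
 then obtain K R where *: "0 <= K" "0<R" "!!k. mj k (geom K R) f" "!!k. mj k (geom K R) g"
  using an_common by blast
 show ?thesis by (rule analytic_wrtI[OF mj_add[OF *(3,4)], where K="2*K" and R=R]) (use * in auto)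
qed

lemma an_mult: "an f ==> an g ==> an (%x. f x * g x)"
proof -
 assume "an f" "an g"
 then obtain K R where *: "0 <= K" "0<R" "!!k. mj k (geom K R) f" "!!k. mj k (geom K R) g"
  using an_common by blast
 have "K * K * real (Suc m) * R ^ m <= K * K*(2 * R) ^ m" for m
  using mult_left_mono[OF Suc_le_two_power[of m], of "K * K * R ^ m"] *
  by (simp add: power_mult_distrib mult.assoc mult.left_commute del: of_nat_Suc) (simp add: mult_ac)
 thus ?thesis by (intro analytic_wrtI[OF mj_mult[OF *(3,4)], where K="K*K" and R="2*R"])
   (use * in \<open>auto simp del: of_nat_Suc simp add: geom_square_nth\<close>)
qed

lemma an_cmult: "an f ==> an (%x. c * f x)"
 using an_mult[OF an_const] by blast

lemma an_diff: "an f ==> an g ==> an (%x. f x - g x)"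
 using an_add[OF _ an_cmult[of g "-1"]] by simp

lemma an_sum: "finite I ==> (!!i. i : I ==> an (F i)) ==> an (%x. \<Sum>i\<in>I. F i x)"
 by (induction I rule: finite_induct) (auto intro: an_add an_const)

lemma an_inverse:
 assumes "an f" "!!x. x : V ==> \<delta> <= abs (f x)" "0<\<delta>"
 shows "an (%x. inverse (f x))"
proof -
 obtain K R where *: "0 <= K" "0<R" "!!k. mj k (geom K R) f"
  using assms(1) unfolding analytic_wrt_def by auto
 \<comment> \<open>With g = K/(1 - R X), the series \<delta> + K - g has constant term \<delta>, and
   its product with 1 - R X is \<delta> (1 - Q X). Its inverse is therefore (1 - R X)/(1 - Q X)
   divided by \<delta>.\<close>
 define Q where "Q = R*(1 + K / \<delta>)"
 define a where "a = fps_const (\<delta> + K) - geom K R"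
 define L where "L = 1 - fps_const R * fps_X"
 define \<psi> where "\<psi> = fps_const (1 / \<delta>) * L * geom 1 Q"
 have LX: "geom K R * L = fps_const K" unfolding L_def by (rule geom_times_linear)
 have "a * L = fps_const \<delta>*(1 - fps_const Q * fps_X)"
 proof -
  have "a * L = fps_const (\<delta> + K) * L - fps_const K"
   unfolding a_def using LX by (simp add: left_diff_distrib)
  also have "... = fps_const \<delta>*(1 - fps_const Q * fps_X)"
   using assms(3) by (simp add: L_def Q_def fps_eq_iff algebra_simps)
  finally show ?thesis .
 qed
 note aL = this
 have "a * \<psi> = fps_const (1/\<delta>)*(a * L) * geom 1 Q"
  unfolding \<psi>_def by (simp only: mult_ac)
 also have "... = (fps_const (1/\<delta>) * fps_const \<delta>)*(geom 1 Q*(1 - fps_const Q * fps_X))"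
  unfolding aL by (simp only: mult_ac)
 also have "... = 1" unfolding geom_times_linear using assms(3) by simp
 finally have a\<psi>: "a * \<psi> = 1" .
 have inv: "inverse a = \<psi>" using a\<psi> by (rule fps_inverse_unique)
 have a0: "fps_nth a 0 = \<delta>" by (simp add: a_def)
 have d: "fps_deriv \<psi> = fps_deriv (geom K R) * \<psi> * \<psi>"
 proof -
  have "fps_deriv (inverse a) = - fps_deriv a*(inverse a)\<^sup>2"
   using a0 assms(3) by (intro fps_inverse_deriv) auto
  moreover have "fps_deriv a = - fps_deriv (geom K R)" by (simp add: a_def)
  ultimately show ?thesis by (simp add: inv power2_eq_square mult.assoc)
 qed
 have bd: "fps_nth \<psi> m <= 1/\<delta> * Q ^ m" for m
 proof (cases m)
  case (Suc l)
  have "0 <= Q" using * assms(3) by (auto simp: Q_def)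
  thus ?thesis using Suc assms(3) *
   by (simp add: \<psi>_def L_def mult.assoc algebra_simps)
 qed (use assms(3) in \<open>simp add: \<psi>_def L_def\<close>)
 show ?thesis
 proof (rule analytic_wrtI[OF mj_inverse[OF *(3) assms(2,3) _ d] _ _ bd])
  show "1 / \<delta> <= fps_nth \<psi> 0" by (simp add: \<psi>_def L_def)
  show "0<Q" using * assms(3) by (auto simp: Q_def intro!: mult_pos_pos add_pos_nonneg)
 qed (use assms(3) in auto)
qed

text \<open>If \<phi> majorises f and \<beta> majorises every coefficient, this series majorises the
  derivative of f along a combination of the q old fields.\<close>

definition frame_op :: "real fps => real fps => real fps" where
 "frame_op \<beta> \<phi> = fps_const (of_nat q)*(\<beta> * fps_deriv \<phi>)"

text \<open>A derivative in the new frame acts on majorants as \<open>frame_op\<close>. The m-th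
  iterate at 0 bounds the derivatives of order m, and division by m! restores the exponential
  normalisation.\<close>

lemma mj_frame:
 assumes step: "!!f G. der f G ==> der' f (%i x. \<Sum>j<q. b i j x * G j x)"
  and b: "!!i j k. i<p ==> j<q ==> mj k \<beta> (b i j)"
 shows "mj k \<phi> f ==> maj V p der' k (Abs_fps (%m. fps_nth ((frame_op \<beta> ^^ m) \<phi>) 0 / fact m)) f"
proof (induction k arbitrary: \<phi> f)
 case (Suc k)
 then obtain G where G: "der f G" "ALL j<q. mj k (fps_deriv \<phi>) (G j)" by auto
 define ser where "ser = Abs_fps (%m. fps_nth ((frame_op \<beta> ^^ m) \<phi>) 0 / fact m)"
 have e: "fps_deriv ser = Abs_fps (%m. fps_nth ((frame_op \<beta> ^^ m) (frame_op \<beta> \<phi>)) 0 / fact m)"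
  by (rule fps_ext) (simp add: ser_def funpow_swap1 del: of_nat_Suc)
 have "maj V p der' k (fps_deriv ser) (%x. \<Sum>j<q. b i j x * G j x)" if "i<p" for i
  unfolding e
 proof (rule Suc.IH)
  show "mj k (frame_op \<beta> \<phi>) (%x. \<Sum>j<q. b i j x * G j x)"
   unfolding frame_op_def by (rule mj_sum, rule mj_mult) (use b that G in auto)
 qed
 thus ?case using step[OF G(1)] maj_bound[OF Suc.prems] unfolding ser_def by auto
qed auto

text \<open>For g = 1/(1 - R X) one has g' = R g^2. Each application thus raises the exponent of g
  by two and produces the next odd number as a factor.\<close>

lemma frame_op_iterate:
 fixes R :: real
 shows "(frame_op (geom B R) ^^ m) (geom K R) =
   fps_const (K*(of_nat q * B * R) ^ m*(\<Prod>i<m. 2 * of_nat i + 1)) * geom 1 R ^ (2 * m + 1)"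
proof (induction m)
 case 0
 thus ?case by (simp add: geom_conv[of K])
next
 case (Suc m)
 define c where "c = K*(of_nat q * B * R) ^ m*(\<Prod>i<m. 2 * real i + 1)"
 have "fps_deriv (geom 1 R ^ (2 * m + 1)) = fps_const (of_nat (2*m+1)) * fps_deriv (geom 1 R) * geom 1 R ^ (2*m)"
  using fps_deriv_power'[of "geom 1 R" "2*m+1"] by (simp add: fps_of_nat del: of_nat_add of_nat_Suc power_Suc)
 hence "frame_op (geom B R) (fps_const c * geom 1 R ^ (2 * m + 1)) =
   fps_const (of_nat q)*((fps_const B * geom 1 R)*(fps_const c*(fps_const (of_nat (2*m+1))*(fps_const R*(geom 1 R)\<^sup>2) * geom 1 R ^ (2*m))))"
  unfolding frame_op_def geom_conv[of B] geom_deriv by simp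
 also have "... = (fps_const (of_nat q) * fps_const B * fps_const c * fps_const (of_nat (2*m+1)) * fps_const R) * geom 1 R ^ (2 * m + 3)"
  by (simp only: mult_ac power_add power2_eq_square power3_eq_cube)
 also have "... = fps_const (K*(of_nat q * B * R) ^ Suc m*(\<Prod>i<Suc m. 2 * of_nat i + 1)) * geom 1 R ^ (2 * Suc m + 1)"
  by (simp add: c_def mult_ac numeral_3_eq_3)
 finally show ?case using Suc by (simp add: c_def)
qed

lemma odd_prod_bound: "(\<Prod>i<m. 2 * real i + 1) <= 2 ^ m * fact m"
proof (induction m)
 case (Suc m)
 have "(\<Prod>i<m. 2 * real i + 1)*(2 * real m + 1) <= 2 ^ m * fact m*(2 * real (Suc m))"
  using Suc by (intro mult_mono) auto
 thus ?case by (simp add: algebra_simps)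
qed auto

text \<open>The product of the first m odd numbers is at most 2^m m!, which is the growth that
  analyticity allows. The coefficients have to be analytic for the old derivations, since these are
  the ones that differentiate them.\<close>

lemma an_frame:
 assumes "an f"
  and step: "!!f G. der f G ==> der' f (%i x. \<Sum>j<q. b i j x * G j x)"
  and b: "!!i j. i<p ==> j<q ==> an (b i j)"
 shows "analytic_wrt V p der' f"
proof -
 have "EX KR. 0 <= fst KR & 0<snd KR & (ALL k. mj k (geom (fst KR) (snd KR)) (b i j))" if "i<p" "j<q" for i j
  using b[OF that] unfolding analytic_wrt_def by auto
 then obtain kr where kr: "!!i j. i<p ==> j<q ==> 0 <= fst (kr i j) & 0<snd (kr i j) &
   (ALL k. mj k (geom (fst (kr i j)) (snd (kr i j))) (b i j))" by metis
 obtain K0 R0 where f: "0 <= K0" "0<R0" "!!k. mj k (geom K0 R0) f"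
  using assms(1) unfolding analytic_wrt_def by auto
 define B where "B = (\<Sum>i<p. \<Sum>j<q. fst (kr i j))"
 define R where "R = R0 + (\<Sum>i<p. \<Sum>j<q. snd (kr i j))"
 have BR: "fst (kr i j) <= B" "snd (kr i j) <= R" if "i<p" "j<q" for i j
 proof -
  have "fst (kr i j) <= (\<Sum>j<q. fst (kr i j))" "snd (kr i j) <= (\<Sum>j<q. snd (kr i j))"
   using that kr by (auto intro!: member_le_sum simp: less_imp_le)
  moreover have "(\<Sum>j<q. fst (kr i j)) <= B" "(\<Sum>j<q. snd (kr i j)) <= (\<Sum>i<p. \<Sum>j<q. snd (kr i j))"
   unfolding B_def using that kr by (auto intro!: member_le_sum[of i "{..<p}"] sum_nonneg simp: less_imp_le)
  ultimately show "fst (kr i j) <= B" "snd (kr i j) <= R" using f(2) unfolding R_def by auto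
 qed
 have R0: "R0 <= R" unfolding R_def using kr by (auto intro!: sum_nonneg simp: less_imp_le)
 have B0: "0 <= B" unfolding B_def using kr by (auto intro!: sum_nonneg)
 have b': "mj k (geom B R) (b i j)" if "i<p" "j<q" for i j k
  by (rule maj_le[of _ _ _ _ "geom (fst (kr i j)) (snd (kr i j))"])
   (use kr[OF that] BR[OF that] in \<open>auto intro!: geom_mono\<close>)
 have f': "mj k (geom K0 R) f" for k
  by (rule maj_le[OF f(3)]) (use f R0 in \<open>auto intro!: geom_mono\<close>)
 have bound: "fps_nth ((frame_op (geom B R) ^^ m) (geom K0 R)) 0 / fact m <= K0*(2*(q * B * R) + 1) ^ m" for m
 proof -
  have nn: "0 <= q * B * R" using B0 f(2) R0 by simp
  have "fps_nth ((frame_op (geom B R) ^^ m) (geom K0 R)) 0 = K0*(of_nat q * B * R) ^ m*(\<Prod>i<m. 2 * of_nat i + 1)"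
   unfolding frame_op_iterate fps_mult_nth_0 fps_power_zeroth by simp
  also have "... <= K0*(of_nat q * B * R) ^ m*(2 ^ m * fact m)"
   using f nn by (intro mult_left_mono odd_prod_bound) auto
  finally have "fps_nth ((frame_op (geom B R) ^^ m) (geom K0 R)) 0 / fact m <= K0*(2*(q * B * R)) ^ m"
   by (simp add: field_simps power_mult_distrib)
  also have "... <= K0*(2*(q * B * R) + 1) ^ m"
   using f nn by (intro mult_left_mono power_mono) auto
  finally show ?thesis .
 qed
 show ?thesis
  using B0 f(2) R0 by (intro analytic_wrtI[OF mj_frame[where \<beta>="geom B R" and \<phi>="geom K0 R" and b=b and der'=der', OF step b' f'], where K=K0 and R="2*(q * B * R) + 1"])
   (auto simp: bound f(1) intro!: add_nonneg_pos)
qed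

end

section \<open>Cubes and the topology of Euclidean space\<close>

definition cube :: "nat => rn => real => rn set" where
 "cube n x e = {y. (ALL i<n. abs (y i - x i)<e) & (ALL i>=n. y i = 0)}"

definition box_between :: "rn => rn => rn set" where
 "box_between x y = {z. ALL k. min (x k) (y k) <= z k & z k <= max (x k) (y k)}"

lemma ex_common_pos:
 assumes "!!i. i<n ==> EX e>0. P i e"
  and "!!i e e'. i<n ==> P i e ==> 0<e' ==> e' <= e ==> P i e'"
 shows "EX e>(0::real). ALL i<(n::nat). P i e"
 using assms
proof (induction n)
 case 0
 thus ?case by (auto intro: exI[of _ 1])
next
 case (Suc n)
 have "EX e>0. ALL i<n. P i e" by (rule Suc.IH) (use Suc.prems in auto)
 moreover have "EX e>0. P n e" using Suc.prems(1) by auto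
 ultimately obtain e e' where *: "e > 0" "ALL i<n. P i e" "e' > 0" "P n e'" by auto
 hence "P i (min e e')" if "i<Suc n" for i
  using that Suc.prems(2)[of i e "min e e'"] Suc.prems(2)[of n e' "min e e'"] by (cases "i = n") auto
 thus ?case using * by (intro exI[of _ "min e e'"]) auto
qed

lemma cube_mono: "d <= e ==> cube n x d \<subseteq> cube n x e"
 by (force simp: cube_def)

lemma cube_center: "x : spaceE n ==> 0<e ==> x : cube n x e"
 by (auto simp: cube_def topspace_Euclidean_space)

lemma cube_subset_topspace: "cube n x e \<subseteq> spaceE n"
 by (auto simp: cube_def topspace_Euclidean_space)

lemma open_coordinate_box: "open {y::rn. ALL i<n. abs (y i - x i)<e}"
proof -
 have "{y::rn. ALL i<n. abs (y i - x i)<e} = (\<Inter>i\<in>{..<n}. (%y. y i) -` {t. abs (t - x i)<e})" by auto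
 moreover have "open ((%y::rn. y i) -` {t. abs (t - x i)<e})" for i
 proof (rule open_vimage)
  have "{t. abs (t - x i)<e} = ball (x i) e" by (auto simp: dist_real_def)
  thus "open {t. abs (t - x i)<e}" by simp
 qed (rule continuous_on_product_coordinates)
 ultimately show ?thesis by (auto intro: open_INT)
qed

lemma openin_Euclidean_space_iff_open:
 "openE n U \<longleftrightarrow> (EX A. open A & U = A \<inter> {x. ALL i>=n. x i = 0})"
 by (simp add: Euclidean_space_def openin_subtopology euclidean_product_topology)

lemma open_contains_coordinate_box:
 assumes "open (A :: rn set)" "x : A" "x : spaceE n"
 shows "EX e>0. cube n x e \<subseteq> A"
proof -
 have "openin (powertop_real UNIV) A" using assms(1) by (simp add: euclidean_product_topology)
 from product_topology_open_contains_basis[OF this assms(2)] obtain X where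
  X: "x : PiE UNIV X" "!!i. open (X i)" "PiE UNIV X \<subseteq> A" by auto
 have "EX e>0. ALL i<n. ALL t. abs (t - x i)<e --> t : X i"
 proof (rule ex_common_pos)
  fix i
  have "x i : X i" using X(1) by auto
  thus "EX e>0. ALL t. abs (t - x i)<e --> t : X i"
   using X(2)[of i] unfolding open_dist dist_real_def by blast
 qed auto
 then obtain e where e: "e > 0" "ALL i<n. ALL t. abs (t - x i)<e --> t : X i" by blast
 have "cube n x e \<subseteq> PiE UNIV X"
 proof
  fix y assume y: "y : cube n x e"
  have "y i : X i" for i
  proof (cases "i<n")
   case False
   hence "y i = x i" using y assms(3) by (auto simp: cube_def topspace_Euclidean_space)
   thus ?thesis using X(1) by auto
  qed (use e y in \<open>auto simp: cube_def\<close>)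
  thus "y : PiE UNIV X" by auto
 qed
 thus ?thesis using e X(3) by blast
qed

lemma openin_cube: "openE n (cube n x e)"
 unfolding openin_Euclidean_space_iff_open
 by (rule exI[of _ "{y. ALL i<n. abs (y i - x i)<e}"]) (auto simp: open_coordinate_box cube_def)

lemma openin_Euclidean_space_iff:
 "openE n U \<longleftrightarrow> U \<subseteq> spaceE n & (ALL x:U. EX e>0. cube n x e \<subseteq> U)"
proof
 assume U: "openE n U"
 then obtain A where A: "open A" "U = A \<inter> {x. ALL i>=n. x i = 0}"
  unfolding openin_Euclidean_space_iff_open by auto
 have "EX e>0. cube n x e \<subseteq> U" if "x : U" for x
 proof -
  have "x : spaceE n" using that openin_subset[OF U] by auto
  moreover have "x : A" using that A(2) by blast
  ultimately obtain e where "e > 0" "cube n x e \<subseteq> A"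
   using open_contains_coordinate_box[of A x n] A(1) by blast
  thus ?thesis using A(2) by (auto simp: cube_def)
 qed
 thus "U \<subseteq> spaceE n & (ALL x:U. EX e>0. cube n x e \<subseteq> U)"
  using openin_subset[OF U] by auto
next
 assume r: "U \<subseteq> spaceE n & (ALL x:U. EX e>0. cube n x e \<subseteq> U)"
 show "openE n U"
 proof (subst openin_subopen, intro ballI)
  fix x assume x: "x : U"
  then obtain e where e: "e > 0" "cube n x e \<subseteq> U" using r by auto
  have "x : spaceE n" using x r by blast
  thus "EX T. openE n T & x : T & T \<subseteq> U"
   using e by (intro exI[of _ "cube n x e"] conjI openin_cube cube_center)
 qed
qed

lemma open_cubeE:
 assumes "openE n U" "x : U"
 obtains e where "e > 0" "cube n x e \<subseteq> U"
 using assms unfolding openin_Euclidean_space_iff by blast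

lemma continuous_on_cube_iff:
 assumes "U \<subseteq> spaceE n"
 shows "continuous_on U (f :: rn => real) \<longleftrightarrow>
  (ALL x:U. ALL eps>0. EX d>0. ALL y:U. (ALL i<n. abs (y i - x i)<d) --> abs (f y - f x)<eps)"
proof
 assume c: "continuous_on U f"
 show "ALL x:U. ALL eps>0. EX d>0. ALL y:U. (ALL i<n. abs (y i - x i)<d) --> abs (f y - f x)<eps"
 proof (intro ballI allI impI)
  fix x and eps :: real assume x: "x : U" and eps: "eps > 0"
  have "open (ball (f x) eps)" "f x : ball (f x) eps" using eps by auto
  then obtain A where A: "open A" "x : A" "ALL y:U. y : A --> f y : ball (f x) eps"
   using c x unfolding continuous_on_topological by meson
  then obtain e where e: "e > 0" "cube n x e \<subseteq> A"
   using open_contains_coordinate_box x assms by blast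
  have "abs (f y - f x)<eps" if "y : U" "ALL i<n. abs (y i - x i)<e" for y
  proof -
   have "y : cube n x e" using that assms by (auto simp: cube_def topspace_Euclidean_space)
   hence "f y : ball (f x) eps" using A(3) that e by blast
   thus ?thesis by (simp add: dist_real_def abs_minus_commute)
  qed
  thus "EX d>0. ALL y:U. (ALL i<n. abs (y i - x i)<d) --> abs (f y - f x)<eps" using e by blast
 qed
next
 assume r: "ALL x:U. ALL eps>0. EX d>0. ALL y:U. (ALL i<n. abs (y i - x i)<d) --> abs (f y - f x)<eps"
 show "continuous_on U f"
  unfolding continuous_on_topological
 proof (intro ballI allI impI)
  fix x B assume x: "x : U" "open B" "f x : B"
  then obtain eps where eps: "eps > 0" "ALL y. dist y (f x)<eps --> y : B" unfolding open_dist by auto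
  then obtain d where d: "d > 0" "ALL y:U. (ALL i<n. abs (y i - x i)<d) --> abs (f y - f x)<eps" using r x by blast
  show "EX A. open A & x : A & (ALL y:U. y : A --> f y : B)"
   using open_coordinate_box[of n x d] d eps by (intro exI[of _ "{y. ALL i<n. abs (y i - x i)<d}"]) (auto simp: dist_real_def)
 qed
qed

lemma continuous_on_cube_bound:
 assumes "continuous_on U f" "openE n U" "x : U" "eps > (0::real)"
 obtains d where "d > 0" "cube n x d \<subseteq> U" "!!y. y : cube n x d ==> abs (f y - f x)<eps"
proof -
 obtain e where e: "e > 0" "cube n x e \<subseteq> U" using open_cubeE assms by blast
 obtain d where d: "d > 0" "ALL y:U. (ALL i<n. abs (y i - x i)<d) --> abs (f y - f x)<eps"
  using assms(1,3,4) continuous_on_cube_iff[OF openin_subset[OF assms(2)], of f] by blast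
 show ?thesis
 proof (rule that[of "min d e"])
  show "cube n x (min d e) \<subseteq> U" using e cube_mono[of "min d e" e n x] by auto
  thus "abs (f y - f x)<eps" if "y : cube n x (min d e)" for y
   using d that by (auto simp: cube_def)
 qed (use d e in auto)
qed

lemma update_in_cube: "x : spaceE n ==> i<n ==> 0<e ==> abs (t - x i)<e ==> x(i := t) : cube n x e"
 by (auto simp: cube_def topspace_Euclidean_space)

lemma eventually_update_in:
 assumes "openE n U" "x : U" "i<n"
 shows "eventually (%t. x(i := t) : U) (nhds (x i))"
proof -
 obtain e where e: "e > 0" "cube n x e \<subseteq> U" using open_cubeE assms by blast
 have "x : spaceE n" using assms openin_subset by blast
 thus ?thesis using e update_in_cube[OF _ assms(3) e(1)] unfolding eventually_nhds_metric dist_real_def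
  by (metis subsetD)
qed

subsection \<open>Functions of class C1\<close>

text \<open>The gradient is an argument instead of \<open>partial\<close>, so that the sum, product
  and chain rules produce it in closed form.\<close>

definition pd :: "nat => rn set => (rn => real) => (nat => rn => real) => bool" where
 "pd n U f G \<longleftrightarrow> continuous_on U f & (ALL i<n. continuous_on U (G i) &
   (ALL x:U. ((%t. f (x(i := t))) has_real_derivative G i x) (at (x i))))"

abbreviation an_pd where "an_pd n U == analytic_wrt U n (pd n U)"

lemma pd_cong:
 assumes "openE n U" "pd n U f G" "!!x. x : U ==> f' x = f x"
  "!!i x. i<n ==> x : U ==> G' i x = G i x"
 shows "pd n U f' G'"
 unfolding pd_def
proof (intro conjI allI impI ballI)
 show "continuous_on U f'" using assms(2,3) unfolding pd_def by (metis continuous_on_cong)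
 show "continuous_on U (G' i)" if "i<n" for i using assms(2,4) that unfolding pd_def
  by (metis continuous_on_cong)
 fix i x assume i: "i<n" "x : U"
 have "eventually (%t. f' (x(i := t)) = f (x(i := t))) (nhds (x i))"
  using eventually_update_in[OF assms(1) i(2,1)] by eventually_elim (use assms(3) in auto)
 thus "((%t. f' (x(i := t))) has_real_derivative G' i x) (at (x i))"
  using DERIV_cong_ev[of "x i" "x i" "%t. f' (x(i := t))" "%t. f (x(i := t))" "G' i x" "G i x"]
   assms(2,4) i unfolding pd_def by auto
qed

lemma pd_subset: "pd n U f G ==> U' \<subseteq> U ==> pd n U' f G"
 unfolding pd_def by (meson continuous_on_subset subsetD)

lemma pd_const: "pd n U (%_. c) (%_ _. 0)"
 unfolding pd_def by auto

lemma pd_add: "pd n U f G ==> pd n U f' G' ==> pd n U (%x. f x + f' x) (%j x. G j x + G' j x)"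
 unfolding pd_def by (auto intro!: continuous_intros DERIV_add)

lemma pd_mult: "pd n U f G ==> pd n U f' G' ==>
  pd n U (%x. f x * f' x) (%j x. f x * G' j x + G j x * f' x)"
 unfolding pd_def
proof (intro conjI allI impI ballI, goal_cases)
 case (3 i x)
 thus ?case using DERIV_mult[of "%t. f (x(i:=t))" "G i x" "x i" UNIV "%t. f' (x(i:=t))" "G' i x"]
  by (simp add: ac_simps)
qed (auto intro!: continuous_intros)

lemma pd_inverse: "pd n U f G ==> (!!x. x : U ==> f x ~= 0) ==>
   pd n U (%x. inverse (f x)) (%j x. - G j x * inverse (f x) * inverse (f x))"
 unfolding pd_def
proof (intro conjI allI impI ballI, goal_cases)
 case (3 i x)
 thus ?case using DERIV_inverse'[of "%t. f (x(i:=t))" "G i x" "x i" UNIV]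
  by (simp add: ac_simps)
qed (auto intro!: continuous_intros)

lemma derivation_pd: "openE n U ==> derivation_system U n (pd n U)"
 by (unfold_locales; (rule pd_const pd_add pd_mult pd_inverse; (assumption | blast))?)
  (rule pd_cong; (assumption | blast))

lemma pd_sum: "finite I ==> (!!k. k : I ==> pd n U (F k) (G k)) ==>
  pd n U (%x. \<Sum>k\<in>I. F k x) (%j x. \<Sum>k\<in>I. G k j x)"
proof (induction I rule: finite_induct)
 case empty
 thus ?case using pd_const[of n U 0] by simp
next
 case (insert k I)
 thus ?case using pd_add[of n U "F k" "G k"] by simp
qed

lemma pd_unique: "pd n U f G ==> pd n U f G' ==> i<n ==> x : U ==> G i x = G' i x"
 unfolding pd_def by (meson DERIV_unique)

lemma pd_coord: "pd n U (%x. x k) (%i _. if i = k then 1 else 0)"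
 unfolding pd_def
proof (intro conjI allI impI ballI)
 show "continuous_on U (%x::rn. x k)"
  by (rule continuous_on_subset[OF continuous_on_product_coordinates]) auto
 show "((%t. (x(i := t)) k) has_real_derivative (if i = k then 1 else 0)) (at (x i))" for i and x :: rn
  by (cases "i = k") auto
qed auto

lemma mvt_between:
 assumes "!!t. min a b <= t ==> t <= max a b ==> (g has_real_derivative g' t) (at t)"
 shows "EX t. min a b <= t & t <= max a b & g b - g a = g' t*(b - a)"
proof (cases a b rule: linorder_cases)
 case less
 then obtain z where "z > a" "z<b" "g b - g a = (b - a) * g' z" using MVT2[of a b g g'] assms by auto
 thus ?thesis using less by (intro exI[of _ z]) (auto simp: mult.commute)
next
 case greater
 then obtain z where "z > b" "z<a" "g a - g b = (a - b) * g' z" using MVT2[of b a g g'] assms by auto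
 thus ?thesis using greater by (intro exI[of _ z]) (auto simp: algebra_simps)
qed auto

text \<open>Pass from x to y by changing one coordinate at a time and apply the one-variable theorem
  to each leg. This is why every coordinate has its own intermediate point.\<close>

lemma pd_mvt:
 assumes "pd n U f G" "x : spaceE n" "y : spaceE n"
  and "box_between x y \<subseteq> U"
 shows "EX \<xi>. (ALL i<n. \<xi> i : box_between x y) & f y - f x = (\<Sum>i<n. G i (\<xi> i)*(y i - x i))"
proof -
 define z where "z k = (%i. if i<k then y i else x i)" for k :: nat
 have "EX \<xi>:box_between x y. f (z (Suc k)) - f (z k) = G k \<xi>*(y k - x k)" if k: "k<n" for k
 proof -
  have upd: "z (Suc k) = (z k)(k := y k)" "z k = (z k)(k := x k)"
   by (auto simp: z_def fun_eq_iff less_Suc_eq)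
  have bx: "(z k)(k := t) : box_between x y" if "min (x k) (y k) <= t" "t <= max (x k) (y k)" for t
   using that by (auto simp: box_between_def z_def)
  have "((%s. f ((z k)(k := s))) has_real_derivative G k ((z k)(k := t))) (at t)"
   if "min (x k) (y k) <= t" "t <= max (x k) (y k)" for t
  proof -
   have "((z k)(k := t)) : U" using bx[OF that] assms(4) by auto
   hence "((%s. f (((z k)(k := t))(k := s))) has_real_derivative G k ((z k)(k := t))) (at (((z k)(k := t)) k))"
    using assms(1) k unfolding pd_def by blast
   thus ?thesis by simp
  qed
  from mvt_between[of "x k" "y k", OF this] show ?thesis using bx upd by metis
 qed
 then obtain \<xi> where \<xi>: "!!k. k<n ==> \<xi> k : box_between x y & f (z (Suc k)) - f (z k) = G k (\<xi> k)*(y k - x k)"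
  by metis
 have "f (z n) - f (z 0) = (\<Sum>k<n. f (z (Suc k)) - f (z k))" using sum_lessThan_telescope[of "%k. f (z k)" n] by simp
 moreover have "z 0 = x" by (simp add: z_def)
 moreover have "z n = y" using assms(2,3) by (auto simp: z_def fun_eq_iff topspace_Euclidean_space)
 ultimately show ?thesis using \<xi> by (intro exI[of _ \<xi>]) auto
qed

lemma box_between_cube: "x : cube n c e ==> y : cube n c e ==> box_between x y \<subseteq> cube n c e"
 unfolding cube_def box_between_def
proof (clarify, intro conjI allI impI)
 fix z i assume a: "ALL i<n. abs (x i - c i)<e" "ALL i<n. abs (y i - c i)<e"
  "ALL k. min (x k) (y k) <= z k & z k <= max (x k) (y k)" "i<n"
 hence "abs (x i - c i)<e" "abs (y i - c i)<e" "min (x i) (y i) <= z i" "z i <= max (x i) (y i)" by auto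
 thus "abs (z i - c i)<e" by linarith
next
 fix z i assume "ALL i>=n. x i = 0" "ALL i>=n. y i = 0" "ALL k. min (x k) (y k) <= z k & z k <= max (x k) (y k)" "n <= i"
 hence "x i = 0" "y i = 0" "min (x i) (y i) <= z i & z i <= max (x i) (y i)" by blast+
 thus "z i = 0" by simp
qed

lemma box_between_dist: "z : box_between x y ==> abs (z i - x i) <= abs (y i - x i)"
 unfolding box_between_def by (auto dest!: spec[of _ i])

lemma pd_mvt_cube:
 assumes "pd n U f G" "x : cube n c e" "y : cube n c e" "cube n c e \<subseteq> U"
 shows "EX \<xi>. (ALL i<n. \<xi> i : cube n c e & (ALL k. abs (\<xi> i k - x k) <= abs (y k - x k))) &
  f y - f x = (\<Sum>i<n. G i (\<xi> i)*(y i - x i))"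
proof -
 have "box_between x y \<subseteq> U" using box_between_cube assms by blast
 then obtain \<xi> where \<xi>: "ALL i<n. \<xi> i : box_between x y" "f y - f x = (\<Sum>i<n. G i (\<xi> i)*(y i - x i))"
  using pd_mvt[OF assms(1)] assms(2,3) cube_subset_topspace by blast
 thus ?thesis using box_between_cube[OF assms(2,3)] box_between_dist by blast
qed

text \<open>Caratheodory's form of differentiability: an exact identity whose coefficients tend to
  the gradient, with no remainder term. The chain rule and the derivative of an inverse map are
  obtained as limits of algebraic identities from it.\<close>

lemma pd_caratheodory:
 assumes "pd n U f G" "openE n U" "x : U"
 obtains e g where "e > 0" "cube n x e \<subseteq> U"
  "!!y. y : cube n x e ==> f y - f x = (\<Sum>i<n. g y i*(y i - x i))"
  "!!eps. eps > 0 ==> EX d>0. ALL y:cube n x d. ALL i<n. abs (g y i - G i x)<eps"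
proof -
 obtain e where e: "e > 0" "cube n x e \<subseteq> U" using open_cubeE assms by blast
 have x: "x : cube n x e" using cube_center e assms openin_subset by blast
 have "EX \<xi>. (ALL i<n. \<xi> i : cube n x e & (ALL k. abs (\<xi> i k - x k) <= abs (y k - x k))) &
   f y - f x = (\<Sum>i<n. G i (\<xi> i)*(y i - x i))" if "y : cube n x e" for y
  using pd_mvt_cube[OF assms(1) x that e(2)] .
 hence "ALL y:cube n x e. EX \<xi>. (ALL i<n. \<xi> i : cube n x e & (ALL k. abs (\<xi> i k - x k) <= abs (y k - x k))) &
   f y - f x = (\<Sum>i<n. G i (\<xi> i)*(y i - x i))" by blast
 from bchoice[OF this] obtain \<xi> where \<xi>: "ALL y:cube n x e. (ALL i<n. \<xi> y i : cube n x e & (ALL k. abs (\<xi> y i k - x k) <= abs (y k - x k))) &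
   f y - f x = (\<Sum>i<n. G i (\<xi> y i)*(y i - x i))" by blast
 show ?thesis
 proof (rule that[of e "%y i. G i (\<xi> y i)"])
  fix eps :: real assume eps: "eps > 0"
  have "EX d>0. ALL i<n. cube n x d \<subseteq> U & (ALL y:cube n x d. abs (G i y - G i x)<eps)"
  proof (rule ex_common_pos)
   fix i assume "i<n"
   hence "continuous_on U (G i)" using assms(1) unfolding pd_def by auto
   from continuous_on_cube_bound[OF this assms(2,3) eps]
   show "EX d>0. cube n x d \<subseteq> U & (ALL y:cube n x d. abs (G i y - G i x)<eps)" by metis
  qed (meson cube_mono subset_iff)
  then obtain d where d: "d > 0" "ALL i<n. ALL y:cube n x d. abs (G i y - G i x)<eps" by blast
  have "\<xi> y i : cube n x d" if "y : cube n x (min d e)" "i<n" for y i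
  proof -
   have y: "y : cube n x e" using that cube_mono[of "min d e" e] by auto
   have "abs (\<xi> y i k - x k) <= abs (y k - x k)" "\<xi> y i : cube n x e" for k using \<xi> y that by auto
   moreover have "abs (y k - x k)<d" if "k<n" for k using \<open>y : cube n x (min d e)\<close> that by (auto simp: cube_def)
   ultimately have "abs (\<xi> y i k - x k)<d" if "k<n" for k using that by (meson le_less_trans)
   thus ?thesis using \<open>\<xi> y i : cube n x e\<close> by (simp add: cube_def)
  qed
  thus "EX d>0. ALL y:cube n x d. ALL i<n. abs (G i (\<xi> y i) - G i x)<eps"
   using d e by (intro exI[of _ "min d e"]) auto
 qed (use e \<xi> in auto)
qed

lemma eventually_in_cube:
 assumes "!!i. i<n ==> ((%r. cu r i) \<longlongrightarrow> x i) F" "eventually (%r. cu r : spaceE n) F" "d > 0"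
 shows "eventually (%r. cu r : cube n x d) F"
proof -
 have "eventually (%r. ALL i:{..<n}. abs (cu r i - x i)<d) F"
  using assms(1) tendstoD[OF assms(1) assms(3)] by (intro eventually_ball_finite) (auto simp: dist_real_def)
 with assms(2) show ?thesis by eventually_elim (auto simp: cube_def topspace_Euclidean_space)
qed

text \<open>The limit is taken in Caratheodory's identity, so the curve has to be differentiable at
  s only. The set S admits one-sided derivatives at the ends of an interval.\<close>

lemma pd_chain_curve:
 assumes "pd n U f G" "openE n U" "cu s : U"
  and d: "!!i. i<n ==> ((%r. cu r i) has_real_derivative v i) (at s within S)"
  and t: "eventually (%r. cu r : spaceE n) (at s within S)"
 shows "((%r. f (cu r)) has_real_derivative (\<Sum>i<n. G i (cu s) * v i)) (at s within S)"
proof -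
 obtain e g where e: "e > 0" "cube n (cu s) e \<subseteq> U"
  "!!y. y : cube n (cu s) e ==> f y - f (cu s) = (\<Sum>i<n. g y i*(y i - cu s i))"
  "!!eps. eps > 0 ==> EX d>0. ALL y:cube n (cu s) d. ALL i<n. abs (g y i - G i (cu s))<eps"
  using pd_caratheodory[OF assms(1-3)] by blast
 have c: "((%r. cu r i) \<longlongrightarrow> cu s i) (at s within S)" if "i<n" for i
  using DERIV_continuous[OF d[OF that]] by (simp add: continuous_within)
 have ev: "eventually (%r. cu r : cube n (cu s) d) (at s within S)" if "d > 0" for d
  using c t that by (rule eventually_in_cube)
 have g: "((%r. g (cu r) i) \<longlongrightarrow> G i (cu s)) (at s within S)" if "i<n" for i
 proof (rule tendstoI)
  fix eps :: real assume "eps > 0"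
  then obtain d where "d > 0" "ALL y:cube n (cu s) d. ALL i<n. abs (g y i - G i (cu s))<eps" using e(4) by blast
  thus "\<forall>\<^sub>F r in at s within S. dist (g (cu r) i) (G i (cu s))<eps"
   using ev[of d] that by (auto simp: dist_real_def elim: eventually_mono)
 qed
 have "((%r. \<Sum>i<n. g (cu r) i*((cu r i - cu s i)/(r - s))) \<longlongrightarrow> (\<Sum>i<n. G i (cu s) * v i)) (at s within S)"
  using d g by (intro tendsto_sum tendsto_mult) (auto simp: has_field_derivative_iff)
 moreover have "\<forall>\<^sub>F r in at s within S. (\<Sum>i<n. g (cu r) i*((cu r i - cu s i)/(r - s))) = (f (cu r) - f (cu s))/(r - s)"
  using ev[OF e(1)] by eventually_elim (simp add: e(3) sum_divide_distrib)
 ultimately show ?thesis unfolding has_field_derivative_iff by (rule Lim_transform_eventually)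
qed

lemma continuous_on_into_Euclidean:
 assumes "!!k. k<n ==> continuous_on A (%x. H x k)" "!!x. x : A ==> H x : spaceE n"
 shows "continuous_on A (H :: 'b::topological_space => rn)"
proof (rule continuous_on_coordinatewise_then_product)
 fix k show "continuous_on A (%x. H x k)"
 proof (cases "k<n")
  case False
  hence "continuous_on A (%x. H x k) = continuous_on A (%_. 0::real)"
   using assms(2) by (intro continuous_on_cong) (auto simp: topspace_Euclidean_space)
  thus ?thesis by simp
 qed (use assms in auto)
qed

lemma pd_compose:
 assumes "pd n U f G" "openE n U" "openin (Euclidean_space m) D"
  and H: "!!k. k<n ==> pd m D (%x. H x k) (K k)" and HU: "!!x. x : D ==> H x : U"
 shows "pd m D (%x. f (H x)) (%i x. \<Sum>k<n. G k (H x) * K k i x)"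
 unfolding pd_def
proof (intro conjI allI impI ballI)
 have HT: "H x : spaceE n" if "x : D" for x using HU[OF that] openin_subset[OF assms(2)] by auto
 have cH: "continuous_on D H"
  using H HT by (intro continuous_on_into_Euclidean[of n]) (auto simp: pd_def)
 have comp: "continuous_on D (%x. h (H x))" if "continuous_on U h" for h :: "rn => real"
  using continuous_on_compose2[OF that cH] HU by auto
 show "continuous_on D (%x. f (H x))" using comp assms(1) unfolding pd_def by blast
 show "continuous_on D (%x. \<Sum>k<n. G k (H x) * K k i x)" if "i<m" for i
  using assms(1) H that unfolding pd_def by (intro continuous_intros comp) auto
 fix i x assume i: "i<m" and x: "x : D"
 have "((%t. f (H (x(i := t)))) has_real_derivative (\<Sum>k<n. G k (H (x(i := x i))) * K k i x)) (at (x i))"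
 proof (rule pd_chain_curve[OF assms(1,2), of "%t. H (x(i := t))"])
  show "H (x(i := x i)) : U" using x HU by simp
  show "((%r. H (x(i := r)) k) has_real_derivative K k i x) (at (x i))" if "k<n" for k
   using H[OF that] i x unfolding pd_def by auto
  have "\<forall>\<^sub>F t in at (x i). x(i := t) : D"
   using eventually_update_in[OF assms(3) x i] by (simp add: eventually_at_filter eventually_mono)
  thus "\<forall>\<^sub>F t in at (x i). H (x(i := t)) : spaceE n"
   by eventually_elim (use HT in auto)
 qed
 thus "((%t. f (H (x(i := t)))) has_real_derivative (\<Sum>k<n. G k (H x) * K k i x)) (at (x i))" by simp
qed

subsection \<open>The classes C_k\<close>

lemma C_k_on_continuous: "C_k_on k n U f ==> continuous_on U f"
 by (cases k) auto

lemma partial_cong: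
 assumes "openE n U" "!!x. x : U ==> f x = g x" "i<n" "x : U"
 shows "partial i f x = partial i g x"
 unfolding partial_def
 by (rule deriv_cong_ev, rule eventually_mono[OF eventually_update_in[OF assms(1,4,3)]]) (use assms(2) in auto)

lemma pd_partial: "pd n U f G ==> i<n ==> x : U ==> partial i f x = G i x"
 unfolding pd_def partial_def by (meson DERIV_imp_deriv)

lemma C_k_on_cong:
 assumes "openE n U"
 shows "(!!x. x : U ==> f x = g x) ==> C_k_on k n U f ==> C_k_on k n U g"
proof (induction k arbitrary: f g)
 case 0
 thus ?case using continuous_on_cong by (metis C_k_on.simps(1))
next
 case (Suc k)
 have 1: "continuous_on U g" using Suc.prems continuous_on_cong[of U U f g] C_k_on_continuous by blast
 have 2: "C_k_on k n U (partial i g)" if "i<n" for i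
  using Suc.IH[of "partial i f" "partial i g"] partial_cong[OF assms Suc.prems(1) that] Suc.prems(2) that by auto
 have 3: "(%t. g (x(i := t))) field_differentiable at (x i)" if "i<n" "x : U" for i x
 proof -
  have "\<forall>\<^sub>F t in nhds (x i). f (x(i := t)) = g (x(i := t))"
   using eventually_update_in[OF assms that(2,1)] by eventually_elim (use Suc.prems(1) in auto)
  moreover have "(%t. f (x(i := t))) field_differentiable at (x i)" using Suc.prems(2) that by auto
  then obtain f' where "((%t. f (x(i := t))) has_real_derivative f') (at (x i))" unfolding field_differentiable_def by blast
  ultimately have "((%t. g (x(i := t))) has_real_derivative f') (at (x i))"
   using DERIV_cong_ev[OF refl _ refl, of "%t. f (x(i := t))" "%t. g (x(i := t))" "x i" f'] by simp
  thus ?thesis unfolding field_differentiable_def by blast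
 qed
 show ?case using 1 2 3 by simp
qed

lemma C_k_on_SucE:
 assumes "C_k_on (Suc k) n U f"
 shows "pd n U f (%i. partial i f)" "!!i. i<n ==> C_k_on k n U (partial i f)"
proof -
 show "C_k_on k n U (partial i f)" if "i<n" for i using assms that by simp
 thus "pd n U f (%i. partial i f)"
  using assms C_k_on_continuous[of k n U "partial _ f"] unfolding pd_def
  by (simp add: DERIV_deriv_iff_field_differentiable partial_def[abs_def])
qed

lemma C_k_on_SucI:
 assumes "openE n U" "pd n U f G" "!!i. i<n ==> C_k_on k n U (G i)"
 shows "C_k_on (Suc k) n U f"
proof -
 have "C_k_on k n U (partial i f)" if "i<n" for i
  by (rule C_k_on_cong[OF assms(1) _ assms(3)[OF that]]) (use pd_partial[OF assms(2) that] in auto)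
 moreover have "(%t. f (x(i := t))) field_differentiable at (x i)" if "i<n" "x : U" for i x
  using assms(2) that unfolding pd_def field_differentiable_def by blast
 ultimately show ?thesis using assms(2) by (auto simp: pd_def)
qed

lemma C_k_on_subset:
 assumes "openE n U'" "U' \<subseteq> U"
 shows "C_k_on k n U f ==> C_k_on k n U' f"
 using assms(2) by (induction k arbitrary: f) (auto intro: continuous_on_subset)

lemma C1_iff: "openE n U ==> C_k_on 1 n U f \<longleftrightarrow> (EX G. pd n U f G)"
 using C_k_on_SucE(1)[of 0 n U f] C_k_on_SucI[of n U f _ 0] unfolding One_nat_def
 by (metis C_k_on.simps(1) pd_def)

lemma C2_iff: "openE n U ==> C_k_on 2 n U f \<longleftrightarrow> (EX G H. pd n U f G & (ALL i<n. pd n U (G i) (H i)))"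
proof
 assume o: "openE n U"
 { assume "C_k_on 2 n U f"
  hence c: "C_k_on (Suc (Suc 0)) n U f" by (simp add: numeral_2_eq_2)
  show "EX G H. pd n U f G & (ALL i<n. pd n U (G i) (H i))"
   by (intro exI[of _ "%i. partial i f"] exI[of _ "%i k. partial k (partial i f)"] conjI allI impI
     C_k_on_SucE(1)[OF c] C_k_on_SucE(1)[OF C_k_on_SucE(2)[OF c]]) }
 { assume "EX G H. pd n U f G & (ALL i<n. pd n U (G i) (H i))"
  then obtain G H where gh: "pd n U f G" "ALL i<n. pd n U (G i) (H i)" by blast
  have "C_k_on (Suc (Suc 0)) n U f"
   using C_k_on_SucI[OF o gh(1)] C_k_on_SucI[OF o, of "G _" _ 0] gh(2) by (metis C_k_on.simps(1) pd_def)
  thus "C_k_on 2 n U f" by (simp add: numeral_2_eq_2) }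
qed

lemma C2_compose:
 assumes "C_k_on 2 n U f" "openE n U" "openin (Euclidean_space m) D"
  and H: "!!k. k<n ==> C_k_on 2 m D (%x. H x k)" and HU: "!!x. x : D ==> H x : U"
 shows "C_k_on 2 m D (%x. f (H x))"
proof -
 obtain G GG where G: "pd n U f G" "ALL i<n. pd n U (G i) (GG i)" using assms(1) C2_iff[OF assms(2)] by blast
 have "ALL k<n. EX K KK. pd m D (%x. H x k) K & (ALL i<m. pd m D (K i) (KK i))"
  using H C2_iff[OF assms(3)] by blast
 then obtain K KK where K: "!!k. k<n ==> pd m D (%x. H x k) (K k) & (ALL i<m. pd m D (K k i) (KK k i))" by metis
 have KD: "pd m D (%x. H x k) (K k)" "!!i. i<m ==> pd m D (K k i) (KK k i)" if "k<n" for k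
  using K[OF that] by auto
 have L1: "pd m D (%x. \<Sum>k<n. G k (H x) * K k i x) (%j x. \<Sum>k<n. G k (H x) * KK k i j x +
   (\<Sum>l<n. GG k l (H x) * K l j x) * K k i x)" if "i<m" for i
  by (intro pd_sum pd_mult pd_compose[OF _ assms(2,3)] KD HU that) (use G(2) in auto)
 have L2: "pd m D (%x. f (H x)) (%i x. \<Sum>k<n. G k (H x) * K k i x)"
  by (intro pd_compose[OF G(1) assms(2,3)] KD(1) HU)
 show ?thesis unfolding C2_iff[OF assms(3)]
  by (rule exI, rule exI, rule conjI, rule L2, intro allI impI, rule L1)
qed

text \<open>The second difference over a square of side h equals h^2 times either mixed derivative
  at some point of the square, according to the order in which the mean value theorem is applied.
  Continuity at x excludes two different values.\<close>

lemma pd_symmetric: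
 assumes "openE n U" "pd n U f G" "pd n U (G i) GI" "pd n U (G j) GJ"
  and ij: "i<n" "j<n" "i ~= j" and x: "x : U"
 shows "GI j x = GJ i x"
proof (rule ccontr)
 assume ne: "GI j x ~= GJ i x"
 define eps where "eps = abs (GI j x - GJ i x)/2"
 have eps: "eps > 0" using ne by (simp add: eps_def)
 have c: "continuous_on U (GI j)" "continuous_on U (GJ i)" using assms(3,4) ij unfolding pd_def by auto
 obtain d1 where d1: "d1 > 0" "cube n x d1 \<subseteq> U" "!!y. y : cube n x d1 ==> abs (GI j y - GI j x)<eps"
  using continuous_on_cube_bound[OF c(1) assms(1) x eps] by blast
 obtain d2 where d2: "d2 > 0" "cube n x d2 \<subseteq> U" "!!y. y : cube n x d2 ==> abs (GJ i y - GJ i x)<eps"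
  using continuous_on_cube_bound[OF c(2) assms(1) x eps] by blast
 define h where "h = min d1 d2/2"
 have h: "h > 0" "h<d1" "h<d2" using d1 d2 by (auto simp: h_def)
 define pt where "pt s t = x(i := x i + s, j := x j + t)" for s t :: real
 have xt: "x : spaceE n" using x openin_subset[OF assms(1)] by auto
 have pt: "pt s t : cube n x d1" "pt s t : cube n x d2" if "0 <= s" "s <= h" "0 <= t" "t <= h" for s t
  using that h xt ij d1 d2 by (auto simp: pt_def cube_def topspace_Euclidean_space)
 have Ds: "((%s. F (pt s t)) has_real_derivative G' (pt s t)) (at s)"
  if "pd n U F GG" "GG i = G'" "0 <= s" "s <= h" "0 <= t" "t <= h" for F GG G' s t
 proof -
  have "pt s t : U" using pt(1) that d1(2) by blast
  hence "((%r. F ((pt s t)(i := r))) has_real_derivative G' (pt s t)) (at ((pt s t) i))"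
   using that ij unfolding pd_def by blast
  moreover have "(pt s t) i = x i + s" "(pt s t)(i := r) = pt (r - x i) t" for r
   using ij by (auto simp: pt_def)
  ultimately have "((%r. F (pt (r - x i) t)) has_real_derivative G' (pt s t)) (at (s + x i))"
   by (simp add: add.commute)
  thus ?thesis using DERIV_shift[of "%r. F (pt (r - x i) t)" "G' (pt s t)" s "x i"] by simp
 qed
 have Dt: "((%t. F (pt s t)) has_real_derivative G' (pt s t)) (at t)"
  if "pd n U F GG" "GG j = G'" "0 <= s" "s <= h" "0 <= t" "t <= h" for F GG G' s t
 proof -
  have "pt s t : U" using pt(1) that d1(2) by blast
  hence "((%r. F ((pt s t)(j := r))) has_real_derivative G' (pt s t)) (at ((pt s t) j))"
   using that ij unfolding pd_def by blast
  moreover have "(pt s t) j = x j + t" "(pt s t)(j := r) = pt s (r - x j)" for r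
   using ij by (auto simp: pt_def)
  ultimately have "((%r. F (pt s (r - x j))) has_real_derivative G' (pt s t)) (at (t + x j))"
   by (simp add: add.commute)
  thus ?thesis using DERIV_shift[of "%r. F (pt s (r - x j))" "G' (pt s t)" t "x j"] by simp
 qed
 define \<Delta> where "\<Delta> = f (pt h h) - f (pt h 0) - f (pt 0 h) + f (pt 0 0)"
 have "EX s t. 0 <= s & s <= h & 0 <= t & t <= h & \<Delta> = h*(h * GI j (pt s t))"
 proof -
  have "EX s. 0<s & s<h & (f (pt h h) - f (pt h 0)) - (f (pt 0 h) - f (pt 0 0)) = (h - 0)*(G i (pt s h) - G i (pt s 0))"
   using h by (intro MVT2) (auto intro!: DERIV_diff Ds[OF assms(2) refl])
  then obtain s where s: "0<s" "s<h" "\<Delta> = h*(G i (pt s h) - G i (pt s 0))" by (auto simp: \<Delta>_def algebra_simps)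
  have "EX t. 0<t & t<h & G i (pt s h) - G i (pt s 0) = (h - 0) * GI j (pt s t)"
   using h s by (intro MVT2) (auto intro!: Dt[OF assms(3) refl])
  then obtain t where "0<t" "t<h" "G i (pt s h) - G i (pt s 0) = (h - 0) * GI j (pt s t)" by blast
  thus ?thesis using s by (intro exI[of _ s] exI[of _ t]) auto
 qed
 then obtain s t where st: "0 <= s" "s <= h" "0 <= t" "t <= h" "\<Delta> = h*(h * GI j (pt s t))" by blast
 have "EX s t. 0 <= s & s <= h & 0 <= t & t <= h & \<Delta> = h*(h * GJ i (pt s t))"
 proof -
  have "EX t. 0<t & t<h & (f (pt h h) - f (pt 0 h)) - (f (pt h 0) - f (pt 0 0)) = (h - 0)*(G j (pt h t) - G j (pt 0 t))"
   using h by (intro MVT2) (auto intro!: DERIV_diff Dt[OF assms(2) refl])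
  then obtain t where t: "0<t" "t<h" "\<Delta> = h*(G j (pt h t) - G j (pt 0 t))" by (auto simp: \<Delta>_def algebra_simps)
  have "EX s. 0<s & s<h & G j (pt h t) - G j (pt 0 t) = (h - 0) * GJ i (pt s t)"
   using h t by (intro MVT2) (auto intro!: Ds[OF assms(4) refl])
  then obtain s where "0<s" "s<h" "G j (pt h t) - G j (pt 0 t) = (h - 0) * GJ i (pt s t)" by blast
  thus ?thesis using t by (intro exI[of _ s] exI[of _ t]) auto
 qed
 then obtain s' t' where st': "0 <= s'" "s' <= h" "0 <= t'" "t' <= h" "\<Delta> = h*(h * GJ i (pt s' t'))" by blast
 have "GI j (pt s t) = GJ i (pt s' t')" using st(5) st'(5) h by simp
 hence "abs (GI j x - GJ i x) <= abs (GI j (pt s t) - GI j x) + abs (GJ i (pt s' t') - GJ i x)" by linarith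
 thus False using d1(3)[OF pt(1)[OF st(1-4)]] d2(3)[OF pt(2)[OF st'(1-4)]] unfolding eps_def by (simp add: field_simps)
qed

subsection \<open>Derivations given by vector fields\<close>

text \<open>Membership asks for a gradient, so f is C^1 in the coordinates; the rules for
  \<open>dw\<close> are then inherited from \<open>pd\<close> although the fields themselves may be
  dependent.\<close>

definition dw :: "nat => rn set => (nat => nat => rn => real) => nat =>
  (rn => real) => (nat => rn => real) => bool" where
 "dw n U w q f G \<longleftrightarrow> (EX P. pd n U f P & (ALL j<q. ALL x:U. G j x = (\<Sum>i<n. w j i x * P i x)))"

abbreviation an_dw where "an_dw n U w q == analytic_wrt U q (dw n U w q)"

lemma dwI: "pd n U f P ==> dw n U w q f (%j x. \<Sum>i<n. w j i x * P i x)"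
 unfolding dw_def by blast

lemma derivation_dw:
 assumes "openE n U"
 shows "derivation_system U q (dw n U w q)"
proof
 show "dw n U w q f G ==> (!!x. x : U ==> f' x = f x) ==> (!!j x. j<q ==> x : U ==> G' j x = G j x) ==> dw n U w q f' G'"
  for f G f' G' using pd_cong[OF assms, of f _ f'] unfolding dw_def by metis
 show "dw n U w q (%_. c) (%_ _. 0)" for c unfolding dw_def using pd_const by force
 show "dw n U w q f G ==> dw n U w q f' G' ==> dw n U w q (%x. f x + f' x) (%j x. G j x + G' j x)" for f G f' G'
  unfolding dw_def using pd_add[of n U f _ f'] by (fastforce simp: sum.distrib algebra_simps)
 show "dw n U w q (%x. f x * f' x) (%j x. f x * G' j x + G j x * f' x)" if dfG: "dw n U w q f G" and dfG': "dw n U w q f' G'" for f G f' G'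
 proof -
  obtain P where P: "pd n U f P" "ALL j<q. ALL x:U. G j x = (\<Sum>i<n. w j i x * P i x)"
   using dfG unfolding dw_def by blast
  obtain P' where P': "pd n U f' P'" "ALL j<q. ALL x:U. G' j x = (\<Sum>i<n. w j i x * P' i x)"
   using dfG' unfolding dw_def by blast
  note P = P P'
  show ?thesis unfolding dw_def
   by (rule exI, rule conjI, rule pd_mult[OF P(1,3)])
    (use P(2,4) in \<open>auto simp: sum_distrib_left sum_distrib_right sum.distrib[symmetric] algebra_simps intro!: sum.cong\<close>)
 qed
 show "dw n U w q (%x. inverse (f x)) (%j x. - G j x * inverse (f x) * inverse (f x))"
  if dfG: "dw n U w q f G" and nz: "!!x. x : U ==> f x ~= 0" for f G
 proof -
  obtain P where P: "pd n U f P" "ALL j<q. ALL x:U. G j x = (\<Sum>i<n. w j i x * P i x)"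
   using dfG unfolding dw_def by blast
  show ?thesis unfolding dw_def
   by (rule exI, rule conjI, rule pd_inverse[OF P(1) nz])
    (use P(2) in \<open>auto simp: sum_distrib_left sum_distrib_right sum_negf algebra_simps\<close>)
 qed
qed

section \<open>Determinants, Cramer's rule and the choice of a basis\<close>

definition fdet :: "nat => (nat => nat => real) => real" where
 "fdet n m = Determinant.det (Matrix.mat n n (%(i, j). m i j))"

definition fadj :: "nat => (nat => nat => real) => nat => nat => real" where
 "fadj n m i j = adj_mat (Matrix.mat n n (%(i, j). m i j)) $$ (i, j)"

lemma fadj_mult:
 assumes "i<n" "j<n"
 shows "(\<Sum>k<n. fadj n m i k * m k j) = (if i = j then fdet n m else 0)"
  and "(\<Sum>k<n. m i k * fadj n m k j) = (if i = j then fdet n m else 0)"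
proof -
 let ?A = "Matrix.mat n n (%(i, j). m i j)"
 have A: "?A : carrier_mat n n" by simp
 note a = adj_mat[OF A]
 have ca: "dim_row (adj_mat ?A) = n" "dim_col (adj_mat ?A) = n" using a(1) by auto
 have "(adj_mat ?A * ?A) $$ (i, j) = (\<Sum>k<n. fadj n m i k * m k j)"
  using assms ca by (simp add: scalar_prod_def fadj_def lessThan_atLeast0)
 moreover have "(adj_mat ?A * ?A) $$ (i, j) = (if i = j then fdet n m else 0)"
  unfolding a(3) using assms by (simp add: fdet_def)
 ultimately show "(\<Sum>k<n. fadj n m i k * m k j) = (if i = j then fdet n m else 0)" by simp
 have "(?A * adj_mat ?A) $$ (i, j) = (\<Sum>k<n. m i k * fadj n m k j)"
  using assms ca by (simp add: scalar_prod_def fadj_def lessThan_atLeast0)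
 moreover have "(?A * adj_mat ?A) $$ (i, j) = (if i = j then fdet n m else 0)"
  unfolding a(2) using assms by (simp add: fdet_def)
 ultimately show "(\<Sum>k<n. m i k * fadj n m k j) = (if i = j then fdet n m else 0)" by simp
qed

lemma fdet_cong: "(!!i j. i<n ==> j<n ==> m i j = m' i j) ==> fdet n m = fdet n m'"
 unfolding fdet_def by (rule arg_cong[where f="Determinant.det"]) (auto intro!: eq_matI)

lemma fdet_id: "fdet n (%i j. if i = j then 1 else 0) = 1"
proof -
 have "Matrix.mat n n (%(i, j). if i = j then 1 else 0 :: real) = 1\<^sub>m n" by (auto intro!: eq_matI)
 thus ?thesis by (simp add: fdet_def)
qed

lemma fdet_nonzero:
 assumes "!!v. (!!i. i<n ==> (\<Sum>j<n. m i j * v j) = 0) ==> ALL j<n. v j = 0"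
 shows "fdet n m ~= 0"
proof
 assume "fdet n m = 0"
 let ?A = "Matrix.mat n n (%(i, j). m i j)"
 have "?A : carrier_mat n n" by simp
 from det_0_iff_vec_prod_zero_field[OF this] \<open>fdet n m = 0\<close>
 obtain v where v: "v : carrier_vec n" "v ~= 0\<^sub>v n" "?A *\<^sub>v v = 0\<^sub>v n" unfolding fdet_def by blast
 have "(\<Sum>j<n. m i j * vec_index v j) = 0" if "i<n" for i
 proof -
  have "vec_index (?A *\<^sub>v v) i = (\<Sum>j<n. m i j * vec_index v j)"
   using v(1) that by (auto simp: scalar_prod_def lessThan_atLeast0 intro!: sum.cong)
  thus ?thesis using v(3) that by simp
 qed
 hence "ALL j<n. vec_index v j = 0" using assms by blast
 hence "v = 0\<^sub>v n" using v(1) by (intro eq_vecI) auto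
 thus False using v(2) by simp
qed

text \<open>Laplace expansion: the cofactors belonging to row k do not see that row.\<close>

lemma fdet_row_linear:
 assumes "k<n"
 shows "EX c. ALL r. fdet n (m(k := r)) = (\<Sum>j<n. r j * c j)"
proof -
 let ?A = "%r. Matrix.mat n n (%(i, j). (m(k := r)) i j)"
 have del: "mat_delete (?A r) k j = mat_delete (?A (%_. 0)) k j" if "j<n" for r j
  using assms that by (intro eq_matI) (auto simp: mat_delete_def)
 have "fdet n (m(k := r)) = (\<Sum>j<n. r j * cofactor (?A (%_. 0)) k j)" for r
 proof -
  have "fdet n (m(k := r)) = (\<Sum>j<n. ?A r $$ (k, j) * cofactor (?A r) k j)"
   unfolding fdet_def by (rule laplace_expansion_row) (use assms in auto)
  also have "... = (\<Sum>j<n. r j * cofactor (?A (%_. 0)) k j)"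
  proof (rule sum.cong[OF refl])
   fix j assume "j : {..<n}"
   hence "cofactor (?A r) k j = cofactor (?A (%_. 0)) k j" using del[of j r] unfolding cofactor_def by (simp only: lessThan_iff)
   thus "?A r $$ (k, j) * cofactor (?A r) k j = r j * cofactor (?A (%_. 0)) k j"
    using assms \<open>j : {..<n}\<close> by simp
  qed
  finally show ?thesis .
 qed
 thus ?thesis by blast
qed

lemma fdet_rows_distinct:
 assumes "fdet n m ~= 0" "i<n" "j<n" "!!k. k<n ==> m i k = m j k"
 shows "i = j"
proof (rule ccontr)
 assume "i ~= j"
 hence "fdet n m = 0" unfolding fdet_def
  by (intro det_identical_rows[of _ n i j]) (use assms in \<open>auto intro!: eq_vecI\<close>)
 thus False using assms by simp
qed

text \<open>An exchange argument. The rows of the identity matrix are replaced by vectors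
  \<open>W l\<close> one after the other; the determinant is linear in the row being replaced, and
  as the \<open>W l\<close> span, some choice keeps it nonzero.\<close>

lemma spanning_imp_basis:
 assumes "!!v. EX a. ALL i<n. v i = (\<Sum>k<q. a k*(W k i :: real))"
 obtains s where "!!i. i<n ==> s i<q" "fdet n (%i. W (s i)) ~= 0"
proof -
 have "EX s. (ALL i<k. s i<q) & fdet n (%i. if i<k then W (s i) else (%j. if i = j then 1 else 0)) ~= 0"
  if "k <= n" for k
  using that
 proof (induction k)
  case 0
  thus ?case using fdet_id[of n] by simp
 next
  case (Suc k)
  then obtain s where s: "ALL i<k. s i<q"
   "fdet n (%i. if i<k then W (s i) else (%j. if i = j then 1 else 0)) ~= 0" by auto
  define m where "m = (%i. if i<k then W (s i) else (%j. if i = j then 1 else (0::real)))"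
  have k: "k<n" using Suc by auto
  obtain c where c: "!!r. fdet n (m(k := r)) = (\<Sum>j<n. r j * c j)" using fdet_row_linear[OF k] by blast
  obtain a where a: "ALL i<n. (if k = i then 1 else 0) = (\<Sum>l<q. a l * W l i)"
   using assms[of "%i. if k = i then 1 else 0"] by blast
  have "m = m(k := (%j. if k = j then 1 else 0))" by (auto simp: m_def)
  hence "fdet n m = (\<Sum>j<n. (if k = j then 1 else 0) * c j)" using c by metis
  also have "... = (\<Sum>j<n. (\<Sum>l<q. a l * W l j) * c j)" using a by (intro sum.cong) auto
  also have "... = (\<Sum>l<q. a l*(\<Sum>j<n. W l j * c j))"
   by (subst sum.swap[of _ "{..<q}"] | simp add: sum_distrib_left sum_distrib_right mult.assoc)+
  finally have "(\<Sum>l<q. a l*(\<Sum>j<n. W l j * c j)) ~= 0" using s(2) by (simp add: m_def)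
  then obtain l where l: "l<q" "(\<Sum>j<n. W l j * c j) ~= 0"
   by (metis (no_types, lifting) lessThan_iff mult_zero_right sum.neutral)
  have "m(k := W l) = (%i. if i<Suc k then W ((s(k := l)) i) else (%j. if i = j then 1 else 0))"
   by (auto simp: m_def less_Suc_eq)
  thus ?case using c[of "W l"] l s(1) by (intro exI[of _ "s(k := l)"]) (auto simp: less_Suc_eq)
 qed
 from this[of n] obtain s where s: "ALL i<n. s i<q"
   "fdet n (%i. if i<n then W (s i) else (%j. if i = j then 1 else 0)) ~= 0" by blast
 have "fdet n (%i. W (s i)) = fdet n (%i. if i<n then W (s i) else (%j. if i = j then 1 else 0))"
  by (rule fdet_cong) auto
 thus ?thesis using that[of s] s by auto
qed

text \<open>Turns a selection of n independent fields into a full reordering, the form that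
  \<open>good_orderings\<close> demands.\<close>

lemma extend_to_bij:
 assumes "inj_on s {..<n}" "s ` {..<n} \<subseteq> {..<q::nat}"
 obtains \<sigma> where "bij_betw \<sigma> {..<q} {..<q}" "n <= q" "!!i. i<n ==> \<sigma> i = s i"
proof -
 have nq: "n <= q" using card_inj_on_le[OF assms] by simp
 have "card ({..<q} - s ` {..<n}) = card ({n..<q})"
  using assms by (simp add: card_Diff_subset card_image)
 then obtain h where h: "bij_betw h {n..<q} ({..<q} - s ` {..<n})"
  by (metis finite_Diff finite_atLeastLessThan finite_lessThan finite_same_card_bij)
 define \<sigma> where "\<sigma> i = (if i<n then s i else h i)" for i
 have "bij_betw \<sigma> {..<n} (s ` {..<n})"
  using assms(1) by (intro bij_betw_imageI) (auto simp: \<sigma>_def inj_on_def)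
 moreover have "bij_betw \<sigma> {n..<q} ({..<q} - s ` {..<n})"
  using h by (rule bij_betw_cong[THEN iffD1, rotated]) (auto simp: \<sigma>_def)
 ultimately have "bij_betw \<sigma> ({..<n} \<union> {n..<q}) (s ` {..<n} \<union> ({..<q} - s ` {..<n}))"
  by (rule bij_betw_combine) auto
 moreover have "{..<n} \<union> {n..<q} = {..<q}" using nq by auto
 moreover have "s ` {..<n} \<union> ({..<q} - s ` {..<n}) = {..<q}" using assms(2) by auto
 ultimately show ?thesis using that[of \<sigma>] nq by (simp add: \<sigma>_def)
qed

subsection \<open>Matrices of functions\<close>

text \<open>The common frame for C^1 and analytic functions. Inverses are taken under a uniform
  lower bound because analyticity carries estimates valid on the whole domain.\<close>

locale func_class =
 fixes n :: nat and P :: "rn set => (rn => real) => bool"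
 assumes cl_subset: "P U f ==> U' \<subseteq> U ==> openE n U' ==> P U' f"
  and cl_const: "openE n U ==> P U (%_. c)"
  and cl_add: "openE n U ==> P U f ==> P U g ==> P U (%x. f x + g x)"
  and cl_mult: "openE n U ==> P U f ==> P U g ==> P U (%x. f x * g x)"
  and cl_inverse: "openE n U ==> P U f ==> (!!x. x : U ==> \<delta> <= abs (f x)) ==> 0<\<delta> ==>
   P U (%x. inverse (f x))"
  and cl_continuous: "openE n U ==> P U f ==> continuous_on U f"
begin

lemma cl_sum: "finite I ==> openE n U ==> (!!i. i : I ==> P U (F i)) ==> P U (%x. \<Sum>i\<in>I. F i x)"
 by (induction I rule: finite_induct) (auto intro: cl_add cl_const)

lemma cl_prod: "finite I ==> openE n U ==> (!!i. i : I ==> P U (F i)) ==> P U (%x. \<Prod>i\<in>I. F i x)"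
 by (induction I rule: finite_induct) (auto intro: cl_mult cl_const)

lemma cl_det_mat:
 assumes U: "openE n U" and A: "!!x. A x : carrier_mat N N"
  and "!!i j. i<N ==> j<N ==> P U (%x. A x $$ (i, j))"
 shows "P U (%x. Determinant.det (A x))"
 unfolding det_def'[OF A]
 by (intro cl_sum cl_prod cl_mult cl_const U assms(3) finite_permutations)
  (auto simp: permutes_in_image dest: permutes_in_image)

lemma cl_fdet:
 assumes "openE n U" "!!i j. i<N ==> j<N ==> P U (M i j)"
 shows "P U (%x. fdet N (%i j. M i j x))"
 unfolding fdet_def by (rule cl_det_mat) (use assms in auto)

lemma cl_fadj:
 assumes U: "openE n U" and M: "!!i j. i<N ==> j<N ==> P U (M i j)" and ij: "i<N" "j<N"
 shows "P U (%x. fadj N (%i j. M i j x) i j)"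
proof -
 have "P U (%x. (-1) ^ (j + i) * Determinant.det (mat_delete (Matrix.mat N N (%(i, j). M i j x)) j i))"
 proof (intro cl_mult cl_const U cl_det_mat[where N="N-1"])
  show "mat_delete (Matrix.mat N N (%(i, j). M i j x)) j i : carrier_mat (N - 1) (N - 1)" for x
   by (rule mat_delete_carrier) simp
  show "P U (%x. mat_delete (Matrix.mat N N (%(i, j). M i j x)) j i $$ (i', j'))" if "i'<N - 1" "j'<N - 1" for i' j'
   using that ij by (auto simp: mat_delete_def intro!: M)
 qed
 thus ?thesis using ij by (simp add: fadj_def adj_mat_def cofactor_def)
qed

lemma local_inverse_matrix:
 assumes U: "openE n U" "x0 : U" and M: "!!i j. i<N ==> j<N ==> P U (M i j)"
  and d: "fdet N (%i j. M i j x0) ~= 0"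
 obtains e I where "e > 0" "cube n x0 e \<subseteq> U"
  "!!i j. i<N ==> j<N ==> P (cube n x0 e) (I i j)"
  "!!i j x. i<N ==> j<N ==> x : cube n x0 e ==> (\<Sum>k<N. I i k x * M k j x) = (if i = j then 1 else 0)"
  "!!i j x. i<N ==> j<N ==> x : cube n x0 e ==> (\<Sum>k<N. M i k x * I k j x) = (if i = j then 1 else 0)"
proof -
 define D where "D x = fdet N (%i j. M i j x)" for x
 have PD: "P U D" unfolding D_def using cl_fdet[OF U(1) M] by simp
 \<comment> \<open>Half of the determinant at \<open>x0\<close> remains as a lower bound on a small
   cube, which is what \<open>cl_inverse\<close> demands.\<close>
 define \<delta> where "\<delta> = abs (D x0)/2"
 have \<delta>: "\<delta> > 0" using d by (simp add: \<delta>_def D_def)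
 obtain e where e: "e > 0" "cube n x0 e \<subseteq> U" "!!y. y : cube n x0 e ==> abs (D y - D x0)<\<delta>"
  using continuous_on_cube_bound[OF cl_continuous[OF U(1) PD] U \<delta>] by blast
 have D\<delta>: "\<delta> <= abs (D y)" if "y : cube n x0 e" for y using e(3)[OF that] abs_triangle_ineq2[of "D x0" "D y"] abs_minus_commute[of "D x0" "D y"] unfolding \<delta>_def by linarith
 have nz: "D y ~= 0" if "y : cube n x0 e" for y using D\<delta>[OF that] \<delta> by auto
 define I where "I i j x = fadj N (%i j. M i j x) i j * inverse (D x)" for i j x
 show ?thesis
 proof (rule that[OF e(1,2), of I])
  have PI: "P (cube n x0 e) (%x. inverse (D x))"
   by (rule cl_inverse[OF openin_cube cl_subset[OF PD e(2) openin_cube] D\<delta> \<delta>])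
  show "P (cube n x0 e) (I i j)" if "i<N" "j<N" for i j
   unfolding I_def using that PI
   by (intro cl_mult cl_fadj openin_cube cl_subset[OF M e(2)])
  fix i j x assume ij: "i<N" "j<N" and x: "x : cube n x0 e"
  show "(\<Sum>k<N. I i k x * M k j x) = (if i = j then 1 else 0)"
  proof -
   have "(\<Sum>k<N. I i k x * M k j x) = (\<Sum>k<N. fadj N (%i j. M i j x) i k * M k j x) * inverse (D x)"
    unfolding I_def sum_distrib_right by (intro sum.cong) auto
   thus ?thesis using fadj_mult(1)[OF ij, of "%i j. M i j x"] nz[OF x] by (simp add: D_def)
  qed
  show "(\<Sum>k<N. M i k x * I k j x) = (if i = j then 1 else 0)"
  proof -
   have "(\<Sum>k<N. M i k x * I k j x) = (\<Sum>k<N. M i k x * fadj N (%i j. M i j x) k j) * inverse (D x)"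
    unfolding I_def sum_distrib_right by (intro sum.cong) auto
   thus ?thesis using fadj_mult(2)[OF ij, of "%i j. M i j x"] nz[OF x] by (simp add: D_def)
  qed
 qed
qed

text \<open>If the fields \<open>w\<close> span at \<open>x0\<close>, constant combinations of them are the coordinate fields at
 \<open>x0\<close>, and the matrix of these combinations remains invertible nearby.\<close>

lemma local_coframe:
 fixes q :: nat
 assumes U: "openE n U" "x0 : U" and w: "!!j i. j<q ==> i<n ==> P U (w j i)"
  and span: "!!v. EX a. ALL i<n. v i = (\<Sum>k<q. a k * w k i x0)"
 obtains e \<beta> where "e > 0" "cube n x0 e \<subseteq> U"
  "!!m j. m<n ==> j<q ==> P (cube n x0 e) (\<beta> m j)"
  "!!m i x. m<n ==> i<n ==> x : cube n x0 e ==> (\<Sum>j<q. \<beta> m j x * w j i x) = (if m = i then 1 else 0)"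
proof -
 have "EX a. ALL m. ALL i<n. (if m = i then 1 else 0) = (\<Sum>k<q. a m k * w k i x0)"
  by (rule choice, rule allI, rule span)
 then obtain a where a: "!!m i. i<n ==> (\<Sum>k<q. a m k * w k i x0) = (if m = i then 1 else (0::real))" by metis
 define M where "M m i x = (\<Sum>k<q. a m k * w k i x)" for m i x
 have "fdet n (%i j. M i j x0) = fdet n (%i j. if i = j then 1 else 0)"
  by (rule fdet_cong) (simp add: M_def a)
 hence d: "fdet n (%i j. M i j x0) ~= 0" by (simp add: fdet_id)
 have PM: "P U (M i j)" if "i<n" "j<n" for i j
  unfolding M_def using that by (intro cl_sum cl_mult cl_const w U finite_lessThan) auto
 show ?thesis
 proof (rule local_inverse_matrix[OF U PM d], goal_cases)
  case (3 e I)
  note e = this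
  show ?thesis
 proof (rule that[OF e(1,2), of "%m j x. \<Sum>k<n. I m k x * a k j"])
  show "P (cube n x0 e) (%x. \<Sum>k<n. I m k x * a k j)" if "m<n" for m j
   using that by (intro cl_sum cl_mult cl_const openin_cube e finite_lessThan) auto
  show "(\<Sum>j<q. (\<Sum>k<n. I m k x * a k j) * w j i x) = (if m = i then 1 else 0)"
   if "m<n" "i<n" "x : cube n x0 e" for m i x
  proof -
   have "(\<Sum>j<q. (\<Sum>k<n. I m k x * a k j) * w j i x) = (\<Sum>j<q. \<Sum>k<n. I m k x*(a k j * w j i x))"
    by (simp add: sum_distrib_right mult.assoc)
   also have "... = (\<Sum>k<n. I m k x * M k i x)"
    by (subst sum.swap) (simp add: M_def sum_distrib_left)
   finally show ?thesis using e(4)[OF that] by simp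
  qed
 qed
 qed
qed

end

lemma dw_subset:
 assumes "dw n U w q f G" "U' \<subseteq> U"
 shows "dw n U' w q f G"
proof -
 obtain P where "pd n U f P" "ALL j<q. ALL x:U. G j x = (\<Sum>i<n. w j i x * P i x)"
  using assms(1) unfolding dw_def by blast
 thus ?thesis unfolding dw_def using pd_subset[OF _ assms(2)] assms(2) by blast
qed

lemma analytic_dw_subset:
 "an_dw n U w q f ==> U' \<subseteq> U ==> an_dw n U' w q f"
proof -
 assume f: "an_dw n U w q f" and U': "U' \<subseteq> U"
 have "an_dw n U' w q (f o id)"
 proof (rule analytic_wrt_transport[where \<sigma>=id, OF f])
  show "dw n U' w q (g o id) (%j. G (id j) o id)" if "dw n U w q g G" for g G
   using dw_subset[OF that U'] by simp
 qed (use U' in auto)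
 thus ?thesis by simp
qed

lemma func_class_C1: "func_class n (%U f. EX G. pd n U f G)"
proof
 show "EX G. pd n U (%x. inverse (f x)) G"
  if "EX G. pd n U f G" "!!x. x : U ==> \<delta> <= abs (f x)" "0<\<delta>" for U f \<delta>
 proof -
  have "f x ~= 0" if "x : U" for x using \<open>0<\<delta>\<close> \<open>!!x. x : U ==> \<delta> <= abs (f x)\<close>[OF that] by auto
  thus ?thesis using that(1) pd_inverse by blast
 qed
 show "EX G. pd n U f G ==> continuous_on U f" for U f by (auto simp: pd_def)
qed (blast intro: pd_const pd_add pd_mult pd_subset)+

lemma analytic_wrt_imp_der: "analytic_wrt U q der f ==> EX G. der f G"
 unfolding analytic_wrt_def by (metis maj.simps(2))

lemma func_class_analytic: "func_class n (%U f. an_pd n U f)"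
proof
 show "an_pd n U' f"
  if "an_pd n U f" "U' \<subseteq> U" for U U' f
 proof -
  have "an_pd n U' (f o id)"
   by (rule analytic_wrt_transport[where \<sigma>=id, OF that(1)]) (use that(2) pd_subset[of n U _ _ U'] in auto)
  thus ?thesis by simp
 qed
 show "continuous_on U f" if "an_pd n U f" for U f
  using analytic_wrt_imp_der[OF that] by (auto simp: pd_def)
 fix U :: "rn set" assume U: "openE n U"
 note d = derivation_pd[OF U]
 show "an_pd n U (%_. c)" for c by (rule derivation_system.an_const[OF d])
 show "an_pd n U f ==> an_pd n U g ==> an_pd n U (%x. f x + g x)" for f g
  by (rule derivation_system.an_add[OF d])
 show "an_pd n U f ==> an_pd n U g ==> an_pd n U (%x. f x * g x)" for f g
  by (rule derivation_system.an_mult[OF d])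
 show "an_pd n U f ==> (!!x. x : U ==> \<delta> <= abs (f x)) ==> 0<\<delta> ==>
   an_pd n U (%x. inverse (f x))" for f \<delta>
  by (rule derivation_system.an_inverse[OF d])
qed

section \<open>Word polynomials and word series\<close>

text \<open>\<open>WP n a m t\<close> is the homogeneous polynomial \<open>\<Sum> a(w) t\<^sub>w\<close> over words \<open>w\<close> of length \<open>m\<close> in
 \<open>n\<close> letters. Indexing power series by words instead of multi-indices makes
 derivatives and products of the coefficients recursive on lists.\<close>

primrec WP :: "nat => (nat list => real) => nat => rn => real" where
 "WP n a 0 t = a []"
| "WP n a (Suc m) t = (\<Sum>j<n. t j * WP n (%w. a (j # w)) m t)"

text \<open>Differentiation in t_i deletes one letter i from a word. The coefficient of the
  derivative at v is therefore the sum of a over the length v + 1 ways of inserting i into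
  v.\<close>

primrec dword :: "nat list => nat => (nat list => real) => real" where
 "dword [] i a = a [i]"
| "dword (j # v) i a = a (i # j # v) + dword v i (%w. a (j # w))"

definition l1 :: "nat => rn => real" where
 "l1 n t = (\<Sum>j<n. abs (t j))"

lemma l1_nonneg: "0 <= l1 n t" by (simp add: l1_def sum_nonneg)

lemma l1_cube: "t : cube n x e ==> 0<e ==> l1 n (%i. t i - x i) <= n * e"
 unfolding l1_def cube_def using sum_bounded_above[of "{..<n}" "%j. abs (t j - x j)" e] by (auto simp: less_imp_le)

lemma WP_cong: "(!!w. w : lists {..<n} ==> length w = m ==> a w = b w) ==> WP n a m t = WP n b m t"
proof (induction m arbitrary: a b)
 case (Suc m)
 show ?case unfolding WP.simps by (intro sum.cong arg_cong2[where f="(*)"] Suc.IH Suc.prems) auto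
qed auto

lemma WP_add: "WP n (%w. a w + b w) m t = WP n a m t + WP n b m t"
 by (induction m arbitrary: a b) (auto simp: sum.distrib algebra_simps)

lemma WP_cmult: "WP n (%w. c * a w) m t = c * WP n a m t"
 by (induction m arbitrary: a) (auto simp: sum_distrib_left algebra_simps)

lemma WP_zero: "WP n (%w. 0) m t = 0"
 by (induction m) auto

lemma WP_sum: "finite I ==> WP n (%w. \<Sum>i\<in>I. a i w) m t = (\<Sum>i\<in>I. WP n (a i) m t)"
 by (induction I rule: finite_induct) (auto simp: WP_add WP_zero)

lemma WP_bound:
 "(!!w. w : lists {..<n} ==> length w = m ==> abs (a w) <= C) ==> abs (WP n a m t) <= C * l1 n t ^ m"
proof (induction m arbitrary: a)
 case (Suc m)
 have "abs (WP n a (Suc m) t) <= (\<Sum>j<n. abs (t j) * abs (WP n (%w. a (j # w)) m t))"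
  unfolding WP.simps by (rule order_trans[OF sum_abs]) (simp add: abs_mult)
 also have "... <= (\<Sum>j<n. abs (t j)*(C * l1 n t ^ m))"
  by (intro sum_mono mult_left_mono Suc.IH Suc.prems) auto
 also have "... = C * l1 n t ^ Suc m" by (simp add: l1_def sum_distrib_right[symmetric])
 finally show ?case .
qed auto

lemma WP_scale: "WP n a m (%i. r * t i) = r ^ m * WP n a m t"
 by (induction m arbitrary: a) (auto simp: sum_distrib_left algebra_simps)

lemma WP_deriv_const:
 assumes "!!w. w : lists {..<n} ==> length w = m ==> (a w has_real_derivative a' w) (at s)"
 shows "((%s. WP n (%w. a w s) m t) has_real_derivative WP n a' m t) (at s)"
 using assms
proof (induction m arbitrary: a a')
 case (Suc m)
 have "((%s. WP n (%w. a (j # w) s) m t) has_real_derivative WP n (%w. a' (j # w)) m t) (at s)" if "j<n" for j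
  by (rule Suc.IH) (use Suc.prems that in auto)
 thus ?case unfolding WP.simps by (intro DERIV_sum DERIV_cmult) auto
qed auto

lemma WP_deriv:
 assumes "i<n"
 shows "((%s. WP n a (Suc m) (t(i := s))) has_real_derivative WP n (%v. dword v i a) m (t(i := s))) (at s)"
proof (induction m arbitrary: a)
 case 0
 have "((%s. \<Sum>j<n. (t(i := s)) j * a [j]) has_real_derivative (\<Sum>j<n. (if j = i then 1 else 0) * a [j])) (at s)"
  by (intro DERIV_sum DERIV_cmult_right) auto
 thus ?case using assms by (simp add: if_distrib[of "%x. x * _"] cong: if_cong)
next
 case (Suc m)
 let ?t = "t(i := s)"
 have "((%s. \<Sum>j<n. (t(i := s)) j * WP n (%w. a (j # w)) (Suc m) (t(i := s))) has_real_derivative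
   (\<Sum>j<n. (if j = i then 1 else 0) * WP n (%w. a (j # w)) (Suc m) ?t +
    WP n (%v. dword v i (%w. a (j # w))) m ?t * ?t j)) (at s)"
  by (intro DERIV_sum DERIV_mult Suc.IH) auto
 also have "(\<Sum>j<n. (if j = i then 1 else 0) * WP n (%w. a (j # w)) (Suc m) ?t +
    WP n (%v. dword v i (%w. a (j # w))) m ?t * ?t j) =
   WP n (%w. a (i # w)) (Suc m) ?t + (\<Sum>j<n. ?t j * WP n (%v. dword v i (%w. a (j # w))) m ?t)"
  using assms by (simp add: sum.distrib if_distrib[of "%x. x * _"] mult.commute cong: if_cong del: fun_upd_apply WP.simps)
 also have "... = WP n (%v. dword v i a) (Suc m) ?t"
  by (simp add: WP_add sum.distrib algebra_simps del: fun_upd_apply)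
 finally show ?case unfolding WP.simps(2)[of n a "Suc m"] .
qed

lemma dword_bound:
 "(!!w. w : lists {..<n} ==> length w = Suc (length v) ==> abs (a w) <= C) ==> i<n ==> v : lists {..<n} ==>
  abs (dword v i a) <= real (Suc (length v)) * C"
proof (induction v arbitrary: a)
 case (Cons j v)
 have "abs (dword v i (%w. a (j # w))) <= real (Suc (length v)) * C"
  by (rule Cons.IH) (use Cons.prems in auto)
 moreover have "abs (a (i # j # v)) <= C" using Cons.prems by auto
 ultimately show ?case by (simp add: algebra_simps)
qed auto

text \<open>The majorant of a word series is the Taylor expansion at \<open>r\<close> of the majorant of its
 coefficients.\<close>

definition shift_fps :: "real fps => real => real fps" where
 "shift_fps \<phi> r = Abs_fps (%k. (suminf (%m. fps_nth ((fps_deriv ^^ k) \<phi>) m * r ^ m)) / fact k)"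

lemma shift_fps_deriv: "fps_deriv (shift_fps \<phi> r) = shift_fps (fps_deriv \<phi>) r"
 by (rule fps_ext) (simp add: shift_fps_def funpow_swap1 del: of_nat_Suc)

definition conv_on :: "real fps => real => bool" where
 "conv_on \<phi> \<rho> \<longleftrightarrow> (ALL x. abs x<\<rho> --> summable (%m. fps_nth \<phi> m * x ^ m))"

lemma conv_on_deriv: "conv_on \<phi> \<rho> ==> conv_on (fps_deriv \<phi>) \<rho>"
 unfolding conv_on_def
proof (intro allI impI)
 fix x :: real assume *: "ALL x. abs x<\<rho> --> summable (%m. fps_nth \<phi> m * x ^ m)" "abs x<\<rho>"
 have "summable (%m. diffs (fps_nth \<phi>) m * x ^ m)"
  by (rule termdiff_converges[of x \<rho>]) (use * in auto)
 thus "summable (%m. fps_nth (fps_deriv \<phi>) m * x ^ m)" by (simp add: diffs_def)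
qed

definition wseries :: "nat => (nat list => real) => rn => rn => real" where
 "wseries n a c y = (suminf (%m. WP n a m (%j. y j - c j)))"

context
 fixes n :: nat and c :: rn and e \<rho> :: real
 assumes e: "0<e" and ne: "n * e<\<rho>"
begin

text \<open>On a cube of half-width e the l1 norm of the displacement is at most n e, and the
  context keeps n e below the radius \<rho> of the majorant. All convergence below rests on this
  comparison.\<close>

lemma wseries_term_bound:
 assumes a: "!!w. w : lists {..<n} ==> abs (a w) <= fps_nth \<phi> (length w)" and y: "y : cube n c e"
  and nn: "!!m. 0 <= fps_nth \<phi> m"
 shows "norm (WP n a m (%j. y j - c j)) <= fps_nth \<phi> m*(n * e) ^ m"
proof -
 have "abs (WP n a m (%j. y j - c j)) <= fps_nth \<phi> m * l1 n (%j. y j - c j) ^ m"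
  by (rule WP_bound) (use a in auto)
 also have "... <= fps_nth \<phi> m*(n * e) ^ m"
  by (intro mult_left_mono power_mono l1_cube[OF y e] l1_nonneg nn)
 finally show ?thesis by simp
qed

lemma summable_majorant: "conv_on \<phi> \<rho> ==> summable (%m. fps_nth \<phi> m*(n * e) ^ m)"
 using e ne unfolding conv_on_def by simp

lemma wseries_sums:
 assumes a: "!!w. w : lists {..<n} ==> abs (a w) <= fps_nth \<phi> (length w)" and y: "y : cube n c e"
  and nn: "!!m. 0 <= fps_nth \<phi> m" and cv: "conv_on \<phi> \<rho>"
 shows "(%m. WP n a m (%j. y j - c j)) sums wseries n a c y"
 unfolding wseries_def
 by (intro summable_sums summable_comparison_test'[OF summable_majorant[OF cv], of 0])
  (use wseries_term_bound[OF a y nn] in auto)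

lemma wseries_bound:
 assumes a: "!!w. w : lists {..<n} ==> abs (a w) <= fps_nth \<phi> (length w)" and y: "y : cube n c e"
  and nn: "!!m. 0 <= fps_nth \<phi> m" and cv: "conv_on \<phi> \<rho>"
 shows "abs (wseries n a c y) <= fps_nth (shift_fps \<phi> (n * e)) 0"
proof -
 have "norm (wseries n a c y) <= (suminf (%m. fps_nth \<phi> m*(n * e) ^ m))"
  unfolding wseries_def by (rule norm_suminf_le[OF wseries_term_bound[OF a y nn] summable_majorant[OF cv]])
 thus ?thesis by (simp add: shift_fps_def)
qed

lemma wseries_continuous:
 assumes a: "!!w. w : lists {..<n} ==> abs (a w) <= fps_nth \<phi> (length w)"
  and nn: "!!m. 0 <= fps_nth \<phi> m" and cv: "conv_on \<phi> \<rho>"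
 shows "continuous_on (cube n c e) (wseries n a c)"
proof -
 have "uniform_limit (cube n c e) (%N y. \<Sum>m<N. WP n a m (%j. y j - c j)) (wseries n a c) sequentially"
  unfolding wseries_def[abs_def]
  by (rule Weierstrass_m_test[OF wseries_term_bound[OF a _ nn] summable_majorant[OF cv]])
 moreover have "continuous_on (cube n c e) (%y. WP n b m (%j. y j - c j))" for b m
 proof (induction m arbitrary: b)
  case (Suc m)
  have "continuous_on (cube n c e) (%y. y j)" for j
   by (rule continuous_on_subset[OF continuous_on_product_coordinates]) auto
  thus ?case unfolding WP.simps by (intro continuous_intros Suc.IH)
 qed auto
 ultimately show ?thesis
  by (intro uniform_limit_theorem[where F=sequentially]) (auto intro!: always_eventually continuous_on_sum)
qed

lemma wseries_pd:
 assumes a: "!!w. w : lists {..<n} ==> abs (a w) <= fps_nth \<phi> (length w)"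
  and nn: "!!m. 0 <= fps_nth \<phi> m" and cv: "conv_on \<phi> \<rho>"
 shows "pd n (cube n c e) (wseries n a c) (%i. wseries n (%v. dword v i a) c)"
proof -
 have b: "abs (dword w i a) <= fps_nth (fps_deriv \<phi>) (length w)" if "w : lists {..<n}" "i<n" for w i
 proof -
  have "abs (a u) <= fps_nth \<phi> (Suc (length w))" if "u : lists {..<n}" "length u = Suc (length w)" for u
   using a[OF that(1)] that(2) by simp
  from dword_bound[OF this that(2,1)] show ?thesis by simp
 qed
 have nn': "0 <= fps_nth (fps_deriv \<phi>) m" for m using nn by simp
 note cv' = conv_on_deriv[OF cv]
 show ?thesis
  unfolding pd_def
 proof (intro conjI allI impI ballI)
  show "continuous_on (cube n c e) (wseries n a c)" by (rule wseries_continuous[OF a nn cv])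
  fix i assume i: "i<n"
  show "continuous_on (cube n c e) (wseries n (%v. dword v i a) c)"
   by (rule wseries_continuous[OF b[OF _ i] nn' cv'])
  fix y assume y: "y : cube n c e"
  define S where "S = ball (c i) e"
  have yS: "y(i := s) : cube n c e" if "s : S" for s
   using y i that by (auto simp: cube_def S_def dist_real_def)
  define f where "f m s = WP n a m (%j. (y(i := s)) j - c j)" for m s
  \<comment> \<open>The constant term has derivative 0 and the term of degree m + 1 a derivative of
    degree m, hence the shift of the index.\<close>
  define f' where "f' m s = (case m of 0 => 0 | Suc m => WP n (%v. dword v i a) m (%j. (y(i := s)) j - c j))" for m s
  have upd: "(%j. (y(i := s)) j - c j) = (%j. y j - c j)(i := s - c i)" for s by auto
  have d: "(f m has_real_derivative f' m s) (at s)" for m s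
  proof (cases m)
   case (Suc k)
   have "((%s. WP n a (Suc k) ((%j. y j - c j)(i := s))) has_real_derivative
     WP n (%v. dword v i a) k ((%j. y j - c j)(i := s - c i))) (at (s + (- c i)))"
    using WP_deriv[OF i, of a k "%j. y j - c j" "s - c i"] by simp
   thus ?thesis unfolding DERIV_shift f_def[abs_def] f'_def Suc upd by simp
  qed (simp add: f_def[abs_def] f'_def)
  have bd: "norm (f' (Suc m) s) <= fps_nth (fps_deriv \<phi>) m*(n * e) ^ m" if "s : S" for m s
   unfolding f'_def using wseries_term_bound[OF b[OF _ i] yS[OF that] nn'] by simp
  have "uniformly_convergent_on S (%N s. \<Sum>m<N. f' m s)"
  proof (rule Weierstrass_m_test'[where M="%m. case m of 0 => 0 | Suc m => fps_nth (fps_deriv \<phi>) m*(n * e) ^ m"])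
   show "norm (f' m s) <= (case m of 0 => 0 | Suc m => fps_nth (fps_deriv \<phi>) m*(n * e) ^ m)" if "s : S" for m s
    using bd[OF that] by (cases m) (auto simp: f'_def)
   show "summable (%m. case m of 0 => 0 | Suc m => fps_nth (fps_deriv \<phi>) m*(n * e) ^ m)"
    by (subst summable_Suc_iff[symmetric]) (use summable_majorant[OF cv'] in simp)
  qed
  moreover have yi: "y i : interior S" using y i by (auto simp: S_def cube_def dist_real_def)
  moreover have "summable (%m. f m (y i))"
   using wseries_sums[OF a y nn cv] by (simp add: f_def sums_iff)
  moreover have "y i : S" using yi interior_subset by blast
  ultimately have "((%s. suminf (%m. f m s)) has_real_derivative (suminf (%m. f' m (y i)))) (at (y i))"
   by (intro has_field_derivative_series'(2)[where S=S and ?x0.0="y i"])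
    (auto simp: S_def intro!: has_field_derivative_at_within d)
  moreover have "(suminf (%m. f m s)) = wseries n a c (y(i := s))" for s by (simp add: f_def wseries_def)
  moreover have "(suminf (%m. f' m (y i))) = wseries n (%v. dword v i a) c y"
  proof -
   have "(%m. f' (Suc m) (y i)) sums wseries n (%v. dword v i a) c y"
    using wseries_sums[OF b[OF _ i] y nn' cv'] by (simp add: f'_def)
   hence "(%m. f' m (y i)) sums (wseries n (%v. dword v i a) c y + f' 0 (y i))"
    by (subst (asm) sums_Suc_iff) simp
   thus ?thesis by (simp add: sums_iff f'_def)
  qed
  ultimately show "((%t. wseries n a c (y(i := t))) has_real_derivative wseries n (%v. dword v i a) c y) (at (y i))"
   by simp
 qed
qed

text \<open>A partial derivative is again a word series: a becomes \<open>dword\<close>, \<phi>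
  becomes its derivative, and \<open>shift_fps\<close> commutes with differentiation. So the
  induction on the depth has to run over all series.\<close>

lemma wseries_maj:
 assumes "!!w. w : lists {..<n} ==> abs (a w) <= fps_nth \<phi> (length w)"
  and "!!m. 0 <= fps_nth \<phi> m" and "conv_on \<phi> \<rho>"
 shows "maj (cube n c e) n (pd n (cube n c e)) k (shift_fps \<phi> (n * e)) (wseries n a c)"
 using assms
proof (induction k arbitrary: a \<phi>)
 case 0
 thus ?case using wseries_bound by simp
next
 case (Suc k)
 have b: "abs (dword w i a) <= fps_nth (fps_deriv \<phi>) (length w)" if "w : lists {..<n}" "i<n" for w i
 proof -
  have "abs (a u) <= fps_nth \<phi> (Suc (length w))" if "u : lists {..<n}" "length u = Suc (length w)" for u
   using Suc.prems(1)[OF that(1)] that(2) by simp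
  from dword_bound[OF this that(2,1)] show ?thesis by simp
 qed
 have "maj (cube n c e) n (pd n (cube n c e)) k (fps_deriv (shift_fps \<phi> (n * e))) (wseries n (%v. dword v i a) c)"
  if "i<n" for i
  unfolding shift_fps_deriv by (rule Suc.IH[OF b[OF _ that] _ conv_on_deriv[OF Suc.prems(3)]]) (use Suc.prems(2) in auto)
 thus ?case using wseries_pd[OF Suc.prems] wseries_bound[OF Suc.prems(1) _ Suc.prems(2,3)] by auto
qed

end

lemma fps_deriv_iterate_nth: "fps_nth ((fps_deriv ^^ k) \<phi>) m = fact (m + k) / fact m*(fps_nth \<phi> (m + k) :: real)"
proof (induction k arbitrary: \<phi>)
 case (Suc k)
 thus ?case by (simp add: funpow_swap1 del: of_nat_Suc of_nat_add)
qed auto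

text \<open>The binomial coefficient of m + k over k is at most 2^(m + k).\<close>

lemma fact_add_le: "fact (m + k) <= 2 ^ (m + k) * fact m*(fact k :: real)"
proof -
 have "real ((m + k) choose k) <= 2 ^ (m + k)"
  using binomial_le_pow2[of "m + k" k] by (metis of_nat_le_iff of_nat_numeral of_nat_power)
 hence "fact m * fact k * real ((m + k) choose k) <= fact m * fact k*2 ^ (m + k)"
  by (intro mult_left_mono) auto
 moreover have "real ((m + k) choose k) = fact (m + k)/(fact k * fact m)"
  using binomial_fact[of k "m + k", where 'a=real] by simp
 ultimately show ?thesis by (simp add: mult_ac)
qed

text \<open>By \<open>fact_add_le\<close>, the k-th derivative of K/(1 - R X) at n e is at most K (2
  R)^k k! times a geometric series of ratio 2 R n e. This explains the factor 2 in the hypothesis on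
  e and in the new rate.\<close>

lemma wseries_analytic:
 assumes a: "!!w. w : lists {..<n} ==> abs (a w) <= K * R ^ length w"
  and KR: "0 <= K" "0<R" and e: "0<e" "2 * R*(n * e)<1"
 shows "an_pd n (cube n c e) (wseries n a c)"
proof (rule analytic_wrtI)
 have cv: "conv_on (geom K R) (1 / R)"
  unfolding conv_on_def
 proof (intro allI impI)
  fix x :: real assume "abs x<1 / R"
  hence "norm (R * x)<1" using KR by (simp add: abs_mult field_simps)
  hence "summable (%m. K*(R * x) ^ m)" by (intro summable_mult summable_geometric)
  thus "summable (%m. fps_nth (geom K R) m * x ^ m)" by (simp add: power_mult_distrib mult.assoc)
 qed
 have ne: "n * e<1 / R"
 proof -
  have "R*(n * e) <= 2 * R*(n * e)" using KR e by simp
  thus ?thesis using e KR by (simp add: field_simps)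
 qed
 show "maj (cube n c e) n (pd n (cube n c e)) k (shift_fps (geom K R) (n * e)) (wseries n a c)" for k
  by (rule wseries_maj[OF e(1) ne _ _ cv]) (use a KR in auto)
 define x where "x = 2 * R*(n * e)"
 have x: "0 <= x" "x<1" using e KR by (auto simp: x_def)
 show "fps_nth (shift_fps (geom K R) (n * e)) k <= K/(1 - x)*(2 * R) ^ k" for k
 proof -
  let ?g = "%m. fps_nth ((fps_deriv ^^ k) (geom K R)) m*(n * e) ^ m"
  have le: "?g m <= K*(2 * R) ^ k * fact k * x ^ m" for m
  proof -
   have "?g m = fact (m + k) / fact m*(K * R ^ (m + k)*(n * e) ^ m)"
    by (simp add: fps_deriv_iterate_nth)
   also have "... <= (2 ^ (m + k) * fact k)*(K * R ^ (m + k)*(n * e) ^ m)"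
    using fact_add_le[of m k] KR e by (intro mult_right_mono) (auto simp: field_simps)
   also have "... = K*(2 * R) ^ k * fact k * x ^ m"
    by (simp add: x_def power_mult_distrib power_add)
   finally show ?thesis .
  qed
  have s: "(%m. K*(2 * R) ^ k * fact k * x ^ m) sums (K*(2 * R) ^ k * fact k*(1/(1 - x)))"
   using x by (intro sums_mult geometric_sums) auto
  have "conv_on ((fps_deriv ^^ k) (geom K R)) (1 / R)" by (induction k) (auto intro: cv conv_on_deriv)
  hence "summable ?g" by (rule summable_majorant[OF e(1) ne])
  hence "suminf ?g <= K*(2 * R) ^ k * fact k*(1/(1 - x))"
   using suminf_le[OF le _ sums_summable[OF s]] sums_unique[OF s] by simp
  thus ?thesis by (simp add: shift_fps_def field_simps)
 qed
 show "0 <= K/(1 - x)" using KR x by simp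
 show "0<2 * R" using KR by simp
qed

subsection \<open>Taylor expansion along a curve\<close>

text \<open>Along the segment the m-th derivative of \<open>D []\<close> is the word polynomial with
  coefficients \<open>D w\<close>, length w = m. Maclaurin's remainder is then at most K times the
  N-th power of R times the l1 norm of t, and tends to 0.\<close>

lemma Taylor_words:
 fixes D :: "nat list => real => real"
 assumes d: "!!w s. w : lists {..<n} ==> 0 <= s ==> s <= 1 ==> (D w has_real_derivative (\<Sum>j<n. t j * D (j # w) s)) (at s)"
  and b: "!!w s. w : lists {..<n} ==> 0 <= s ==> s <= 1 ==> abs (D w s) <= K * R ^ length w * fact (length w)"
  and R: "0 <= R" "R * l1 n t<1"
 shows "(%m. WP n (%w. D w 0 / fact m) m t) sums D [] 1"
proof -
 define df where "df m s = WP n (%w. D w s) m t" for m s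
 have dd: "(df m has_real_derivative df (Suc m) s) (at s)" if "0 <= s" "s <= 1" for m s
 proof -
  have "(df m has_real_derivative WP n (%w. \<Sum>j<n. t j * D (j # w) s) m t) (at s)"
   unfolding df_def by (rule WP_deriv_const) (use d that in auto)
  thus ?thesis by (simp add: WP_sum WP_cmult df_def)
 qed
 have rem: "norm (D [] 1 - (\<Sum>m<N. df m 0 / fact m)) <= K*(R * l1 n t) ^ N" if N: "N > 0" for N
 proof -
  obtain \<theta> where \<theta>: "0<\<theta>" "\<theta><1" "df 0 1 = (\<Sum>m<N. df m 0 / fact m*1 ^ m) + df N \<theta> / fact N*1 ^ N"
   using Maclaurin[of 1 N df "df 0"] N dd by auto
  have "abs (df N \<theta>) <= (K * R ^ N * fact N) * l1 n t ^ N"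
   unfolding df_def
  proof (rule WP_bound)
   fix w assume "w : lists {..<n}" "length w = N"
   thus "abs (D w \<theta>) <= K * R ^ N * fact N" using b[of w \<theta>] \<theta>(1,2) by simp
  qed
  hence "abs (df N \<theta> / fact N) <= K*(R * l1 n t) ^ N" by (simp add: field_simps power_mult_distrib)
  moreover have "df 0 1 = D [] 1" by (simp add: df_def)
  moreover from this have "D [] 1 - (\<Sum>m<N. df m 0 / fact m) = df N \<theta> / fact N" using \<theta>(3) by simp
  ultimately show ?thesis by (simp only: real_norm_def)
 qed
 have "(%N. K*(R * l1 n t) ^ N) \<longlonglongrightarrow> K*0"
  using R l1_nonneg[of n t] by (intro tendsto_mult tendsto_const LIMSEQ_power_zero) auto
 note lim = this[unfolded mult_zero_right]
 have "(%N. D [] 1 - (\<Sum>m<N. df m 0 / fact m)) \<longlonglongrightarrow> 0"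
  by (intro Lim_null_comparison[OF eventually_mono[OF eventually_gt_at_top[of 0] rem] lim])
 from tendsto_diff[OF tendsto_const[of "D [] 1"] this]
 have "(%m. df m 0 / fact m) sums D [] 1" unfolding sums_def by simp
 moreover have "df m 0 / fact m = WP n (%w. D w 0 / fact m) m t" for m
  using WP_cmult[of n "1 / fact m" "%w. D w 0" m t] by (simp add: df_def)
 ultimately show ?thesis by simp
qed

subsection \<open>Words and multi-indices\<close>

definition mon :: "rn => nat list => real" where
 "mon t w = prod_list (map t w)"

definition content :: "nat list => nat => nat" where
 "content w i = count_list w i"

definition sorted_word :: "nat => (nat => nat) => nat list" where
 "sorted_word n al = concat (map (%i. replicate (al i) i) [0..<n])"

definition words :: "nat => nat => nat list set" where
 "words n m = {w : lists {..<n}. length w = m}"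

lemma finite_words: "finite (words n m)"
 unfolding words_def using finite_lists_length_eq[of "{..<n}" m] by (simp add: lists_eq_set conj_commute)

lemma words_0: "words n 0 = {[]}"
 by (auto simp: words_def)

lemma words_Suc: "words n (Suc m) = (%(j, w). j # w) ` ({..<n} \<times> words n m)"
 by (auto simp: words_def image_iff length_Suc_conv)

lemma sum_words_Suc: "(\<Sum>w\<in>words n (Suc m). f w) = (\<Sum>j<n. \<Sum>w\<in>words n m. f (j # w))"
 unfolding words_Suc by (subst sum.reindex) (auto simp: inj_on_def sum.cartesian_product intro!: sum.cong)

lemma WP_words: "WP n a m t = (\<Sum>w\<in>words n m. a w * mon t w)"
 by (induction m arbitrary: a)
  (auto simp: words_0 mon_def sum_words_Suc sum_distrib_left algebra_simps intro!: sum.cong)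

lemma l1_power_words: "l1 n t ^ m = (\<Sum>w\<in>words n m. abs (mon t w))"
 by (induction m)
  (auto simp: words_0 mon_def sum_words_Suc l1_def abs_mult sum_distrib_left[symmetric] sum_distrib_right[symmetric])

lemma lists_Sigma: "bij_betw (%(m, w). w) (Sigma UNIV (words n)) (lists {..<n})"
 by (auto simp: bij_betw_def inj_on_def words_def image_iff)

text \<open>The absolute values of the monomials of length m add up to the m-th power of the l1
  norm, so grouping the words by length leaves a geometric series.\<close>

lemma summable_lists:
 assumes "!!w. w : lists {..<n} ==> abs (a w) <= K * R ^ length w" "0 <= K" "0 <= R" "R * l1 n t<1"
 shows "(%w. a w * mon t w) summable_on lists {..<n}"
proof -
 have "(%mw. K * R ^ fst mw * abs (mon t (snd mw))) summable_on Sigma UNIV (words n)"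
 proof (rule summable_on_SigmaI)
  show "((%w. K * R ^ fst (m, w) * abs (mon t (snd (m, w)))) has_sum (K*(R * l1 n t) ^ m)) (words n m)" for m
   using finite_words by (intro has_sum_finiteI)
    (auto simp: l1_power_words power_mult_distrib sum_distrib_left mult.assoc)
  show "(%m. K*(R * l1 n t) ^ m) summable_on UNIV"
   using assms l1_nonneg[of n t]
   by (intro summable_nonneg_imp_summable_on summable_mult summable_geometric) auto
 qed (use assms in auto)
 hence "(%mw. norm (a (snd mw) * mon t (snd mw))) summable_on Sigma UNIV (words n)"
 proof (rule Infinite_Sum.abs_summable_on_comparison_test')
  show "norm (a (snd x) * mon t (snd x)) <= K * R ^ fst x * abs (mon t (snd x))" if "x : Sigma UNIV (words n)" for x
   using that assms(1)[of "snd x"] by (auto simp: words_def abs_mult intro!: mult_right_mono)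
 qed
 hence "(%mw. a (snd mw) * mon t (snd mw)) summable_on Sigma UNIV (words n)"
  by (rule abs_summable_summable)
 thus ?thesis
  using summable_on_reindex_bij_betw[OF lists_Sigma, of "%w. a w * mon t w"] by (simp add: case_prod_unfold)
qed

lemma has_sum_lists_iff_sums:
 assumes "(%w. a w * mon t w) summable_on lists {..<n}"
 shows "((%w. a w * mon t w) has_sum s) (lists {..<n}) \<longleftrightarrow> (%m. WP n a m t) sums s"
proof -
 have imp: "(%m. WP n a m t) sums s" if "((%w. a w * mon t w) has_sum s) (lists {..<n})" for s
 proof -
  have "((%mw. a (snd mw) * mon t (snd mw)) has_sum s) (Sigma UNIV (words n))"
   using that has_sum_reindex_bij_betw[OF lists_Sigma, of "%w. a w * mon t w"] by (simp add: case_prod_unfold)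
  hence "((%m. WP n a m t) has_sum s) UNIV"
   by (rule has_sum_SigmaD) (use finite_words in \<open>auto simp: WP_words intro!: has_sum_finiteI\<close>)
  thus ?thesis by (rule has_sum_imp_sums)
 qed
 obtain s' where s': "((%w. a w * mon t w) has_sum s') (lists {..<n})" using assms by (auto simp: summable_on_def)
 show ?thesis using imp imp[OF s'] s' sums_unique2 by blast
qed

lemma content_multiindices: "w : lists {..<n} ==> content w : multiindices n"
 by (auto simp: multiindices_def content_def intro!: count_notin)

lemma mon_content: "w : lists {..<n} ==> mon t w = (\<Prod>i<n. t i ^ content w i)"
proof (induction w)
 case (Cons j w)
 have "(\<Prod>i<n. t i ^ content (j # w) i) = (\<Prod>i<n. (if i = j then t i else 1) * t i ^ content w i)"
  by (intro prod.cong) (auto simp: content_def)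
 also have "... = (\<Prod>i<n. (if i = j then t i else 1))*(\<Prod>i<n. t i ^ content w i)"
  by (rule prod.distrib)
 also have "(\<Prod>i<n. (if i = j then t i else 1)) = t j" using Cons.prems by simp
 finally show ?case using Cons by (simp add: mon_def)
qed (simp add: mon_def content_def)

lemma length_content: "w : lists {..<n} ==> length w = (\<Sum>i<n. content w i)"
proof (induction w)
 case (Cons j w)
 have "(\<Sum>i<n. content (j # w) i) = (\<Sum>i<n. (if i = j then 1 else 0) + content w i)"
  by (intro sum.cong) (auto simp: content_def)
 thus ?case using Cons by (simp add: sum.distrib)
qed (simp add: content_def)

lemma sorted_word_lists: "sorted_word n al : lists {..<n}"
 by (auto simp: sorted_word_def lists_eq_set)

lemma content_sorted_word:
 assumes "al : multiindices n"
 shows "content (sorted_word n al) = al"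
proof
 fix i
 have rep: "count_list (replicate k j) i = (if i = j then k else 0)" for k j :: nat by (induction k) auto
 have "count_list (sorted_word N al) i = (if i<N then al i else 0)" for N
  by (induction N) (auto simp: sorted_word_def rep less_Suc_eq)
 thus "content (sorted_word n al) i = al i"
  using assms by (auto simp: content_def multiindices_def)
qed

lemma length_sorted_word: "al : multiindices n ==> length (sorted_word n al) = (\<Sum>i<n. al i)"
 using length_content[OF sorted_word_lists] content_sorted_word by metis

lemma finite_fiber: "finite {w : lists {..<n}. content w = al}"
proof (rule finite_subset)
 show "{w : lists {..<n}. content w = al} \<subseteq> words n (\<Sum>i<n. al i)"
  using length_content by (auto simp: words_def)
qed (rule finite_words)

lemma has_sum_multiindices:
 assumes "((%w. a w * mon t w) has_sum s) (lists {..<n})"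
 shows "((%al. (\<Sum>w | w : lists {..<n} & content w = al. a w)*(\<Prod>i<n. t i ^ al i)) has_sum s) (multiindices n)"
proof -
 let ?F = "%al. {w : lists {..<n}. content w = al}"
 have cm: "content w : multiindices n" if "ALL i:set w. i<n" for w
  using content_multiindices[of w n] that by auto
 have "bij_betw snd (Sigma (multiindices n) ?F) (lists {..<n})"
  by (auto simp: bij_betw_def inj_on_def image_iff cm)
 moreover have mc: "mon t w = (\<Prod>i<n. t i ^ content w i)" if "ALL i:set w. i<n" for w
  using mon_content[of w n t] that by auto
 ultimately have "((%alw. a (snd alw) * mon t (snd alw)) has_sum s) (Sigma (multiindices n) ?F)"
  using has_sum_reindex_bij_betw[of snd _ _ "%w. a w * mon t w"] assms by blast
 thus ?thesis
 proof (rule has_sum_SigmaD)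
  fix al assume "al : multiindices n"
  show "((%w. a (snd (al, w)) * mon t (snd (al, w))) has_sum
    (\<Sum>w | w : lists {..<n} & content w = al. a w)*(\<Prod>i<n. t i ^ al i)) (?F al)"
   by (rule has_sum_finiteI[OF finite_fiber]) (auto simp: sum_distrib_right mc intro!: sum.cong)
 qed
qed

text \<open>The opposite of regrouping by content: the sorted word carries the whole coefficient of
  its multi-index, and all other rearrangements get coefficient 0.\<close>

lemma has_sum_words_of_multiindices:
 assumes "((%al. c al*(\<Prod>i<n. t i ^ al i)) has_sum s) (multiindices n)"
 shows "((%w. (if w = sorted_word n (content w) then c (content w) else 0) * mon t w) has_sum s) (lists {..<n})"
proof -
 let ?g = "%w. c (content w) * mon t w"
 have inj: "inj_on (sorted_word n) (multiindices n)"
  by (rule inj_on_inverseI[where g=content]) (rule content_sorted_word)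
 have "((?g o sorted_word n) has_sum s) (multiindices n)"
  using assms by (rule has_sum_cong[THEN iffD1, rotated])
   (simp add: content_sorted_word mon_content[OF sorted_word_lists])
 hence "(?g has_sum s) (sorted_word n ` multiindices n)"
  using has_sum_reindex[OF inj] by blast
 thus ?thesis
 proof (rule has_sum_cong_neutral[THEN iffD1, rotated -1])
  show "(if w = sorted_word n (content w) then c (content w) else 0) * mon t w = 0"
   if "w : lists {..<n} - sorted_word n ` multiindices n" for w
   using that content_multiindices[of w n] by auto
  show "?g w = (if w = sorted_word n (content w) then c (content w) else 0) * mon t w"
   if "w : sorted_word n ` multiindices n \<inter> lists {..<n}" for w
   using that by (auto simp: content_sorted_word)
 qed (use sorted_word_lists in auto)
qed

subsection \<open>Real analytic functions\<close>

definition AM :: "nat => rn set => real fps => (rn => real) => bool" where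
 "AM n U \<phi> f \<longleftrightarrow> (ALL k. maj U n (pd n U) k \<phi> f)"

text \<open>The gradient witnesses found at different depths all agree with \<open>partial\<close>
  on U, so one function inherits the bounds of every depth.\<close>

lemma AM_partial:
 assumes U: "openE n U" and f: "AM n U \<phi> f"
 shows "pd n U f (%i. partial i f)" "!!i. i<n ==> AM n U (fps_deriv \<phi>) (partial i f)"
proof -
 have G: "EX G. pd n U f G & (ALL j<n. maj U n (pd n U) k (fps_deriv \<phi>) (G j))" for k
  using f unfolding AM_def by (metis maj.simps(2))
 then obtain G where G1: "pd n U f G" by blast
 show "pd n U f (%i. partial i f)" by (rule pd_cong[OF U G1]) (use pd_partial[OF G1] in auto)
 fix i assume i: "i<n"
 show "AM n U (fps_deriv \<phi>) (partial i f)" unfolding AM_def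
 proof
  fix k obtain G where "pd n U f G" "ALL j<n. maj U n (pd n U) k (fps_deriv \<phi>) (G j)" using G by blast
  thus "maj U n (pd n U) k (fps_deriv \<phi>) (partial i f)"
   using derivation_system.mj_cong[OF derivation_pd[OF U]] pd_partial i by blast
 qed
qed

lemma AM_bound: "AM n U \<phi> f ==> x : U ==> abs (f x) <= fps_nth \<phi> 0"
 unfolding AM_def using maj_bound[of U n "pd n U" 0 \<phi> f x] by blast

lemma AM_foldr:
 assumes U: "openE n U" and f: "AM n U \<phi> f"
 shows "w : lists {..<n} ==> AM n U ((fps_deriv ^^ length w) \<phi>) (foldr partial w f)"
 by (induction w) (use f AM_partial(2)[OF U] in auto)

lemma AM_funpow:
 assumes U: "openE n U" and f: "AM n U \<phi> f" and i: "i<n"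
 shows "AM n U ((fps_deriv ^^ k) \<phi>) ((partial i ^^ k) f)"
 by (induction k) (use f AM_partial(2)[OF U _ i] in auto)

lemma AM_partial_multi:
 assumes U: "openE n U" and f: "AM n U \<phi> f"
 shows "AM n U ((fps_deriv ^^ (\<Sum>i<n. al i)) \<phi>) (partial_multi n al f)"
proof -
 have "N <= n ==> AM n U ((fps_deriv ^^ (\<Sum>i<N. al i)) \<phi>) (fold (%i. partial i ^^ al i) [0..<N] f)" for N
 proof (induction N)
  case (Suc N)
  thus ?case using AM_funpow[OF U, of _ _ N "al N"] by (simp add: funpow_add add.commute)
 qed (use f in auto)
 thus ?thesis by (simp add: partial_multi_def)
qed

lemma AM_C_k: "AM n U \<phi> f ==> openE n U ==> C_k_on k n U f"
proof (induction k arbitrary: \<phi> f)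
 case 0
 thus ?case using AM_partial(1)[OF 0(2,1)] by (simp add: pd_def)
next
 case (Suc k)
 show ?case
  by (rule C_k_on_SucI[OF Suc.prems(2) AM_partial(1)[OF Suc.prems(2,1)]])
   (rule Suc.IH[OF AM_partial(2)[OF Suc.prems(2,1)] Suc.prems(2)])
qed

lemma deriv_geom_0: "fps_nth ((fps_deriv ^^ k) (geom K R)) 0 = fact k * K * R ^ k"
 by (simp add: fps_deriv_iterate_nth)

lemma analytic_wrt_AM: "an_pd n U f \<longleftrightarrow> (EX K R. 0 <= K & 0<R & AM n U (geom K R) f)"
 by (simp add: analytic_wrt_def AM_def)

lemma analytic_imp_power_series:
 assumes U: "openE n U" and f: "AM n U (geom K R) f" and KR: "0 <= K" "0<R"
  and x: "x : U" and e: "0<e" "cube n x e \<subseteq> U" "R*(n * e)<1"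
  and y: "y : cube n x e"
 shows "((%w. foldr partial w f x / fact (length w) * mon (%j. y j - x j) w) has_sum f y) (lists {..<n})"
proof -
 define t where "t = (%j. y j - x j)"
 define cu where "cu s = (%j. x j + s * t j)" for s :: real
 have xt: "x : spaceE n" using x openin_subset[OF U] by auto
 have cut: "cu s : spaceE n" for s
  using xt y by (auto simp: cu_def t_def topspace_Euclidean_space cube_def)
 have cuU: "cu s : U" if "0 <= s" "s <= 1" for s
 proof -
  have "abs (s * t i)<e" if "i<n" for i
  proof -
   have "abs (s * t i) <= 1 * abs (t i)" unfolding abs_mult using \<open>0 <= s\<close> \<open>s <= 1\<close> by (intro mult_right_mono) auto
   also have "... < e" using y that by (simp add: t_def cube_def)
   finally show ?thesis .
  qed
  hence "cu s : cube n x e" using cut[of s] by (auto simp: cube_def cu_def topspace_Euclidean_space)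
  thus ?thesis using e by blast
 qed
 define D where "D w s = foldr partial w f (cu s)" for w s
 have D1: "(D w has_real_derivative (\<Sum>j<n. t j * D (j # w) s)) (at s)" if "w : lists {..<n}" "0 <= s" "s <= 1" for w s
 proof -
  have "((%s. foldr partial w f (cu s)) has_real_derivative (\<Sum>j<n. partial j (foldr partial w f) (cu s) * t j)) (at s)"
  proof (rule pd_chain_curve[where cu=cu and s=s, OF AM_partial(1)[OF U AM_foldr[OF U f that(1)]] U cuU[OF that(2,3)]])
   show "((%r. cu r i) has_real_derivative t i) (at s)" for i
    unfolding cu_def by (auto intro!: derivative_eq_intros)
  qed (use cut in auto)
  thus ?thesis unfolding D_def[abs_def] by (simp add: mult.commute)
 qed
 have D2: "abs (D w s) <= K * R ^ length w * fact (length w)" if "w : lists {..<n}" "0 <= s" "s <= 1" for w s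
  using AM_bound[OF AM_foldr[OF U f that(1)] cuU[OF that(2,3)]] by (simp add: D_def deriv_geom_0 mult_ac)
 have "l1 n t <= n * e" using l1_cube[OF y e(1)] by (simp add: t_def)
 hence "R * l1 n t <= R*(n * e)" using KR by (intro mult_left_mono) auto
 hence Rt: "R * l1 n t<1" using e(3) by linarith
 have "(%m. WP n (%w. D w 0 / fact m) m t) sums D [] 1"
  by (rule Taylor_words[OF D1 D2 _ Rt]) (use KR in auto)
 moreover have "WP n (%w. D w 0 / fact m) m t = WP n (%w. foldr partial w f x / fact (length w)) m t" for m
  by (rule WP_cong) (simp add: D_def cu_def)
 moreover have "D [] 1 = f y" by (simp add: D_def cu_def t_def)
 ultimately have s: "(%m. WP n (%w. foldr partial w f x / fact (length w)) m t) sums f y" by simp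
 have "(%w. foldr partial w f x / fact (length w) * mon t w) summable_on lists {..<n}"
 proof (rule summable_lists[OF _ _ _ Rt])
  show "abs (foldr partial w f x / fact (length w)) <= K * R ^ length w" if "w : lists {..<n}" for w
   using D2[OF that, of 0] by (simp add: D_def cu_def field_simps)
 qed (use KR in auto)
 from iffD2[OF has_sum_lists_iff_sums[OF this] s] show ?thesis unfolding t_def .
qed

lemma small_cube:
 assumes "openE n U" "x : U" "0 <= R"
 obtains e where "0<e" "cube n x e \<subseteq> U" "R*(n * e)<(1::real)"
proof -
 obtain e where e: "e > 0" "cube n x e \<subseteq> U" using open_cubeE assms by blast
 define e' where "e' = min e (1/(R * n + 1))"
 have p: "0<R * n + 1" using assms(3) by (simp add: add_nonneg_pos)
 have "e'*(R * n + 1) <= 1" using p by (simp add: e'_def min_def field_simps split: if_splits)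
 moreover have e': "e' > 0" "e' <= e" using e p by (auto simp: e'_def)
 ultimately have "R*(n * e')<1" by (simp add: algebra_simps)
 thus ?thesis using that[of e'] e' e cube_mono[of e' e n x] by auto
qed

lemma analytic_imp_real_analytic:
 assumes U: "openE n U" and f: "an_pd n U f"
 shows "real_analytic_on n U f"
 unfolding real_analytic_on_def
proof
 fix x assume x: "x : U"
 obtain K R where KR: "0 <= K" "0<R" "AM n U (geom K R) f" using f unfolding analytic_wrt_AM by blast
 obtain e where e: "0<e" "cube n x e \<subseteq> U" "R*(real n * e)<1"
  by (rule small_cube[OF U x less_imp_le[OF KR(2)]])
 define c where "c al = (\<Sum>w | w : lists {..<n} & content w = al. foldr partial w f x / fact (length w))" for al
 have "((%al. c al*(\<Prod>i<n. (y i - x i) ^ al i)) has_sum f y) (multiindices n)"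
  if "y : spaceE n" "ALL i<n. abs (y i - x i)<e" for y
 proof -
  have "y : cube n x e" using that by (auto simp: cube_def topspace_Euclidean_space)
  from has_sum_multiindices[OF analytic_imp_power_series[OF U KR(3,1,2) x e this]]
  show ?thesis by (simp add: c_def)
 qed
 thus "EX c. EX e>0. ALL y:spaceE n. (ALL i<n. abs (y i - x i)<e) -->
    ((%al. c al*(\<Prod>i<n. (y i - x i) ^ al i)) has_sum f y) (multiindices n)" using e(1) by blast
qed

lemma real_analytic_imp_analytic:
 assumes U: "openE n U" and f: "real_analytic_on n U f" and x: "x : U"
 obtains e where "0<e" "cube n x e \<subseteq> U" "an_pd n (cube n x e) f"
proof -
 obtain c e0 where e0: "e0 > 0" and c: "!!y. y : spaceE n ==> (ALL i<n. abs (y i - x i)<e0) ==>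
    ((%al. c al*(\<Prod>i<n. (y i - x i) ^ al i)) has_sum f y) (multiindices n)"
  using f x unfolding real_analytic_on_def by blast
 have xt: "x : spaceE n" using x openin_subset[OF U] by auto
 define a where "a w = (if w = sorted_word n (content w) then c (content w) else 0)" for w
 have hs: "((%w. a w * mon (%j. y j - x j) w) has_sum f y) (lists {..<n})" if "y : cube n x e0" for y
  unfolding a_def by (rule has_sum_words_of_multiindices, rule c)
   (use that cube_subset_topspace in \<open>auto simp: cube_def\<close>)
 \<comment> \<open>Every coordinate below n of this point differs from that of x by e0/2.
   Summability here bounds a(w) (e0/2)^m for all words w of length m, which is a geometric majorant
   of rate 2/e0.\<close>
 define y0 where "y0 = (%i. if i<n then x i + e0/2 else 0)"
 have y0: "y0 : cube n x e0" using e0 by (auto simp: y0_def cube_def)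
 have mon0: "mon (%j. y0 j - x j) w = (e0/2) ^ length w" if "w : lists {..<n}" for w
  using that by (induction w) (auto simp: mon_def y0_def)
 have "(%w. norm (a w * mon (%j. y0 j - x j) w)) summable_on lists {..<n}"
  by (rule summable_on_iff_abs_summable_on_real[THEN iffD1, OF has_sum_imp_summable[OF hs[OF y0]]])
 then obtain K where K: "!!w. w : lists {..<n} ==> norm (a w * mon (%j. y0 j - x j) w) <= K"
 proof -
  assume s: "(%w. norm (a w * mon (%j. y0 j - x j) w)) summable_on lists {..<n}"
   and t: "!!K. (!!w. w : lists {..<n} ==> norm (a w * mon (%j. y0 j - x j) w) <= K) ==> thesis"
  show thesis
  proof (rule t)
   fix w assume w: "w : lists {..<n}"
   have "sum (%w. norm (a w * mon (%j. y0 j - x j) w)) {w} <= (\<Sum>\<^sub>\<infinity>w\<in>lists {..<n}. norm (a w * mon (%j. y0 j - x j) w))"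
    by (rule finite_sum_le_infsum[OF s]) (use w in auto)
   thus "norm (a w * mon (%j. y0 j - x j) w) <= (\<Sum>\<^sub>\<infinity>w\<in>lists {..<n}. norm (a w * mon (%j. y0 j - x j) w))" by simp
  qed
 qed
 define R where "R = 2 / e0"
 have R: "R > 0" using e0 by (simp add: R_def)
 have ab: "abs (a w) <= K * R ^ length w" if "w : lists {..<n}" for w
  using K[OF that] e0 mon0[OF that] by (simp add: abs_mult R_def field_simps power_divide)
 have K0: "K >= 0" using K[of "[]"] by (simp add: order_trans[OF abs_ge_zero])
 have R2: "0 <= 2 * R" using R by simp
 obtain e1 where e1: "0<e1" "cube n x e1 \<subseteq> U" "2 * R*(real n * e1)<1" by (rule small_cube[OF U x R2])
 define e where "e = min e0 e1"
 have e: "0<e" "e <= e0" "e <= e1" using e0 e1 by (auto simp: e_def)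
 have "2 * R*(n * e) <= 2 * R*(n * e1)" using R e by (intro mult_left_mono) auto
 hence eR: "2 * R*(n * e)<1" using e1 by linarith
 have an: "an_pd n (cube n x e) (wseries n a x)"
  by (rule wseries_analytic[OF ab K0 R e(1) eR])
 have "f y = wseries n a x y" if "y : cube n x e" for y
 proof -
  have "y : cube n x e0" using that cube_mono[OF e(2)] by blast
  from hs[OF this] have "(%m. WP n a m (%j. y j - x j)) sums f y"
   using has_sum_lists_iff_sums has_sum_imp_summable by blast
  thus ?thesis by (simp add: wseries_def sums_iff)
 qed
 hence "an_pd n (cube n x e) f"
  by (intro derivation_system.an_cong[OF derivation_pd[OF openin_cube] an]) auto
 thus ?thesis using that[of e] e e1 cube_mono[OF e(3), of n x] by auto
qed

text \<open>Having a power series is a condition at each point, so uniform bounds on some small cube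
  around every point suffice.\<close>

lemma real_analytic_on_local:
 assumes "openE n U"
  and "!!x. x : U ==> EX e>0. cube n x e \<subseteq> U & an_pd n (cube n x e) f"
 shows "real_analytic_on n U f"
 unfolding real_analytic_on_def
proof
 fix x assume x: "x : U"
 then obtain e where e: "e > 0" "an_pd n (cube n x e) f" using assms by blast
 have "x : cube n x e" using x e openin_subset[OF assms(1)] by (intro cube_center) auto
 with analytic_imp_real_analytic[OF openin_cube e(2)]
 show "EX c. EX e>0. ALL y:spaceE n. (ALL i<n. abs (y i - x i)<e) -->
    ((%al. c al*(\<Prod>i<n. (y i - x i) ^ al i)) has_sum f y) (multiindices n)"
  unfolding real_analytic_on_def by blast
qed

subsection \<open>The spaces C_omega\<close>

text \<open>Splitting off one index at a time costs a power of 2 by \<open>fact_add_le\<close>; n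
  such steps account for the factor n in the exponent.\<close>

lemma fact_sum_le: "fact (\<Sum>i<n. al i) <= 2 ^ (n*(\<Sum>i<n. al i))*(\<Prod>i<n. fact (al i) :: real)"
proof (induction n)
 case (Suc n)
 let ?s = "\<Sum>i<n. al i" and ?t = "\<Sum>i<Suc n. al i"
 have "fact (?s + al n) <= 2 ^ (?s + al n) * fact ?s*(fact (al n) :: real)" by (rule fact_add_le)
 also have "... <= 2 ^ (?s + al n)*(2 ^ (n * ?s)*(\<Prod>i<n. fact (al i))) * fact (al n)"
  using Suc by (intro mult_right_mono mult_left_mono) auto
 also have "... <= 2 ^ (?s + al n)*(2 ^ (n*(?s + al n))*(\<Prod>i<n. fact (al i))) * fact (al n)"
  by (intro mult_right_mono mult_left_mono power_increasing) (auto intro: prod_nonneg)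
 also have "... = 2 ^ (Suc n * ?t)*(\<Prod>i<Suc n. fact (al i))"
  by (simp add: power_add algebra_simps)
 finally show ?case by simp
qed auto

lemma summable_multiindices:
 fixes x :: real
 assumes "0 <= x" "n * x<1"
 shows "(%al. x ^ (\<Sum>i<n. al i)) summable_on multiindices n"
proof -
 have "(%w. 1 * mon (%_. x) w) summable_on lists {..<n}"
  by (rule summable_lists[where K=1 and R=1]) (use assms in \<open>auto simp: l1_def\<close>)
 hence "(%w. x ^ length w) summable_on lists {..<n}"
  by (simp add: mon_def map_replicate_const)
 hence "(%w. x ^ length w) summable_on (sorted_word n ` multiindices n)"
  by (rule summable_on_subset_banach) (use sorted_word_lists in auto)
 moreover have "inj_on (sorted_word n) (multiindices n)"
  by (rule inj_on_inverseI[where g=content]) (rule content_sorted_word)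
 ultimately have "((%w. x ^ length w) o sorted_word n) summable_on multiindices n"
  using summable_on_reindex by blast
 thus ?thesis by (rule summable_on_cong[THEN iffD1, rotated]) (simp add: length_sorted_word)
qed

lemma analytic_imp_C_omega:
 assumes U: "openE n U" and F: "!!i. i<m ==> an_pd n U (%x. F x i)"
 shows "C_omega n m U F"
proof -
 have "EX KR. 0 <= fst KR & 0<snd KR & AM n U (geom (fst KR) (snd KR)) (%x. F x i)" if "i<m" for i
  using F[OF that] unfolding analytic_wrt_AM by auto
 then obtain kr where kr: "!!i. i<m ==> 0 <= fst (kr i) & 0<snd (kr i) & AM n U (geom (fst (kr i)) (snd (kr i))) (%x. F x i)"
  by metis
 define K where "K = (\<Sum>i<m. fst (kr i))"
 define R where "R = 1 + (\<Sum>i<m. snd (kr i))"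
 have R: "R > 0" "K >= 0" using kr by (auto simp: R_def K_def less_imp_le intro!: add_pos_nonneg sum_nonneg)
 have AMi: "AM n U (geom K R) (%x. F x i)" if "i<m" for i
 proof -
  have "fst (kr i) <= K" "snd (kr i) <= (\<Sum>i<m. snd (kr i))"
   unfolding K_def using kr that by (auto intro!: member_le_sum simp: less_imp_le)
  hence "fps_le (geom (fst (kr i)) (snd (kr i))) (geom K R)"
   using kr[OF that] by (intro geom_mono) (auto simp: R_def)
  thus ?thesis using kr[OF that] maj_le unfolding AM_def by blast
 qed
 \<comment> \<open>Chosen so that r R 2^n = 1/(n + 1). The power of 2 absorbs the quotient
   |al|!/al!, and n/(n + 1) < 1 makes the sum over the multi-indices converge.\<close>
 define r where "r = 1/(R*2 ^ n*(n + 1))"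
 have r: "r > 0" using R by (simp add: r_def)
 define x where "x = r * R*2 ^ n"
 have xeq: "x = 1/(n + 1)" using R by (simp add: x_def r_def)
 have x: "0 <= x" "n * x<1" by (simp_all add: xeq)
 have bound: "ennreal (r ^ (\<Sum>i<n. al i)/(\<Prod>i<n. fact (al i))) *
    (SUP z\<in>U. ennreal (L2_set (%i. partial_multi n al (%z. F z i) z) {..<m})) <= ennreal (m * K * x ^ (\<Sum>i<n. al i))" for al
 proof -
  let ?s = "\<Sum>i<n. al i"
  have "L2_set (%i. partial_multi n al (%z. F z i) z) {..<m} <= m*(fact ?s * K * R ^ ?s)" if "z : U" for z
  proof -
   have "L2_set (%i. partial_multi n al (%z. F z i) z) {..<m} <= (\<Sum>i<m. abs (partial_multi n al (%z. F z i) z))"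
    by (rule L2_set_le_sum_abs)
   also have "... <= (\<Sum>i<m. fact ?s * K * R ^ ?s)"
    using AM_bound[OF AM_partial_multi[OF U AMi] that] by (intro sum_mono) (auto simp: deriv_geom_0)
   finally show ?thesis by simp
  qed
  hence "(SUP z\<in>U. ennreal (L2_set (%i. partial_multi n al (%z. F z i) z) {..<m})) <= ennreal (m*(fact ?s * K * R ^ ?s))"
   by (intro SUP_least ennreal_leI)
  hence "ennreal (r ^ ?s/(\<Prod>i<n. fact (al i))) *
    (SUP z\<in>U. ennreal (L2_set (%i. partial_multi n al (%z. F z i) z) {..<m})) <=
    ennreal (r ^ ?s/(\<Prod>i<n. fact (al i))) * ennreal (m*(fact ?s * K * R ^ ?s))"
   by (rule mult_left_mono) simp
  also have "... = ennreal (r ^ ?s/(\<Prod>i<n. fact (al i))*(m*(fact ?s * K * R ^ ?s)))"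
   using r by (intro ennreal_mult'[symmetric]) (auto intro!: divide_nonneg_nonneg prod_nonneg)
  also have "... <= ennreal (m * K * x ^ ?s)"
  proof (rule ennreal_leI)
   have P: "(\<Prod>i<n. fact (al i) :: real) > 0" by (rule prod_pos) simp
   have "r ^ ?s/(\<Prod>i<n. fact (al i))*(m*(fact ?s * K * R ^ ?s)) = (m * K * r ^ ?s * R ^ ?s/(\<Prod>i<n. fact (al i))) * fact ?s"
    by simp
   also have "... <= (m * K * r ^ ?s * R ^ ?s/(\<Prod>i<n. fact (al i)))*(2 ^ (n * ?s)*(\<Prod>i<n. fact (al i)))"
    using r R P by (intro mult_left_mono fact_sum_le) auto
   also have "... = m * K * x ^ ?s"
    using P by (simp add: x_def power_mult_distrib power_mult)
   finally show "r ^ ?s/(\<Prod>i<n. fact (al i))*(m*(fact ?s * K * R ^ ?s)) <= m * K * x ^ ?s" .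
  qed
  finally show ?thesis .
 qed
 have sm: "(%al. m * K * x ^ (\<Sum>i<n. al i)) summable_on multiindices n"
  by (rule summable_on_cmult_right[OF summable_multiindices[OF x]])
 have "(\<Sum>\<^sub>\<infinity>al\<in>multiindices n. ennreal (r ^ (\<Sum>i<n. al i)/(\<Prod>i<n. fact (al i))) *
    (SUP z\<in>U. ennreal (L2_set (%i. partial_multi n al (%z. F z i) z) {..<m})))
   <= (\<Sum>\<^sub>\<infinity>al\<in>multiindices n. ennreal (m * K * x ^ (\<Sum>i<n. al i)))"
  by (rule infsum_mono) (auto intro: bound nonneg_summable_on_complete)
 also have "... <= ennreal (\<Sum>\<^sub>\<infinity>al\<in>multiindices n. m * K * x ^ (\<Sum>i<n. al i))"
 proof (rule infsum_le_finite_sums)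
  fix A assume A: "finite A" "A \<subseteq> multiindices n"
  have "(\<Sum>al\<in>A. ennreal (m * K * x ^ (\<Sum>i<n. al i))) = ennreal (\<Sum>al\<in>A. m * K * x ^ (\<Sum>i<n. al i))"
   using R x by (intro sum_ennreal) auto
  also have "... <= ennreal (\<Sum>\<^sub>\<infinity>al\<in>multiindices n. m * K * x ^ (\<Sum>i<n. al i))"
   by (rule ennreal_leI, rule finite_sum_le_infsum[OF sm A]) (use R x in auto)
  finally show "(\<Sum>al\<in>A. ennreal (m * K * x ^ (\<Sum>i<n. al i))) <= ennreal (\<Sum>\<^sub>\<infinity>al\<in>multiindices n. m * K * x ^ (\<Sum>i<n. al i))" .
 qed (auto intro: nonneg_summable_on_complete)
 also have "... < \<infinity>" by simp
 finally have "C_omega_r n m r U F"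
  unfolding C_omega_r_def using AM_C_k[OF AMi U] by auto
 thus ?thesis unfolding C_omega_def using r by blast
qed

lemma partial_smooth_commute:
 assumes U: "openE n U" and f: "!!k. C_k_on k n U f" and ij: "i<n" "j<n" and x: "x : U"
 shows "partial i (partial j f) x = partial j (partial i f) x"
proof (cases "i = j")
 case False
 have c: "C_k_on (Suc (Suc 0)) n U f" by (rule f)
 note c' = C_k_on_SucE(2)[OF c]
 show ?thesis
  using pd_symmetric[OF U C_k_on_SucE(1)[OF c] C_k_on_SucE(1)[OF c'[OF ij(1)]] C_k_on_SucE(1)[OF c'[OF ij(2)]] ij False x]
  by simp
qed auto

lemma smooth_partial: "(!!k. C_k_on k n U f) ==> i<n ==> C_k_on k n U (partial i f)"
 by (metis C_k_on_SucE(2))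

lemma smooth_funpow: "(!!k. C_k_on k n U f) ==> i<n ==> C_k_on k n U ((partial i ^^ a) f)"
 by (induction a arbitrary: k) (auto intro: smooth_partial)

lemma partial_funpow_commute:
 assumes U: "openE n U" and f: "!!k. C_k_on k n U f" and ij: "i<n" "j<n"
 shows "x : U ==> partial i ((partial j ^^ a) f) x = (partial j ^^ a) (partial i f) x"
proof (induction a arbitrary: x)
 case (Suc a)
 have "partial i ((partial j ^^ Suc a) f) x = partial j (partial i ((partial j ^^ a) f)) x"
  using partial_smooth_commute[OF U smooth_funpow[OF f ij(2)] ij Suc.prems] by simp
 also have "... = partial j ((partial j ^^ a) (partial i f)) x"
  using partial_cong[OF U _ ij(2) Suc.prems] Suc.IH by blast
 finally show ?case by simp
qed auto

lemma smooth_partial_multi: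
 assumes "!!k. C_k_on k n U f"
 shows "C_k_on k n U (partial_multi n al f)"
proof -
 have "N <= n ==> C_k_on k n U (fold (%i. partial i ^^ al i) [0..<N] f)" for N
  by (induction N arbitrary: k) (use assms in \<open>auto intro: smooth_funpow\<close>)
 thus ?thesis by (simp add: partial_multi_def)
qed

lemma funpow_partial_cong:
 assumes "openE n U" "!!x. x : U ==> f x = g x" "i<n"
 shows "x : U ==> (partial i ^^ a) f x = (partial i ^^ a) g x"
proof (induction a arbitrary: x)
 case (Suc a)
 have "partial i ((partial i ^^ a) f) x = partial i ((partial i ^^ a) g) x"
  by (rule partial_cong[OF assms(1) _ assms(3) Suc.prems]) (rule Suc.IH)
 thus ?case by simp
qed (use assms in auto)

text \<open>\<open>partial_multi\<close> differentiates in a fixed order of the coordinates, so an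
  additional derivative must be commuted past those of larger index. This is where symmetry of
  second derivatives enters.\<close>

lemma partial_partial_multi:
 assumes U: "openE n U" and f: "!!k. C_k_on k n U f" and j: "j<n" and x: "x : U"
 shows "partial j (partial_multi n al f) x = partial_multi n (al(j := Suc (al j))) f x"
proof -
 let ?F = "%al N. fold (%i. partial i ^^ al i) [0..<N] f"
 let ?\<beta> = "al(j := Suc (al j))"
 have smooth: "N <= n ==> C_k_on k n U (?F al N)" for N k al
  by (induction N arbitrary: k) (use f in \<open>auto intro: smooth_funpow\<close>)
 have same: "N <= j ==> ?F ?\<beta> N = ?F al N" for N
  by (induction N) auto
 have "N <= n ==> j<N ==> ALL x:U. partial j (?F al N) x = ?F ?\<beta> N x" for N
 proof (induction N)
  case (Suc N)
  have N: "N<n" "N <= n" using Suc.prems by auto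
  show ?case
  proof (cases "j = N")
   case True
   have "?F ?\<beta> N = ?F al N" using same True by blast
   hence "?F ?\<beta> (Suc N) = partial j (?F al (Suc N))" using True by simp
   thus ?thesis by simp
  next
   case False
   hence IH: "ALL x:U. partial j (?F al N) x = ?F ?\<beta> N x" using Suc by auto
   have "partial j ((partial N ^^ al N) (?F al N)) x = (partial N ^^ al N) (?F ?\<beta> N) x" if "x : U" for x
    using partial_funpow_commute[OF U smooth[OF N(2)] j N(1) that]
     funpow_partial_cong[OF U _ N(1) that, of "partial j (?F al N)" "?F ?\<beta> N"] IH by simp
   thus ?thesis using False by simp
  qed
 qed auto
 thus ?thesis using j x by (simp add: partial_multi_def)
qed

text \<open>A single summand is at most the whole sum B, which bounds the derivative of index al by
  al! B (1/r)^|al|. As al! <= |al|!, this is a bound by a geometric majorant of rate 1/r.\<close>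

lemma C_omega_imp_analytic:
 assumes U: "openE n U" and F: "C_omega n m U F" and i: "i<m"
 shows "an_pd n U (%x. F x i)"
proof -
 obtain r where r: "r > 0" "C_omega_r n m r U F" using F unfolding C_omega_def by blast
 define f where "f = (%x. F x i)"
 have sm: "C_k_on k n U f" for k using r(2) i unfolding C_omega_r_def f_def by blast
 let ?T = "%al. ennreal (r ^ (\<Sum>i<n. al i)/(\<Prod>i<n. fact (al i))) *
    (SUP z\<in>U. ennreal (L2_set (%i. partial_multi n al (%z. F z i) z) {..<m}))"
 define B where "B = enn2real (\<Sum>\<^sub>\<infinity>al\<in>multiindices n. ?T al)"
 have fin: "(\<Sum>\<^sub>\<infinity>al\<in>multiindices n. ?T al)<\<infinity>" using r(2) unfolding C_omega_r_def by blast
 have B: "(\<Sum>\<^sub>\<infinity>al\<in>multiindices n. ?T al) = ennreal B" "B >= 0"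
  using fin by (auto simp: B_def ennreal_enn2real_if)
 have bd: "abs (partial_multi n al f x) <= fact (\<Sum>i<n. al i) * B*(1 / r) ^ (\<Sum>i<n. al i)" if al: "al : multiindices n" and x: "x : U" for al x
 proof -
  let ?s = "\<Sum>i<n. al i"
  have P: "(\<Prod>i<n. fact (al i) :: real) > 0" by (rule prod_pos) simp
  have "abs (partial_multi n al f x) <= L2_set (%i. partial_multi n al (%z. F z i) x) {..<m}"
   using member_le_L2_set[of "{..<m}" i "%i. abs (partial_multi n al (%z. F z i) x)"] i by (simp add: f_def L2_set_def)
  hence "ennreal (r ^ ?s/(\<Prod>i<n. fact (al i)) * abs (partial_multi n al f x)) <=
    ennreal (r ^ ?s/(\<Prod>i<n. fact (al i)) * L2_set (%i. partial_multi n al (%z. F z i) x) {..<m})"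
   using r P by (intro ennreal_leI mult_left_mono) auto
  also have "... = ennreal (r ^ ?s/(\<Prod>i<n. fact (al i))) * ennreal (L2_set (%i. partial_multi n al (%z. F z i) x) {..<m})"
   using r P by (intro ennreal_mult) (auto simp: L2_set_nonneg)
  also have "... <= ?T al"
   by (intro mult_left_mono SUP_upper x) simp
  also have "... <= (\<Sum>\<^sub>\<infinity>al\<in>multiindices n. ?T al)"
   using infsum_mono_neutral[OF nonneg_summable_on_complete[of "{al}" ?T] nonneg_summable_on_complete[of "multiindices n" ?T]] al by simp
  finally have "r ^ ?s/(\<Prod>i<n. fact (al i)) * abs (partial_multi n al f x) <= B"
   unfolding B(1) using B(2) by (simp add: ennreal_le_iff)
  hence "abs (partial_multi n al f x) <= (\<Prod>i<n. fact (al i)) * B*(1 / r) ^ ?s"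
   using r P by (simp add: field_simps power_divide)
  also have "... <= fact ?s * B*(1 / r) ^ ?s"
  proof (intro mult_right_mono B)
   show "(\<Prod>i<n. fact (al i) :: real) <= fact ?s"
   proof (induction n)
    case (Suc N)
    have "fact (\<Sum>i<N. al i) * fact (al N) <= (fact ((\<Sum>i<N. al i) + al N) :: real)"
    proof -
     have "fact (\<Sum>i<N. al i) * fact (al N) dvd (fact ((\<Sum>i<N. al i) + al N) :: nat)" by (rule fact_fact_dvd_fact)
     hence "fact (\<Sum>i<N. al i) * fact (al N) <= (fact ((\<Sum>i<N. al i) + al N) :: nat)" by (rule dvd_imp_le) simp
     thus ?thesis by (metis of_nat_fact of_nat_le_iff of_nat_mult)
    qed
    moreover have "(\<Prod>i<N. fact (al i) :: real) * fact (al N) <= fact (\<Sum>i<N. al i) * fact (al N)"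
     using Suc by (intro mult_right_mono) auto
    ultimately have "(\<Prod>i<N. fact (al i) :: real) * fact (al N) <= fact ((\<Sum>i<N. al i) + al N)" by linarith
    thus ?case by simp
   qed auto
  qed (use r in auto)
  finally show ?thesis .
 qed
 have "maj U n (pd n U) k ((fps_deriv ^^ (\<Sum>i<n. al i)) (geom B (1 / r))) (partial_multi n al f)"
  if "al : multiindices n" for k al
  using that
 proof (induction k arbitrary: al)
  case 0
  thus ?case using bd by (simp add: deriv_geom_0)
 next
  case (Suc k)
  have up: "al(j := Suc (al j)) : multiindices n" if "j<n" for j
   using Suc.prems that by (auto simp: multiindices_def)
  have s: "(\<Sum>i<n. (al(j := Suc (al j))) i) = Suc (\<Sum>i<n. al i)" if "j<n" for j
  proof -
   have "(\<Sum>i<n. (al(j := Suc (al j))) i) = (\<Sum>i<n. al i + (if i = j then 1 else 0))"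
    by (intro sum.cong) auto
   thus ?thesis using that by (simp add: sum.distrib)
  qed
  have "pd n U (partial_multi n al f) (%j. partial_multi n (al(j := Suc (al j))) f)"
   by (rule pd_cong[OF U C_k_on_SucE(1)[OF smooth_partial_multi[OF sm]]])
    (use partial_partial_multi[OF U sm] in auto)
  moreover have "maj U n (pd n U) k (fps_deriv ((fps_deriv ^^ (\<Sum>i<n. al i)) (geom B (1 / r)))) (partial_multi n (al(j := Suc (al j))) f)"
   if "j<n" for j
   using Suc.IH[OF up[OF that]] unfolding s[OF that] by (simp only: funpow.simps comp_apply)
  ultimately show ?case using bd[OF Suc.prems] by (auto simp: deriv_geom_0)
 qed
 from this[of "%_. 0"] have "maj U n (pd n U) k (geom B (1 / r)) (partial_multi n (%_. 0) f)" for k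
  by (simp add: multiindices_def)
 moreover have "fold (%i. partial i ^^ 0) [0..<N] f = f" for N by (induction N) auto
 hence "partial_multi n (%_. 0) f = f" by (simp add: partial_multi_def)
 ultimately show ?thesis unfolding analytic_wrt_def f_def[symmetric]
  using B(2) r(1) by (intro exI[of _ B] exI[of _ "1 / r"]) auto
qed

subsection \<open>Ordinary differential equations\<close>

definition ccube :: "nat => rn => real => rn set" where
 "ccube n x e = {y. (ALL i<n. abs (y i - x i) <= e) & (ALL i>=n. y i = 0)}"

lemma deriv_bound_segment:
 fixes g :: "real => real"
 assumes "!!t. t : {a..b} ==> (g has_real_derivative g' t) (at t within {a..b})"
  and "!!t. t : {a..b} ==> abs (g' t) <= B" and "s : {a..b}" "t : {a..b}"
 shows "abs (g t - g s) <= B * abs (t - s)"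
 using field_differentiable_bound[of "{a..b}" g g' B t s] assms by auto

text \<open>On an interval this short, integration turns a bound D into D/2 + eps (b - a). Iterating
  from any bound leads to the fixed point 2 eps (b - a). With eps = 0 this is uniqueness.\<close>

lemma small_Gronwall:
 fixes \<delta> :: "real => nat => real"
 assumes d: "!!i s. i<n ==> s : {a..b} ==> ((%r. \<delta> r i) has_real_derivative \<delta>' s i) (at s within {a..b})"
  and b: "!!i s. i<n ==> s : {a..b} ==> abs (\<delta>' s i) <= L*(\<Sum>k<n. abs (\<delta> s k)) + eps"
  and s0: "s0 : {a..b}" "!!i. i<n ==> \<delta> s0 i = 0"
  and L: "0 <= L" "n * L*(b - a) <= 1/2" "0 <= eps" and i: "i<n" and s: "s : {a..b}"
 shows "abs (\<delta> s i) <= 2 * eps*(b - a)"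
proof -
 have ab: "0 <= b - a" using s by auto
 have "EX B. ALL s:{a..b}. abs (\<delta> s i) <= B" if "i<n" for i
 proof -
  have "continuous_on {a..b} (%s. \<delta> s i)"
   by (rule DERIV_continuous_on[OF d[OF that]])
  hence "bounded ((%s. \<delta> s i) ` {a..b})"
   by (intro compact_imp_bounded compact_continuous_image) auto
  thus ?thesis unfolding bounded_iff by auto
 qed
 then obtain B where B: "!!i s. i<n ==> s : {a..b} ==> abs (\<delta> s i) <= B i" by metis
 define C where "C = (\<Sum>i<n. abs (B i))"
 have C: "abs (\<delta> s i) <= C" if "i<n" "s : {a..b}" for i s
 proof -
  have "abs (B i) <= C" unfolding C_def using that by (intro member_le_sum) auto
  thus ?thesis using B[OF that] by linarith
 qed
 have step: "ALL i<n. ALL s:{a..b}. abs (\<delta> s i) <= D/2 + eps*(b - a)"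
  if D: "ALL i<n. ALL s:{a..b}. abs (\<delta> s i) <= D" for D
 proof (intro allI impI ballI)
  fix i s assume i: "i<n" and s: "s : {a..b}"
  have D0: "0 <= D" using D i s by (meson abs_ge_zero order_trans)
  have "abs (\<delta>' r i) <= L*(n * D) + eps" if "r : {a..b}" for r
  proof -
   have "(\<Sum>k<n. abs (\<delta> r k)) <= n * D" using D that sum_bounded_above[of "{..<n}" "%k. abs (\<delta> r k)" D] by auto
   thus ?thesis using b[OF i that] mult_left_mono[of "\<Sum>k<n. abs (\<delta> r k)" "n * D" L] L(1) by linarith
  qed
  from deriv_bound_segment[OF d[OF i] this s0(1) s]
  have "abs (\<delta> s i) <= (L*(n * D) + eps) * abs (s - s0)" using s0(2)[OF i] by simp
  also have "... <= (L*(n * D) + eps)*(b - a)"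
   using s s0(1) L D0 by (intro mult_left_mono) auto
  also have "... = (n * L*(b - a)) * D + eps*(b - a)" by (simp add: algebra_simps)
  also have "... <= (1/2) * D + eps*(b - a)" using L D0 by (intro add_right_mono mult_right_mono) auto
  finally show "abs (\<delta> s i) <= D/2 + eps*(b - a)" by simp
 qed
 have it: "ALL i<n. ALL s:{a..b}. abs (\<delta> s i) <= C/2 ^ k + 2 * eps*(b - a)" for k
 proof (induction k)
  case 0
  thus ?case using C L ab by (auto intro: order_trans[OF C])
 next
  case (Suc k)
  from step[OF this] show ?case by (simp add: field_simps)
 qed
 have "(%k. C*(1/2) ^ k + 2 * eps*(b - a)) \<longlonglongrightarrow> C*0 + 2 * eps*(b - a)"
  by (intro tendsto_add tendsto_mult tendsto_const LIMSEQ_power_zero) auto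
 hence "abs (\<delta> s i) <= C*0 + 2 * eps*(b - a)"
  by (rule LIMSEQ_le_const) (use it i s in \<open>auto simp: power_divide\<close>)
 thus ?thesis by simp
qed

text \<open>K T <= \<rho> keeps the iterates in the closed cube, and n L T <= 1/2 makes the Picard
  map halve distances. Time runs in both directions from 0.\<close>

lemma Picard_local:
 fixes F :: "rn => nat => real"
 assumes x: "x : spaceE n" and \<rho>: "0 <= \<rho>"
  and K: "!!y i. y : ccube n x \<rho> ==> i<n ==> abs (F y i) <= K"
  and Lip: "!!y z i. y : ccube n x \<rho> ==> z : ccube n x \<rho> ==> i<n ==> abs (F y i - F z i) <= L*(\<Sum>k<n. abs (y k - z k))"
  and T: "0<T" "0 <= K" "0 <= L" "K * T <= \<rho>" "n * L * T <= 1/2"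
 obtains cu where "cu 0 = x" "!!t. t : {-T..T} ==> cu t : ccube n x \<rho>"
  "!!t i. t : {-T..T} ==> i<n ==> ((%s. cu s i) has_real_derivative F (cu t) i) (at t within {-T..T})"
proof -
 define good where "good cu \<longleftrightarrow> (ALL i<n. continuous_on {-T..T} (%s. cu s i)) & (ALL s:{-T..T}. cu s : ccube n x \<rho>)" for cu :: "real => rn"
 \<comment> \<open>The integral from 0 to t, written with base point -T because t may be negative.
   Coordinates from n on are set to 0, so the values remain in Euclidean space.\<close>
 define P where "P cu t i = (if i<n then x i + (integral {-T..t} (%s. F (cu s) i) - integral {-T..0} (%s. F (cu s) i)) else 0)"
  for cu t i
 have cF: "continuous_on {-T..T} (%s. F (cu s) i)" if g: "good cu" and i: "i<n" for cu i
  unfolding continuous_on_def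
 proof
  fix s assume s: "s : {-T..T}"
  have "((%r. L*(\<Sum>k<n. abs (cu r k - cu s k))) \<longlongrightarrow> L*(\<Sum>k<n. abs (cu s k - cu s k))) (at s within {-T..T})"
   using g s unfolding good_def continuous_on_def by (intro tendsto_intros) auto
  hence "((%r. L*(\<Sum>k<n. abs (cu r k - cu s k))) \<longlongrightarrow> 0) (at s within {-T..T})" by simp
  moreover have "\<forall>\<^sub>F r in at s within {-T..T}. norm (F (cu r) i - F (cu s) i) <= L*(\<Sum>k<n. abs (cu r k - cu s k))"
   using Lip g i s unfolding good_def eventually_at_filter by (intro always_eventually) auto
  ultimately have "((%r. F (cu r) i - F (cu s) i) \<longlongrightarrow> 0) (at s within {-T..T})" by (rule Lim_null_comparison[rotated])
  thus "((%r. F (cu r) i) \<longlongrightarrow> F (cu s) i) (at s within {-T..T})" by (rule Lim_null[THEN iffD2])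
 qed
 have PD: "((%s. P cu s i) has_real_derivative F (cu t) i) (at t within {-T..T})"
  if g: "good cu" and i: "i<n" and t: "t : {-T..T}" for cu i t
 proof -
  have "((%s. x i + (integral {-T..s} (%s. F (cu s) i) - integral {-T..0} (%s. F (cu s) i))) has_real_derivative
    0 + (F (cu t) i - 0)) (at t within {-T..T})"
   by (intro DERIV_add DERIV_diff DERIV_const integral_has_real_derivative cF g i t)
  thus ?thesis using i by (simp add: P_def)
 qed
 have P0: "P cu 0 = x" for cu using x by (auto simp: P_def topspace_Euclidean_space fun_eq_iff)
 have Plip: "abs (P cu t i - P cu s i) <= K * abs (t - s)" if "good cu" "i<n" "s : {-T..T}" "t : {-T..T}" for cu i s t
  by (rule deriv_bound_segment[OF PD[OF that(1,2)] _ that(3,4)]) (use K that in \<open>auto simp: good_def\<close>)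
 have T0: "0 : {-T..T}" using T by auto
 have Pgood: "good (P cu)" if g: "good cu" for cu
  unfolding good_def
 proof (intro conjI allI impI ballI)
  show "continuous_on {-T..T} (%s. P cu s i)" if "i<n" for i
   by (rule DERIV_continuous_on[OF PD[OF g that]])
  fix s assume s: "s : {-T..T}"
  have "abs (P cu s i - x i) <= \<rho>" if "i<n" for i
  proof -
   have "abs (P cu s i - x i) <= K * abs (s - 0)" using Plip[OF g that T0 s] P0 by simp
   also have "... <= K * T" using s T by (intro mult_left_mono) auto
   finally show ?thesis using T by linarith
  qed
  thus "P cu s : ccube n x \<rho>" by (auto simp: ccube_def P_def)
 qed
 have contr: "abs (P cu t i - P \<eta> t i) <= D/2" if g: "good cu" "good \<eta>" and i: "i<n" and t: "t : {-T..T}"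
  and D: "!!k s. k<n ==> s : {-T..T} ==> abs (cu s k - \<eta> s k) <= D" for cu \<eta> i t D
 proof -
  have D0: "0 <= D" using D[OF i t] by linarith
  have "abs ((P cu t i - P \<eta> t i) - (P cu 0 i - P \<eta> 0 i)) <= (L*(n * D)) * abs (t - 0)"
  proof (rule deriv_bound_segment[OF _ _ T0 t])
   show "((%t. P cu t i - P \<eta> t i) has_real_derivative (F (cu s) i - F (\<eta> s) i)) (at s within {-T..T})" if "s : {-T..T}" for s
    using PD[OF g(1) i that] PD[OF g(2) i that] by (intro DERIV_diff)
   fix s assume s: "s : {-T..T}"
   have "abs (F (cu s) i - F (\<eta> s) i) <= L*(\<Sum>k<n. abs (cu s k - \<eta> s k))" using Lip g i s unfolding good_def by auto
   also have "... <= L*(n * D)"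
    using T(3) D s sum_bounded_above[of "{..<n}" "%k. abs (cu s k - \<eta> s k)" D] by (intro mult_left_mono) auto
   finally show "abs (F (cu s) i - F (\<eta> s) i) <= L*(n * D)" .
  qed
  also have "... <= (L*(n * D)) * T" using t T D0 by (intro mult_left_mono) auto
  also have "... = (n * L * T) * D" by simp
  also have "... <= (1/2) * D" by (rule mult_right_mono[OF T(5) D0])
  finally show ?thesis by (simp add: P0)
 qed
 define u where "u m = (P ^^ m) (%_. x)" for m
 have uS: "u (Suc m) = P (u m)" for m by (simp add: u_def)
 have u0: "u 0 = (%_. x)" by (simp add: u_def)
 have ug: "good (u m)" for m
 proof (induction m)
  case 0
  show ?case using x \<rho> by (auto simp: u0 good_def ccube_def topspace_Euclidean_space)
 qed (auto simp: uS Pgood)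
 have ud: "abs (u (Suc m) t i - u m t i) <= \<rho>/2 ^ m" if "i<n" "t : {-T..T}" for m i t
  using that
 proof (induction m arbitrary: i t)
  case 0
  have "u (Suc 0) t : ccube n x \<rho>" using ug[of "Suc 0"] 0 unfolding good_def by blast
  thus ?case using 0 by (simp add: u0 ccube_def)
 next
  case (Suc m)
  have "abs (P (u (Suc m)) t i - P (u m) t i) <= (\<rho>/2 ^ m)/2"
   by (rule contr[OF ug ug Suc.prems Suc.IH])
  thus ?case unfolding uS[symmetric] by (simp add: mult.commute)
 qed
 have up: "abs (u (m + p) t i - u m t i) <= 2 * \<rho>/2 ^ m" if "i<n" "t : {-T..T}" for m p i t
 proof -
  have "abs (u (m + p) t i - u m t i) <= 2 * \<rho>/2 ^ m - 2 * \<rho>/2 ^ (m + p)"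
  proof (induction p)
   case (Suc p)
   have "abs (u (m + Suc p) t i - u m t i) <= abs (u (Suc (m + p)) t i - u (m + p) t i) + abs (u (m + p) t i - u m t i)" by simp
   also have "... <= \<rho>/2 ^ (m + p) + (2 * \<rho>/2 ^ m - 2 * \<rho>/2 ^ (m + p))"
    using ud[OF that, of "m + p"] Suc by (rule add_mono)
   also have "... = 2 * \<rho>/2 ^ m - 2 * \<rho>/2 ^ (m + Suc p)" by simp
   finally show ?case .
  qed auto
  moreover have "0 <= 2 * \<rho>/2 ^ (m + p)" using \<rho> by simp
  ultimately show ?thesis by linarith
 qed
 have lim0: "(%m. 2 * \<rho>/2 ^ m) \<longlonglongrightarrow> 0"
  using tendsto_mult[OF tendsto_const[of "2 * \<rho>"] LIMSEQ_power_zero[of "1/2::real"]] by (simp add: power_divide)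
 have l: "convergent (%m. u m t i)" if "i<n" "t : {-T..T}" for i t
 proof -
  have "Cauchy (%m. u m t i)"
  proof (rule metric_CauchyI)
   fix e :: real assume "e > 0"
   then obtain M where M: "!!m. m >= M ==> 2 * \<rho>/2 ^ m<e/2"
    using order_tendstoD(2)[OF lim0, of "e/2"] unfolding eventually_sequentially by auto
   have "dist (u m t i) (u k t i)<e" if mk: "m >= M" "k >= M" for m k
   proof -
    have "abs (u m t i - u M t i)<e/2" "abs (u k t i - u M t i)<e/2"
     using up[OF \<open>i<n\<close> \<open>t : {-T..T}\<close>, of M "m - M"] up[OF \<open>i<n\<close> \<open>t : {-T..T}\<close>, of M "k - M"] M[of M] mk by auto
    thus ?thesis unfolding dist_real_def by linarith
   qed
   thus "EX M. ALL m>=M. ALL k>=M. dist (u m t i) (u k t i)<e" by blast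
  qed
  thus ?thesis by (rule Cauchy_convergent)
 qed
 define cu where "cu t i = (if i<n then lim (%m. u m t i) else 0)" for t i
 have cul: "(%m. u m t i) \<longlonglongrightarrow> cu t i" if "i<n" "t : {-T..T}" for i t using l[OF that] that by (simp add: cu_def convergent_LIMSEQ_iff)
 have err: "abs (cu t i - u m t i) <= 2 * \<rho>/2 ^ m" if "i<n" "t : {-T..T}" for m t i
 proof -
  have "(%p. abs (u (m + p) t i - u m t i)) \<longlonglongrightarrow> abs (cu t i - u m t i)"
   using LIMSEQ_ignore_initial_segment[OF cul[OF that], of m] by (intro tendsto_intros) (simp add: add.commute)
  thus ?thesis by (rule LIMSEQ_le_const2) (use up[OF that] in auto)
 qed
 have cug: "good cu" unfolding good_def
 proof (intro conjI allI impI ballI)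
  fix i assume i: "i<n"
  have "abs (cu t i - cu s i) <= K * abs (t - s)" if st: "s : {-T..T}" "t : {-T..T}" for s t
  proof -
   have "(%m. abs (u (Suc m) t i - u (Suc m) s i)) \<longlonglongrightarrow> abs (cu t i - cu s i)"
    using cul[OF i st(2)] cul[OF i st(1)] by (intro tendsto_intros LIMSEQ_Suc)
   thus ?thesis by (rule LIMSEQ_le_const2) (use Plip[OF ug i st] in \<open>auto simp: uS\<close>)
  qed
  thus "continuous_on {-T..T} (%s. cu s i)"
   by (intro lipschitz_on_continuous_on[of K] lipschitz_onI) (use T in \<open>auto simp: dist_real_def\<close>)
 next
  fix s assume s: "s : {-T..T}"
  have "abs (cu s i - x i) <= \<rho>" if i: "i<n" for i
  proof -
   have "(%m. abs (u m s i - x i)) \<longlonglongrightarrow> abs (cu s i - x i)" using cul[OF i s] by (intro tendsto_intros)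
   thus ?thesis by (rule LIMSEQ_le_const2) (use ug s i in \<open>auto simp: good_def ccube_def\<close>)
  qed
  thus "cu s : ccube n x \<rho>" by (auto simp: ccube_def cu_def)
 qed
 have fix_: "cu t i = P cu t i" if "i<n" "t : {-T..T}" for t i
 proof -
  have "abs (P cu t i - cu t i) <= 2*(2 * \<rho>/2 ^ m)" for m
  proof -
   define r where "r = 2 * \<rho>/2 ^ m"
   have "abs (P cu t i - P (u m) t i) <= (2 * \<rho>/2 ^ m)/2" by (rule contr[OF cug ug that err])
   moreover have "abs (cu t i - P (u m) t i) <= 2 * \<rho>/2 ^ Suc m" using err[OF that, of "Suc m"] by (simp add: uS)
   moreover have "2 * \<rho>/2 ^ Suc m <= r" "0 <= r" using \<rho> by (auto simp: field_simps r_def)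
   ultimately show ?thesis unfolding r_def[symmetric] by linarith
  qed
  moreover have "(%m. 2*(2 * \<rho>/2 ^ m)) \<longlonglongrightarrow> 2*0" by (intro tendsto_mult tendsto_const lim0)
  ultimately have "abs (P cu t i - cu t i) <= 2*0" by (intro LIMSEQ_le_const) auto
  thus ?thesis by simp
 qed
 show ?thesis
 proof (rule that[of cu])
  show "cu 0 = x"
  proof
   fix i show "cu 0 i = x i"
    using fix_[OF _ T0, of i] P0[of cu] x by (cases "i<n") (auto simp: cu_def topspace_Euclidean_space)
  qed
  show "cu t : ccube n x \<rho>" if "t : {-T..T}" for t using cug that unfolding good_def by blast
  show "((%s. cu s i) has_real_derivative F (cu t) i) (at t within {-T..T})" if "t : {-T..T}" "i<n" for t i
   by (rule has_field_derivative_transform_within[where d=1, OF PD[OF cug that(2,1)] _ that(1)]) (use fix_ that in auto)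
 qed
qed

lemma C1_local_bounds:
 fixes N :: nat
 assumes U: "openE n U" and x0: "x0 : U"
  and w: "!!j i. j<N ==> i<n ==> pd n U (w j i) (w' j i)"
 obtains e K L where "0<e" "0 <= K" "0 <= L" "cube n x0 e \<subseteq> U"
  "!!j i y. j<N ==> i<n ==> y : cube n x0 e ==> abs (w j i y) <= K"
  "!!j i m y. j<N ==> i<n ==> m<n ==> y : cube n x0 e ==> abs (w' j i m y) <= L"
  "!!j i y z. j<N ==> i<n ==> y : cube n x0 e ==> z : cube n x0 e ==>
   abs (w j i y - w j i z) <= L*(\<Sum>k<n. abs (y k - z k))"
proof -
 define Q where "Q f e \<longleftrightarrow> cube n x0 e \<subseteq> U & (ALL y:cube n x0 e. abs (f y - f x0)<(1::real))" for f and e :: real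
 have mono: "Q f e'" if "Q f e" "0<e'" "e' <= e" for f e e'
  using that cube_mono[of e' e n x0] unfolding Q_def by blast
 have ex: "EX e>0. Q f e" if "continuous_on U f" for f :: "rn => real"
 proof (rule continuous_on_cube_bound[where eps=1, OF that U x0])
  show "0<(1::real)" by simp
 next
  fix d :: real
  assume "0<d" "cube n x0 d \<subseteq> U" "!!y. y : cube n x0 d ==> abs (f y - f x0)<1"
  thus ?thesis unfolding Q_def by blast
 qed
 have "EX e>0. ALL j<N. ALL i<n. Q (w j i) e & (ALL m<n. Q (w' j i m) e)"
 proof (rule ex_common_pos)
  fix j assume j: "j<N"
  show "EX e>0. ALL i<n. Q (w j i) e & (ALL m<n. Q (w' j i m) e)"
  proof (rule ex_common_pos)
   fix i assume i: "i<n"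
   have c: "continuous_on U (w j i)" "!!m. m<n ==> continuous_on U (w' j i m)"
    using w[OF j i] unfolding pd_def by auto
   have "EX e>0. ALL m<n. Q (w' j i m) e"
    by (rule ex_common_pos) (use ex c mono in auto)
   then obtain e1 where e1: "e1 > 0" "ALL m<n. Q (w' j i m) e1" by blast
   obtain e2 where e2: "e2 > 0" "Q (w j i) e2" using ex[OF c(1)] by blast
   show "EX e>0. Q (w j i) e & (ALL m<n. Q (w' j i m) e)"
    using e1 e2 mono[of _ e1 "min e1 e2"] mono[of _ e2 "min e1 e2"] by (intro exI[of _ "min e1 e2"]) auto
  qed (use mono in blast)
 qed (use mono in blast)
 then obtain e0 where e0: "e0 > 0" "!!j i. j<N ==> i<n ==> Q (w j i) e0"
  "!!j i m. j<N ==> i<n ==> m<n ==> Q (w' j i m) e0" by blast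
 obtain e3 where e3: "e3 > 0" "cube n x0 e3 \<subseteq> U" using open_cubeE[OF U x0] by blast
 define e where "e = min e0 e3"
 have e: "e > 0" "e <= e0" "cube n x0 e \<subseteq> U" using e0 e3 cube_mono[of e e3 n x0] by (auto simp: e_def)
 have Qe: "Q (w j i) e" "m<n ==> Q (w' j i m) e" if "j<N" "i<n" for j i m
  using e0(2,3) mono[OF _ e(1,2)] that by auto
 define K where "K = 1 + (\<Sum>j<N. \<Sum>i<n. abs (w j i x0))"
 define L where "L = 1 + (\<Sum>j<N. \<Sum>i<n. \<Sum>m<n. abs (w' j i m x0))"
 have K: "abs (w j i y) <= K" if "j<N" "i<n" "y : cube n x0 e" for j i y
 proof -
  have "abs (w j i x0) <= (\<Sum>i<n. abs (w j i x0))" using that by (intro member_le_sum) auto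
  also have "... <= (\<Sum>j<N. \<Sum>i<n. abs (w j i x0))" using that by (intro member_le_sum[of j "{..<N}" "%j. \<Sum>i<n. abs (w j i x0)"]) (auto intro: sum_nonneg)
  finally show ?thesis using Qe(1)[OF that(1,2)] that(3) unfolding Q_def K_def by force
 qed
 have L: "abs (w' j i m y) <= L" if "j<N" "i<n" "m<n" "y : cube n x0 e" for j i m y
 proof -
  have "abs (w' j i m x0) <= (\<Sum>m<n. abs (w' j i m x0))" using that by (intro member_le_sum) auto
  also have "... <= (\<Sum>i<n. \<Sum>m<n. abs (w' j i m x0))" using that by (intro member_le_sum[of i "{..<n}" "%i. \<Sum>m<n. abs (w' j i m x0)"]) (auto intro: sum_nonneg)
  also have "... <= (\<Sum>j<N. \<Sum>i<n. \<Sum>m<n. abs (w' j i m x0))" using that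
   by (intro member_le_sum[of j "{..<N}" "%j. \<Sum>i<n. \<Sum>m<n. abs (w' j i m x0)"]) (auto intro!: sum_nonneg)
  finally show ?thesis using Qe(2)[OF that(1,2,3)] that(4) unfolding Q_def L_def by force
 qed
 show ?thesis
 proof (rule that[OF e(1) _ _ e(3) K L])
  show "0 <= K" "0 <= L" by (auto simp: K_def L_def intro!: add_nonneg_nonneg sum_nonneg)
  fix j i y z assume ji: "j<N" "i<n" and y: "y : cube n x0 e" and z: "z : cube n x0 e"
  obtain \<xi> where \<xi>: "ALL m<n. \<xi> m : cube n x0 e" "w j i y - w j i z = (\<Sum>m<n. w' j i m (\<xi> m)*(y m - z m))"
   using pd_mvt_cube[OF w[OF ji] z y e(3)] by blast
  have "abs (w j i y - w j i z) <= (\<Sum>m<n. abs (w' j i m (\<xi> m)*(y m - z m)))" unfolding \<xi>(2) by (rule sum_abs)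
  also have "... <= (\<Sum>m<n. L * abs (y m - z m))"
   unfolding abs_mult using L ji \<xi>(1) by (intro sum_mono mult_right_mono) auto
  finally show "abs (w j i y - w j i z) <= L*(\<Sum>k<n. abs (y k - z k))" by (simp add: sum_distrib_left)
 qed
qed

lemma ccube_subset_cube:
 assumes "x : cube n x0 (e/2)" "0<e"
 shows "ccube n x (e/4) \<subseteq> cube n x0 e"
proof
 fix y assume y: "y : ccube n x (e/4)"
 have "abs (y i - x0 i)<e" if "i<n" for i
 proof -
  have "abs (y i - x i) <= e/4" "abs (x i - x0 i)<e/2" using y assms(1) that by (auto simp: ccube_def cube_def)
  thus ?thesis using assms(2) by linarith
 qed
 thus "y : cube n x0 e" using y by (auto simp: cube_def ccube_def)
qed

text \<open>A curve started in the half cube moves by at most e/4 up to time T, so one time serves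
  all these starting points. The time interval is opened to obtain two-sided derivatives.\<close>

lemma local_solution:
 fixes F :: "rn => nat => real"
 assumes e: "0<e" and K: "!!y i. y : cube n x0 e ==> i<n ==> abs (F y i) <= K"
  and Lip: "!!y z i. y : cube n x0 e ==> z : cube n x0 e ==> i<n ==> abs (F y i - F z i) <= L*(\<Sum>k<n. abs (y k - z k))"
  and T: "0<T" "0 <= K" "0 <= L" "K * T <= e/4" "n * L * T <= 1/2"
  and x: "x : cube n x0 (e/2)"
 obtains cu where "cu 0 = x" "!!t. abs t<T ==> cu t : cube n x0 e"
  "!!t i. abs t<T ==> i<n ==> ((%s. cu s i) has_real_derivative F (cu t) i) (at t)"
proof -
 note sub = ccube_subset_cube[OF x e]
 have xt: "x : spaceE n" using x cube_subset_topspace by blast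
 show ?thesis
 proof (rule Picard_local[OF xt _ _ _ T, of F])
  show "0 <= e/4" using e by simp
  show "abs (F y i) <= K" if "y : ccube n x (e/4)" "i<n" for y i using K sub that by blast
  show "abs (F y i - F z i) <= L*(\<Sum>k<n. abs (y k - z k))" if "y : ccube n x (e/4)" "z : ccube n x (e/4)" "i<n" for y z i
   using Lip sub that by blast
  fix cu assume g: "cu 0 = x" "!!t. t : {-T..T} ==> cu t : ccube n x (e/4)"
   "!!t i. t : {-T..T} ==> i<n ==> ((%s. cu s i) has_real_derivative F (cu t) i) (at t within {-T..T})"
  show thesis
  proof (rule that[where cu=cu, OF g(1)])
   show "cu t : cube n x0 e" if "abs t<T" for t using g(2)[of t] sub that by (auto simp: abs_less_iff)
   show "((%s. cu s i) has_real_derivative F (cu t) i) (at t)" if "abs t<T" "i<n" for t i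
   proof -
    have "t : interior {-T..T}" using that by (auto simp: abs_less_iff)
    thus ?thesis using g(3)[of t i] that at_within_interior[of t "{-T..T}"] interior_subset by fastforce
   qed
  qed
 qed
qed

text \<open>If the witnesses always agree with an operator \<open>Dp\<close>, it names the
  derivatives independently of the depth. \<open>mj_foldr\<close> then bounds arbitrary words in
  these operators.\<close>

lemma (in derivation_system) mj_operator:
 assumes D: "!!f G j x. der f G ==> j<q ==> x : V ==> G j x = Dp j f x"
  and f: "!!k. mj k \<phi> f"
 shows "der f (%j. Dp j f)" "!!j k. j<q ==> mj k (fps_deriv \<phi>) (Dp j f)"
proof -
 have ex: "EX G. der f G & (ALL j<q. mj k (fps_deriv \<phi>) (G j))" for k using f[of "Suc k"] by auto
 then obtain G where "der f G" by blast
 thus "der f (%j. Dp j f)" by (rule der_cong) (use D[OF \<open>der f G\<close>] in auto)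
 fix j k assume j: "j<q"
 obtain G where G: "der f G" "ALL j<q. mj k (fps_deriv \<phi>) (G j)" using ex by blast
 show "mj k (fps_deriv \<phi>) (Dp j f)"
  by (rule mj_cong[of _ _ "G j"]) (use G(2) j D[OF G(1) j] in auto)
qed

lemma (in derivation_system) mj_foldr:
 assumes D: "!!f G j x. der f G ==> j<q ==> x : V ==> G j x = Dp j f x"
  and f: "!!k. mj k \<phi> f"
 shows "v : lists {..<q} ==> mj k ((fps_deriv ^^ length v) \<phi>) (foldr Dp v f)"
proof (induction v arbitrary: k)
 case (Cons j v)
 have "mj k (fps_deriv ((fps_deriv ^^ length v) \<phi>)) (Dp j (foldr Dp v f))"
 proof (rule mj_operator(2)[where Dp=Dp])
  show "!!f G j x. der f G ==> j<q ==> x : V ==> G j x = Dp j f x" by (rule D)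
 qed (use Cons in auto)
 thus ?case by simp
qed (use f in auto)

definition XD :: "nat => (nat => nat => rn => real) => nat => (rn => real) => rn => real" where
 "XD n w j f x = (\<Sum>i<n. w j i x * partial i f x)"

lemma dw_XD: "dw n U w q f G ==> j<q ==> x : U ==> G j x = XD n w j f x"
proof -
 assume f: "dw n U w q f G" and j: "j<q" and x: "x : U"
 obtain P where P: "pd n U f P" "ALL j<q. ALL x:U. G j x = (\<Sum>i<n. w j i x * P i x)"
  using f unfolding dw_def by blast
 thus "G j x = XD n w j f x"
  unfolding XD_def using j x pd_partial[OF P(1) _ x] by simp
qed

lemma dw_words:
 assumes U: "openE n U" and f: "!!k. maj U q (dw n U w q) k (geom K R) f"
  and v: "v : lists {..<q}"
 shows "dw n U w q (foldr (XD n w) v f) (%j. foldr (XD n w) (j # v) f)"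
  "!!x. x : U ==> abs (foldr (XD n w) v f x) <= K * R ^ length v * fact (length v)"
proof -
 interpret ds: derivation_system U q "dw n U w q" by (rule derivation_dw[OF U])
 have m: "maj U q (dw n U w q) k ((fps_deriv ^^ length v) (geom K R)) (foldr (XD n w) v f)" for k
 proof (rule ds.mj_foldr[where Dp="XD n w"])
  show "!!f G j x. dw n U w q f G ==> j<q ==> x : U ==> G j x = XD n w j f x" by (rule dw_XD)
 qed (use f v in auto)
 have "dw n U w q (foldr (XD n w) v f) (%j. XD n w j (foldr (XD n w) v f))"
 proof (rule ds.mj_operator(1)[where Dp="XD n w"])
  show "!!f G j x. dw n U w q f G ==> j<q ==> x : U ==> G j x = XD n w j f x" by (rule dw_XD)
 qed (rule m)
 thus "dw n U w q (foldr (XD n w) v f) (%j. foldr (XD n w) (j # v) f)" by simp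
 show "abs (foldr (XD n w) v f x) <= K * R ^ length v * fact (length v)" if "x : U" for x
  using maj_bound[OF m that] by (simp add: deriv_geom_0 mult_ac)
qed

lemma l1_scale: "l1 n (%i. s * t i) = abs s * l1 n t"
 by (simp add: l1_def abs_mult sum_distrib_left)

subsection \<open>Power series solutions of linear equations along rays\<close>

text \<open>Monomials multiply by concatenation, so the product of two word series sums over the
  splittings of a word into prefix and suffix.\<close>

lemma WP_conv:
 "WP n (%w. \<Sum>j\<le>m. p (take j w) * q (drop j w)) m t = (\<Sum>j\<le>m. WP n p j t * WP n q (m - j) t)"
proof (induction m arbitrary: p)
 case (Suc m)
 have "WP n (%w. \<Sum>j\<le>Suc m. p (take j w) * q (drop j w)) (Suc m) t =
   (\<Sum>i<n. t i * WP n (%w. p [] * q (i # w) + (\<Sum>j\<le>m. p (i # take j w) * q (drop j w))) m t)"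
  by (simp add: sum.atMost_Suc_shift del: sum.atMost_Suc)
 also have "... = p [] * WP n q (Suc m) t + (\<Sum>i<n. t i*(\<Sum>j\<le>m. WP n (%w. p (i # w)) j t * WP n q (m - j) t))"
 proof -
  have IH: "WP n (%w. \<Sum>j\<le>m. p (i # take j w) * q (drop j w)) m t = (\<Sum>j\<le>m. WP n (%w. p (i # w)) j t * WP n q (m - j) t)" for i
   by (rule Suc.IH[of "%w. p (i # w)"])
  show ?thesis unfolding WP_add WP_cmult IH by (simp add: distrib_left sum.distrib sum_distrib_left mult.left_commute)
 qed
 also have "(\<Sum>i<n. t i*(\<Sum>j\<le>m. WP n (%w. p (i # w)) j t * WP n q (m - j) t)) =
   (\<Sum>j\<le>m. (\<Sum>i<n. t i * WP n (%w. p (i # w)) j t) * WP n q (m - j) t)"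
  unfolding sum_distrib_left sum_distrib_right by (subst sum.swap) (simp add: mult.assoc)
 finally show ?case by (simp add: sum.atMost_Suc_shift del: sum.atMost_Suc)
qed auto

text \<open>Word coefficients of the solution \<open>y\<close> of
 \<open>d/dr (r\<^sup>s y(rt)) = s r\<^sup>s\<^sup>-\<^sup>1 y(0) - r\<^sup>s \<Sum> t\<^sub>a C\<^sub>a(rt) y(rt)\<close>, for \<open>s : {0, 1}\<close>.\<close>

function ode_coeff :: "nat => nat => (nat => nat => nat => nat list => real) => (nat => real) => nat list => nat => real" where
 "ode_coeff N s C y0 [] k = y0 k"
| "ode_coeff N s C y0 (a # w) k = - (1 / real (length w + 1 + s)) *
   (\<Sum>b<N. \<Sum>j\<le>length w. C a b k (take j w) * ode_coeff N s C y0 (drop j w) b)"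
 by pat_completeness auto
termination by (relation "Wellfounded.measure (%(N, s, C, y0, w, k). length w)") auto

text \<open>The factor 1/(length w + 1 + s) cancels the number length w + 1 of splittings of w. What
  remains is N K per letter, so a rate Q above both R and N K is reproduced by the
  recursion.\<close>

lemma ode_coeff_bound:
 fixes K R Y Q :: real
 assumes C: "!!a b k w. a<n ==> b<N ==> k<N ==> w : lists {..<n} ==> abs (C a b k w) <= K * R ^ length w"
  and y0: "!!k. k<N ==> abs (y0 k) <= Y" and Q: "0 <= K" "0 <= R" "R <= Q" "N * K <= Q" "0 <= Y"
 shows "w : lists {..<n} ==> k<N ==> abs (ode_coeff N s C y0 w k) <= Y * Q ^ length w"
proof (induction "length w" arbitrary: w k rule: less_induct)
 case less
 show ?case
 proof (cases w)
  case (Cons a v)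
  have a: "a<n" and v: "v : lists {..<n}" using less.prems Cons by auto
  have Q0: "0 <= Q" using Q by linarith
  have "abs (C a b k (take j v) * ode_coeff N s C y0 (drop j v) b) <= K * Y * Q ^ length v" if "b<N" "j <= length v" for b j
  proof -
   have l: "take j v : lists {..<n}" "drop j v : lists {..<n}"
    using v set_take_subset[of j v] set_drop_subset[of j v] by (auto simp: lists_eq_set)
   have "abs (C a b k (take j v)) <= K * R ^ j" using C[OF a that(1) less.prems(2) l(1)] that(2) by simp
   also have "... <= K * Q ^ j" using Q by (intro mult_left_mono power_mono) auto
   finally have 1: "abs (C a b k (take j v)) <= K * Q ^ j" .
   have 2: "abs (ode_coeff N s C y0 (drop j v) b) <= Y * Q ^ (length v - j)"
    using less.hyps[of "drop j v" b] l(2) that Cons by simp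
   have "abs (C a b k (take j v) * ode_coeff N s C y0 (drop j v) b) <= (K * Q ^ j)*(Y * Q ^ (length v - j))"
    unfolding abs_mult by (rule mult_mono[OF 1 2]) (use Q Q0 in auto)
   also have "... = K * Y*(Q ^ j * Q ^ (length v - j))" by simp
   also have "Q ^ j * Q ^ (length v - j) = Q ^ length v" using that(2) by (simp add: power_add[symmetric])
   finally show ?thesis .
  qed
  hence "(\<Sum>b<N. \<Sum>j\<le>length v. abs (C a b k (take j v) * ode_coeff N s C y0 (drop j v) b)) <= (\<Sum>b<N. \<Sum>j\<le>length v. K * Y * Q ^ length v)"
   by (intro sum_mono) auto
  also have "... = (real (length v) + 1)*(N * K*(Y * Q ^ length v))" by simp
  finally have S: "abs (\<Sum>b<N. \<Sum>j\<le>length v. C a b k (take j v) * ode_coeff N s C y0 (drop j v) b) <= (real (length v) + 1)*(N * K*(Y * Q ^ length v))"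
   by (intro order_trans[OF sum_abs] order_trans[OF sum_mono[OF sum_abs]])
  have "abs (ode_coeff N s C y0 w k) = (1 / real (length v + 1 + s)) * abs (\<Sum>b<N. \<Sum>j\<le>length v. C a b k (take j v) * ode_coeff N s C y0 (drop j v) b)"
   unfolding Cons ode_coeff.simps abs_mult by simp
  also have "... <= (1 / real (length v + 1))*((real (length v) + 1)*(N * K*(Y * Q ^ length v)))"
   by (intro mult_mono S) (auto intro!: frac_le)
  also have "... = (N * K)*(Y * Q ^ length v)" by (simp add: field_simps)
  also have "... <= Q*(Y * Q ^ length v)" using Q Q0 by (intro mult_right_mono) auto
  finally show ?thesis by (simp add: Cons mult_ac)
 qed (use y0 less.prems in auto)
qed

text \<open>The recursion for words, collected by length. Splittings become a Cauchy product, which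
  is the recursion for power series in the ray parameter.\<close>

lemma WP_ode_coeff:
 assumes "k<N"
 shows "real (m + 1 + s) * WP n (%w. ode_coeff N s C y0 w k) (Suc m) t =
  - (\<Sum>b<N. \<Sum>j\<le>m. (\<Sum>a<n. t a * WP n (C a b k) j t) * WP n (%w. ode_coeff N s C y0 w b) (m - j) t)"
proof -
 let ?y = "ode_coeff N s C y0"
 have eq: "WP n (%w. ?y (a # w) k) m t = - (1 / real (m + 1 + s))*(\<Sum>b<N. \<Sum>j\<le>m. WP n (C a b k) j t * WP n (%w. ?y w b) (m - j) t)" for a
 proof -
  have "WP n (%w. ?y (a # w) k) m t = WP n (%w. - (1 / real (m + 1 + s))*(\<Sum>b<N. \<Sum>j\<le>m. C a b k (take j w) * ?y (drop j w) b)) m t"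
   by (rule WP_cong) simp
  also have "... = - (1 / real (m + 1 + s))*(\<Sum>b<N. WP n (%w. \<Sum>j\<le>m. C a b k (take j w) * ?y (drop j w) b) m t)"
   unfolding WP_cmult by (subst WP_sum) auto
  also have "(\<Sum>b<N. WP n (%w. \<Sum>j\<le>m. C a b k (take j w) * ?y (drop j w) b) m t) =
    (\<Sum>b<N. \<Sum>j\<le>m. WP n (C a b k) j t * WP n (%w. ?y w b) (m - j) t)"
   by (intro sum.cong refl WP_conv)
  finally show ?thesis .
 qed
 have "real (m + 1 + s) * WP n (%w. ?y w k) (Suc m) t =
   (\<Sum>a<n. t a*(real (m + 1 + s) * WP n (%w. ?y (a # w) k) m t))"
  unfolding WP.simps by (simp only: sum_distrib_left mult.left_commute)
 also have "... = (\<Sum>a<n. t a * - (\<Sum>b<N. \<Sum>j\<le>m. WP n (C a b k) j t * WP n (%w. ?y w b) (m - j) t))"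
  unfolding eq by (intro sum.cong refl) (simp add: field_simps)
 also have "... = - (\<Sum>a<n. \<Sum>b<N. \<Sum>j\<le>m. t a * WP n (C a b k) j t * WP n (%w. ?y w b) (m - j) t)"
  by (simp add: sum_negf sum_distrib_left mult.assoc)
 also have "(\<Sum>a<n. \<Sum>b<N. \<Sum>j\<le>m. t a * WP n (C a b k) j t * WP n (%w. ?y w b) (m - j) t) =
   (\<Sum>b<N. \<Sum>j\<le>m. \<Sum>a<n. t a * WP n (C a b k) j t * WP n (%w. ?y w b) (m - j) t)"
  by (rule trans[OF sum.swap]) (intro sum.cong[OF refl] sum.swap)
 finally show ?thesis by (simp add: sum_distrib_right)
qed

lemma power_series_linear_ode:
 fixes \<zeta> :: "nat => nat => real" and \<Gamma> :: "nat => nat => nat => real"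
 assumes q: "0<q" "q<1" and \<zeta>: "!!k m. k<N ==> abs (\<zeta> k m) <= A * q ^ m"
  and \<Gamma>: "!!k b m. k<N ==> b<N ==> abs (\<Gamma> k b m) <= B * q ^ m"
  and rec: "!!k m. k<N ==> real (Suc m) * \<zeta> k (Suc m) = (if m = 0 then e k else 0) - (\<Sum>b<N. \<Sum>j\<le>m. \<Gamma> k b j * \<zeta> b (m - j))"
  and k: "k<N" and r: "abs r <= 1"
 shows "((%r. suminf (%m. \<zeta> k m * r ^ m)) has_real_derivative
   e k - (\<Sum>b<N. (suminf (%m. \<Gamma> k b m * r ^ m))*(suminf (%m. \<zeta> b m * r ^ m)))) (at r)"
proof -
 \<comment> \<open>A radius strictly beyond 1 allows termwise differentiation also at |r| =
   1.\<close>
 obtain \<kappa> where \<kappa>: "1<\<kappa>" "\<kappa> * q<1"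
 proof -
  have "1<1 / q" using q by simp
  then obtain \<kappa> where "1<\<kappa>" "\<kappa><1 / q" using dense by blast
  thus ?thesis using that[of \<kappa>] q by (simp add: field_simps)
 qed
 have sm: "summable (%m. norm (f m * x ^ m))" if f: "!!m. abs (f m) <= D * q ^ m" and x: "abs x <= \<kappa>" for f :: "nat => real" and D x
 proof (rule summable_comparison_test')
  have D: "0 <= D" using f[of 0] by simp
  show "norm (norm (f m * x ^ m)) <= D*(\<kappa> * q) ^ m" for m
  proof -
   have "abs (f m) * abs x ^ m <= (D * q ^ m) * \<kappa> ^ m"
    using f x D q by (intro mult_mono power_mono) auto
   thus ?thesis by (simp add: abs_mult power_abs power_mult_distrib mult_ac)
  qed
  show "summable (%m. D*(\<kappa> * q) ^ m)" using \<kappa> q by (intro summable_mult summable_geometric) auto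
 qed
 have r\<kappa>: "abs r <= \<kappa>" using r \<kappa> by linarith
 have s\<zeta>: "summable (%m. \<zeta> b m * \<kappa> ^ m)" if "b<N" for b
  using sm[OF \<zeta>[OF that], of \<kappa>] \<kappa> summable_norm_cancel by force
 have "((%r. suminf (%m. \<zeta> k m * r ^ m)) has_real_derivative (suminf (%m. diffs (\<zeta> k) m * r ^ m))) (at r)"
  by (rule termdiffs_strong[OF s\<zeta>[OF k]]) (use r \<kappa> in auto)
 moreover have "(%m. diffs (\<zeta> k) m * r ^ m) sums (e k - (\<Sum>b<N. (suminf (%m. \<Gamma> k b m * r ^ m))*(suminf (%m. \<zeta> b m * r ^ m))))"
 proof -
  have "(%m. \<Sum>j\<le>m. (\<Gamma> k b j * r ^ j)*(\<zeta> b (m - j) * r ^ (m - j))) sums ((suminf (%m. \<Gamma> k b m * r ^ m))*(suminf (%m. \<zeta> b m * r ^ m)))"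
   if "b<N" for b
   by (rule Cauchy_product_sums[OF sm[OF \<Gamma>[OF k that] r\<kappa>] sm[OF \<zeta>[OF that] r\<kappa>]])
  moreover have "(\<Sum>j\<le>m. (\<Gamma> k b j * r ^ j)*(\<zeta> b (m - j) * r ^ (m - j))) = (\<Sum>j\<le>m. \<Gamma> k b j * \<zeta> b (m - j)) * r ^ m" for b m
   unfolding sum_distrib_right
  proof (rule sum.cong[OF refl])
   fix j assume "j : {..m}"
   hence "r ^ m = r ^ j * r ^ (m - j)" by (simp add: power_add[symmetric])
   thus "\<Gamma> k b j * r ^ j*(\<zeta> b (m - j) * r ^ (m - j)) = \<Gamma> k b j * \<zeta> b (m - j) * r ^ m" by simp
  qed
  ultimately have "(%m. \<Sum>b<N. (\<Sum>j\<le>m. \<Gamma> k b j * \<zeta> b (m - j)) * r ^ m) sums (\<Sum>b<N. (suminf (%m. \<Gamma> k b m * r ^ m))*(suminf (%m. \<zeta> b m * r ^ m)))"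
   by (intro sums_sum) auto
  moreover have "(%m. (if m = 0 then e k else 0) * r ^ m) sums (e k)"
  proof -
   have "(%m. (if m = 0 then e k else 0) * r ^ m) = (%m. if m = 0 then e k else 0)" by auto
   thus ?thesis using sums_single[of 0 "%_. e k"] by simp
  qed
  ultimately have "(%m. (if m = 0 then e k else 0) * r ^ m - (\<Sum>b<N. (\<Sum>j\<le>m. \<Gamma> k b j * \<zeta> b (m - j)) * r ^ m)) sums
    (e k - (\<Sum>b<N. (suminf (%m. \<Gamma> k b m * r ^ m))*(suminf (%m. \<zeta> b m * r ^ m))))"
   by (rule sums_diff[rotated])
  moreover have "(if m = 0 then e k else 0) * r ^ m - (\<Sum>b<N. (\<Sum>j\<le>m. \<Gamma> k b j * \<zeta> b (m - j)) * r ^ m) = diffs (\<zeta> k) m * r ^ m" for m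
   unfolding diffs_def using rec[OF k, of m] by (simp add: sum_distrib_right[symmetric] left_diff_distrib[symmetric] del: of_nat_Suc)
  ultimately show ?thesis by simp
 qed
 ultimately show ?thesis by (simp add: sums_iff)
qed

text \<open>The curve is compact: parameters of a violating sequence accumulate at some l, and there
  continuity of f is contradicted.\<close>

lemma uniform_near_curve:
 fixes f :: "rn => real" and cu :: "real => rn"
 assumes U: "openE n U" and f: "continuous_on U f"
  and cu: "!!r. r : {a..b} ==> cu r : U" "!!i. i<n ==> continuous_on {a..b} (%r. cu r i)" and \<eta>: "\<eta> > 0"
 shows "EX d>0. ALL r:{a..b}. ALL \<xi>:U. (ALL i<n. abs (\<xi> i - cu r i)<d) --> abs (f \<xi> - f (cu r)) <= \<eta>"
proof (rule ccontr)
 assume "\<not> ?thesis"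
 hence "ALL m. EX r \<xi>. r : {a..b} & \<xi> : U & (ALL i<n. abs (\<xi> i - cu r i)<1 / real (Suc m)) & abs (f \<xi> - f (cu r)) > \<eta>"
  by (metis not_less zero_less_divide_1_iff of_nat_0_less_iff zero_less_Suc)
 then obtain r \<xi> where r: "!!m. r m : {a..b}" and \<xi>: "!!m. \<xi> m : U"
  "!!m i. i<n ==> abs (\<xi> m i - cu (r m) i)<1 / real (Suc m)" "!!m. abs (f (\<xi> m) - f (cu (r m))) > \<eta>" by metis
 have "seq_compact {a..b}" using compact_imp_seq_compact compact_Icc by blast
 then obtain l \<sigma> where l: "l : {a..b}" "strict_mono \<sigma>" "(r o \<sigma>) \<longlonglongrightarrow> l"
  using r unfolding seq_compact_def by blast
 define y where "y = cu l"
 have yU: "y : U" using cu(1) l by (simp add: y_def)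
 obtain d where d: "d > 0" "cube n y d \<subseteq> U" "!!z. z : cube n y d ==> abs (f z - f y)<\<eta>/2"
  using continuous_on_cube_bound[OF f U yU, of "\<eta>/2"] \<eta> by auto
 have top: "z : spaceE n" if "z : U" for z using that openin_subset[OF U] by auto
 have c1: "(%m. cu (r (\<sigma> m)) i) \<longlonglongrightarrow> y i" if "i<n" for i
  using cu(2)[OF that] l r unfolding continuous_on_sequentially y_def by (auto simp: comp_def)
 have "eventually (%m. cu (r (\<sigma> m)) : cube n y d) sequentially"
  by (rule eventually_in_cube[OF c1 _ d(1)]) (auto intro!: always_eventually top[OF cu(1)[OF r]])
 moreover have c2: "(%m. \<xi> (\<sigma> m) i) \<longlonglongrightarrow> y i" if "i<n" for i
 proof -
  have "(%m. 1 / real (Suc (\<sigma> m))) \<longlonglongrightarrow> 0"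
   using LIMSEQ_subseq_LIMSEQ[OF LIMSEQ_Suc[OF lim_1_over_n] l(2)] by (simp add: comp_def)
  hence "(%m. \<xi> (\<sigma> m) i - cu (r (\<sigma> m)) i) \<longlonglongrightarrow> 0"
   by (rule Lim_null_comparison[rotated]) (use \<xi>(2)[OF that] in \<open>auto intro!: always_eventually less_imp_le simp del: of_nat_Suc\<close>)
  from tendsto_add[OF this c1[OF that]] show ?thesis by simp
 qed
 have "eventually (%m. \<xi> (\<sigma> m) : cube n y d) sequentially"
  by (rule eventually_in_cube[OF c2 _ d(1)]) (auto intro!: always_eventually top[OF \<xi>(1)])
 ultimately have "eventually (%m. False) sequentially"
 proof eventually_elim
  case (elim m)
  show ?case using d(3)[OF elim(1)] d(3)[OF elim(2)] \<xi>(3)[of "\<sigma> m"] by linarith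
 qed
 thus False by simp
qed

lemma deriv_from_estimate:
 fixes f :: "real => real"
 assumes "!!eps. eps > 0 ==> EX d>0. ALL h. abs h<d --> abs (f (x + h) - f x - h * D) <= eps * abs h"
 shows "(f has_real_derivative D) (at x)"
 unfolding DERIV_def LIM_eq
proof (intro allI impI)
 fix eps :: real assume "0<eps"
 then obtain d where d: "d > 0" "!!h. abs h<d ==> abs (f (x + h) - f x - h * D) <= eps/2 * abs h" using assms[of "eps/2"] by auto
 have "norm ((f (x + h) - f x) / h - D)<eps" if "h ~= 0" "norm (h - 0)<d" for h
 proof -
  have "abs ((f (x + h) - f x) / h - D) = abs (f (x + h) - f x - h * D) / abs h"
   using that by (simp add: abs_divide[symmetric] diff_divide_distrib)
  also have "... <= eps/2" using d(2)[of h] that by (simp add: divide_le_eq)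
  finally show ?thesis using \<open>0<eps\<close> by simp
 qed
 thus "EX s>0. ALL h. h ~= 0 & norm (h - 0)<s --> norm ((f (x + h) - f x) / h - D)<eps" using d(1) by blast
qed

text \<open>The left side is the derivative along a ray of one component of the combination of the
  fields with coefficients z, by the product rule. The equation of z is made such that the bracket
  terms cancel; what is left is the flow equation linearised along the ray.\<close>

lemma bracket_algebra:
 fixes z e t V :: "nat => real"
 assumes br: "!!a l. a<n ==> l<N ==> (\<Sum>m<n. W a m * D l m - W l m * D a m) = (\<Sum>k<N. c a l k * V k)"
 shows "(\<Sum>l<N. (e l - (\<Sum>b<N. (\<Sum>a<n. t a * c a b l) * z b)) * V l + z l*(\<Sum>m<n. D l m*(\<Sum>a<n. t a * W a m)))
  = (\<Sum>l<N. e l * V l) + (\<Sum>a<n. t a*(\<Sum>m<n. D a m*(\<Sum>l<N. z l * W l m)))"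
proof -
 have S2: "(\<Sum>l<N. z l*(\<Sum>m<n. D l m*(\<Sum>a<n. t a * W a m))) = (\<Sum>a<n. \<Sum>l<N. t a * z l*(\<Sum>m<n. W a m * D l m))"
 proof -
  have "z l*(\<Sum>m<n. D l m*(\<Sum>a<n. t a * W a m)) = (\<Sum>a<n. t a * z l*(\<Sum>m<n. W a m * D l m))" for l
   unfolding sum_distrib_left by (rule trans[OF sum.swap]) (simp add: mult_ac)
  thus ?thesis by (simp only:) (rule sum.swap)
 qed
 have S3: "(\<Sum>a<n. t a*(\<Sum>m<n. D a m*(\<Sum>l<N. z l * W l m))) = (\<Sum>a<n. \<Sum>l<N. t a * z l*(\<Sum>m<n. W l m * D a m))"
 proof -
  have "t a*(\<Sum>m<n. D a m*(\<Sum>l<N. z l * W l m)) = (\<Sum>l<N. t a * z l*(\<Sum>m<n. W l m * D a m))" for a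
   unfolding sum_distrib_left by (rule trans[OF sum.swap]) (simp add: mult_ac)
  thus ?thesis by simp
 qed
 have S1: "(\<Sum>l<N. (\<Sum>b<N. (\<Sum>a<n. t a * c a b l) * z b) * V l) = (\<Sum>a<n. \<Sum>b<N. t a * z b*(\<Sum>l<N. c a b l * V l))"
 proof -
  have "(\<Sum>l<N. (\<Sum>b<N. (\<Sum>a<n. t a * c a b l) * z b) * V l) = (\<Sum>l<N. \<Sum>b<N. \<Sum>a<n. t a * z b*(c a b l * V l))"
   by (simp add: sum_distrib_left sum_distrib_right mult_ac)
  also have "... = (\<Sum>b<N. \<Sum>l<N. \<Sum>a<n. t a * z b*(c a b l * V l))" by (rule sum.swap)
  also have "... = (\<Sum>b<N. \<Sum>a<n. \<Sum>l<N. t a * z b*(c a b l * V l))" by (intro sum.cong refl sum.swap)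
  also have "... = (\<Sum>a<n. \<Sum>b<N. \<Sum>l<N. t a * z b*(c a b l * V l))" by (rule sum.swap)
  finally show ?thesis by (simp add: sum_distrib_left)
 qed
 have "(\<Sum>a<n. \<Sum>l<N. t a * z l*(\<Sum>m<n. W a m * D l m)) - (\<Sum>a<n. \<Sum>l<N. t a * z l*(\<Sum>m<n. W l m * D a m)) =
   (\<Sum>a<n. \<Sum>l<N. t a * z l*(\<Sum>m<n. W a m * D l m - W l m * D a m))"
  by (simp add: sum_subtractf right_diff_distrib)
 also have "... = (\<Sum>a<n. \<Sum>b<N. t a * z b*(\<Sum>l<N. c a b l * V l))"
  by (intro sum.cong refl) (simp add: br)
 finally have "(\<Sum>l<N. z l*(\<Sum>m<n. D l m*(\<Sum>a<n. t a * W a m))) - (\<Sum>a<n. t a*(\<Sum>m<n. D a m*(\<Sum>l<N. z l * W l m)))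
   = (\<Sum>l<N. (\<Sum>b<N. (\<Sum>a<n. t a * c a b l) * z b) * V l)" unfolding S1 S2 S3 .
 thus ?thesis by (simp add: sum.distrib left_diff_distrib sum_subtractf)
qed

subsection \<open>The exponential map\<close>

locale exp_map =
 fixes n N :: nat and w :: "nat => nat => rn => real" and w' :: "nat => nat => nat => rn => real"
  and x0 :: rn and e K L :: real
 assumes nN: "n <= N" and x0: "x0 : spaceE n" and e: "0<e" and K: "0 <= K" and L: "0 <= L"
  and pdw: "!!j i. j<N ==> i<n ==> pd n (cube n x0 e) (w j i) (w' j i)"
  and wK: "!!j i y. j<N ==> i<n ==> y : cube n x0 e ==> abs (w j i y) <= K"
  and w'L: "!!j i m y. j<N ==> i<n ==> m<n ==> y : cube n x0 e ==> abs (w' j i m y) <= L"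
  and wL: "!!j i y z. j<N ==> i<n ==> y : cube n x0 e ==> z : cube n x0 e ==>
   abs (w j i y - w j i z) <= L*(\<Sum>k<n. abs (y k - z k))"
begin

abbreviation "U \<equiv> cube n x0 e"

lemma openU: "openE n U" by (rule openin_cube)

lemma x0U: "x0 : U" using cube_center x0 e by blast

lemma Utop: "y : U ==> y : spaceE n" using cube_subset_topspace by blast

text \<open>The field with parameter t has size and Lipschitz bounds K and L multiplied by the l1
  norm of t. The two terms are the conditions of \<open>local_solution\<close> for the time 2; the
  summands 1 avoid division by 0.\<close>

definition \<tau>0 :: real where "\<tau>0 = min (e/(8*(K + 1))) (1/(4*(n + 1)*(L + 1)))"

definition F :: "rn => rn => nat => real" where "F t y i = (\<Sum>a<n. t a * w a i y)"

lemma \<tau>0_pos: "0<\<tau>0" using e K L by (simp add: \<tau>0_def)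

lemma small_time:
 assumes "l1 n t<\<tau>0"
 shows "(l1 n t * K)*2 <= e/4" "n*(l1 n t * L)*2 <= 1/2"
proof -
 have "l1 n t <= e/(8*(K + 1))" using assms by (simp add: \<tau>0_def)
 hence "l1 n t*(8*(K + 1)) <= e" using K by (simp add: field_simps)
 thus "(l1 n t * K)*2 <= e/4" using l1_nonneg[of n t] by (simp add: algebra_simps)
 have "l1 n t <= 1/(4*(n + 1)*(L + 1))" using assms by (simp add: \<tau>0_def)
 moreover have "0<4*(n + 1)*(L + 1)" using L by simp
 ultimately have "l1 n t*(4*(n + 1)*(L + 1)) <= 1" by (simp only: pos_le_divide_eq)
 moreover have "l1 n t*(4 * n * L) <= l1 n t*(4*(n + 1)*(L + 1))"
  using L by (intro mult_left_mono l1_nonneg mult_mono) auto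
 ultimately show "n*(l1 n t * L)*2 <= 1/2" by (simp add: algebra_simps)
qed

lemma F_bound: "y : U ==> i<n ==> abs (F t y i) <= l1 n t * K"
proof -
 assume y: "y : U" "i<n"
 have "abs (F t y i) <= (\<Sum>a<n. abs (t a) * K)"
  unfolding F_def using wK y nN by (intro order_trans[OF sum_abs] sum_mono) (auto simp: abs_mult intro!: mult_left_mono)
 thus ?thesis by (simp add: l1_def sum_distrib_right)
qed

lemma F_Lip: "y : U ==> z : U ==> i<n ==> abs (F t y i - F t z i) <= (l1 n t * L)*(\<Sum>k<n. abs (y k - z k))"
proof -
 assume y: "y : U" "z : U" "i<n"
 have "abs (F t y i - F t z i) = abs (\<Sum>a<n. t a*(w a i y - w a i z))" by (simp add: F_def sum_subtractf right_diff_distrib)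
 also have "... <= (\<Sum>a<n. abs (t a)*(L*(\<Sum>k<n. abs (y k - z k))))"
  using wL y nN by (intro order_trans[OF sum_abs] sum_mono) (auto simp: abs_mult intro!: mult_left_mono)
 finally show ?thesis by (simp add: l1_def sum_distrib_right mult.assoc)
qed

text \<open>Time extends beyond 1 so that the curve has two-sided derivatives on all of
  [0, 1].\<close>

definition is_sol :: "rn => (real => rn) => bool" where
 "is_sol t g \<longleftrightarrow> g 0 = x0 & (ALL r. abs r<2 --> g r : U) &
   (ALL r i. abs r<2 --> i<n --> ((%s. g s i) has_real_derivative F t (g r) i) (at r))"

definition cu :: "rn => real => rn" where "cu t = (SOME g. is_sol t g)"

lemma cu_sol:
 assumes "l1 n t<\<tau>0"
 shows "is_sol t (cu t)"
proof -
 have "EX g. is_sol t g"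
 proof (rule local_solution[of e n x0 "F t" "l1 n t * K" "l1 n t * L" 2 x0])
  show "x0 : cube n x0 (e/2)" using cube_center x0 e by auto
  fix g :: "real => rn"
  assume "g 0 = x0" "!!t. abs t<2 ==> g t : U"
   "!!r i. abs r<2 ==> i<n ==> ((%s. g s i) has_real_derivative F t (g r) i) (at r)"
  hence "is_sol t g" by (auto simp: is_sol_def)
  thus ?thesis by blast
 qed (use e F_bound F_Lip small_time[OF assms] K L l1_nonneg in auto)
 thus ?thesis unfolding cu_def by (rule someI_ex)
qed

lemma
 assumes "l1 n t<\<tau>0"
 shows cu_0: "cu t 0 = x0" and cu_U: "abs r<2 ==> cu t r : U"
  and cu_deriv: "abs r<2 ==> i<n ==> ((%s. cu t s i) has_real_derivative F t (cu t r) i) (at r)"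
 using cu_sol[OF assms] unfolding is_sol_def by auto

text \<open>Gronwall, with the field of t' regarded as a perturbation of the field of t. Equal
  parameters give uniqueness, different ones the Lipschitz dependence on the parameter.\<close>

lemma cu_Lipschitz:
 assumes t: "l1 n t<\<tau>0"
  and \<eta>: "\<eta> 0 = x0" "!!r. r : {0..1} ==> \<eta> r : U"
   "!!r i. r : {0..1} ==> i<n ==> ((%s. \<eta> s i) has_real_derivative F t' (\<eta> r) i) (at r within {0..1})"
  and r: "r : {0..1}" and i: "i<n"
 shows "abs (\<eta> r i - cu t r i) <= 2*(l1 n (%j. t' j - t j) * K)"
proof -
 have "abs (\<eta> r i - cu t r i) <= 2*(l1 n (%j. t' j - t j) * K)*(1 - 0)"
 proof (rule small_Gronwall[where \<delta>="%r i. \<eta> r i - cu t r i" and n=n and L="l1 n t * L" and ?s0.0=0])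
  show "((%r. \<eta> r i - cu t r i) has_real_derivative F t' (\<eta> s) i - F t (cu t s) i) (at s within {0..1})"
   if "i<n" "s : {0..1}" for i s
   using that by (intro DERIV_diff \<eta>(3) has_field_derivative_at_within[OF cu_deriv[OF t]]) auto
  fix i s assume i: "i<n" and s: "s : {0..(1::real)}"
  have g: "cu t s : U" using cu_U[OF t] s by auto
  have "F t' (\<eta> s) i - F t (\<eta> s) i = F (%j. t' j - t j) (\<eta> s) i"
   by (simp add: F_def sum_subtractf left_diff_distrib)
  hence "abs (F t' (\<eta> s) i - F t (\<eta> s) i) <= l1 n (%j. t' j - t j) * K" using F_bound[OF \<eta>(2)[OF s] i] by simp
  thus "abs (F t' (\<eta> s) i - F t (cu t s) i) <= l1 n t * L*(\<Sum>k<n. abs (\<eta> s k - cu t s k)) + l1 n (%j. t' j - t j) * K"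
   using F_Lip[OF \<eta>(2)[OF s] g i, of t] by linarith
 next
  have "n*(l1 n t * L)*2 <= 1/2" by (rule small_time(2)[OF t])
  moreover have "x*(1 - 0) <= 1/2" if "x*2 <= 1/2" "0 <= x" for x :: real using that by simp
  moreover have "0 <= n*(l1 n t * L)" using L l1_nonneg by simp
  ultimately show "n*(l1 n t * L)*(1 - 0) <= 1/2" by blast
 qed (use \<eta>(1) cu_0[OF t] r i L K l1_nonneg in auto)
 thus ?thesis by simp
qed

definition \<Phi> :: "rn => rn" where "\<Phi> t = cu t 1"

lemma \<Phi>_U: "l1 n t<\<tau>0 ==> \<Phi> t : U"
 unfolding \<Phi>_def by (rule cu_U) auto

text \<open>The curve of t run at speed s solves the equation with parameter s t, and uniqueness
  identifies the two. So the values of \<open>\<Phi>\<close> on a ray trace a single solution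
  curve.\<close>

lemma \<Phi>_ray:
 assumes t: "l1 n t<\<tau>0" and s: "0 <= s" "s <= 1"
 shows "\<Phi> (%i. s * t i) = cu t s"
proof -
 have st: "l1 n (%i. s * t i)<\<tau>0"
 proof -
  have "s * l1 n t <= 1 * l1 n t" using s l1_nonneg by (intro mult_right_mono) auto
  thus ?thesis using t s by (simp add: l1_scale)
 qed
 have sr: "abs (s * r)<2" if "r : {0..1}" for r
 proof -
  have "abs (s * r) <= 1*1" unfolding abs_mult using that s by (intro mult_mono) auto
  thus ?thesis by simp
 qed
 have eq: "cu t (s*1) i = cu (%i. s * t i) 1 i" if i: "i<n" for i
 proof -
  have "abs (cu t (s*1) i - cu (%i. s * t i) 1 i) <= 2*(l1 n (%j. s * t j - s * t j) * K)"
  proof (rule cu_Lipschitz[OF st, of "%r. cu t (s * r)"])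
   show "((%r. cu t (s * r) i) has_real_derivative F (%j. s * t j) (cu t (s * r)) i) (at r within {0..1})"
    if "r : {0..1}" "i<n" for r i
   proof -
    have "((%r. cu t (s * r) i) has_real_derivative F t (cu t (s * r)) i * s) (at r)"
     by (rule DERIV_chain2[where f="%s. cu t s i" and g="%r. s * r", OF cu_deriv[OF t sr[OF that(1)] that(2)]]) (auto intro!: derivative_eq_intros)
    moreover have "F t (cu t (s * r)) i * s = F (%j. s * t j) (cu t (s * r)) i"
     by (simp add: F_def sum_distrib_left mult_ac)
    ultimately show ?thesis using has_field_derivative_at_within by metis
   qed
   show "cu t (s * r) : U" if "r : {0..1}" for r by (rule cu_U[OF t sr[OF that]])
  qed (use cu_0[OF t] i in auto)
  thus ?thesis by (simp add: l1_def)
 qed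
 have "cu t s : spaceE n" "\<Phi> (%i. s * t i) : spaceE n"
  using Utop cu_U[OF t, of s] \<Phi>_U[OF st] s by auto
 thus ?thesis using eq by (auto simp: \<Phi>_def fun_eq_iff topspace_Euclidean_space not_less) (metis not_less)
qed

lemma \<Phi>_0: "\<Phi> (%_. 0) = x0"
proof -
 have "l1 n (%_. 0)<\<tau>0" using \<tau>0_pos by (simp add: l1_def)
 from \<Phi>_ray[OF this, of 0] cu_0[OF this] show ?thesis by simp
qed

lemma curve_in: "l1 n t<\<tau>0 ==> r : {0..1} ==> cu t r : U"
 by (rule cu_U) auto

lemma cu_chain:
 assumes t: "l1 n t<\<tau>0" and f: "pd n U f P" and r: "0 <= r" "r <= 1"
 shows "((%s. f (cu t s)) has_real_derivative (\<Sum>m<n. P m (cu t r) * F t (cu t r) m)) (at r)"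
proof (rule pd_chain_curve[where cu="cu t" and s=r, OF f openU])
 show "cu t r : U" using r by (intro cu_U[OF t]) auto
 show "((%s. cu t s i) has_real_derivative F t (cu t r) i) (at r)" if "i<n" for i
  using r that by (intro cu_deriv[OF t]) auto
 have "eventually (%s. s : {-2<..<2}) (at r)"
  using r by (intro eventually_at_in_open') auto
 thus "\<forall>\<^sub>F s in at r. cu t s : spaceE n"
  by eventually_elim (rule Utop[OF cu_U[OF t]], auto simp: abs_less_iff)
qed

definition tc :: "(rn => real) => nat list => real" where
 "tc f v = foldr (XD n w) v f x0 / fact (length v)"

lemma tc_bound:
 assumes "!!k. maj U N (dw n U w N) k (geom Kf Rf) f" "v : lists {..<n}"
 shows "abs (tc f v) <= Kf * Rf ^ length v"
proof -
 have "v : lists {..<N}" using assms(2) nN by auto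
 from dw_words(2)[OF openU assms(1) this x0U] show ?thesis by (simp add: tc_def field_simps)
qed

lemma taylor:
 assumes f: "!!k. maj U N (dw n U w N) k (geom Kf Rf) f" and R: "0 <= Rf"
  and t: "l1 n t<\<tau>0" "Rf * l1 n t<1"
 shows "(%m. WP n (tc f) m t) sums f (\<Phi> t)"
proof -
 define D where "D v s = foldr (XD n w) v f (cu t s)" for v s
 have "(%m. WP n (%v. D v 0 / fact m) m t) sums D [] 1"
 proof (rule Taylor_words[OF _ _ R t(2)])
  fix v s assume v: "v : lists {..<n}" and s: "0 <= s" "s <= (1::real)"
  have vN: "v : lists {..<N}" using v nN by auto
  note dwv = dw_words(1)[OF openU f vN]
  obtain P where P: "pd n U (foldr (XD n w) v f) P"
   "!!j x. j<N ==> x : U ==> foldr (XD n w) (j # v) f x = (\<Sum>i<n. w j i x * P i x)"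
   using dwv unfolding dw_def by blast
  have g: "cu t s : U" using s by (intro cu_U[OF t(1)]) auto
  have "(\<Sum>m<n. P m (cu t s) * F t (cu t s) m) = (\<Sum>m<n. \<Sum>j<n. t j*(w j m (cu t s) * P m (cu t s)))"
   by (simp add: F_def sum_distrib_left mult_ac)
  also have "... = (\<Sum>j<n. t j*(\<Sum>m<n. w j m (cu t s) * P m (cu t s)))"
   by (rule trans[OF sum.swap]) (simp add: sum_distrib_left)
  also have "... = (\<Sum>j<n. t j * D (j # v) s)"
   using P(2) g nN by (intro sum.cong refl arg_cong2[where f="(*)"]) (auto simp: D_def)
  finally show "(D v has_real_derivative (\<Sum>j<n. t j * D (j # v) s)) (at s)"
   using cu_chain[OF t(1) P(1) s] unfolding D_def[abs_def] by simp
  show "abs (D v s) <= Kf * Rf ^ length v * fact (length v)"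
   unfolding D_def by (rule dw_words(2)[OF openU f vN g])
 qed
 moreover have "WP n (%v. D v 0 / fact m) m t = WP n (tc f) m t" for m
  by (rule WP_cong) (simp add: D_def tc_def cu_0[OF t(1)])
 ultimately show ?thesis by (simp add: D_def \<Phi>_def)
qed

end

section \<open>Equations along rays and the Jacobian of the exponential map\<close>

locale exp_struct = exp_map +
 fixes c :: "nat => nat => nat => rn => real" and Kc Rc :: real
 assumes c: "!!a b k j. a<n ==> b<N ==> k<N ==> maj U N (dw n U w N) j (geom Kc Rc) (c a b k)"
  and Kc: "0 <= Kc" and Rc: "0<Rc"
  and br: "!!a b i x. a<n ==> b<N ==> i<n ==> x : U ==>
   (\<Sum>m<n. w a m x * w' b i m x - w b m x * w' a i m x) = (\<Sum>k<N. c a b k x * w k i x)"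
begin

text \<open>The growth rate demanded by \<open>ode_coeff_bound\<close>: it dominates both Rc and N
  Kc.\<close>

definition Q :: real where "Q = Rc + N * Kc"

definition \<tau>1 :: real where "\<tau>1 = min \<tau>0 (1 / Q)"

lemma Q_pos: "0<Q" using Kc Rc by (simp add: Q_def add_pos_nonneg)

lemma \<tau>1_pos: "0<\<tau>1" using \<tau>0_pos Q_pos by (simp add: \<tau>1_def)

lemma \<tau>1: "l1 n t<\<tau>1 ==> l1 n t<\<tau>0" "l1 n t<\<tau>1 ==> Q * l1 n t<1" "l1 n t<\<tau>1 ==> Rc * l1 n t<1"
proof -
 show "l1 n t<\<tau>1 ==> l1 n t<\<tau>0" by (simp add: \<tau>1_def)
 show Q: "l1 n t<\<tau>1 ==> Q * l1 n t<1" using Q_pos by (simp add: \<tau>1_def field_simps)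
 have "Rc * l1 n t <= Q * l1 n t" using Kc by (intro mult_right_mono l1_nonneg) (simp add: Q_def)
 thus "l1 n t<\<tau>1 ==> Rc * l1 n t<1" using Q by linarith
qed

definition yc :: "nat => (nat => real) => nat => nat list => real" where
 "yc s y0 k v = ode_coeff N s (%a b k. tc (c a b k)) y0 v k"

text \<open>For s = 1 and a unit vector as data these turn out to be the coefficients of a partial
  derivative of \<open>\<Phi>\<close> in the fields. For s = 0 they transport a linear relation
  given at \<open>x0\<close>.\<close>

definition sol :: "nat => (nat => real) => nat => rn => real" where
 "sol s y0 k t = wseries n (yc s y0 k) (%_. 0) t"

lemma yc_bound:
 assumes "!!k. k<N ==> abs (y0 k) <= Y" "0 <= Y" "v : lists {..<n}" "k<N"
 shows "abs (yc s y0 k v) <= Y * Q ^ length v"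
 unfolding yc_def
proof (rule ode_coeff_bound[where n=n and K=Kc and R=Rc and Y=Y])
 show "abs (tc (c a b k) w) <= Kc * Rc ^ length w" if "a<n" "b<N" "k<N" "w : lists {..<n}" for a b k w
  by (rule tc_bound[OF c that(4)]) (use that in auto)
qed (use assms Kc Rc in \<open>auto simp: Q_def\<close>)

text \<open>For s at most 1, the coefficients in r of r^s y(r t). The factor r^s makes the equation
  regular at r = 0, shifts the series by s, and equals 1 at r = 1, where the values of
  \<open>sol\<close> are recovered.\<close>

definition zc :: "nat => (nat => real) => rn => nat => nat => real" where
 "zc s y0 t k m = (if s = 0 then WP n (yc s y0 k) m t else case m of 0 => 0 | Suc m => WP n (yc s y0 k) m t)"

definition zs :: "nat => (nat => real) => rn => nat => real => real" where
 "zs s y0 t k r = (suminf (%m. zc s y0 t k m * r ^ m))"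

lemma zs_0: "zs s y0 t k 0 = (if s = 0 then y0 k else 0)"
 using powser_zero[of "zc s y0 t k"] by (simp add: zs_def zc_def yc_def)

lemma WP_yc_bound:
 assumes "!!k. k<N ==> abs (y0 k) <= Y" "0 <= Y" "k<N"
 shows "abs (WP n (yc s y0 k) m t) <= Y*(Q * l1 n t) ^ m"
proof -
 have "abs (WP n (yc s y0 k) m t) <= (Y * Q ^ m) * l1 n t ^ m"
 proof (rule WP_bound)
  fix v assume "v : lists {..<n}" "length v = m"
  thus "abs (yc s y0 k v) <= Y * Q ^ m" using yc_bound[of y0 Y v k s] assms by simp
 qed
 thus ?thesis by (simp add: power_mult_distrib mult.assoc)
qed

lemma zs_1:
 assumes t: "l1 n t<\<tau>1" and k: "k<N"
 shows "zs s y0 t k 1 = sol s y0 k t"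
proof -
 define Y where "Y = (\<Sum>k<N. abs (y0 k))"
 have Y: "abs (y0 k) <= Y" if "k<N" for k unfolding Y_def using that by (intro member_le_sum) auto
 have Y0: "0 <= Y" unfolding Y_def by (rule sum_nonneg) simp
 have "summable (%m. WP n (yc s y0 k) m t)"
 proof (rule summable_comparison_test'[where g="%m. Y*(Q * l1 n t) ^ m" and N=0])
  have "norm (Q * l1 n t)<1" using \<tau>1(2)[OF t] Q_pos l1_nonneg[of n t] by simp
  thus "summable (%m. Y*(Q * l1 n t) ^ m)" by (intro summable_mult summable_geometric)
  show "norm (WP n (yc s y0 k) m t) <= Y*(Q * l1 n t) ^ m" for m
   using WP_yc_bound[of y0 Y k s m t, OF Y Y0 k] by simp
 qed
 hence "(%m. WP n (yc s y0 k) m t) sums sol s y0 k t"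
  by (simp add: sol_def wseries_def summable_sums)
 hence "(%m. zc s y0 t k m) sums sol s y0 k t"
 proof (cases "s = 0")
  case False
  assume a: "(%m. WP n (yc s y0 k) m t) sums sol s y0 k t"
  hence "(%m. zc s y0 t k (Suc m)) sums sol s y0 k t" using False by (simp add: zc_def)
  hence "(%m. zc s y0 t k m) sums (sol s y0 k t + zc s y0 t k 0)" by (subst (asm) sums_Suc_iff) simp
  thus ?thesis using False by (simp add: zc_def)
 qed (simp add: zc_def)
 thus ?thesis by (simp add: zs_def sums_iff)
qed

lemma zs_deriv:
 assumes t: "l1 n t<\<tau>1" and s: "s <= 1" and k: "k<N" and r: "0 <= r" "r <= 1"
 shows "(zs s y0 t k has_real_derivative (if s = 1 then y0 k else 0) -
   (\<Sum>b<N. (\<Sum>a<n. t a * c a b k (cu t r)) * zs s y0 t b r)) (at r)"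
proof -
 define Y where "Y = (\<Sum>k<N. abs (y0 k))"
 have Y: "abs (y0 k) <= Y" if "k<N" for k unfolding Y_def using that by (intro member_le_sum) auto
 have Y0: "0 <= Y" unfolding Y_def by (rule sum_nonneg) simp
 \<comment> \<open>A ratio above Q times the l1 norm of t and below 1, and positive also for t =
   0.\<close>
 define q where "q = (Q * l1 n t + 1)/2"
 have Ql: "0 <= Q * l1 n t" "Q * l1 n t<1" using \<tau>1(2)[OF t] Q_pos l1_nonneg[of n t] by auto
 have q: "0<q" "q<1" "Q * l1 n t <= q"
 proof -
  have "0<(x + 1)/2 & (x + 1)/2<1 & x <= (x + 1)/2" if "0 <= x" "x<1" for x :: real using that by simp
  from this[OF Ql] show "0<q" "q<1" "Q * l1 n t <= q" unfolding q_def by blast+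
 qed
 have Rl: "Rc * l1 n t <= q"
 proof -
  have "Rc * l1 n t <= Q * l1 n t" using Kc by (intro mult_right_mono l1_nonneg) (simp add: Q_def)
  thus ?thesis using q(3) by linarith
 qed
 define \<Gamma> where "\<Gamma> k b m = (\<Sum>a<n. t a * WP n (tc (c a b k)) m t)" for k b m
 have \<zeta>: "abs (zc s y0 t k m) <= Y / q * q ^ m" if k: "k<N" for k m
 proof -
  have 1: "abs (WP n (yc s y0 k) m t) <= Y * q ^ m" for m
   using WP_yc_bound[of y0 Y k s m t, OF Y Y0 k] mult_left_mono[OF power_mono[OF q(3) Ql(1), of m] Y0] by linarith
  \<comment> \<open>Replacing Y by Y/q absorbs the index shift that occurs for s = 1.\<close>
  have Yq: "Y <= Y / q" using q Y0 by (simp add: field_simps mult_left_le)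
  have 2: "Y * q ^ m <= Y / q * q ^ m" for m using Yq q by (intro mult_right_mono) auto
  show ?thesis
  proof (cases "s = 0")
   case True
   thus ?thesis using 1[of m] 2[of m] by (simp add: zc_def)
  next
   case False
   thus ?thesis using 1 q Y0 by (cases m) (auto simp: zc_def)
  qed
 qed
 have \<Gamma>b: "abs (\<Gamma> k b m) <= (l1 n t * Kc) * q ^ m" if "k<N" "b<N" for k b m
 proof -
  have "abs (WP n (tc (c a b k)) m t) <= Kc * q ^ m" if a: "a<n" for a
  proof -
   have "abs (WP n (tc (c a b k)) m t) <= (Kc * Rc ^ m) * l1 n t ^ m"
    by (rule WP_bound) (use tc_bound[OF c[OF a \<open>b<N\<close> \<open>k<N\<close>]] in auto)
   also have "... = Kc*(Rc * l1 n t) ^ m" by (simp add: power_mult_distrib)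
   also have "... <= Kc * q ^ m" using Rl Rc l1_nonneg[of n t] Kc by (intro mult_left_mono power_mono) auto
   finally show ?thesis .
  qed
  hence "abs (\<Gamma> k b m) <= (\<Sum>a<n. abs (t a)*(Kc * q ^ m))"
   unfolding \<Gamma>_def by (intro order_trans[OF sum_abs] sum_mono) (auto simp: abs_mult intro!: mult_left_mono)
  thus ?thesis by (simp add: l1_def sum_distrib_right mult.assoc)
 qed
 have rec: "real (Suc m) * zc s y0 t k (Suc m) = (if m = 0 then (if s = 1 then y0 k else 0) else 0) -
   (\<Sum>b<N. \<Sum>j\<le>m. \<Gamma> k b j * zc s y0 t b (m - j))" if k: "k<N" for k m
 proof (cases "s = 0")
  case True
  thus ?thesis
   using WP_ode_coeff[OF k, of m 0 n "%a b k. tc (c a b k)" y0 t]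
   by (simp add: zc_def \<Gamma>_def yc_def[abs_def] del: WP.simps(2))
 next
  case False
  hence s1: "s = Suc 0" using s by simp
  show ?thesis
  proof (cases m)
   case 0
   thus ?thesis using s1 by (simp add: zc_def yc_def)
  next
   case (Suc p)
   have "(\<Sum>b<N. \<Sum>j\<le>Suc p. \<Gamma> k b j * zc s y0 t b (Suc p - j)) = (\<Sum>b<N. \<Sum>j\<le>p. \<Gamma> k b j * WP n (yc s y0 b) (p - j) t)"
   proof (rule sum.cong[OF refl])
    fix b
    \<comment> \<open>The summand j = p + 1 contains \<open>zc\<close> at index 0, which is 0 for s
      = 1. The remaining range is that of the unshifted recursion of degree p.\<close>
    have "(\<Sum>j\<le>Suc p. \<Gamma> k b j * zc s y0 t b (Suc p - j)) = (\<Sum>j\<le>p. \<Gamma> k b j * zc s y0 t b (Suc p - j))"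
     using s1 by (simp add: zc_def)
    also have "... = (\<Sum>j\<le>p. \<Gamma> k b j * WP n (yc s y0 b) (p - j) t)"
     using s1 by (intro sum.cong refl) (simp add: zc_def Suc_diff_le)
    finally show "(\<Sum>j\<le>Suc p. \<Gamma> k b j * zc s y0 t b (Suc p - j)) = (\<Sum>j\<le>p. \<Gamma> k b j * WP n (yc s y0 b) (p - j) t)" .
   qed
   thus ?thesis
    using WP_ode_coeff[OF k, of p 1 n "%a b k. tc (c a b k)" y0 t] s1 Suc
    by (simp add: zc_def \<Gamma>_def yc_def[abs_def] del: WP.simps(2))
  qed
 qed
 have "((%r. suminf (%m. zc s y0 t k m * r ^ m)) has_real_derivative
   (if s = 1 then y0 k else 0) - (\<Sum>b<N. (suminf (%m. \<Gamma> k b m * r ^ m))*(suminf (%m. zc s y0 t b m * r ^ m)))) (at r)"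
  by (rule power_series_linear_ode[where \<zeta>="zc s y0 t" and \<Gamma>=\<Gamma> and e="%k. if s = 1 then y0 k else 0",
     OF q(1,2) \<zeta> \<Gamma>b rec k]) (use r in auto)
 moreover have "(suminf (%m. \<Gamma> k b m * r ^ m)) = (\<Sum>a<n. t a * c a b k (cu t r))" if b: "b<N" for b
 proof -
  have rt: "l1 n (%i. r * t i) <= l1 n t"
   using mult_right_mono[OF r(2) l1_nonneg[of n t]] r by (simp add: l1_scale)
  have "(%m. WP n (tc (c a b k)) m (%i. r * t i)) sums c a b k (cu t r)" if a: "a<n" for a
  proof -
   have "(%m. WP n (tc (c a b k)) m (%i. r * t i)) sums c a b k (\<Phi> (%i. r * t i))"
   proof (rule taylor[OF c[OF a b k] less_imp_le[OF Rc]])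
    show "l1 n (%i. r * t i)<\<tau>0" using rt \<tau>1(1)[OF t] by linarith
    show "Rc * l1 n (%i. r * t i)<1" using mult_left_mono[OF rt less_imp_le[OF Rc]] \<tau>1(3)[OF t] by linarith
   qed
   thus ?thesis using \<Phi>_ray[OF \<tau>1(1)[OF t] r] by simp
  qed
  hence "(%m. \<Sum>a<n. t a*(r ^ m * WP n (tc (c a b k)) m t)) sums (\<Sum>a<n. t a * c a b k (cu t r))"
   by (intro sums_sum sums_mult) (auto simp: WP_scale)
  moreover have "(%m. \<Sum>a<n. t a*(r ^ m * WP n (tc (c a b k)) m t)) = (%m. \<Gamma> k b m * r ^ m)"
   by (simp add: \<Gamma>_def sum_distrib_left mult_ac)
  ultimately show ?thesis by (simp add: sums_iff)
 qed
 ultimately show ?thesis unfolding zs_def[abs_def] by simp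
qed

definition Z :: "nat => (nat => real) => rn => nat => real => real" where
 "Z s y0 t i r = (\<Sum>l<N. zs s y0 t l r * w l i (cu t r))"

text \<open>\<open>bracket_algebra\<close> cancels the brackets, so the combination solves the
  equation linearised along the ray. For s = 1 and the unit vector of an index a < n, the source is
  the derivative of the field \<open>F\<close> with respect to t_a.\<close>

lemma Z_deriv:
 assumes t: "l1 n t<\<tau>1" and s: "s <= 1" and i: "i<n" and r: "0 <= r" "r <= 1"
 shows "(Z s y0 t i has_real_derivative (\<Sum>l<N. (if s = 1 then y0 l else 0) * w l i (cu t r)) +
   (\<Sum>a<n. t a*(\<Sum>m<n. w' a i m (cu t r) * Z s y0 t m r))) (at r)"
proof -
 have gU: "cu t r : U" using r by (intro curve_in \<tau>1(1)[OF t]) auto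
 have "(Z s y0 t i has_real_derivative (\<Sum>l<N. ((if s = 1 then y0 l else 0) -
   (\<Sum>b<N. (\<Sum>a<n. t a * c a b l (cu t r)) * zs s y0 t b r)) * w l i (cu t r) +
   (\<Sum>m<n. w' l i m (cu t r) * F t (cu t r) m) * zs s y0 t l r)) (at r)"
  unfolding Z_def[abs_def]
  by (intro DERIV_sum DERIV_mult zs_deriv t s r cu_chain \<tau>1(1)[OF t] pdw i) auto
 also have "(\<Sum>l<N. ((if s = 1 then y0 l else 0) -
   (\<Sum>b<N. (\<Sum>a<n. t a * c a b l (cu t r)) * zs s y0 t b r)) * w l i (cu t r) +
   (\<Sum>m<n. w' l i m (cu t r) * F t (cu t r) m) * zs s y0 t l r) =
  (\<Sum>l<N. ((if s = 1 then y0 l else 0) -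
   (\<Sum>b<N. (\<Sum>a<n. t a * c a b l (cu t r)) * zs s y0 t b r)) * w l i (cu t r) +
   zs s y0 t l r*(\<Sum>m<n. w' l i m (cu t r)*(\<Sum>a<n. t a * w a m (cu t r))))"
  by (simp add: F_def mult.commute)
 also have "... = (\<Sum>l<N. (if s = 1 then y0 l else 0) * w l i (cu t r)) +
   (\<Sum>a<n. t a*(\<Sum>m<n. w' a i m (cu t r)*(\<Sum>l<N. zs s y0 t l r * w l m (cu t r))))"
  by (rule bracket_algebra) (use br i gU nN in auto)
 finally show ?thesis by (simp add: Z_def[abs_def])
qed

lemma linearised_bound:
 assumes "cu t r : U" "i<n"
 shows "abs (\<Sum>a<n. t a*(\<Sum>m<n. w' a i m (cu t r) * v m)) <= (l1 n t * L)*(\<Sum>m<n. abs (v m))"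
proof -
 have "abs (\<Sum>m<n. w' a i m (cu t r) * v m) <= L*(\<Sum>m<n. abs (v m))" if "a<n" for a
  unfolding sum_distrib_left using w'L assms nN that
  by (intro order_trans[OF sum_abs] sum_mono) (auto simp: abs_mult intro!: mult_right_mono)
 hence "abs (\<Sum>a<n. t a*(\<Sum>m<n. w' a i m (cu t r) * v m)) <= (\<Sum>a<n. abs (t a)*(L*(\<Sum>m<n. abs (v m))))"
  by (intro order_trans[OF sum_abs] sum_mono) (auto simp: abs_mult intro!: mult_left_mono)
 thus ?thesis by (simp add: l1_def sum_distrib_right mult.assoc)
qed

lemma small_time_1:
 assumes "l1 n t<\<tau>0"
 shows "n*(l1 n t * L)*(1 - 0) <= 1/2"
proof -
 have "x*(1 - 0) <= 1/2" if "x*2 <= 1/2" "0 <= x" for x :: real using that by simp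
 moreover have "0 <= n*(l1 n t * L)" using L l1_nonneg by simp
 ultimately show ?thesis using small_time(2)[OF assms] by blast
qed

text \<open>The combination vanishes at the origin of the ray and solves a homogeneous linear
  equation, so Gronwall with eps = 0 keeps it at 0.\<close>

lemma relation_transport:
 assumes t: "l1 n t<\<tau>1" and y0: "!!i. i<n ==> (\<Sum>l<N. y0 l * w l i x0) = 0" and i: "i<n"
 shows "(\<Sum>l<N. sol 0 y0 l t * w l i (\<Phi> t)) = 0"
proof -
 have "abs (Z 0 y0 t i 1) <= 2*0*(1 - 0)"
 proof (rule small_Gronwall[where \<delta>="%r i. Z 0 y0 t i r" and n=n and L="l1 n t * L" and ?s0.0=0])
  show "((%r. Z 0 y0 t i r) has_real_derivative (\<Sum>a<n. t a*(\<Sum>m<n. w' a i m (cu t s) * Z 0 y0 t m s))) (at s within {0..1})"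
   if "i<n" "s : {0..1}" for i s
   using Z_deriv[OF t _ that(1), of 0 s y0] that(2) by (simp add: has_field_derivative_at_within)
  show "abs (\<Sum>a<n. t a*(\<Sum>m<n. w' a i m (cu t s) * Z 0 y0 t m s)) <= l1 n t * L*(\<Sum>k<n. abs (Z 0 y0 t k s)) + 0"
   if "i<n" "s : {0..1}" for i s
   using linearised_bound[OF curve_in[OF \<tau>1(1)[OF t] that(2)] that(1)] by simp
  show "Z 0 y0 t i 0 = 0" if "i<n" for i
   using y0[OF that] by (simp add: Z_def zs_0 cu_0[OF \<tau>1(1)[OF t]])
  show "n*(l1 n t * L)*(1 - 0) <= 1/2" by (rule small_time_1[OF \<tau>1(1)[OF t]])
 qed (use i L l1_nonneg in auto)
 thus ?thesis using zs_1[OF t] by (simp add: Z_def \<Phi>_def)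
qed

lemma \<Phi>_Lipschitz:
 assumes "l1 n t<\<tau>0" "l1 n t'<\<tau>0" "r : {0..1}" "i<n"
 shows "abs (cu t' r i - cu t r i) <= 2*(l1 n (%j. t' j - t j) * K)"
proof (rule cu_Lipschitz[OF assms(1) _ _ _ assms(3,4)])
 show "((%s. cu t' s i) has_real_derivative F t' (cu t' r) i) (at r within {0..1})" if "r : {0..1}" "i<n" for r i
  by (rule has_field_derivative_at_within[OF cu_deriv[OF assms(2) _ that(2)]]) (use that in auto)
qed (use cu_0[OF assms(2)] curve_in[OF assms(2)] in auto)

text \<open>\<open>J\<close> solves the variational equation with initial value 0. The change of the
  curve minus h \<open>J\<close> obeys the same linear estimate with error |h| eps/2, and Gronwall
  on [0, 1] bounds it by eps |h|.\<close>

lemma \<Phi>_partial: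
 assumes t: "l1 n t<\<tau>1" and i: "i<n" and k: "k<n"
 shows "((%s. \<Phi> (t(i := s)) k) has_real_derivative
   (\<Sum>l<N. sol 1 (%l. if l = i then 1 else 0) l t * w l k (\<Phi> t))) (at (t i))"
proof (rule deriv_from_estimate)
 fix eps :: real assume eps: "eps > 0"
 note t0 = \<tau>1(1)[OF t]
 define y0 where "y0 = (%l. if l = i then 1 else (0::real))"
 define J where "J m r = Z 1 y0 t m r" for m r
 have iN: "i<N" using i nN by simp
 have dJ: "((%r. J m r) has_real_derivative w i m (cu t r) + (\<Sum>a<n. t a*(\<Sum>p<n. w' a m p (cu t r) * J p r))) (at r)"
  if "m<n" "r : {0..1}" for m r
 proof -
  have "(\<Sum>l<N. (if (1::nat) = 1 then y0 l else 0) * w l m (cu t r)) = (\<Sum>l<N. if l = i then w l m (cu t r) else 0)"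
   by (intro sum.cong) (auto simp: y0_def)
  hence "(\<Sum>l<N. (if (1::nat) = 1 then y0 l else 0) * w l m (cu t r)) = w i m (cu t r)" using iN by simp
  thus ?thesis using Z_deriv[OF t _ that(1), of 1 r y0] that(2) unfolding J_def[abs_def] by simp
 qed
 have exB: "EX B. ALL r:{0..1}. abs (J m r) <= B" if "m<n" for m
 proof -
  have "continuous_on {0..1} (J m)"
   by (rule DERIV_continuous_on[OF has_field_derivative_at_within[OF dJ[OF that]]])
  hence "bounded (J m ` {0..1})" by (intro compact_imp_bounded compact_continuous_image) auto
  thus ?thesis unfolding bounded_iff by auto
 qed
 define B where "B m = (SOME B. ALL r:{0..1}. abs (J m r) <= B)" for m
 have B: "abs (J m r) <= B m" if "m<n" "r : {0..1}" for m r
  using someI_ex[OF exB[OF that(1)]] that(2) by (simp add: B_def)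
 define C where "C = (\<Sum>m<n. abs (B m))"
 have C0: "0 <= C" unfolding C_def by (rule sum_nonneg) simp
 have JC: "abs (J m r) <= C" if "m<n" "r : {0..1}" for m r
 proof -
  have "abs (B m) <= C" unfolding C_def using that by (intro member_le_sum) auto
  thus ?thesis using B[OF that] by linarith
 qed
 \<comment> \<open>Tolerance for the derivatives of the fields: multiplied by the l1 norm of t and
   by the bound n C for \<open>J\<close> it contributes at most eps/4.\<close>
 define \<eta> where "\<eta> = eps/(4*(l1 n t*(n * C) + 1))"
 have A0: "0 <= l1 n t*(n * C)" using C0 l1_nonneg by simp
 have \<eta>: "\<eta> > 0" using eps A0 by (simp add: \<eta>_def)
 have \<eta>2: "l1 n t*(n * C) * \<eta> <= eps/4"
 proof -
  have "l1 n t*(n * C) * \<eta> <= (l1 n t*(n * C) + 1) * \<eta>" using \<eta> by (intro mult_right_mono) auto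
  also have "... = eps/4" using A0 by (simp add: \<eta>_def field_simps)
  finally show ?thesis .
 qed
 define near where "near a k m d \<longleftrightarrow> (ALL r:{0..1}. ALL \<xi>:U. (ALL i<n. abs (\<xi> i - cu t r i)<d) -->
   abs (w' a k m \<xi> - w' a k m (cu t r)) <= \<eta>)" for a k m and d :: real
 have near_mono: "near a k m d'" if "near a k m d" "d' <= d" for a k m d d'
  using that unfolding near_def by (meson less_le_trans)
 have near_ex: "EX d>0. near a k m d" if a: "a<n" "k<n" "m<n" for a k m
  unfolding near_def
 proof (rule uniform_near_curve[OF openU _ curve_in[OF t0] _ \<eta>])
  have aN: "a<N" using a nN by simp
  show "continuous_on U (w' a k m)" using pdw[OF aN a(2)] a(3) unfolding pd_def by blast
  show "continuous_on {0..1} (%r. cu t r j)" if "j<n" for j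
   by (rule DERIV_continuous_on[OF has_field_derivative_at_within[OF cu_deriv[OF t0 _ that]]]) auto
 qed
 have "EX d>0. ALL a<n. ALL k<n. ALL m<n. near a k m d"
  by (intro ex_common_pos near_ex) (use near_mono in blast)+
 then obtain d0 where d0: "d0 > 0" and "ALL a<n. ALL k<n. ALL m<n. near a k m d0" by blast
 hence nd0: "abs (w' a k m \<xi> - w' a k m (cu t r)) <= \<eta>" if "a<n" "k<n" "m<n" "r : {0..1}" "\<xi> : U"
   "!!i. i<n ==> abs (\<xi> i - cu t r i)<d0" for a k m r \<xi>
  using that unfolding near_def by blast
 \<comment> \<open>Three demands on |h|: the new parameter stays in the domain, the two curves
   differ by less than \<open>d0\<close>, and \<open>w i\<close> changes by at most eps/4 between
   them.\<close>
 define d where "d = min (\<tau>1 - l1 n t) (min (d0/(2 * K + 1)) (eps/(8*(n * L * K + 1))))"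
 have nLK: "0 <= n * L * K" using L K by simp
 have d: "d > 0" using t d0 eps K nLK by (simp add: d_def)
 have "abs (\<Phi> (t(i := t i + h)) k - \<Phi> (t(i := t i)) k - h*(\<Sum>l<N. sol 1 y0 l t * w l k (\<Phi> t))) <= eps * abs h"
  if h: "abs h<d" for h
 proof -
  define t' where "t' = t(i := t i + h)"
  have l1t': "l1 n (%j. t' j - t j) = abs h"
  proof -
   have "l1 n (%j. t' j - t j) = (\<Sum>j<n. if j = i then abs h else 0)"
    unfolding l1_def by (intro sum.cong) (auto simp: t'_def)
   thus ?thesis using i by simp
  qed
  have "l1 n t' <= l1 n t + l1 n (%j. t' j - t j)"
   unfolding l1_def sum.distrib[symmetric] by (rule sum_mono) linarith
  hence t'0: "l1 n t'<\<tau>0" using h l1t' \<tau>1_def by (auto simp: d_def)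
  have hd0: "2*(abs h * K)<d0"
  proof -
   have "abs h<d0/(2 * K + 1)" using h by (simp add: d_def)
   hence "abs h*(2 * K + 1)<d0" using K by (simp add: field_simps)
   thus ?thesis using abs_ge_zero[of h] by (simp add: algebra_simps)
  qed
  have hnLK: "n * L*(2*(abs h * K)) <= eps/4"
  proof -
   have "abs h<eps/(8*(n * L * K + 1))" using h by (simp add: d_def)
   hence "abs h*(8*(n * L * K + 1)) <= eps" using nLK by (simp add: field_simps)
   thus ?thesis using abs_ge_zero[of h] by (simp add: algebra_simps)
  qed
  define \<delta> where "\<delta> r m = cu t' r m - cu t r m - h * J m r" for r m
  define \<delta>' where "\<delta>' r m = F t' (cu t' r) m - F t (cu t r) m -
    h*(w i m (cu t r) + (\<Sum>a<n. t a*(\<Sum>p<n. w' a m p (cu t r) * J p r)))" for r m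
  have close: "abs (cu t' r m - cu t r m) <= 2*(abs h * K)" if "r : {0..1}" "m<n" for r m
   using \<Phi>_Lipschitz[OF t0 t'0 that] l1t' by simp
  have "abs (\<delta> 1 k) <= 2*(abs h*(eps/2))*(1 - 0)"
  proof (rule small_Gronwall[where \<delta>=\<delta> and \<delta>'=\<delta>' and n=n and L="l1 n t * L" and ?s0.0=0])
   show "((%r. \<delta> r m) has_real_derivative \<delta>' s m) (at s within {0..1})" if "m<n" "s : {0..1}" for m s
   proof (rule has_field_derivative_at_within)
    show "((%r. \<delta> r m) has_real_derivative \<delta>' s m) (at s)"
     unfolding \<delta>_def \<delta>'_def using that
     by (intro DERIV_diff DERIV_cmult cu_deriv t0 t'0 dJ) auto
   qed
   show "\<delta> 0 m = 0" if "m<n" for m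
    by (simp add: \<delta>_def J_def Z_def zs_0 cu_0[OF t0] cu_0[OF t'0])
   show "n*(l1 n t * L)*(1 - 0) <= 1/2" by (rule small_time_1[OF t0])
   fix m r assume m: "m<n" and r: "r : {0..(1::real)}"
   have gU: "cu t r : U" "cu t' r : U" using curve_in t0 t'0 r by auto
   \<comment> \<open>The defect in replacing the increment of \<open>w a\<close> between the two
     curves by its linearisation in the direction \<open>J\<close>.\<close>
   define E where "E a = (w a m (cu t' r) - w a m (cu t r)) - h*(\<Sum>p<n. w' a m p (cu t r) * J p r)" for a
   have "F t' y m = F t y m + h * w i m y" for y
   proof -
    have "F t' y m = (\<Sum>a<n. t a * w a m y + (if a = i then h * w a m y else 0))"
     unfolding F_def by (intro sum.cong) (auto simp: t'_def algebra_simps)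
    thus ?thesis using i by (simp add: sum.distrib F_def)
   qed
   hence \<delta>'eq: "\<delta>' r m = (\<Sum>a<n. t a * E a) + h*(w i m (cu t' r) - w i m (cu t r))"
    unfolding \<delta>'_def E_def F_def by (simp add: right_diff_distrib sum_subtractf sum_distrib_left sum.distrib algebra_simps)
   have Eb: "abs (E a) <= L*(\<Sum>p<n. abs (\<delta> r p)) + abs h*(n*(\<eta> * C))" if a: "a<n" for a
   proof -
    have aN: "a<N" using a nN by simp
    obtain \<xi> where \<xi>: "!!p. p<n ==> \<xi> p : U & (ALL j. abs (\<xi> p j - cu t r j) <= abs (cu t' r j - cu t r j))"
     "w a m (cu t' r) - w a m (cu t r) = (\<Sum>p<n. w' a m p (\<xi> p)*(cu t' r p - cu t r p))"
     using pd_mvt_cube[OF pdw[OF aN m] gU order_refl] by blast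
    have Ea: "E a = (\<Sum>p<n. w' a m p (\<xi> p) * \<delta> r p + h*((w' a m p (\<xi> p) - w' a m p (cu t r)) * J p r))"
     unfolding E_def \<xi>(2) sum_distrib_left sum_subtractf[symmetric]
     by (intro sum.cong refl) (simp add: \<delta>_def algebra_simps)
    have "abs (E a) <= (\<Sum>p<n. L * abs (\<delta> r p) + abs h*(\<eta> * C))"
    unfolding Ea
    proof (rule order_trans[OF sum_abs], rule sum_mono)
     fix p assume "p : {..<n}"
     hence p: "p<n" by simp
     have 1: "abs (w' a m p (\<xi> p)) <= L" using w'L aN m p \<xi>(1) by blast
     have "abs (\<xi> p j - cu t r j)<d0" if "j<n" for j
      using \<xi>(1)[OF p] close[OF r that] hd0 by (meson le_less_trans order_trans)
     hence 2: "abs (w' a m p (\<xi> p) - w' a m p (cu t r)) <= \<eta>" using nd0[OF a m p r] \<xi>(1)[OF p] by blast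
     have "abs (w' a m p (\<xi> p) * \<delta> r p) <= L * abs (\<delta> r p)" unfolding abs_mult by (rule mult_right_mono[OF 1]) simp
     moreover have "abs (h*((w' a m p (\<xi> p) - w' a m p (cu t r)) * J p r)) <= abs h*(\<eta> * C)"
      unfolding abs_mult using 2 JC[OF p r] \<eta> by (intro mult_left_mono mult_mono) auto
     ultimately show "abs (w' a m p (\<xi> p) * \<delta> r p + h*((w' a m p (\<xi> p) - w' a m p (cu t r)) * J p r)) <= L * abs (\<delta> r p) + abs h*(\<eta> * C)"
      by linarith
    qed
    also have "(\<Sum>p<n. L * abs (\<delta> r p) + abs h*(\<eta> * C)) = L*(\<Sum>p<n. abs (\<delta> r p)) + abs h*(n*(\<eta> * C))"
     unfolding sum.distrib sum_distrib_left[symmetric] by simp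
    finally show ?thesis .
   qed
   have "abs (\<Sum>a<n. t a * E a) <= (\<Sum>a<n. abs (t a)*(L*(\<Sum>p<n. abs (\<delta> r p)) + abs h*(n*(\<eta> * C))))"
    using Eb by (intro order_trans[OF sum_abs] sum_mono) (auto simp: abs_mult intro!: mult_left_mono)
   also have "... = l1 n t * L*(\<Sum>p<n. abs (\<delta> r p)) + abs h*(l1 n t*(n * C) * \<eta>)"
    unfolding l1_def sum_distrib_right[symmetric] by (simp add: algebra_simps)
   also have "... <= l1 n t * L*(\<Sum>p<n. abs (\<delta> r p)) + abs h*(eps/4)"
    using \<eta>2 by (intro add_left_mono mult_left_mono) auto
   finally have b1: "abs (\<Sum>a<n. t a * E a) <= l1 n t * L*(\<Sum>p<n. abs (\<delta> r p)) + abs h*(eps/4)" .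
   have "abs (w i m (cu t' r) - w i m (cu t r)) <= L*(\<Sum>p<n. abs (cu t' r p - cu t r p))"
    by (rule wL[OF iN m gU(2,1)])
   also have "... <= L*(n*(2*(abs h * K)))"
    using close[OF r] sum_bounded_above[of "{..<n}" "%p. abs (cu t' r p - cu t r p)" "2*(abs h * K)"] L
    by (intro mult_left_mono) auto
   also have "... <= eps/4" using hnLK by (simp add: mult_ac)
   finally have b2: "abs (h*(w i m (cu t' r) - w i m (cu t r))) <= abs h*(eps/4)"
    unfolding abs_mult by (intro mult_left_mono) auto
   show "abs (\<delta>' r m) <= l1 n t * L*(\<Sum>p<n. abs (\<delta> r p)) + abs h*(eps/2)"
   proof -
    have "abs h*(eps/2) = abs h*(eps/4) + abs h*(eps/4)" by simp
    thus ?thesis unfolding \<delta>'eq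
     using b1 b2 abs_triangle_ineq[of "\<Sum>a<n. t a * E a" "h*(w i m (cu t' r) - w i m (cu t r))"] by linarith
   qed
  qed (use k L l1_nonneg eps in auto)
  moreover have "\<delta> 1 k = \<Phi> t' k - \<Phi> t k - h*(\<Sum>l<N. sol 1 y0 l t * w l k (\<Phi> t))"
   using zs_1[OF t, of _ 1 y0] by (simp add: \<delta>_def \<Phi>_def J_def Z_def)
  ultimately show ?thesis by (simp add: t'_def mult.commute)
 qed
 thus "EX d>0. ALL h. abs h<d --> abs (\<Phi> (t(i := t i + h)) k - \<Phi> (t(i := t i)) k -
   h*(\<Sum>l<N. sol 1 (%l. if l = i then 1 else 0) l t * w l k (\<Phi> t))) <= eps * abs h"
  using d unfolding y0_def by blast
qed

end

locale exp_basis = exp_struct +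
 assumes basis: "fdet n (%i j. w i j x0) ~= 0"
begin

abbreviation O0 :: rn where "O0 \<equiv> %_. 0"

lemma O0_top: "O0 : spaceE n" by (simp add: topspace_Euclidean_space)

text \<open>Coefficients of a linear relation between \<open>w l\<close> and the basis \<open>w 0, ..., w (n - 1)\<close> at \<open>x0\<close>.\<close>

definition rv :: "nat => nat => real" where
 "rv l k = (if k<n then - (\<Sum>j<n. w l j x0 * fadj n (%i j. w i j x0) j k / fdet n (%i j. w i j x0))
   else if k = l then 1 else 0)"

lemma sum_split: "(\<Sum>k<N. f k) = (\<Sum>k<n. f k) + (\<Sum>k=n..<N. (f k :: real))"
 using sum.atLeastLessThan_concat[of 0 n N f] nN by (simp add: lessThan_atLeast0)

lemma rv_relation:
 assumes l: "n <= l" "l<N" and i: "i<n"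
 shows "(\<Sum>k<N. rv l k * w k i x0) = 0"
proof -
 let ?A = "%i j. w i j x0"
 have "(\<Sum>k<n. (\<Sum>j<n. w l j x0 * fadj n ?A j k / fdet n ?A) * w k i x0) =
   (\<Sum>j<n. w l j x0 / fdet n ?A*(\<Sum>k<n. fadj n ?A j k * w k i x0))"
  unfolding sum_distrib_left sum_distrib_right by (rule trans[OF sum.swap]) (simp add: mult.assoc)
 also have "... = (\<Sum>j<n. w l j x0 / fdet n ?A*(if j = i then fdet n ?A else 0))"
  using fadj_mult(1)[OF _ i, of _ ?A] by (intro sum.cong refl) auto
 also have "... = w l i x0" using basis i by (simp add: if_distrib[of "%x. _ * x"] cong: if_cong)
 finally have 1: "(\<Sum>k<n. rv l k * w k i x0) = - w l i x0" by (simp add: rv_def sum_negf)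
 have "(\<Sum>k=n..<N. rv l k * w k i x0) = (\<Sum>k=n..<N. if k = l then w k i x0 else 0)"
  by (intro sum.cong) (auto simp: rv_def)
 hence "(\<Sum>k=n..<N. rv l k * w k i x0) = w l i x0" using l by simp
 thus ?thesis unfolding sum_split using 1 by simp
qed

text \<open>An N by N matrix: the rows below n expand the partial derivatives of
  \<open>\<Phi>\<close> in the fields, the others are transported relations. Its inverse expresses
  the fields by the partial derivatives.\<close>

definition \<Gamma> :: "nat => nat => rn => real" where
 "\<Gamma> i l t = (if i<n then sol 1 (%l. if l = i then 1 else 0) l t else sol 0 (rv i) l t)"

lemma sol_0: "sol s y0 l O0 = y0 l"
proof -
 have "WP n a m (%j. O0 j - 0) = (if m = 0 then a [] else 0)" for a m by (cases m) auto
 hence "(%m. WP n (yc s y0 l) m (%j. O0 j - 0)) = (%m. if m = 0 then yc s y0 l [] else 0)" by auto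
 thus ?thesis using sums_unique[OF sums_single[of 0 "%_. yc s y0 l []"]]
  by (simp add: sol_def wseries_def yc_def)
qed

text \<open>At 0 the first n rows are unit vectors, and a row l >= n has a 1 in column l and
  otherwise entries only in the first n columns. Hence the kernel is trivial.\<close>

lemma \<Gamma>_det_0: "fdet N (%i l. \<Gamma> i l O0) ~= 0"
proof (rule fdet_nonzero)
 fix v :: "nat => real" assume v: "!!i. i<N ==> (\<Sum>j<N. \<Gamma> i j O0 * v j) = 0"
 have 1: "v i = 0" if "i<n" for i
 proof -
  have "(\<Sum>j<N. \<Gamma> i j O0 * v j) = (\<Sum>j<N. if j = i then v j else 0)"
   using that by (intro sum.cong) (auto simp: \<Gamma>_def sol_0)
  thus ?thesis using v[of i] that nN by simp
 qed
 have 2: "v l = 0" if "n <= l" "l<N" for l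
 proof -
  have "(\<Sum>j<N. \<Gamma> l j O0 * v j) = (\<Sum>j<N. if j = l then v j else 0)"
   using that 1 by (intro sum.cong) (auto simp: \<Gamma>_def sol_0 rv_def)
  thus ?thesis using v[of l] that by simp
 qed
 show "ALL j<N. v j = 0" using 1 2 not_less by blast
qed

lemma sol_analytic:
 fixes d :: real
 assumes "0<d" "2 * Q*(n * d)<1" "k<N"
 shows "an_pd n (cube n O0 d) (sol s y0 k)"
proof -
 define Y where "Y = (\<Sum>k<N. abs (y0 k))"
 have Y: "abs (y0 k) <= Y" if "k<N" for k unfolding Y_def using that by (intro member_le_sum) auto
 have Y0: "0 <= Y" unfolding Y_def by (rule sum_nonneg) simp
 have "an_pd n (cube n O0 d) (wseries n (yc s y0 k) O0)"
  by (rule wseries_analytic[OF yc_bound[of y0 Y _ k s, OF Y Y0 _ assms(3)] Y0 Q_pos assms(1,2)])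
 thus ?thesis unfolding sol_def[abs_def] .
qed

lemma l1_cube_0: fixes d :: real shows "t : cube n O0 d ==> 0<d ==> l1 n t <= n * d"
 using l1_cube[of t n O0 d] by simp

text \<open>The Jacobian of \<open>\<Phi>\<close>, with component index k first and derivative index
  i second.\<close>

definition D :: "nat => nat => rn => real" where
 "D k i t = (\<Sum>l<N. \<Gamma> i l t * w l k (\<Phi> t))"

lemma \<Phi>_cont:
 fixes d :: real
 assumes d: "0<d" "n * d<\<tau>1" and k: "k<n"
 shows "continuous_on (cube n O0 d) (%t. \<Phi> t k)"
 unfolding continuous_on_cube_iff[OF cube_subset_topspace]
proof (intro ballI allI impI)
 fix t and eps :: real assume t: "t : cube n O0 d" and eps: "eps > 0"
 define d' where "d' = eps/(2*(n * K) + 1)"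
 have nK: "0 <= n * K" using K by simp
 have d': "d' > 0" using eps nK by (simp add: d'_def)
 have "abs (\<Phi> t' k - \<Phi> t k)<eps" if t': "t' : cube n O0 d" "ALL i<n. abs (t' i - t i)<d'" for t'
 proof -
  have l: "l1 n t<\<tau>0" "l1 n t'<\<tau>0" using l1_cube_0[OF t d(1)] l1_cube_0[OF t'(1) d(1)] d(2) \<tau>1(1) by (auto simp: \<tau>1_def)
  have "abs (\<Phi> t' k - \<Phi> t k) <= 2*(l1 n (%j. t' j - t j) * K)"
   unfolding \<Phi>_def by (rule \<Phi>_Lipschitz[OF l _ k]) simp
  also have "... <= 2*((n * d') * K)"
   using t'(2) K sum_bounded_above[of "{..<n}" "%i. abs (t' i - t i)" d']
   by (intro mult_left_mono mult_right_mono) (auto simp: l1_def less_imp_le)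
  also have "... < (2*(n * K) + 1) * d'" using d' by (simp add: algebra_simps)
  also have "... = eps" using nK by (simp add: d'_def)
  finally show ?thesis .
 qed
 thus "EX d'>0. ALL t':cube n O0 d. (ALL i<n. abs (t' i - t i)<d') --> abs (\<Phi> t' k - \<Phi> t k)<eps" using d' by blast
qed

text \<open>A bootstrap. Continuity of \<open>\<Phi>\<close> makes the Jacobian continuous, so
  \<open>\<Phi>\<close> is C^1; the C^1 fields composed with it are then C^1, and so is the
  Jacobian.\<close>

lemma \<Phi>_pd:
 fixes d :: real
 assumes d: "0<d" "n * d<\<tau>1" "2 * Q*(n * d)<1" and k: "k<n"
 shows "pd n (cube n O0 d) (%t. \<Phi> t k) (D k)"
  and "!!i. i<n ==> EX G. pd n (cube n O0 d) (D k i) G"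
proof -
 have \<Phi>in: "\<Phi> t : U" if "t : cube n O0 d" for t
  using l1_cube_0[OF that d(1)] d(2) by (intro \<Phi>_U \<tau>1(1)) linarith
 have c\<Phi>: "continuous_on (cube n O0 d) \<Phi>"
  by (rule continuous_on_into_Euclidean[of n]) (use \<Phi>_cont[OF d(1,2)] Utop[OF \<Phi>in] in auto)
 have cS: "continuous_on (cube n O0 d) (\<Gamma> i l)" if "l<N" for i l
  using analytic_wrt_imp_der[OF sol_analytic[OF d(1,3) that]] unfolding \<Gamma>_def[abs_def] pd_def by (cases "i<n") auto
 have cw: "continuous_on (cube n O0 d) (%t. w l k (\<Phi> t))" if "l<N" for l
  by (rule continuous_on_compose2[OF _ c\<Phi>]) (use pdw[OF that k] \<Phi>in in \<open>auto simp: pd_def\<close>)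
 have pdk: "pd n (cube n O0 d) (%t. \<Phi> t k) (D k)" if k: "k<n" for k
  unfolding pd_def
 proof (intro conjI allI impI ballI)
  show "continuous_on (cube n O0 d) (%t. \<Phi> t k)" by (rule \<Phi>_cont[OF d(1,2) k])
  have cw: "continuous_on (cube n O0 d) (%t. w l k (\<Phi> t))" if "l<N" for l
   by (rule continuous_on_compose2[OF _ c\<Phi>]) (use pdw[OF that k] \<Phi>in in \<open>auto simp: pd_def\<close>)
  show "continuous_on (cube n O0 d) (D k i)" for i
   unfolding D_def[abs_def] by (intro continuous_on_sum continuous_on_mult cS cw) auto
  fix i t assume i: "i<n" and t: "t : cube n O0 d"
  have "l1 n t<\<tau>1" using l1_cube_0[OF t d(1)] d(2) by linarith
  from \<Phi>_partial[OF this i k] show "((%s. \<Phi> (t(i := s)) k) has_real_derivative D k i t) (at (t i))"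
   using i by (simp add: D_def \<Gamma>_def)
 qed
 show "pd n (cube n O0 d) (%t. \<Phi> t k) (D k)" by (rule pdk[OF k])
 fix i assume i: "i<n"
 have "EX G. pd n (cube n O0 d) (\<Gamma> i l) G" if "l<N" for l
  using analytic_wrt_imp_der[OF sol_analytic[OF d(1,3) that]] i unfolding \<Gamma>_def[abs_def] by auto
 then obtain G where G: "!!l. l<N ==> pd n (cube n O0 d) (\<Gamma> i l) (G l)" by metis
 show "EX G. pd n (cube n O0 d) (D k i) G"
  unfolding D_def[abs_def]
  by (rule exI, rule pd_sum[OF finite_lessThan], rule pd_mult[OF G pd_compose[OF pdw openU openin_cube]])
   (use k pdk \<Phi>in in auto)
qed

lemma exp_chart:
 obtains \<tau> W where "0<\<tau>" "!!t. t : cube n O0 \<tau> ==> \<Phi> t : U"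
  "!!k. k<n ==> pd n (cube n O0 \<tau>) (%t. \<Phi> t k) (D k)"
  "!!k i. k<n ==> i<n ==> EX G. pd n (cube n O0 \<tau>) (D k i) G"
  "!!t. t : cube n O0 \<tau> ==> fdet n (%i k. D k i t) ~= 0"
  "!!k i. k<N ==> i<n ==> an_pd n (cube n O0 \<tau>) (W k i)"
  "!!k m t. k<N ==> m<n ==> t : cube n O0 \<tau> ==> (\<Sum>i<n. W k i t * D m i t) = w k m (\<Phi> t)"
  "inj_on \<Phi> (cube n O0 \<tau>)"
  "!!f. an_dw n U w N f ==> EX \<tau>'>0. \<tau>' <= \<tau> &
    an_pd n (cube n O0 \<tau>') (%t. f (\<Phi> t))"
proof -
 interpret an: func_class n "%U f. an_pd n U f" by (rule func_class_analytic)
 interpret C1: func_class n "%U f. EX G. pd n U f G" by (rule func_class_C1)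
 have one: "0<(1::real)" by simp
 have "EX d>0. real n * d<\<tau>1 & 2 * Q*(real n * d)<1"
 proof -
  define R where "R = max (2 * Q) (1 / \<tau>1)"
  have R: "0<R" "2 * Q <= R" "1 / \<tau>1 <= R" using Q_pos by (simp_all add: R_def less_max_iff_disj)
  obtain d where d: "0<d" "R*(real n * d)<1"
   by (rule small_cube[OF openin_cube[of n O0 1] cube_center[OF O0_top one] less_imp_le[OF R(1)]])
  have nd: "0 <= real n * d" using d by simp
  have "2 * Q*(real n * d) <= R*(real n * d)" "1 / \<tau>1*(real n * d) <= R*(real n * d)" by (rule mult_right_mono[OF R(2) nd], rule mult_right_mono[OF R(3) nd])
  hence "2 * Q*(real n * d)<1" "1 / \<tau>1*(real n * d)<1" using d by linarith+
  thus ?thesis using d \<tau>1_pos by (intro exI[of _ d]) (auto simp: field_simps)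
 qed
 then obtain d where d: "0<d" "real n * d<\<tau>1" "2 * Q*(real n * d)<1" by blast
 have \<Gamma>an: "an_pd n (cube n O0 d) (\<Gamma> i l)" if "i<N" "l<N" for i l
  using sol_analytic[OF d(1,3) that(2)] unfolding \<Gamma>_def[abs_def] by (cases "i<n") auto
 have O0in: "O0 : cube n O0 d" by (rule cube_center[OF O0_top d(1)])
 show thesis
 proof (rule an.local_inverse_matrix[OF openin_cube O0in \<Gamma>an \<Gamma>_det_0])
  fix e1 I
  assume e1: "0<e1" "cube n O0 e1 \<subseteq> cube n O0 d"
   and I: "!!i j. i<N ==> j<N ==> an_pd n (cube n O0 e1) (I i j)"
   and I\<Gamma>: "!!i j x. i<N ==> j<N ==> x : cube n O0 e1 ==> (\<Sum>k<N. I i k x * \<Gamma> k j x) = (if i = j then 1 else 0)"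
  have D0: "D k i O0 = w i k x0" if "i<n" for i k
  proof -
   have "D k i O0 = (\<Sum>l<N. if l = i then w l k x0 else 0)"
    unfolding D_def using that by (intro sum.cong) (auto simp: \<Gamma>_def sol_0 \<Phi>_0)
   thus ?thesis using that nN by simp
  qed
  have DC1: "EX G. pd n (cube n O0 d) (D k i) G" if "i<n" "k<n" for i k
   using \<Phi>_pd(2)[OF d] that by blast
  have "fdet n (%i k. D k i O0) = fdet n (%i j. w i j x0)" by (rule fdet_cong) (simp add: D0)
  hence det0: "fdet n (%i k. D k i O0) ~= 0" using basis by simp
  show thesis
  proof (rule C1.local_inverse_matrix[where M="%i k. D k i", OF openin_cube O0in DC1 det0])
   fix e2 J
   assume e2: "0<e2" "cube n O0 e2 \<subseteq> cube n O0 d"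
    and JD2: "!!i j x. i<n ==> j<n ==> x : cube n O0 e2 ==> (\<Sum>k<n. J i k x * D j k x) = (if i = j then 1 else 0)"
    and JD: "!!i j x. i<n ==> j<n ==> x : cube n O0 e2 ==> (\<Sum>k<n. D k i x * J k j x) = (if i = j then 1 else 0)"
   \<comment> \<open>\<open>A\<close> bounds the row sums of the inverse Jacobian \<open>J\<close>
     at 0, and eps is chosen so that n A eps <= 1/2. A Jacobian that varies by less than eps on the
     cube then forces injectivity.\<close>
   define A where "A = 1 + (\<Sum>j<n. \<Sum>k<n. abs (J k j O0))"
   have A: "1 <= A" unfolding A_def by (simp add: sum_nonneg)
   define eps where "eps = 1/(2*(n + 1) * A)"
   have eps: "0<eps" using A by (simp add: eps_def)
   have Aeps: "A * eps = 1/(2*(real n + 1))"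
   proof -
    have "A ~= 0" "real n + 1 ~= 0" using A by auto
    thus ?thesis unfolding eps_def by (simp add: divide_simps)
   qed
   have nA: "n*(A * eps) <= 1/2" unfolding Aeps by (simp add: field_simps)
   have "EX e>0. ALL k<n. ALL i<n. cube n O0 e \<subseteq> cube n O0 d & (ALL y:cube n O0 e. abs (D k i y - D k i O0)<eps)"
   proof (intro ex_common_pos)
    fix k i assume "k<n" "i<n"
    hence "continuous_on (cube n O0 d) (D k i)" using DC1 by (auto simp: pd_def)
    from continuous_on_cube_bound[OF this openin_cube O0in eps]
    show "EX e>0. cube n O0 e \<subseteq> cube n O0 d & (ALL y:cube n O0 e. abs (D k i y - D k i O0)<eps)" by metis
   qed (use cube_mono in blast)+
   then obtain e3 where e3: "0<e3" "!!k i y. k<n ==> i<n ==> y : cube n O0 e3 ==> abs (D k i y - D k i O0)<eps"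
    by blast
   define \<tau> where "\<tau> = min (min d e1) (min e2 e3)"
   have \<tau>: "0<\<tau>" "\<tau> <= d" "\<tau> <= e1" "\<tau> <= e2" "\<tau> <= e3" using d e1 e2 e3 by (auto simp: \<tau>_def)
   note sub = cube_mono[OF \<tau>(2), of n O0] cube_mono[OF \<tau>(3), of n O0] cube_mono[OF \<tau>(4), of n O0] cube_mono[OF \<tau>(5), of n O0]
   have l\<tau>: "l1 n t<\<tau>1" if "t : cube n O0 \<tau>" for t
    using l1_cube_0[of t d] that sub(1) d by fastforce
   have pd\<tau>: "pd n (cube n O0 \<tau>) (%t. \<Phi> t k) (D k)" if "k<n" for k
    by (rule pd_subset[OF \<Phi>_pd(1)[OF d that] sub(1)])
   show thesis
   proof (rule that[where \<tau>=\<tau> and W=I])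
    show "0<\<tau>" by fact
    show "\<Phi> t : U" if "t : cube n O0 \<tau>" for t by (rule \<Phi>_U[OF \<tau>1(1)[OF l\<tau>[OF that]]])
    show "pd n (cube n O0 \<tau>) (%t. \<Phi> t k) (D k)" if "k<n" for k by (rule pd\<tau>[OF that])
    show "EX G. pd n (cube n O0 \<tau>) (D k i) G" if "k<n" "i<n" for k i
     using DC1[OF that(2,1)] pd_subset[OF _ sub(1)] by blast
    show "an_pd n (cube n O0 \<tau>) (I k i)" if "k<N" "i<n" for k i
     using that nN by (intro an.cl_subset[OF I sub(2) openin_cube]) auto
    show "fdet n (%i k. D k i t) ~= 0" if t: "t : cube n O0 \<tau>" for t
    proof (rule fdet_nonzero)
     fix v :: "nat => real" assume v: "!!i. i<n ==> (\<Sum>j<n. D j i t * v j) = 0"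
     have te: "t : cube n O0 e2" using t sub by blast
     have "v j = 0" if j: "j<n" for j
     proof -
      have "0 = (\<Sum>i<n. J j i t*(\<Sum>k<n. D k i t * v k))" using v by simp
      also have "... = (\<Sum>k<n. (\<Sum>i<n. J j i t * D k i t) * v k)"
       unfolding sum_distrib_left sum_distrib_right by (rule trans[OF sum.swap]) (simp add: mult.assoc)
      also have "... = (\<Sum>k<n. if k = j then v k else 0)"
       using JD2[OF j _ te] by (intro sum.cong) auto
      finally show ?thesis using j by simp
     qed
     thus "ALL j<n. v j = 0" by blast
    qed
    show "(\<Sum>i<n. I k i t * D m i t) = w k m (\<Phi> t)" if k: "k<N" and m: "m<n" and t: "t : cube n O0 \<tau>" for k m t
    proof -
     have te: "t : cube n O0 e1" using t sub by blast
     \<comment> \<open>The relation rows give 0 at the image point, so only the contributions of the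
       n partial derivatives survive in the product with the inverse matrix.\<close>
     have rel: "(\<Sum>l<N. \<Gamma> i l t * w l m (\<Phi> t)) = 0" if "n <= i" "i<N" for i
      using relation_transport[OF l\<tau>[OF t] rv_relation[OF that] m] that by (simp add: \<Gamma>_def)
     have "(\<Sum>i<n. I k i t * D m i t) = (\<Sum>i<N. I k i t*(\<Sum>l<N. \<Gamma> i l t * w l m (\<Phi> t)))"
      unfolding sum_split[of "%i. I k i t*(\<Sum>l<N. \<Gamma> i l t * w l m (\<Phi> t))"] using rel by (simp add: D_def)
     also have "... = (\<Sum>l<N. (\<Sum>i<N. I k i t * \<Gamma> i l t) * w l m (\<Phi> t))"
      unfolding sum_distrib_left sum_distrib_right by (rule trans[OF sum.swap]) (simp add: mult.assoc)
     also have "... = (\<Sum>l<N. if l = k then w l m (\<Phi> t) else 0)"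
      using I\<Gamma>[OF k _ te] by (intro sum.cong) auto
     finally show ?thesis using k by simp
    qed
    show "inj_on \<Phi> (cube n O0 \<tau>)"
    proof (rule inj_onI)
     fix t s assume t: "t : cube n O0 \<tau>" and s: "s : cube n O0 \<tau>" and eq: "\<Phi> t = \<Phi> s"
     define P where "P k \<xi> \<longleftrightarrow> (ALL i<n. \<xi> i : cube n O0 \<tau>) & \<Phi> t k - \<Phi> s k = (\<Sum>i<n. D k i (\<xi> i)*(t i - s i))" for k \<xi>
     define \<xi> where "\<xi> k = (SOME z. P k z)" for k
     have P: "P k (\<xi> k)" if "k<n" for k
      unfolding \<xi>_def
     proof (rule someI_ex[where P="P k"])
      show "EX z. P k z" unfolding P_def using pd_mvt_cube[OF pd\<tau>[OF that] s t order_refl] by blast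
     qed
     have \<xi>: "!!k i. k<n ==> i<n ==> \<xi> k i : cube n O0 \<tau>"
      "!!k. k<n ==> \<Phi> t k - \<Phi> s k = (\<Sum>i<n. D k i (\<xi> k i)*(t i - s i))"
      using P unfolding P_def by blast+
     \<comment> \<open>Compare the mean value expansion of \<Phi> t - \<Phi> s = 0 with its Jacobian
       at 0 and apply the inverse \<open>J\<close>. Summed over j this bounds the l1 distance of t
       and s by half of itself.\<close>
     have bj: "abs (t j - s j) <= (A * eps)*(\<Sum>i<n. abs (t i - s i))" if j: "j<n" for j
     proof -
      have "0 = (\<Sum>k<n. J k j O0*(\<Phi> t k - \<Phi> s k))" by (simp add: eq)
      also have "... = (\<Sum>k<n. J k j O0*(\<Sum>i<n. D k i (\<xi> k i)*(t i - s i)))"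
       using \<xi>(2) by (intro sum.cong) auto
      also have "... = (\<Sum>i<n. (\<Sum>k<n. D k i O0 * J k j O0)*(t i - s i)) +
        (\<Sum>i<n. (\<Sum>k<n. J k j O0*(D k i (\<xi> k i) - D k i O0))*(t i - s i))"
      proof -
       have "(\<Sum>k<n. J k j O0*(\<Sum>i<n. D k i (\<xi> k i)*(t i - s i))) = (\<Sum>i<n. (\<Sum>k<n. J k j O0 * D k i (\<xi> k i))*(t i - s i))"
        unfolding sum_distrib_left sum_distrib_right by (rule trans[OF sum.swap]) (simp add: mult.assoc)
       also have "... = (\<Sum>i<n. ((\<Sum>k<n. D k i O0 * J k j O0) + (\<Sum>k<n. J k j O0*(D k i (\<xi> k i) - D k i O0)))*(t i - s i))"
        by (simp add: sum.distrib[symmetric] algebra_simps)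
       finally show ?thesis by (simp add: distrib_right sum.distrib)
      qed
      also have "(\<Sum>i<n. (\<Sum>k<n. D k i O0 * J k j O0)*(t i - s i)) = (\<Sum>i<n. if i = j then t i - s i else 0)"
       using JD[OF _ j cube_center[OF O0_top e2(1)]] by (intro sum.cong) auto
      also have "... = t j - s j" using j by simp
      finally have "abs (t j - s j) = abs (\<Sum>i<n. (\<Sum>k<n. J k j O0*(D k i (\<xi> k i) - D k i O0))*(t i - s i))" by linarith
      also have "... <= (\<Sum>i<n. (A * eps) * abs (t i - s i))"
      proof (rule order_trans[OF sum_abs], rule sum_mono)
       fix i assume "i : {..<n}"
       hence i: "i<n" by simp
       have "abs (\<Sum>k<n. J k j O0*(D k i (\<xi> k i) - D k i O0)) <= (\<Sum>k<n. abs (J k j O0) * eps)"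
       proof (rule order_trans[OF sum_abs], rule sum_mono)
        fix k assume "k : {..<n}"
        hence k: "k<n" by simp
        have "\<xi> k i : cube n O0 e3" using \<xi>(1)[OF k i] sub by blast
        thus "abs (J k j O0*(D k i (\<xi> k i) - D k i O0)) <= abs (J k j O0) * eps"
         unfolding abs_mult using e3(2)[OF k i] by (intro mult_left_mono) (auto intro: less_imp_le)
       qed
       also have "... = (\<Sum>k<n. abs (J k j O0)) * eps" by (simp add: sum_distrib_right)
       also have "... <= A * eps"
       proof (rule mult_right_mono)
        have "(\<Sum>k<n. abs (J k j O0)) <= (\<Sum>j<n. \<Sum>k<n. abs (J k j O0))"
         using j by (intro member_le_sum[of j "{..<n}" "%j. \<Sum>k<n. abs (J k j O0)"]) (auto intro: sum_nonneg)
        thus "(\<Sum>k<n. abs (J k j O0)) <= A" by (simp add: A_def)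
       qed (use eps in simp)
       finally show "abs ((\<Sum>k<n. J k j O0*(D k i (\<xi> k i) - D k i O0))*(t i - s i)) <= A * eps * abs (t i - s i)"
        unfolding abs_mult by (rule mult_right_mono) simp
      qed
      finally show ?thesis by (simp add: sum_distrib_left)
     qed
     define S where "S = (\<Sum>i<n. abs (t i - s i))"
     have S0: "0 <= S" unfolding S_def by (rule sum_nonneg) simp
     have "S <= (\<Sum>j<n. (A * eps) * S)" unfolding S_def using bj by (intro sum_mono) auto
     also have "... = (n*(A * eps)) * S" by simp
     also have "... <= (1/2) * S" by (rule mult_right_mono[OF nA S0])
     finally have "S = 0" using S0 by simp
     hence "ALL i<n. t i = s i" unfolding S_def by (subst (asm) sum_nonneg_eq_0_iff) auto
     thus "t = s" using t s by (auto simp: cube_def fun_eq_iff) (metis not_less)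
    qed
    show "EX \<tau>'>0. \<tau>' <= \<tau> & an_pd n (cube n O0 \<tau>') (%t. f (\<Phi> t))"
     if f: "an_dw n U w N f" for f
    proof -
     obtain Kf Rf where KR: "0 <= Kf" "0<Rf" "!!k. maj U N (dw n U w N) k (geom Kf Rf) f"
      using f unfolding analytic_wrt_def by blast
     have R2: "0 <= 2 * Rf" using KR(2) by simp
     \<comment> \<open>The domain of the Taylor expansion depends on the rate of f, hence the radius
       is chosen only after f.\<close>
     obtain \<rho> where \<rho>: "0<\<rho>" "2 * Rf*(real n * \<rho>)<1"
      by (rule small_cube[OF openin_cube[of n O0 1] cube_center[OF O0_top one] R2])
     define \<tau>' where "\<tau>' = min \<tau> \<rho>"
     have \<tau>': "0<\<tau>'" "\<tau>' <= \<tau>" "\<tau>' <= \<rho>" using \<tau> \<rho> by (auto simp: \<tau>'_def)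
     have "2 * Rf*(n * \<tau>') <= 2 * Rf*(n * \<rho>)" using R2 \<tau>' by (intro mult_left_mono) auto
     hence R\<tau>: "2 * Rf*(n * \<tau>')<1" using \<rho> by linarith
     have "an_pd n (cube n O0 \<tau>') (wseries n (tc f) O0)"
      by (rule wseries_analytic[OF tc_bound[OF KR(3)] KR(1,2) \<tau>'(1) R\<tau>])
     moreover have "f (\<Phi> t) = wseries n (tc f) O0 t" if t: "t : cube n O0 \<tau>'" for t
     proof -
      have t\<tau>: "t : cube n O0 \<tau>" using t cube_mono[OF \<tau>'(2)] by blast
      have "Rf * l1 n t <= Rf*(n * \<tau>')" using l1_cube_0[OF t \<tau>'(1)] KR(1,2) by (intro mult_left_mono) auto
      moreover have "0 <= Rf*(n * \<tau>')" using KR(1,2) \<tau>' by simp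
      ultimately have "Rf * l1 n t<1" using R\<tau> by linarith
      from taylor[OF KR(3) less_imp_le[OF KR(2)] \<tau>1(1)[OF l\<tau>[OF t\<tau>]] this]
      show ?thesis by (simp add: wseries_def sums_iff)
     qed
     ultimately have "an_pd n (cube n O0 \<tau>') (%t. f (\<Phi> t))"
      by (rule derivation_system.an_cong[OF derivation_pd[OF openin_cube]])
     thus ?thesis using \<tau>' by blast
    qed
   qed
  qed
 qed
qed

end

subsection \<open>Differentiability from derivatives along flows\<close>

lemma family_bound:
 fixes h :: "nat => nat => rn => real"
 assumes U: "openE n U" and x0: "x0 : U"
  and h: "!!i j. i<a ==> j<b ==> continuous_on U (h i j)"
 obtains e B where "0<e" "0 <= B" "cube n x0 e \<subseteq> U"
  "!!i j y. i<a ==> j<b ==> y : cube n x0 e ==> abs (h i j y) <= B"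
proof -
 have "EX e>0. ALL i<a. ALL j<b. ALL y:cube n x0 e. abs (h i j y - h i j x0)<1"
 proof (intro ex_common_pos)
  fix i j assume ij: "i<a" "j<b"
  show "EX e>0. ALL y:cube n x0 e. abs (h i j y - h i j x0)<1"
  proof (rule continuous_on_cube_bound[where eps=1, OF h[OF ij] U x0])
   fix d :: real assume "0<d" "!!y. y : cube n x0 d ==> abs (h i j y - h i j x0)<1"
   thus ?thesis by blast
  qed simp
 qed (use cube_mono in blast)+
 then obtain e1 where e1: "e1 > 0" "!!i j y. i<a ==> j<b ==> y : cube n x0 e1 ==> abs (h i j y - h i j x0)<1"
  by blast
 obtain e2 where e2: "e2 > 0" "cube n x0 e2 \<subseteq> U" using open_cubeE[OF U x0] by blast
 define B where "B = 1 + (\<Sum>i<a. \<Sum>j<b. abs (h i j x0))"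
 show ?thesis
 proof (rule that[of "min e1 e2" B])
  show "0 <= B" unfolding B_def by (intro add_nonneg_nonneg sum_nonneg) auto
  show "cube n x0 (min e1 e2) \<subseteq> U" using e2 cube_mono[of "min e1 e2" e2 n x0] by auto
  fix i j y assume ij: "i<a" "j<b" and y: "y : cube n x0 (min e1 e2)"
  have "abs (h i j x0) <= (\<Sum>j<b. abs (h i j x0))" using ij by (intro member_le_sum) auto
  also have "... <= (\<Sum>i<a. \<Sum>j<b. abs (h i j x0))"
   using ij by (intro member_le_sum[of i "{..<a}" "%i. \<Sum>j<b. abs (h i j x0)"]) (auto intro: sum_nonneg)
  finally have "abs (h i j x0) <= B - 1" by (simp add: B_def)
  moreover have "abs (h i j y - h i j x0)<1" using e1(2)[OF ij] y cube_mono[of "min e1 e2" e1 n x0] by auto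
  ultimately show "abs (h i j y) <= B" by linarith
 qed (use e1 e2 in auto)
qed

text \<open>A continuous function with continuous derivatives along the flows of spanning fields is
 Lipschitz: two nearby points are joined up to a quadratic error by flowing along the fields one
 after the other, and iterating halves the distance each time. The same approximation then gives
 the partial derivatives.\<close>

locale flow_diff =
 fixes n q :: nat and w :: "nat => nat => rn => real" and x0 :: rn and e K L B BG T :: real
  and f :: "rn => real" and G :: "nat => rn => real" and \<beta> :: "nat => nat => rn => real"
 assumes e: "0<e" and K: "0 <= K" and L: "0 <= L" and B: "0 <= B" and BG: "0 <= BG"
  and T: "0<T" "K * T <= e/4" "n * L * T <= 1/2"
  and wK: "!!j i y. j<q ==> i<n ==> y : cube n x0 e ==> abs (w j i y) <= K"
  and wL: "!!j i y z. j<q ==> i<n ==> y : cube n x0 e ==> z : cube n x0 e ==>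
   abs (w j i y - w j i z) <= L*(\<Sum>k<n. abs (y k - z k))"
  and f: "continuous_on (cube n x0 e) f" and Gc: "!!j. j<q ==> continuous_on (cube n x0 e) (G j)"
  and GB: "!!j y. j<q ==> y : cube n x0 e ==> abs (G j y) <= BG"
  and \<beta>c: "!!m j. m<n ==> j<q ==> continuous_on (cube n x0 e) (\<beta> m j)"
  and \<beta>B: "!!m j y. m<n ==> j<q ==> y : cube n x0 e ==> abs (\<beta> m j y) <= B"
  and \<beta>w: "!!m i y. m<n ==> i<n ==> y : cube n x0 e ==> (\<Sum>j<q. \<beta> m j y * w j i y) = (if m = i then 1 else 0)"
  and fl: "!!x j cu T. x : cube n x0 e ==> j<q ==> 0<T ==> cu 0 = x ==> (!!t. abs t<T ==> cu t : cube n x0 e) ==>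
   (!!t i. abs t<T ==> i<n ==> ((%s. cu s i) has_real_derivative w j i (cu t)) (at t)) ==>
   ((%t. f (cu t)) has_real_derivative G j x) (at 0)"
begin

text \<open>The hypothesis on f speaks of time 0 only. Restarting the curve at time t carries it to
  every time.\<close>

lemma fl_shift:
 assumes j: "j<q" and cu: "!!t. abs t<T' ==> cu t : cube n x0 e"
  "!!t i. abs t<T' ==> i<n ==> ((%s. cu s i) has_real_derivative w j i (cu t)) (at t)" and t: "abs t<T'"
 shows "((%s. f (cu s)) has_real_derivative G j (cu t)) (at t)"
proof -
 have in': "abs (s + t)<T'" if "abs s<T' - abs t" for s using that by linarith
 have "((%s. f (cu (s + t))) has_real_derivative G j (cu t)) (at 0)"
 proof (rule fl[where cu="%s. cu (s + t)" and T="T' - abs t"])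
  show "((%r. cu (r + t) i) has_real_derivative w j i (cu (s + t))) (at s)" if "abs s<T' - abs t" "i<n" for s i
   using cu(2)[OF in'[OF that(1)] that(2)] DERIV_shift[of "%r. cu r i" _ s t] by simp
 qed (use j cu(1) in' t in auto)
 thus ?thesis using DERIV_shift[of "%s. f (cu s)" "G j (cu t)" 0 t] by simp
qed

text \<open>Two errors of size n L K \<sigma> arise per unit of flow time: the bending of the leg
  itself and the displacement of its starting point from x.\<close>

definition "C2 = 2 * n * L * K"

lemma C2: "0 <= C2" using L K by (simp add: C2_def)

lemma quarter: "x : cube n x0 (e/4) ==> (!!i. i<n ==> abs (p i - x i) <= d) ==> d<e/4 ==> (!!i. n <= i ==> p i = 0) ==>
  p : cube n x0 (e/2)"
 unfolding cube_def
proof (clarsimp)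
 fix i assume "ALL i<n. abs (x i - x0 i)*4<e" "!!i. i<n ==> abs (p i - x i) <= d" "d*4<e" "i<n"
 hence "abs (x i - x0 i)*4<e" "abs (p i - x i) <= d" by auto
 thus "abs (p i - x0 i)*2<e" using \<open>d*4<e\<close> abs_triangle_ineq[of "p i - x i" "x i - x0 i"] by simp
qed

text \<open>Flow along the fields in turn, along the j-th for time \<open>s j\<close>. On each leg
  the mean value theorem turns the change of f into a value of G at some point \<open>z j\<close> of
  that leg.\<close>

lemma multistep:
 assumes x: "x : cube n x0 (e/4)" and \<sigma>: "(\<Sum>j<q. abs (s j)) <= \<sigma>" "\<sigma><T" "K * \<sigma><e/4"
 shows "N <= q ==> EX p z. (ALL i>=n. p i = 0) & (ALL i<n. abs (p i - x i) <= K*(\<Sum>j<N. abs (s j))) &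
  (ALL i<n. abs (p i - x i - (\<Sum>j<N. s j * w j i x)) <= C2 * \<sigma>*(\<Sum>j<N. abs (s j))) &
  f p - f x = (\<Sum>j<N. s j * G j (z j)) & (ALL j<N. z j : cube n x0 e & (ALL i<n. abs (z j i - x i) <= K * \<sigma>))"
proof (induction N)
 case 0
 thus ?case using x by (intro exI[of _ x]) (auto simp: cube_def)
next
 case (Suc N)
 then obtain p z where p0: "!!i. n <= i ==> p i = 0" and pK: "!!i. i<n ==> abs (p i - x i) <= K*(\<Sum>j<N. abs (s j))"
  and pC: "!!i. i<n ==> abs (p i - x i - (\<Sum>j<N. s j * w j i x)) <= C2 * \<sigma>*(\<Sum>j<N. abs (s j))"
  and fp: "f p - f x = (\<Sum>j<N. s j * G j (z j))"
  and z: "!!j. j<N ==> z j : cube n x0 e & (ALL i<n. abs (z j i - x i) <= K * \<sigma>)" by auto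
 have N: "N<q" using Suc.prems by simp
 have sub: "(\<Sum>j<Suc N. abs (s j)) <= \<sigma>"
  using sum_mono2[of "{..<q}" "{..<Suc N}" "%j. abs (s j)"] N \<sigma>(1) by auto
 have pos: "0 <= (\<Sum>j<N. abs (s j))" by (rule sum_nonneg) simp
 have sN: "abs (s N) <= \<sigma>" "(\<Sum>j<N. abs (s j)) <= \<sigma>"
  using sub pos abs_ge_zero[of "s N"] unfolding sum.lessThan_Suc by (linarith, linarith)
 have \<sigma>0: "0 <= \<sigma>" using sN(1) by linarith
 have pK': "abs (p i - x i) <= K * \<sigma>" if "i<n" for i
  using pK[OF that] mult_left_mono[OF sN(2) K] by linarith
 have pin: "p : cube n x0 (e/2)" by (rule quarter[OF x pK' \<sigma>(3) p0])
 have xe: "x : cube n x0 e" "p : cube n x0 e" using x pin cube_mono[of "e/4" e n x0] cube_mono[of "e/2" e n x0] e by auto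
 obtain cu where cu: "cu 0 = p" "!!t. abs t<T ==> cu t : cube n x0 e"
  "!!t i. abs t<T ==> i<n ==> ((%s. cu s i) has_real_derivative w N i (cu t)) (at t)"
  by (rule local_solution[of e n x0 "%y i. w N i y" K L T p]) (use e K L T wK[OF N] wL[OF N] pin in auto)
 let ?I = "{- abs (s N)..abs (s N)}"
 have I: "abs t<T" if "t : ?I" for t using that sN \<sigma>(2) by auto
 have g1: "abs (cu t i - p i) <= K * abs t" if t: "t : ?I" and i: "i<n" for t i
 proof -
  have "abs (cu t i - cu 0 i) <= K * abs (t - 0)"
  proof (rule deriv_bound_segment[OF _ _ _ t])
   show "((%t. cu t i) has_real_derivative w N i (cu t)) (at t within ?I)" if "t : ?I" for t
    by (rule has_field_derivative_at_within[OF cu(3)[OF I[OF that] i]])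
   show "abs (w N i (cu t)) <= K" if "t : ?I" for t by (rule wK[OF N i cu(2)[OF I[OF that]]])
  qed auto
  thus ?thesis by (simp add: cu(1))
 qed
 have g2: "abs (cu (s N) i - p i - s N * w N i p) <= (L*(n*(K * abs (s N)))) * abs (s N)" if i: "i<n" for i
 proof -
  have "abs ((cu (s N) i - s N * w N i p) - (cu 0 i - 0 * w N i p)) <= (L*(n*(K * abs (s N)))) * abs (s N - 0)"
  proof (rule deriv_bound_segment[where a="- abs (s N)" and b="abs (s N)"])
   fix t assume t: "t : ?I"
   have "((%t. cu t i - t * w N i p) has_real_derivative w N i (cu t) - 1 * w N i p) (at t)"
    by (intro DERIV_diff cu(3) I t i DERIV_cmult_right DERIV_ident)
   thus "((%t. cu t i - t * w N i p) has_real_derivative (w N i (cu t) - w N i p)) (at t within ?I)"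
    by (simp add: has_field_derivative_at_within)
   have "abs (w N i (cu t) - w N i p) <= L*(\<Sum>k<n. abs (cu t k - p k))" by (rule wL[OF N i cu(2)[OF I[OF t]] xe(2)])
   also have "... <= L*(\<Sum>k<n. K * abs (s N))"
   proof (intro mult_left_mono L sum_mono)
    fix k assume "k : {..<n}"
    hence "abs (cu t k - p k) <= K * abs t" using g1[OF t] by simp
    also have "... <= K * abs (s N)" using t by (intro mult_left_mono K) auto
    finally show "abs (cu t k - p k) <= K * abs (s N)" .
   qed
   finally show "abs (w N i (cu t) - w N i p) <= L*(n*(K * abs (s N)))" by simp
  qed auto
  thus ?thesis by (simp add: cu(1))
 qed
 have "EX t. min 0 (s N) <= t & t <= max 0 (s N) & f (cu (s N)) - f (cu 0) = G N (cu t)*(s N - 0)"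
 proof (rule mvt_between)
  fix t assume "min 0 (s N) <= t" "t <= max 0 (s N)"
  hence "abs t<T" by (intro I) auto
  thus "((%t. f (cu t)) has_real_derivative G N (cu t)) (at t)" by (intro fl_shift[where T'=T, OF N]) (use cu in auto)
 qed
 then obtain t where t: "min 0 (s N) <= t" "t <= max 0 (s N)" "f (cu (s N)) - f p = G N (cu t) * s N" by (auto simp: cu(1))
 have tI: "t : ?I" "s N : ?I" using t by auto
 have zb: "abs (cu t i - x i) <= K*(\<Sum>j<Suc N. abs (s j))" if t: "t : ?I" and i: "i<n" for t i
 proof -
  have "abs (cu t i - x i) <= K * abs t + K*(\<Sum>j<N. abs (s j))" using g1[OF t i] pK[OF i] by linarith
  also have "K * abs t <= K * abs (s N)" using t by (intro mult_left_mono K) auto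
  finally show ?thesis by (simp add: algebra_simps)
 qed
 show ?case
 proof (intro exI[of _ "cu (s N)"] exI[of _ "z(N := cu t)"] conjI allI impI)
  show "cu (s N) i = 0" if "n <= i" for i using cu(2)[OF I[OF tI(2)]] that by (auto simp: cube_def)
  show "abs (cu (s N) i - x i) <= K*(\<Sum>j<Suc N. abs (s j))" if "i<n" for i by (rule zb[OF tI(2) that])
  show "f (cu (s N)) - f x = (\<Sum>j<Suc N. s j * G j ((z(N := cu t)) j))" using fp t(3) by (simp add: mult.commute)
  show "(z(N := cu t)) j : cube n x0 e" if "j<Suc N" for j
   using z[of j] cu(2)[OF I[OF tI(1)]] that by (auto simp: less_Suc_eq)
  show "abs ((z(N := cu t)) j i - x i) <= K * \<sigma>" if "j<Suc N" "i<n" for j i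
   using z[of j] zb[OF tI(1) that(2)] mult_left_mono[OF sub K] that by (auto simp: less_Suc_eq)
  show "abs (cu (s N) i - x i - (\<Sum>j<Suc N. s j * w j i x)) <= C2 * \<sigma>*(\<Sum>j<Suc N. abs (s j))" if i: "i<n" for i
  proof -
   have "abs (w N i p - w N i x) <= L*(\<Sum>k<n. abs (p k - x k))" by (rule wL[OF N i xe(2,1)])
   also have "... <= L*(\<Sum>k<n. K * \<sigma>)" using pK' by (intro mult_left_mono L sum_mono) auto
   finally have "abs (s N) * abs (w N i p - w N i x) <= abs (s N)*(L*(n*(K * \<sigma>)))" by (intro mult_left_mono) auto
   hence a: "abs (s N * w N i p - s N * w N i x) <= abs (s N)*(L*(n*(K * \<sigma>)))"
    by (simp add: abs_mult[symmetric] right_diff_distrib)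
   have "(L*(n*(K * abs (s N)))) * abs (s N) <= (L*(n*(K * \<sigma>))) * abs (s N)"
    using sN L K by (intro mult_right_mono mult_left_mono) auto
   hence b: "abs (cu (s N) i - p i - s N * w N i p) <= (L*(n*(K * \<sigma>))) * abs (s N)" using g2[OF i] by linarith
   have "abs (cu (s N) i - x i - (\<Sum>j<Suc N. s j * w j i x)) <=
     abs (cu (s N) i - p i - s N * w N i p) + abs (s N * w N i p - s N * w N i x) + abs (p i - x i - (\<Sum>j<N. s j * w j i x))"
    by simp
   also have "... <= (L*(n*(K * \<sigma>))) * abs (s N) + abs (s N)*(L*(n*(K * \<sigma>))) + C2 * \<sigma>*(\<Sum>j<N. abs (s j))"
    using a b pC[OF i] by linarith
   also have "... = C2 * \<sigma>*(\<Sum>j<Suc N. abs (s j))" by (simp add: C2_def algebra_simps)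
   finally show ?thesis .
  qed
 qed
qed

text \<open>Ratio between the total flow time and the l1 norm of the displacement aimed at.\<close>

definition "M = q * B"

lemma M: "0 <= M" using B by (simp add: M_def)

text \<open>As \<open>\<beta>\<close> is dual to the fields, combining its rows with weights v gives
  flow times whose first-order displacement is v. The total time is of order v, so the target x + v
  is missed by a quadratic amount.\<close>

lemma aim:
 assumes x: "x : cube n x0 (e/4)" and v: "M * l1 n v<T" "K*(M * l1 n v)<e/4"
 obtains p z where "!!i. n <= i ==> p i = 0" "l1 n (%i. p i - (x i + v i)) <= n*(C2 * M\<^sup>2)*(l1 n v)\<^sup>2"
  "f p - f x = (\<Sum>j<q. (\<Sum>m<n. v m * \<beta> m j x) * G j (z j))"
  "!!j. j<q ==> z j : cube n x0 e" "!!j i. j<q ==> i<n ==> abs (z j i - x i) <= K*(M * l1 n v)"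
  "(\<Sum>j<q. abs (\<Sum>m<n. v m * \<beta> m j x)) <= M * l1 n v"
proof -
 have xe: "x : cube n x0 e" using x cube_mono[of "e/4" e n x0] e by auto
 define s where "s j = (\<Sum>m<n. v m * \<beta> m j x)" for j
 have sb: "abs (s j) <= l1 n v * B" if "j<q" for j
  unfolding s_def l1_def sum_distrib_right using \<beta>B[OF _ that xe]
  by (intro order_trans[OF sum_abs] sum_mono) (auto simp: abs_mult intro!: mult_left_mono)
 have "(\<Sum>j<q. abs (s j)) <= (\<Sum>j<q. l1 n v * B)" using sb by (intro sum_mono) auto
 hence \<sigma>: "(\<Sum>j<q. abs (s j)) <= M * l1 n v" by (simp add: M_def mult_ac)
 obtain p z where p: "!!i. n <= i ==> p i = 0"
  "!!i. i<n ==> abs (p i - x i - (\<Sum>j<q. s j * w j i x)) <= C2*(M * l1 n v)*(\<Sum>j<q. abs (s j))"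
  "f p - f x = (\<Sum>j<q. s j * G j (z j))"
  "!!j. j<q ==> z j : cube n x0 e & (ALL i<n. abs (z j i - x i) <= K*(M * l1 n v))"
  using multistep[OF x \<sigma> v order_refl] by blast
 have sw: "(\<Sum>j<q. s j * w j i x) = v i" if i: "i<n" for i
 proof -
  have "(\<Sum>j<q. s j * w j i x) = (\<Sum>m<n. v m*(\<Sum>j<q. \<beta> m j x * w j i x))"
   unfolding s_def sum_distrib_left sum_distrib_right by (rule trans[OF sum.swap]) (simp add: mult.assoc)
  also have "... = (\<Sum>m<n. if m = i then v m else 0)" using \<beta>w[OF _ i xe] by (intro sum.cong) auto
  finally show ?thesis using i by simp
 qed
 show ?thesis
 proof (rule that[of p z])
  have "abs (p i - (x i + v i)) <= C2 * M\<^sup>2*(l1 n v)\<^sup>2" if "i<n" for i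
  proof -
   have "abs (p i - (x i + v i)) <= C2*(M * l1 n v)*(\<Sum>j<q. abs (s j))" using p(2)[OF that] sw[OF that] by (simp add: algebra_simps)
   also have "... <= C2*(M * l1 n v)*(M * l1 n v)" using C2 M l1_nonneg by (intro mult_left_mono[OF \<sigma>]) auto
   finally show ?thesis by (simp add: power2_eq_square mult_ac)
  qed
  hence "l1 n (%i. p i - (x i + v i)) <= (\<Sum>i<n. C2 * M\<^sup>2*(l1 n v)\<^sup>2)" unfolding l1_def[of n "%i. p i - (x i + v i)"] by (intro sum_mono) auto
  thus "l1 n (%i. p i - (x i + v i)) <= n*(C2 * M\<^sup>2)*(l1 n v)\<^sup>2" by (simp add: mult_ac)
 qed (use p \<sigma> in \<open>auto simp: s_def\<close>)
qed

text \<open>The fourth inequality makes the quadratic miss at most half of the distance to the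
  target; the others keep the flow inside the cube.\<close>

lemma small_radius:
 obtains r where "0<r" "M * r<T" "K*(M * r)<e/4" "n*(C2 * M\<^sup>2) * r <= 1/2" "r<e/16"
proof -
 define a where "a = min (min (T/(M + 1)) (e/(4*(K * M + 1)))) (min (1/(2*(n*(C2 * M\<^sup>2) + 1))) (e/16))"
 have KM: "0 <= K * M" "0 <= n*(C2 * M\<^sup>2)" using K M C2 by auto
 have a0: "0<a" unfolding a_def using T(1) M e KM by (simp add: add_nonneg_pos)
 have "a <= T/(M + 1)" "a <= e/(4*(K * M + 1))" "a <= 1/(2*(n*(C2 * M\<^sup>2) + 1))" "a <= e/16"
  unfolding a_def by (simp_all only: min_le_iff_disj order_refl simp_thms)
 hence b: "a*(M + 1) <= T" "a*(4*(K * M + 1)) <= e" "a*(2*(n*(C2 * M\<^sup>2) + 1)) <= 1" "a <= e/16"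
  using M KM by (auto simp: pos_le_divide_eq add_nonneg_pos)
 define r where "r = a/2"
 have r: "0<r" "a = 2 * r" using a0 by (auto simp: r_def)
 have nn: "0 <= r * M" "0 <= r*(K * M)" "0 <= r*(n*(C2 * M\<^sup>2))" using r M KM by auto
 show ?thesis
  by (rule that[of r]) (use r b nn in \<open>auto simp: algebra_simps\<close>)
qed

lemma coord_le_l1: "i<n ==> abs (a i) <= l1 n a"
 unfolding l1_def by (intro member_le_sum) auto

lemma Lipschitz_f:
 assumes r: "0<r" "M * r<T" "K*(M * r)<e/4" "n*(C2 * M\<^sup>2) * r <= 1/2" "r<e/16"
  and y: "y : cube n x0 (e/8)" and x: "x : spaceE n" and xy: "l1 n (%i. x i - y i) <= r"
 shows "abs (f x - f y) <= 2*(M * BG) * l1 n (%i. x i - y i)"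
proof -
 let ?C = "M * BG"
 have half: "EX p:spaceE n. l1 n (%i. p i - y i) <= l1 n (%i. x i - y i)/2 &
   abs (f p - f x) <= ?C * l1 n (%i. x i - y i)"
  if x: "x : spaceE n" and xy: "l1 n (%i. x i - y i) <= r" for x
 proof -
  define v where "v = (%i. y i - x i)"
  have lv: "l1 n v = l1 n (%i. x i - y i)" unfolding l1_def v_def by (simp add: abs_minus_commute)
  have x4: "x : cube n x0 (e/4)"
  proof -
   have "abs (x i - x0 i)<e/4" if "i<n" for i
   proof -
    have "abs (x i - y i) <= r" using coord_le_l1[OF that, of "%i. x i - y i"] xy by simp
    moreover have "abs (y i - x0 i)<e/8" using y that by (auto simp: cube_def)
    ultimately show ?thesis using r(5) e by linarith
   qed
   thus ?thesis using x by (auto simp: cube_def topspace_Euclidean_space)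
  qed
  have "M * l1 n v <= M * r" using M xy lv by (intro mult_left_mono) auto
  hence v: "M * l1 n v<T" "K*(M * l1 n v)<e/4"
   using r mult_left_mono[of "M * l1 n v" "M * r" K] K by linarith+
  show ?thesis
  proof (rule aim[OF x4 v])
  fix p z assume p: "!!i. n <= i ==> p i = 0"
   "l1 n (%i. p i - (x i + v i)) <= n*(C2 * M\<^sup>2)*(l1 n v)\<^sup>2"
   "f p - f x = (\<Sum>j<q. (\<Sum>m<n. v m * \<beta> m j x) * G j (z j))" "!!j. j<q ==> z j : cube n x0 e"
   "!!j i. j<q ==> i<n ==> abs (z j i - x i) <= K*(M * l1 n v)"
   "(\<Sum>j<q. abs (\<Sum>m<n. v m * \<beta> m j x)) <= M * l1 n v"
  have "l1 n (%i. p i - y i) <= (n*(C2 * M\<^sup>2) * l1 n v) * l1 n v"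
   using p(2) by (simp add: v_def power2_eq_square mult.assoc)
  also have "... <= (1/2) * l1 n v"
  proof (rule mult_right_mono[OF _ l1_nonneg])
   have "n*(C2 * M\<^sup>2) * l1 n v <= n*(C2 * M\<^sup>2) * r" using C2 xy lv by (intro mult_left_mono) auto
   thus "n*(C2 * M\<^sup>2) * l1 n v <= 1/2" using r(4) by linarith
  qed
  finally have 1: "l1 n (%i. p i - y i) <= l1 n (%i. x i - y i)/2" using lv by simp
  have "abs (f p - f x) <= (\<Sum>j<q. abs (\<Sum>m<n. v m * \<beta> m j x) * BG)"
   unfolding p(3) using GB p(4) by (intro order_trans[OF sum_abs] sum_mono) (auto simp: abs_mult intro!: mult_left_mono)
  also have "... <= (M * l1 n v) * BG" unfolding sum_distrib_right[symmetric] by (rule mult_right_mono[OF p(6) BG])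
  finally have "abs (f p - f x) <= ?C * l1 n (%i. x i - y i)" by (simp add: lv mult_ac)
  thus ?thesis using 1 p(1) by (auto simp: topspace_Euclidean_space)
  qed
 qed
 let ?d = "l1 n (%i. x i - y i)"
 have d0: "0 <= ?d" by (rule l1_nonneg)
 have C0: "0 <= ?C" using M BG by simp
 \<comment> \<open>The factor 1 - 1/2^k is the partial sum of the halved step lengths; its limit
   accounts for the 2 in the Lipschitz constant.\<close>
 have it: "EX p:spaceE n. l1 n (%i. p i - y i) <= ?d/2 ^ k & abs (f p - f x) <= 2 * ?C * ?d*(1 - 1/2 ^ k)" for k
 proof (induction k)
  case 0
  thus ?case using x by (intro bexI[of _ x]) auto
 next
  case (Suc k)
  then obtain p where p: "p : spaceE n" "l1 n (%i. p i - y i) <= ?d/2 ^ k"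
   "abs (f p - f x) <= 2 * ?C * ?d*(1 - 1/2 ^ k)" by blast
  have "?d/2 ^ k <= ?d/1" using d0 by (intro divide_left_mono) auto
  hence "l1 n (%i. p i - y i) <= r" using p(2) xy by simp
  from half[OF p(1) this] obtain p' where p': "p' : spaceE n"
   "l1 n (%i. p' i - y i) <= l1 n (%i. p i - y i)/2" "abs (f p' - f p) <= ?C * l1 n (%i. p i - y i)" by blast
  have "abs (f p' - f p) <= ?C*(?d/2 ^ k)" using p'(3) mult_left_mono[OF p(2) C0] by linarith
  hence "abs (f p' - f x) <= ?C*(?d/2 ^ k) + 2 * ?C * ?d*(1 - 1/2 ^ k)" using p(3) by linarith
  also have "... = 2 * ?C * ?d*(1 - 1/2 ^ Suc k)" by (simp add: field_simps)
  finally show ?case using p' p(2) by (intro bexI[of _ p']) auto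
 qed
 have "abs (f x - f y) <= 2 * ?C * ?d + eps" if eps: "eps > 0" for eps
 proof -
  have ye: "y : cube n x0 e" using y cube_mono[of "e/8" e n x0] e by auto
  obtain d where d: "d > 0" "!!z. z : cube n y d ==> abs (f z - f y)<eps"
   using continuous_on_cube_bound[OF f openin_cube ye eps] by metis
  have "(%k. ?d*(1/2) ^ k) \<longlonglongrightarrow> ?d*0" by (intro tendsto_mult tendsto_const LIMSEQ_power_zero) auto
  hence "eventually (%k. ?d*(1/2) ^ k<d) sequentially" by (rule order_tendstoD) (use d in simp)
  then obtain k where k: "?d*(1/2) ^ k<d" by (auto simp: eventually_sequentially)
  obtain p where p: "p : spaceE n" "l1 n (%i. p i - y i) <= ?d/2 ^ k"
   "abs (f p - f x) <= 2 * ?C * ?d*(1 - 1/2 ^ k)" using it by blast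
  have "p : cube n y d"
  proof -
   have "abs (p i - y i)<d" if "i<n" for i
    using coord_le_l1[OF that, of "%i. p i - y i"] p(2) k by (simp add: power_divide)
   thus ?thesis using p(1) by (auto simp: cube_def topspace_Euclidean_space)
  qed
  hence "abs (f p - f y)<eps" by (rule d(2))
  moreover have "2 * ?C * ?d*(1 - 1/2 ^ k) <= 2 * ?C * ?d*1" using C0 d0 by (intro mult_left_mono) auto
  ultimately show ?thesis using p(3) by linarith
 qed
 thus ?thesis by (rule field_le_epsilon)
qed

text \<open>Aim at the point shifted by h. The endpoint reached misses it quadratically, which
  \<open>Lipschitz_f\<close> makes negligible for f, while the values of G on the legs tend to G at
  x.\<close>

lemma partial_f:
 assumes x: "x : cube n x0 (e/16)" and i: "i<n"
 shows "((%t. f (x(i := t))) has_real_derivative (\<Sum>j<q. \<beta> i j x * G j x)) (at (x i))"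
proof (rule deriv_from_estimate)
 fix eps :: real assume eps: "eps > 0"
 obtain r where r: "0<r" "M * r<T" "K*(M * r)<e/4" "n*(C2 * M\<^sup>2) * r <= 1/2" "r<e/16"
  by (rule small_radius)
 have x4: "x : cube n x0 (e/4)" and xe: "x : cube n x0 e"
  using x cube_mono[of "e/16" "e/4" n x0] cube_mono[of "e/16" e n x0] e by auto
 have xt: "x : spaceE n" using xe cube_subset_topspace by blast
 \<comment> \<open>The flow time is at most M |h|, so this variation of G costs at most eps/2 times
   |h|.\<close>
 define \<eta> where "\<eta> = eps/(2*(M + 1))"
 have \<eta>: "\<eta> > 0" using eps M by (simp add: \<eta>_def)
 have "EX d>0. ALL j<q. ALL z:cube n x d. abs (G j z - G j x)<\<eta>"
 proof (rule ex_common_pos)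
  fix j assume "j<q"
  show "EX d>0. ALL z:cube n x d. abs (G j z - G j x)<\<eta>"
   using continuous_on_cube_bound[OF Gc[OF \<open>j<q\<close>] openin_cube xe \<eta>] by metis
 qed (use cube_mono in blast)
 then obtain d0 where d0: "d0 > 0" "!!j z. j<q ==> z : cube n x d0 ==> abs (G j z - G j x)<\<eta>" by blast
 \<comment> \<open>The Lipschitz constant of f times the constant of the quadratic miss.\<close>
 define A where "A = 2*(M * BG)*(n*(C2 * M\<^sup>2))"
 have A: "0 <= A" using M BG C2 by (simp add: A_def)
 have KM: "0 <= K * M" using K M by simp
 define d where "d = min r (min (d0/(K * M + 1)) (eps/(2*(A + 1))))"
 have d: "d > 0" using r d0 eps A KM by (simp add: d_def add_nonneg_pos)
 have "abs (f (x(i := x i + h)) - f (x(i := x i)) - h*(\<Sum>j<q. \<beta> i j x * G j x)) <= eps * abs h" if h: "abs h<d" for h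
 proof -
  define v where "v = (%m. if m = i then h else 0)"
  define y where "y = x(i := x i + h)"
  have lv: "l1 n v = abs h" unfolding l1_def v_def using i by (simp add: if_distrib[of abs] cong: if_cong)
  have hr: "abs h<r" "abs h<d0/(K * M + 1)" "abs h<eps/(2*(A + 1))" using h by (auto simp: d_def)
  have hd0: "K*(M * abs h)<d0"
  proof -
   have "abs h*(K * M + 1)<d0" using hr(2) KM by (simp add: pos_less_divide_eq add_nonneg_pos)
   thus ?thesis using abs_ge_zero[of h] by (simp add: algebra_simps)
  qed
  have hA: "A * abs h <= eps/2"
  proof -
   have "abs h*(2*(A + 1))<eps" using hr(3) A by (simp add: pos_less_divide_eq)
   thus ?thesis using abs_ge_zero[of h] by (simp add: algebra_simps)
  qed
  have "M * abs h <= M * r" using hr M by (intro mult_left_mono) auto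
  hence v: "M * l1 n v<T" "K*(M * l1 n v)<e/4"
   using r lv mult_left_mono[of "M * abs h" "M * r" K] K by auto
  show ?thesis
  proof (rule aim[OF x4 v])
  fix p z assume p: "!!i. n <= i ==> p i = 0"
   "l1 n (%i. p i - (x i + v i)) <= n*(C2 * M\<^sup>2)*(l1 n v)\<^sup>2"
   "f p - f x = (\<Sum>j<q. (\<Sum>m<n. v m * \<beta> m j x) * G j (z j))" "!!j. j<q ==> z j : cube n x0 e"
   "!!j i. j<q ==> i<n ==> abs (z j i - x i) <= K*(M * l1 n v)"
   "(\<Sum>j<q. abs (\<Sum>m<n. v m * \<beta> m j x)) <= M * l1 n v"
  have yv: "(%m. p m - (x m + v m)) = (%m. p m - y m)" by (auto simp: y_def v_def)
  have ly: "l1 n (%m. p m - y m) <= n*(C2 * M\<^sup>2) * abs h * abs h"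
   using p(2) unfolding yv lv by (simp add: power2_eq_square mult.assoc)
  also have "... <= (1/2) * abs h"
  proof (rule mult_right_mono)
   have "n*(C2 * M\<^sup>2) * abs h <= n*(C2 * M\<^sup>2) * r" using C2 hr by (intro mult_left_mono) auto
   thus "n*(C2 * M\<^sup>2) * abs h <= 1/2" using r(4) by linarith
  qed simp
  finally have lr: "l1 n (%m. p m - y m) <= r" using hr by linarith
  have y8: "y : cube n x0 (e/8)"
  proof -
   have "abs (y k - x0 k)<e/8" if "k<n" for k
   proof -
    have "abs (x k - x0 k)<e/16" using x that by (auto simp: cube_def)
    thus ?thesis
     using hr(1) r(5) abs_triangle_ineq[of "x k - x0 k" h] by (cases "k = i") (simp_all add: y_def algebra_simps)
   qed
   moreover have "y k = 0" if "n <= k" for k using xt that i by (auto simp: y_def topspace_Euclidean_space)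
   ultimately show ?thesis by (auto simp: cube_def)
  qed
  have "abs (f p - f y) <= 2*(M * BG) * l1 n (%m. p m - y m)"
   by (rule Lipschitz_f[OF r y8 _ lr]) (use p(1) in \<open>auto simp: topspace_Euclidean_space\<close>)
  also have "... <= 2*(M * BG)*(n*(C2 * M\<^sup>2) * abs h * abs h)" using M BG by (intro mult_left_mono[OF ly]) auto
  also have "... = (A * abs h) * abs h" by (simp add: A_def mult_ac)
  also have "... <= (eps/2) * abs h" by (rule mult_right_mono[OF hA]) simp
  finally have e1: "abs (f p - f y) <= (eps/2) * abs h" .
  have sv: "(\<Sum>m<n. v m * \<beta> m j x) = h * \<beta> i j x" for j
   using i by (simp add: v_def if_distrib[of "%x. x * _"] cong: if_cong)
  have "f p - f x - h*(\<Sum>j<q. \<beta> i j x * G j x) = (\<Sum>j<q. (h * \<beta> i j x)*(G j (z j) - G j x))"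
   unfolding p(3) sv by (simp add: sum_distrib_left right_diff_distrib sum_subtractf mult.assoc)
  also have "abs ... <= (\<Sum>j<q. abs (h * \<beta> i j x) * \<eta>)"
  proof (rule order_trans[OF sum_abs], rule sum_mono)
   fix j assume "j : {..<q}"
   hence j: "j<q" by simp
   have "z j : cube n x d0"
   proof -
    have "abs (z j k - x k)<d0" if "k<n" for k using p(5)[OF j that] hd0 lv by simp
    thus ?thesis using p(4)[OF j] by (auto simp: cube_def)
   qed
   from d0(2)[OF j this] show "abs (h * \<beta> i j x*(G j (z j) - G j x)) <= abs (h * \<beta> i j x) * \<eta>"
    unfolding abs_mult[of "h * \<beta> i j x"] by (intro mult_left_mono) auto
  qed
  also have "... <= (M * abs h) * \<eta>"
   unfolding sum_distrib_right[symmetric] using p(6) \<eta> unfolding sv lv by (intro mult_right_mono) auto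
  also have "... <= (eps/2) * abs h"
  proof -
   have "M * \<eta> <= (M + 1) * \<eta>" using \<eta> by (intro mult_right_mono) auto
   also have "... = eps/2"
   proof -
    have "M + 1 ~= 0" using M by linarith
    thus ?thesis unfolding \<eta>_def by (simp only: times_divide_eq_right mult_divide_mult_cancel_left[where c="M + 1"] mult.commute[of 2] divide_divide_eq_left[symmetric]) simp
   qed
   finally have "(M * \<eta>) * abs h <= (eps/2) * abs h" by (rule mult_right_mono) simp
   thus ?thesis by (simp add: mult_ac)
  qed
  finally have e2: "abs (f p - f x - h*(\<Sum>j<q. \<beta> i j x * G j x)) <= (eps/2) * abs h" .
  have "eps * abs h = (eps/2) * abs h + (eps/2) * abs h" by simp
  thus ?thesis using e1 e2 unfolding y_def[symmetric] fun_upd_triv by linarith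
  qed
 qed
 thus "EX d>0. ALL h. abs h<d --> abs (f (x(i := x i + h)) - f (x(i := x i)) - h*(\<Sum>j<q. \<beta> i j x * G j x)) <= eps * abs h"
  using d by blast
qed

lemma pd_f: "pd n (cube n x0 (e/16)) f (%i x. \<Sum>j<q. \<beta> i j x * G j x)"
proof -
 have sub: "cube n x0 (e/16) \<subseteq> cube n x0 e" using e by (intro cube_mono) auto
 show ?thesis
  unfolding pd_def using partial_f continuous_on_subset[OF f sub]
  by (auto intro!: continuous_on_sum continuous_on_mult continuous_on_subset[OF _ sub] \<beta>c Gc)
qed

text \<open>The gradient has been expressed through G. That G is conversely the derivative along the
  fields follows by computing the derivative of f on an integral curve in two ways.\<close>

lemma dw_f: "dw n (cube n x0 (e/16)) w q f G"
 unfolding dw_def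
proof (intro exI conjI allI impI ballI)
 show p: "pd n (cube n x0 (e/16)) f (%i x. \<Sum>j<q. \<beta> i j x * G j x)" by (rule pd_f)
 fix j x assume j: "j<q" and x: "x : cube n x0 (e/16)"
 have x2: "x : cube n x0 (e/2)" using x cube_mono[of "e/16" "e/2" n x0] e by auto
 obtain cu where cu: "cu 0 = x" "!!t. abs t<T ==> cu t : cube n x0 e"
  "!!t i. abs t<T ==> i<n ==> ((%s. cu s i) has_real_derivative w j i (cu t)) (at t)"
  by (rule local_solution[of e n x0 "%y i. w j i y" K L T x]) (use e K L T wK[OF j] wL[OF j] x2 in auto)
 have "((%t. f (cu t)) has_real_derivative G j (cu 0)) (at 0)"
  by (rule fl_shift[where T'=T, OF j]) (use cu T in auto)
 moreover have "((%t. f (cu t)) has_real_derivative (\<Sum>i<n. (\<Sum>j<q. \<beta> i j (cu 0) * G j (cu 0)) * w j i (cu 0))) (at 0)"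
 proof (rule pd_chain_curve[where cu=cu and s=0, OF p openin_cube])
  show "cu 0 : cube n x0 (e/16)" using cu(1) x by simp
  show "((%r. cu r i) has_real_derivative w j i (cu 0)) (at 0)" if "i<n" for i using cu(3)[of 0 i] that T by simp
  have "eventually (%t. t : {-T<..<T}) (at 0)" using T by (intro eventually_at_in_open') auto
  thus "\<forall>\<^sub>F t in at 0. cu t : spaceE n"
  proof eventually_elim
   case (elim t)
   hence "cu t : cube n x0 e" by (intro cu(2)) (auto simp: abs_less_iff)
   thus ?case using cube_subset_topspace by blast
  qed
 qed
 ultimately have "G j (cu 0) = (\<Sum>i<n. (\<Sum>j<q. \<beta> i j (cu 0) * G j (cu 0)) * w j i (cu 0))" by (rule DERIV_unique)
 thus "G j x = (\<Sum>i<n. w j i x*(\<Sum>j<q. \<beta> i j x * G j x))" unfolding cu(1) by (simp add: mult.commute)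
qed

end

text \<open>The hypothesis \<open>fl\<close> tests f on arbitrary integral curves inside U, so the
  analysis does not mention \<open>flow\<close>. All bounds are gathered on one cube, and the time T
  is fitted to them.\<close>

lemma flow_derivatives_imp_C1:
 assumes U: "openE n U" and x0: "x0 : U"
  and w: "!!j i. j<q ==> i<n ==> pd n U (w j i) (w' j i)"
  and span: "!!v. EX a. ALL i<n. v i = (\<Sum>k<q. a k * w k i x0)"
  and f: "continuous_on U f" and G: "!!j. j<q ==> continuous_on U (G j)"
  and fl: "!!x j cu T. x : U ==> j<q ==> 0<T ==> cu 0 = x ==> (!!t. abs t<T ==> cu t : U) ==>
   (!!t i. abs t<T ==> i<n ==> ((%s. cu s i) has_real_derivative w j i (cu t)) (at t)) ==>
   ((%t. f (cu t)) has_real_derivative G j x) (at 0)"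
 shows "EX e>0. cube n x0 e \<subseteq> U & dw n (cube n x0 e) w q f G"
proof -
 interpret C1: func_class n "%U f. EX G. pd n U f G" by (rule func_class_C1)
 have w1: "EX G. pd n U (w j i) G" if "j<q" "i<n" for j i using w[OF that] by blast
 show ?thesis
 proof (rule C1.local_coframe[OF U x0 w1 span])
  fix e1 \<beta> assume e1: "0<e1" "cube n x0 e1 \<subseteq> U"
   and \<beta>: "!!m j. m<n ==> j<q ==> EX G. pd n (cube n x0 e1) (\<beta> m j) G"
   and \<beta>w: "!!m i x. m<n ==> i<n ==> x : cube n x0 e1 ==> (\<Sum>j<q. \<beta> m j x * w j i x) = (if m = i then 1 else 0)"
  have x01: "x0 : cube n x0 e1" using cube_center e1 x0 openin_subset[OF U] by blast
  have \<beta>c: "continuous_on (cube n x0 e1) (\<beta> m j)" if "m<n" "j<q" for m j using \<beta>[OF that] by (auto simp: pd_def)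
  have w2: "pd n (cube n x0 e1) (w j i) (w' j i)" if "j<q" "i<n" for j i by (rule pd_subset[OF w[OF that] e1(2)])
  have G2: "continuous_on (cube n x0 e1) (G j)" if "i<(1::nat)" "j<q" for i j by (rule continuous_on_subset[OF G[OF that(2)] e1(2)])
  show ?thesis
  proof (rule family_bound[where a=n and b=q and h=\<beta>, OF openin_cube x01 \<beta>c])
  fix e2 B :: real assume e2: "0<e2" "0 <= B" "cube n x0 e2 \<subseteq> cube n x0 e1"
   "!!i j y. i<n ==> j<q ==> y : cube n x0 e2 ==> abs (\<beta> i j y) <= B"
  show ?thesis
  proof (rule family_bound[where a=1 and b=q and h="%_. G", OF openin_cube x01 G2])
  fix e3 BG :: real assume e3: "0<e3" "0 <= BG" "cube n x0 e3 \<subseteq> cube n x0 e1"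
   "!!i j y. i<(1::nat) ==> j<q ==> y : cube n x0 e3 ==> abs (G j y) <= BG"
  show ?thesis
  proof (rule C1_local_bounds[where N=q and w=w and w'=w', OF openin_cube x01 w2])
  fix e4 K L :: real assume e4: "0<e4" "0 <= K" "0 <= L" "cube n x0 e4 \<subseteq> cube n x0 e1"
   "!!j i y. j<q ==> i<n ==> y : cube n x0 e4 ==> abs (w j i y) <= K"
   "!!j i m y. j<q ==> i<n ==> m<n ==> y : cube n x0 e4 ==> abs (w' j i m y) <= L"
   "!!j i y z. j<q ==> i<n ==> y : cube n x0 e4 ==> z : cube n x0 e4 ==>
    abs (w j i y - w j i z) <= L*(\<Sum>k<n. abs (y k - z k))"
  define e where "e = min e2 (min e3 e4)"
  have e: "0<e" using e2 e3 e4 by (simp add: e_def)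
  have sub: "cube n x0 e \<subseteq> cube n x0 e2" "cube n x0 e \<subseteq> cube n x0 e3" "cube n x0 e \<subseteq> cube n x0 e4"
   "cube n x0 e \<subseteq> cube n x0 e1" "cube n x0 e \<subseteq> U"
  proof -
   show "cube n x0 e \<subseteq> cube n x0 e2" "cube n x0 e \<subseteq> cube n x0 e3" "cube n x0 e \<subseteq> cube n x0 e4"
    by (rule cube_mono, simp add: e_def)+
   thus "cube n x0 e \<subseteq> cube n x0 e1" "cube n x0 e \<subseteq> U" using e2(3) e1(2) by blast+
  qed
  define T where "T = min (e/(4*(K + 1))) (1/(2*(n * L + 1)))"
  have nL: "0 <= n * L" using e4 by simp
  have T: "0<T" "K * T <= e/4" "n * L * T <= 1/2"
  proof -
   show T0: "0<T" using e e4 nL by (simp add: T_def add_nonneg_pos)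
   have "T <= e/(4*(K + 1))" "T <= 1/(2*(n * L + 1))" by (auto simp: T_def)
   hence "T*(4*(K + 1)) <= e" "T*(2*(n * L + 1)) <= 1"
    using e4 nL by (auto simp: pos_le_divide_eq add_nonneg_pos)
   thus "K * T <= e/4" "n * L * T <= 1/2" using T0 by (auto simp: algebra_simps)
  qed
  interpret flow_diff n q w x0 e K L B BG T f G \<beta>
  proof
   show "((%t. f (cu t)) has_real_derivative G j x) (at 0)"
    if "x : cube n x0 e" "j<q" "0<T" "cu 0 = x" "!!t. abs t<T ==> cu t : cube n x0 e"
     "!!t i. abs t<T ==> i<n ==> ((%s. cu s i) has_real_derivative w j i (cu t)) (at t)" for x j cu T
    by (rule fl[of x j T cu]) (use that sub in auto)
   show "continuous_on (cube n x0 e) f" by (rule continuous_on_subset[OF f sub(5)])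
   show "continuous_on (cube n x0 e) (G j)" if "j<q" for j by (rule continuous_on_subset[OF G[OF that] sub(5)])
   show "continuous_on (cube n x0 e) (\<beta> m j)" if "m<n" "j<q" for m j by (rule continuous_on_subset[OF \<beta>c[OF that] sub(4)])
   show "abs (w j i y) <= K" if "j<q" "i<n" "y : cube n x0 e" for j i y using e4(5) that sub by blast
   show "abs (w j i y - w j i z) <= L*(\<Sum>k<n. abs (y k - z k))" if "j<q" "i<n" "y : cube n x0 e" "z : cube n x0 e" for j i y z
    using e4(7) that sub by blast
   show "abs (G j y) <= BG" if "j<q" "y : cube n x0 e" for j y using e3(4)[of 0 j y] that sub by auto
   show "abs (\<beta> m j y) <= B" if "m<n" "j<q" "y : cube n x0 e" for m j y using e2(4) that sub by blast
   show "(\<Sum>j<q. \<beta> m j y * w j i y) = (if m = i then 1 else 0)" if "m<n" "i<n" "y : cube n x0 e" for m i y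
    using \<beta>w that sub by blast
  qed (use e T e2 e3 e4 in auto)
  have "cube n x0 (e/16) \<subseteq> U" using sub cube_mono[of "e/16" e n x0] e by auto
  thus ?thesis using dw_f e by (intro exI[of _ "e/16"]) auto
  qed
  qed
  qed
 qed
qed

subsection \<open>Inverses of C2 maps\<close>

lemma tendsto_det_mat:
 assumes A: "!!x. A x : carrier_mat N N" "B : carrier_mat N N"
  and "!!i j. i<N ==> j<N ==> ((%x. A x $$ (i, j)) \<longlongrightarrow> (B $$ (i, j) :: real)) F"
 shows "((%x. Determinant.det (A x)) \<longlongrightarrow> Determinant.det B) F"
 unfolding det_def'[OF A(1)] det_def'[OF A(2)]
 by (intro tendsto_sum tendsto_mult tendsto_const tendsto_prod assms(3))
  (auto simp: permutes_in_image dest: permutes_in_image)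

lemma tendsto_fdet:
 assumes "!!i j. i<n ==> j<n ==> ((%x. M x i j) \<longlongrightarrow> m i j) F"
 shows "((%x. fdet n (M x)) \<longlongrightarrow> fdet n m) F"
 unfolding fdet_def by (rule tendsto_det_mat[where N=n]) (use assms in auto)

lemma tendsto_fadj:
 assumes M: "!!i j. i<n ==> j<n ==> ((%x. M x i j) \<longlongrightarrow> m i j) F" and ij: "i<n" "j<n"
 shows "((%x. fadj n (M x) i j) \<longlongrightarrow> fadj n m i j) F"
proof -
 have "((%x. (-1) ^ (j + i) * Determinant.det (mat_delete (Matrix.mat n n (%(i, j). M x i j)) j i)) \<longlongrightarrow>
   (-1) ^ (j + i) * Determinant.det (mat_delete (Matrix.mat n n (%(i, j). m i j)) j i)) F"
 proof (intro tendsto_mult tendsto_const tendsto_det_mat[where N="n-1"])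
  show "mat_delete (Matrix.mat n n (%(i, j). M x i j)) j i : carrier_mat (n - 1) (n - 1)" for x
   by (rule mat_delete_carrier) simp
  show "mat_delete (Matrix.mat n n (%(i, j). m i j)) j i : carrier_mat (n - 1) (n - 1)"
   by (rule mat_delete_carrier) simp
  show "((%x. mat_delete (Matrix.mat n n (%(i, j). M x i j)) j i $$ (i', j')) \<longlongrightarrow>
   mat_delete (Matrix.mat n n (%(i, j). m i j)) j i $$ (i', j')) F" if "i'<n - 1" "j'<n - 1" for i' j'
   using that ij by (auto simp: mat_delete_def intro!: M)
 qed
 thus ?thesis using ij by (simp add: fadj_def adj_mat_def cofactor_def)
qed

lemma fdet_transpose: "fdet n (%i j. m j i) = fdet n m"
proof -
 let ?A = "Matrix.mat n n (%(i, j). m i j)"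
 have "Matrix.mat n n (%(i, j). m j i) = transpose_mat ?A" by (auto intro!: eq_matI)
 thus ?thesis using det_transpose[of ?A n] by (simp add: fdet_def)
qed

text \<open>Cramer's rule without division.\<close>

lemma fdet_solve:
 assumes "!!k. k<n ==> (\<Sum>i<n. m k i * v i) = b k" and i: "i<n"
 shows "fdet n m * v i = (\<Sum>k<n. fadj n m i k * b k)"
proof -
 have "(\<Sum>k<n. fadj n m i k * b k) = (\<Sum>k<n. fadj n m i k*(\<Sum>l<n. m k l * v l))" using assms by (intro sum.cong) auto
 also have "... = (\<Sum>l<n. (\<Sum>k<n. fadj n m i k * m k l) * v l)"
  unfolding sum_distrib_left sum_distrib_right by (rule trans[OF sum.swap]) (simp add: mult.assoc)
 also have "... = (\<Sum>l<n. if l = i then fdet n m * v l else 0)" by (intro sum.cong) (auto simp: fadj_mult i)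
 finally show ?thesis using i by simp
qed

text \<open>Invariance of domain; with injectivity at hand it takes the place of the contraction
  argument for inverse functions.\<close>

lemma injective_imp_open_image:
 assumes U: "openE n U" and W: "openE n W" "W \<subseteq> U"
  and c: "continuous_on U \<Phi>" and top: "!!t. t : U ==> \<Phi> t : spaceE n" and inj: "inj_on \<Phi> U"
 shows "openE n (\<Phi> ` W)"
proof (rule invariance_of_domain_Euclidean_space[OF W(1)])
 have W': "W \<subseteq> spaceE n" by (rule openin_subset[OF W(1)])
 have "subtopology (Euclidean_space n) W = top_of_set W"
  using W' by (simp add: Euclidean_space_def euclidean_product_topology subtopology_subtopology inf.absorb2 topspace_Euclidean_space)
 moreover have "Euclidean_space n = top_of_set (spaceE n)"
  by (simp add: Euclidean_space_def euclidean_product_topology topspace_Euclidean_space)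
 moreover have "continuous_on W \<Phi>" by (rule continuous_on_subset[OF c W(2)])
 moreover have "\<Phi> : W \<rightarrow> spaceE n" using top W(2) by blast
 ultimately show "continuous_map (subtopology (Euclidean_space n) W) (Euclidean_space n) \<Phi>"
  by (metis continuous_map_in_subtopology continuous_map_iff_continuous topspace_euclidean_subtopology)
 show "inj_on \<Phi> W" by (rule inj_on_subset[OF inj W(2)])
qed

text \<open>Open images make the inverse continuous. Its difference quotients solve a linear system
  whose matrix, from Caratheodory's form, tends to the Jacobian, so Cramer's rule yields the
  derivative. Composed with the inverse, the inverse Jacobian is C^1.\<close>

lemma injective_imp_inverse_C2:
 assumes U: "openE n U" and pd\<Phi>: "!!k. k<n ==> pd n U (%t. \<Phi> t k) (D k)"
  and D1: "!!k i. k<n ==> i<n ==> EX G. pd n U (D k i) G" and det: "!!t. t : U ==> fdet n (%k i. D k i t) ~= 0"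
  and top: "!!t. t : U ==> \<Phi> t : spaceE n" and inj: "inj_on \<Phi> U" and i: "i<n"
 shows "C_k_on 2 n (\<Phi> ` U) (%y. inv_into U \<Phi> y i)"
proof -
 interpret C1: func_class n "%U f. EX G. pd n U f G" by (rule func_class_C1)
 define \<Psi> where "\<Psi> = inv_into U \<Phi>"
 have c\<Phi>: "continuous_on U \<Phi>"
  by (rule continuous_on_into_Euclidean[of n]) (use pd\<Phi> top in \<open>auto simp: pd_def\<close>)
 note oi = injective_imp_open_image[OF U _ _ c\<Phi> top inj]
 have oU: "openE n (\<Phi> ` U)" by (rule oi[OF U order_refl])
 have \<Psi>U: "\<Psi> y : U" "\<Phi> (\<Psi> y) = y" if "y : \<Phi> ` U" for y
  unfolding \<Psi>_def by (rule inv_into_into[OF that], rule f_inv_into_f[OF that])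
 have \<Psi>\<Phi>: "\<Psi> (\<Phi> t) = t" if "t : U" for t unfolding \<Psi>_def by (rule inv_into_f_f[OF inj that])
 have near: "EX d>0. cube n y d \<subseteq> \<Phi> ` U & \<Psi> ` cube n y d \<subseteq> cube n (\<Psi> y) e" if y: "y : \<Phi> ` U" and e: "0<e" for y and e :: real
 proof -
  obtain e' where e': "0<e'" "cube n (\<Psi> y) e' \<subseteq> U" using open_cubeE[OF U \<Psi>U(1)[OF y]] by blast
  define W where "W = cube n (\<Psi> y) (min e e')"
  have W: "W \<subseteq> U" "W \<subseteq> cube n (\<Psi> y) e" unfolding W_def using e' cube_mono[of "min e e'" _ n "\<Psi> y"] by (meson min.cobounded1 min.cobounded2 subset_trans)+
  have oW: "openE n (\<Phi> ` W)" by (rule oi[OF _ W(1)]) (simp add: W_def openin_cube)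
  have "\<Psi> y : W" unfolding W_def using \<Psi>U(1)[OF y] openin_subset[OF U] e e' by (intro cube_center) auto
  hence "y : \<Phi> ` W" using \<Psi>U(2)[OF y] by (metis imageI)
  then obtain d where d: "0<d" "cube n y d \<subseteq> \<Phi> ` W" using open_cubeE[OF oW] by blast
  have "\<Psi> ` \<Phi> ` W = W" using \<Psi>\<Phi> W(1) by (force simp: image_image)
  hence "\<Psi> ` cube n y d \<subseteq> cube n (\<Psi> y) e" using d(2) W(2) by blast
  thus ?thesis using d W(1) by blast
 qed
 have c\<Psi>: "continuous_on (\<Phi> ` U) (%y. \<Psi> y l)" if l: "l<n" for l
  unfolding continuous_on_cube_iff[OF openin_subset[OF oU]]
 proof (intro ballI allI impI)
  fix y and eps :: real assume y: "y : \<Phi> ` U" and eps: "0<eps"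
  obtain d where d: "0<d" "\<Psi> ` cube n y d \<subseteq> cube n (\<Psi> y) eps" using near[OF y eps] by blast
  have "abs (\<Psi> z l - \<Psi> y l)<eps" if "z : \<Phi> ` U" "ALL i<n. abs (z i - y i)<d" for z
  proof -
   have "z : cube n y d" using that openin_subset[OF oU] by (auto simp: cube_def topspace_Euclidean_space)
   thus ?thesis using d(2) l by (auto simp: cube_def)
  qed
  thus "EX d>0. ALL z:\<Phi> ` U. (ALL i<n. abs (z i - y i)<d) --> abs (\<Psi> z l - \<Psi> y l)<eps" using d(1) by blast
 qed
 define J where "J l m t = fadj n (%k i. D k i t) l m * inverse (fdet n (%k i. D k i t))" for l m t
 have J1: "EX G. pd n U (J l m) G" if lm: "l<n" "m<n" for l m
 proof -
  have "EX G. pd n U (%t. fadj n (%k i. D k i t) l m) G" by (rule C1.cl_fadj[where M=D, OF U D1 lm])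
  then obtain G1 where G1: "pd n U (%t. fadj n (%k i. D k i t) l m) G1" by blast
  have "EX G. pd n U (%t. fdet n (%k i. D k i t)) G" by (rule C1.cl_fdet[where M=D, OF U D1])
  then obtain G2 where G2: "pd n U (%t. fdet n (%k i. D k i t)) G2" by blast
  show ?thesis unfolding J_def[abs_def] using pd_mult[OF G1 pd_inverse[OF G2 det]] by blast
 qed
 have top\<Psi>: "\<Psi> y : spaceE n" if "y : \<Phi> ` U" for y using \<Psi>U(1)[OF that] openin_subset[OF U] by blast
 have c\<Psi>': "continuous_on (\<Phi> ` U) \<Psi>" by (rule continuous_on_into_Euclidean[OF c\<Psi> top\<Psi>])
 have pd\<Psi>: "pd n (\<Phi> ` U) (%y. \<Psi> y l) (%m y. J l m (\<Psi> y))" if l: "l<n" for l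
  unfolding pd_def
 proof (intro conjI allI impI ballI c\<Psi>[OF l])
  fix m assume m: "m<n"
  have "continuous_on U (J l m)" using J1[OF l m] by (auto simp: pd_def)
  thus "continuous_on (\<Phi> ` U) (%y. J l m (\<Psi> y))"
   by (rule continuous_on_compose2[OF _ c\<Psi>']) (use \<Psi>U(1) in blast)
  fix y assume y: "y : \<Phi> ` U"
  define t0 where "t0 = \<Psi> y"
  have t0: "t0 : U" "\<Phi> t0 = y" unfolding t0_def using \<Psi>U[OF y] by auto
  \<comment> \<open>Packs the Caratheodory data of the k-th component into one predicate, so that
    they can be chosen for every k.\<close>
  define Q where "Q k = (%(e, g). 0<e & cube n t0 e \<subseteq> U & (ALL t:cube n t0 e. \<Phi> t k - \<Phi> t0 k = (\<Sum>i<n. g t i*(t i - t0 i))) &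
   (ALL eps>0. EX d>0. ALL t:cube n t0 d. ALL i<n. abs (g t i - D k i t0)<eps))" for k :: nat
  define E where "E k = fst (SOME eg. Q k eg)" for k
  define g where "g k = snd (SOME eg. Q k eg)" for k
  have Q: "Q k (E k, g k)" if k: "k<n" for k
  proof -
   have "EX eg. Q k eg"
   proof (rule pd_caratheodory[OF pd\<Phi>[OF k] U t0(1)])
    fix e g assume "e > 0" "cube n t0 e \<subseteq> U"
     "!!y. y : cube n t0 e ==> \<Phi> y k - \<Phi> t0 k = (\<Sum>i<n. g y i*(y i - t0 i))"
     "!!eps. eps > 0 ==> EX d>0. ALL y:cube n t0 d. ALL i<n. abs (g y i - D k i t0)<eps"
    hence "Q k (e, g)" unfolding Q_def by blast
    thus ?thesis by blast
   qed
   thus ?thesis unfolding E_def g_def prod.collapse by (rule someI_ex[where P="Q k"])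
  qed
  have evd: "eventually (%s. y(m := s) : \<Phi> ` U & \<Psi> (y(m := s)) : cube n t0 d) (at (y m))" if d: "0<d" for d
  proof -
   obtain d' where d': "0<d'" "cube n y d' \<subseteq> \<Phi> ` U" "\<Psi> ` cube n y d' \<subseteq> cube n t0 d" using near[OF y d] unfolding t0_def by blast
   have yt: "y : spaceE n" using y openin_subset[OF oU] by blast
   have yd: "y : cube n y d'" by (rule cube_center[OF yt d'(1)])
   have "eventually (%s. y(m := s) : cube n y d') (at (y m))"
    using eventually_update_in[OF openin_cube yd m] by (simp add: eventually_nhds_conv_at)
   thus ?thesis by eventually_elim (use d' in blast)
  qed
  have lim: "((%s. g k (\<Psi> (y(m := s))) i) \<longlongrightarrow> D k i t0) (at (y m))" if k: "k<n" and i: "i<n" for k i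
  proof (rule tendstoI)
   fix eps :: real assume "0<eps"
   then obtain d where d: "0<d" "ALL t:cube n t0 d. ALL i<n. abs (g k t i - D k i t0)<eps" using Q[OF k] unfolding Q_def by auto
   show "eventually (%s. dist (g k (\<Psi> (y(m := s))) i) (D k i t0)<eps) (at (y m))"
    using evd[OF d(1)] by eventually_elim (use d(2) i in \<open>simp add: dist_real_def\<close>)
  qed
  have det0: "fdet n (%k i. D k i t0) ~= 0" by (rule det[OF t0(1)])
  have limdet: "((%s. fdet n (%k i. g k (\<Psi> (y(m := s))) i)) \<longlongrightarrow> fdet n (%k i. D k i t0)) (at (y m))"
   by (rule tendsto_fdet) (rule lim)
  have limadj: "((%s. fadj n (%k i. g k (\<Psi> (y(m := s))) i) l m) \<longlongrightarrow> fadj n (%k i. D k i t0) l m) (at (y m))"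
   by (rule tendsto_fadj[OF _ l m]) (rule lim)
  have "((%s. fadj n (%k i. g k (\<Psi> (y(m := s))) i) l m / fdet n (%k i. g k (\<Psi> (y(m := s))) i)) \<longlongrightarrow> J l m t0) (at (y m))"
   unfolding J_def divide_inverse by (intro tendsto_mult tendsto_inverse limadj limdet det0)
  moreover have "eventually (%s. (\<Psi> (y(m := s)) l - \<Psi> y l)/(s - y m) =
    fadj n (%k i. g k (\<Psi> (y(m := s))) i) l m / fdet n (%k i. g k (\<Psi> (y(m := s))) i)) (at (y m))"
  proof -
   have "EX e>0. ALL k<n. ALL t:cube n t0 e. \<Phi> t k - \<Phi> t0 k = (\<Sum>i<n. g k t i*(t i - t0 i))"
   proof (rule ex_common_pos)
    show "EX e>0. ALL t:cube n t0 e. \<Phi> t k - \<Phi> t0 k = (\<Sum>i<n. g k t i*(t i - t0 i))" if "k<n" for k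
     using Q[OF that] unfolding Q_def by auto
   qed (use cube_mono in blast)
   then obtain e where e: "0<e" "!!k t. k<n ==> t : cube n t0 e ==> \<Phi> t k - \<Phi> t0 k = (\<Sum>i<n. g k t i*(t i - t0 i))" by blast
   have ev0: "eventually (%s. fdet n (%k i. g k (\<Psi> (y(m := s))) i) ~= 0) (at (y m))"
    by (rule tendsto_imp_eventually_ne[OF limdet det0])
   have ne: "eventually (%s. s ~= y m) (at (y m))" by (simp add: eventually_at_filter)
   show ?thesis
    using evd[OF e(1)] ev0 ne
   proof eventually_elim
    case (elim s)
    let ?t = "\<Psi> (y(m := s))"
    have \<Phi>t: "\<Phi> ?t = y(m := s)" using \<Psi>U(2) elim by blast
    have "fdet n (%k i. g k ?t i)*(?t l - t0 l) = (\<Sum>k<n. fadj n (%k i. g k ?t i) l k*(if k = m then s - y m else 0))"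
    proof (rule fdet_solve[OF _ l, where v="%l. ?t l - t0 l"])
     fix k assume k: "k<n"
     have "?t : cube n t0 e" using elim by blast
     from e(2)[OF k this] show "(\<Sum>i<n. g k ?t i*(?t i - t0 i)) = (if k = m then s - y m else 0)"
      unfolding \<Phi>t t0(2) by auto
    qed
    also have "... = fadj n (%k i. g k ?t i) l m*(s - y m)" using m by (simp add: if_distrib[of "%x. _ * x"] cong: if_cong)
    finally show ?case using elim unfolding t0_def by (simp add: divide_simps mult.commute)
   qed
  qed
  ultimately have "((%s. (\<Psi> (y(m := s)) l - \<Psi> y l)/(s - y m)) \<longlongrightarrow> J l m t0) (at (y m))"
   using tendsto_cong by fastforce
  thus "((%s. \<Psi> (y(m := s)) l) has_real_derivative J l m (\<Psi> y)) (at (y m))"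
   unfolding has_field_derivative_iff t0_def by simp
 qed
 have J\<Psi>1: "EX G. pd n (\<Phi> ` U) (%y. J i m (\<Psi> y)) G" if m: "m<n" for m
 proof -
  obtain G where "pd n U (J i m) G" using J1[OF i m] by blast
  from pd_compose[OF this U oU pd\<Psi> \<Psi>U(1)] show ?thesis by blast
 qed
 define GG where "GG m = (SOME G. pd n (\<Phi> ` U) (%y. J i m (\<Psi> y)) G)" for m
 have GG: "pd n (\<Phi> ` U) (%y. J i m (\<Psi> y)) (GG m)" if "m<n" for m
  unfolding GG_def by (rule someI_ex[OF J\<Psi>1[OF that]])
 show ?thesis
  unfolding C2_iff[OF oU] \<Psi>_def[symmetric]
  by (rule exI[of _ "%m y. J i m (\<Psi> y)"], rule exI[of _ GG]) (use pd\<Psi>[OF i] GG in simp)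
qed

subsection \<open>Charts and flows\<close>

lemma chart_facts:
 assumes "is_chart n T c"
 shows "openin T (fst c)" "openE n (snd c ` fst c)" "inj_on (snd c) (fst c)"
  "!!y. y : fst c ==> chart_inv c (snd c y) = y"
  "!!x. x : snd c ` fst c ==> snd c (chart_inv c x) = x"
  "!!x. x : snd c ` fst c ==> chart_inv c x : fst c"
  "fst c \<subseteq> topspace T"
proof -
 show o: "openin T (fst c)" "openE n (snd c ` fst c)" using assms by (auto simp: is_chart_def)
 show s: "fst c \<subseteq> topspace T" by (rule openin_subset[OF o(1)])
 have "inj_on (snd c) (topspace (subtopology T (fst c)))"
  using assms homeomorphic_imp_injective_map unfolding is_chart_def by blast
 thus i: "inj_on (snd c) (fst c)" using s by (simp add: inf.absorb2)
 show "chart_inv c (snd c y) = y" if "y : fst c" for y unfolding chart_inv_def by (rule inv_into_f_f[OF i that])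
 show "snd c (chart_inv c x) = x" if "x : snd c ` fst c" for x unfolding chart_inv_def by (rule f_inv_into_f[OF that])
 show "chart_inv c x : fst c" if "x : snd c ` fst c" for x unfolding chart_inv_def by (rule inv_into_into[OF that])
qed

lemma chart_open_image:
 assumes c: "is_chart n T c" and V: "openin T V" "V \<subseteq> fst c"
 shows "openE n (snd c ` V)"
proof -
 have "open_map (subtopology T (fst c)) (subtopology (Euclidean_space n) (snd c ` fst c)) (snd c)"
  using c homeomorphic_imp_open_map unfolding is_chart_def by blast
 moreover have "openin (subtopology T (fst c)) V" using V chart_facts(1)[OF c] by (simp add: openin_open_subtopology)
 ultimately have "openin (subtopology (Euclidean_space n) (snd c ` fst c)) (snd c ` V)" unfolding open_map_def by blast
 thus ?thesis using chart_facts(2)[OF c] by (simp add: openin_open_subtopology)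
qed

lemma chart_inv_image:
 assumes c: "is_chart n T c" and W: "W \<subseteq> snd c ` fst c"
 shows "chart_inv c ` W = {y : fst c. snd c y : W}" "snd c ` chart_inv c ` W = W" "chart_inv c ` W \<subseteq> fst c"
proof -
 show 1: "chart_inv c ` W = {y : fst c. snd c y : W}"
 proof
  show "chart_inv c ` W \<subseteq> {y : fst c. snd c y : W}" using chart_facts(5,6)[OF c] W by (auto simp: subset_iff)
  show "{y : fst c. snd c y : W} \<subseteq> chart_inv c ` W"
  proof
   fix y assume "y : {y : fst c. snd c y : W}"
   thus "y : chart_inv c ` W" using chart_facts(4)[OF c, of y] by (intro image_eqI[of _ _ "snd c y"]) auto
  qed
 qed
 have "snd c (chart_inv c x) = x" if "x : W" for x using chart_facts(5)[OF c] W that by blast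
 thus "snd c ` chart_inv c ` W = W" by (auto simp: image_image)
 show "chart_inv c ` W \<subseteq> fst c" unfolding 1 by blast
qed

lemma image_chart_inv:
 assumes c: "is_chart n T c" and V: "V \<subseteq> fst c"
 shows "chart_inv c ` snd c ` V = V"
proof -
 have "chart_inv c (snd c x) = x" if "x : V" for x using chart_facts(4)[OF c] V that by blast
 thus ?thesis by (auto simp: image_image)
qed

lemma chart_open_preimage:
 assumes c: "is_chart n T c" and W: "openE n W" "W \<subseteq> snd c ` fst c"
 shows "openin T (chart_inv c ` W)"
proof -
 have "continuous_map (subtopology T (fst c)) (subtopology (Euclidean_space n) (snd c ` fst c)) (snd c)"
  using c homeomorphic_imp_continuous_map unfolding is_chart_def by blast
 moreover have "openin (subtopology (Euclidean_space n) (snd c ` fst c)) W"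
  using W chart_facts(2)[OF c] by (simp add: openin_open_subtopology)
 ultimately have "openin (subtopology T (fst c)) {y : topspace (subtopology T (fst c)). snd c y : W}"
  by (rule openin_continuous_map_preimage)
 moreover have "{y : topspace (subtopology T (fst c)). snd c y : W} = chart_inv c ` W"
  using chart_facts(7)[OF c] unfolding chart_inv_image(1)[OF c W(2)] by auto
 ultimately show ?thesis using chart_facts(1)[OF c] by (simp add: openin_open_subtopology)
qed

lemma Euclidean_subtopology:
 assumes "U \<subseteq> spaceE n"
 shows "subtopology (Euclidean_space n) U = top_of_set U"
 using assms
 by (simp add: Euclidean_space_def euclidean_product_topology subtopology_subtopology inf.absorb2 topspace_Euclidean_space)

lemma chart_inv_continuous:
 assumes c: "is_chart n T c"
 shows "continuous_map (top_of_set (snd c ` fst c)) T (chart_inv c)"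
proof -
 note sub = openin_subset[OF chart_facts(2)[OF c]]
 have "continuous_map (subtopology (Euclidean_space n) (snd c ` fst c)) T (chart_inv c)"
  unfolding continuous_map_def
 proof (intro conjI allI impI)
  show "chart_inv c : topspace (subtopology (Euclidean_space n) (snd c ` fst c)) \<rightarrow> topspace T"
   using chart_facts(6,7)[OF c] by (auto simp: topspace_subtopology)
  fix V assume "openin T V"
  hence "openE n (snd c ` (V \<inter> fst c))"
   by (intro chart_open_image[OF c] openin_Int chart_facts(1)[OF c]) auto
  moreover have "{x : topspace (subtopology (Euclidean_space n) (snd c ` fst c)). chart_inv c x : V} = snd c ` (V \<inter> fst c)"
  proof (intro equalityI subsetI)
   fix x assume "x : {x : topspace (subtopology (Euclidean_space n) (snd c ` fst c)). chart_inv c x : V}"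
   hence x: "x : snd c ` fst c" "chart_inv c x : V" by auto
   show "x : snd c ` (V \<inter> fst c)"
    using x chart_facts(5,6)[OF c x(1)] by (intro image_eqI[of _ _ "chart_inv c x"]) auto
  next
   fix x assume "x : snd c ` (V \<inter> fst c)"
   thus "x : {x : topspace (subtopology (Euclidean_space n) (snd c ` fst c)). chart_inv c x : V}"
    using chart_facts(4)[OF c] sub by auto
  qed
  ultimately show "openin (subtopology (Euclidean_space n) (snd c ` fst c)) {x : topspace (subtopology (Euclidean_space n) (snd c ` fst c)). chart_inv c x : V}"
   using chart_facts(2)[OF c] by (simp add: openin_open_subtopology) blast
 qed
 thus ?thesis unfolding Euclidean_subtopology[OF sub] .
qed

lemma chart_continuous:
 assumes c: "is_chart n T c"
 shows "continuous_map (subtopology T (fst c)) euclidean (snd c)"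
proof -
 note sub = openin_subset[OF chart_facts(2)[OF c]]
 have "continuous_map (subtopology T (fst c)) (subtopology (Euclidean_space n) (snd c ` fst c)) (snd c)"
  using c homeomorphic_imp_continuous_map unfolding is_chart_def by blast
 thus ?thesis unfolding Euclidean_subtopology[OF sub] by (simp add: continuous_map_in_subtopology)
qed

lemma chart_continuous_iff:
 assumes c: "is_chart n T c" and V: "openin T V" "V \<subseteq> fst c"
 shows "continuous_map (subtopology T V) euclideanreal f \<longleftrightarrow> continuous_on (snd c ` V) (f o chart_inv c)"
proof
 have VT: "V \<subseteq> topspace T" by (rule openin_subset[OF V(1)])
 assume f: "continuous_map (subtopology T V) euclideanreal f"
 have "continuous_map (top_of_set (snd c ` V)) (subtopology T V) (chart_inv c)"
  unfolding continuous_map_in_subtopology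
 proof
  show "continuous_map (top_of_set (snd c ` V)) T (chart_inv c)"
   by (rule continuous_map_from_subtopology_mono[OF chart_inv_continuous[OF c]]) (use V in blast)
  show "chart_inv c : topspace (top_of_set (snd c ` V)) \<rightarrow> V" using image_chart_inv[OF c V(2)] by auto
 qed
 from continuous_map_compose[OF this f] show "continuous_on (snd c ` V) (f o chart_inv c)"
  by simp
next
 assume f: "continuous_on (snd c ` V) (f o chart_inv c)"
 have "continuous_map (subtopology T V) (top_of_set (snd c ` V)) (snd c)"
  unfolding continuous_map_in_subtopology
  using continuous_map_from_subtopology_mono[OF chart_continuous[OF c] V(2)] by auto
 from continuous_map_compose[OF this f[folded continuous_map_iff_continuous]]
 have "continuous_map (subtopology T V) euclideanreal (f o chart_inv c o snd c)" .
 thus "continuous_map (subtopology T V) euclideanreal f"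
  by (rule continuous_map_eq) (use chart_facts(4)[OF c] V(2) in auto)
qed

text \<open>All local gradients coincide with \<open>partial\<close> applied to f, so they fit
  together.\<close>

lemma dw_local:
 assumes U: "openE n U"
  and loc: "!!x. x : U ==> EX e>0. cube n x e \<subseteq> U & dw n (cube n x e) w q f G"
 shows "dw n U w q f G"
proof -
 have p: "EX e>0. cube n x e \<subseteq> U & x : cube n x e & pd n (cube n x e) f (%i. partial i f) &
   (ALL j<q. G j x = (\<Sum>i<n. w j i x * partial i f x))" if x: "x : U" for x
 proof -
  obtain e P where e: "0<e" "cube n x e \<subseteq> U" and P: "pd n (cube n x e) f P"
   "ALL j<q. ALL y:cube n x e. G j y = (\<Sum>i<n. w j i y * P i y)" using loc[OF x] unfolding dw_def by blast
  have xin: "x : cube n x e" using cube_center[OF _ e(1)] x openin_subset[OF U] by blast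
  have "pd n (cube n x e) f (%i. partial i f)"
   by (rule pd_cong[OF openin_cube P(1)]) (use pd_partial[OF P(1)] in auto)
  moreover have "ALL j<q. G j x = (\<Sum>i<n. w j i x * partial i f x)" using P xin pd_partial[OF P(1) _ xin] by simp
  ultimately show ?thesis using e xin by blast
 qed
 have cont: "continuous_on U h" if h: "!!x e. 0<e ==> pd n (cube n x e) f (%i. partial i f) ==> continuous_on (cube n x e) h"
  for h :: "rn => real"
  unfolding continuous_on_cube_iff[OF openin_subset[OF U]]
 proof (intro ballI allI impI)
  fix x and eps :: real assume x: "x : U" and eps: "0<eps"
  obtain e where e: "0<e" "x : cube n x e" "pd n (cube n x e) f (%i. partial i f)" using p[OF x] by blast
  show "EX d>0. ALL y:U. (ALL i<n. abs (y i - x i)<d) --> abs (h y - h x)<eps"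
  proof (rule continuous_on_cube_bound[OF h[OF e(1,3)] openin_cube e(2) eps])
   fix d assume d: "0<d" "!!y. y : cube n x d ==> abs (h y - h x)<eps"
   have "y : cube n x d" if "y : U" "ALL i<n. abs (y i - x i)<d" for y
    using that openin_subset[OF U] by (auto simp: cube_def topspace_Euclidean_space)
   thus ?thesis using d by blast
  qed
 qed
 have "pd n U f (%i. partial i f)"
  unfolding pd_def
 proof (intro conjI allI impI ballI cont)
  fix i x assume i: "i<n" and x: "x : U"
  show "((%t. f (x(i := t))) has_real_derivative partial i f x) (at (x i))"
   using p[OF x] i unfolding pd_def by blast
 qed (auto simp: pd_def)
 moreover have "ALL j<q. ALL x:U. G j x = (\<Sum>i<n. w j i x * partial i f x)" using p by blast
 ultimately show ?thesis unfolding dw_def by blast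
qed

section \<open>Integral curves and flows on the leaf\<close>

locale spanned_manifold =
 fixes S :: "'a topology" and n q :: nat and A :: "'a chart set" and Y :: "nat => 'a vfield"
 assumes mfd: "is_manifold (C_k_on 2) n S A"
  and vf: "!!j. j<q ==> vector_field (C_k_on 1) S n A (Y j)"
  and span: "spanning_on n A (topspace S) q Y"
begin

abbreviation "img c \<equiv> snd c ` fst c"

definition "wc c j i x = Y j c (chart_inv c x) i"

lemma chart: "c : A ==> is_chart n S c"
 using mfd unfolding is_manifold_def is_atlas_def by blast

lemma cover: "y : topspace S ==> EX c:A. y : fst c"
 using mfd unfolding is_manifold_def is_atlas_def by blast

lemma compatible: "c : A ==> d : A ==> compatible_charts (C_k_on 2) n c d"
 using mfd unfolding is_manifold_def is_atlas_def by blast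

lemma maximal: "is_chart n S c ==> (!!d. d : A ==> compatible_charts (C_k_on 2) n c d) ==> c : A"
 using mfd unfolding is_manifold_def by blast

lemma open_overlap: "c : A ==> d : A ==> openE n (snd c ` (fst c \<inter> fst d))"
 by (rule chart_open_image[OF chart]) (auto intro: openin_Int chart_facts(1)[OF chart])

lemma transition:
 assumes c: "c : A" "d : A" and i: "i<n"
 shows "C_k_on 2 n (snd c ` (fst c \<inter> fst d)) (%x. in_coords c d id x i)"
 using compatible[OF c] i unfolding compatible_charts_def by blast

lemma in_coords_eq: "c : A ==> y : fst c ==> in_coords c d id (snd c y) = snd d y"
 by (simp add: in_coords_def chart_facts(4)[OF chart])

lemma transform:
 assumes "c : A" "d : A" "y : fst c" "y : fst d" "j<q" "i<n"
 shows "Y j d y i = (\<Sum>k<n. partial k (%x. in_coords c d id x i) (snd c y) * Y j c y k)"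
proof -
 have "F_related S n A n A id (Y j) (Y j)" using vf[OF assms(5)] by (simp add: vector_field_def)
 moreover have "y : topspace S" using chart_facts(7)[OF chart[OF assms(1)]] assms(3) by blast
 ultimately show ?thesis using assms unfolding F_related_def differential_def by fastforce
qed

lemma wc_C1: "c : A ==> j<q ==> i<n ==> EX G. pd n (img c) (wc c j i) G"
proof -
 assume c: "c : A" and j: "j<q" and i: "i<n"
 have "C_k_on 1 n (img c) (%x. Y j c (chart_inv c x) i)"
  using vf[OF j] c i unfolding vector_field_def regular_components_def by blast
 thus ?thesis unfolding C1_iff[OF chart_facts(2)[OF chart[OF c]]] wc_def[abs_def] .
qed

definition wc' where "wc' c j i k = partial k (wc c j i)"

lemma wc_pd: "c : A ==> j<q ==> i<n ==> pd n (img c) (wc c j i) (wc' c j i)"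
proof -
 assume c: "c : A" and j: "j<q" and i: "i<n"
 obtain G where G: "pd n (img c) (wc c j i) G" using wc_C1[OF c j i] by blast
 show "pd n (img c) (wc c j i) (wc' c j i)"
  by (rule pd_cong[OF chart_facts(2)[OF chart[OF c]] G]) (use pd_partial[OF G] in \<open>auto simp: wc'_def\<close>)
qed

lemma wc_span:
 assumes c: "c : A" and x: "x : img c"
 shows "EX a. ALL i<n. v i = (\<Sum>k<q. a k * wc c k i x)"
proof -
 have "chart_inv c x : topspace S \<inter> fst c"
  using chart_facts(6)[OF chart[OF c] x] chart_facts(7)[OF chart[OF c]] by blast
 thus ?thesis using span c unfolding spanning_on_def wc_def by blast
qed

text \<open>\<open>integral_curve\<close> asks for the derivative in every chart. A solution in one
  chart passes to the others by the chain rule for the transition map and the transformation law of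
  the components.\<close>

lemma curve_imp_integral_curve:
 assumes c: "c : A" and j: "j<q" and I: "open I" and cu: "!!t. t : I ==> cu t : img c"
  "!!t i. t : I ==> i<n ==> ((%s. cu s i) has_real_derivative wc c j i (cu t)) (at t)"
 shows "integral_curve S n A (Y j) I (%t. chart_inv c (cu t))"
 unfolding integral_curve_def
proof (intro conjI ballI impI allI)
 note ch = chart[OF c]
 have top: "cu t : spaceE n" if "t : I" for t
  using cu(1)[OF that] openin_subset[OF chart_facts(2)[OF ch]] by blast
 have "continuous_on I cu"
 proof (rule continuous_on_into_Euclidean[OF _ top])
  fix k assume k: "k<n"
  show "continuous_on I (%t. cu t k)"
   by (rule continuous_at_imp_continuous_on) (use cu(2) k DERIV_isCont in blast)
 qed
 hence "continuous_map (top_of_set I) (top_of_set (img c)) cu"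
  using cu(1) by (auto simp: continuous_map_in_subtopology)
 from continuous_map_compose[OF this chart_inv_continuous[OF ch]]
 show "continuous_map (top_of_set I) S (%t. chart_inv c (cu t))" by (simp add: comp_def)
 fix t d i assume t: "t : I" and d: "d : A" "chart_inv c (cu t) : fst d" and i: "i<n"
 let ?y = "chart_inv c (cu t)"
 have y: "?y : fst c" "snd c ?y = cu t" using chart_facts(5,6)[OF ch cu(1)[OF t]] by auto
 have ov: "cu t : snd c ` (fst c \<inter> fst d)" using y d(2) by (intro image_eqI[of _ _ ?y]) auto
 have C2: "C_k_on (Suc 1) n (snd c ` (fst c \<inter> fst d)) (%x. in_coords c d id x i)"
  using transition[OF c d(1) i] by (simp add: numeral_2_eq_2)
 have "((%r. in_coords c d id (cu r) i) has_real_derivative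
   (\<Sum>k<n. partial k (%x. in_coords c d id x i) (cu t) * wc c j k (cu t))) (at t)"
 proof (rule pd_chain_curve[where cu=cu and s=t, OF C_k_on_SucE(1)[OF C2] open_overlap[OF c d(1)] ov cu(2)[OF t]])
  have "eventually (%r. r : I) (at t)" using I t by (intro eventually_at_in_open') auto
  thus "\<forall>\<^sub>F r in at t. cu r : spaceE n" by eventually_elim (rule top)
 qed
 thus "((%s. snd d (chart_inv c (cu s)) i) has_real_derivative Y j d ?y i) (at t)"
  unfolding transform[OF c d(1) y(1) d(2) j i] by (simp add: in_coords_def wc_def y(2))
qed

lemma integral_curve_deriv:
 assumes g: "integral_curve S n A (Y j) I g" and c: "c : A" and t: "t : I" "g t : fst c" and i: "i<n"
 shows "((%s. snd c (g s) i) has_real_derivative wc c j i (snd c (g t))) (at t)"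
 using g c t i chart_facts(4)[OF chart[OF c] t(2)] unfolding integral_curve_def wc_def by simp

lemma integral_curve_near:
 assumes g: "integral_curve S n A (Y j) I g" and I: "open I" "t : I" and W: "openin S W" "g t : W"
 obtains \<delta> where "0<\<delta>" "!!s. abs (s - t)<\<delta> ==> s : I & g s : W"
proof -
 have "openin (top_of_set I) {s : topspace (top_of_set I). g s : W}"
  by (rule openin_continuous_map_preimage[OF _ W(1)]) (use g in \<open>simp add: integral_curve_def\<close>)
 hence "open {s : I. g s : W}" using I(1) by (simp add: openin_open_eq)
 then obtain \<delta> where "0<\<delta>" "ball t \<delta> \<subseteq> {s : I. g s : W}" using I(2) W(2) openE by blast
 thus ?thesis by (intro that[of \<delta>]) (auto simp: dist_real_def abs_minus_commute subset_iff)
qed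

text \<open>In a chart around the common point the difference of the two curves satisfies Gronwall's
  estimate with eps = 0.\<close>

lemma integral_curves_agree_near:
 assumes g: "integral_curve S n A (Y j) I g" and h: "integral_curve S n A (Y j) J h"
  and I: "open I" "open J" and t0: "t0 : I" "t0 : J" "g t0 = h t0" and j: "j<q"
 obtains \<delta> where "0<\<delta>" "!!s. abs (s - t0)<\<delta> ==> s : I & s : J & g s = h s"
proof -
 have "g t0 : topspace S" using g t0(1) unfolding integral_curve_def continuous_map_def by auto
 then obtain c where c: "c : A" "g t0 : fst c" using cover by blast
 note ch = chart[OF c(1)]
 define x where "x = snd c (g t0)"
 have x: "x : img c" using c by (auto simp: x_def)
 show ?thesis
 proof (rule C1_local_bounds[where N=q and w="wc c" and w'="wc' c", OF chart_facts(2)[OF ch] x wc_pd[OF c(1)]])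
 fix e K L :: real assume e: "0<e" "0 <= K" "0 <= L" "cube n x e \<subseteq> img c"
   "!!j i y. j<q ==> i<n ==> y : cube n x e ==> abs (wc c j i y) <= K"
   "!!j i m y. j<q ==> i<n ==> m<n ==> y : cube n x e ==> abs (wc' c j i m y) <= L"
   "!!j i y z. j<q ==> i<n ==> y : cube n x e ==> z : cube n x e ==>
    abs (wc c j i y - wc c j i z) <= L*(\<Sum>k<n. abs (y k - z k))"
 define W where "W = chart_inv c ` cube n x e"
 have W: "openin S W" unfolding W_def by (rule chart_open_preimage[OF ch openin_cube e(4)])
 have Wc: "y : fst c" "snd c y : cube n x e" if "y : W" for y
  using that unfolding W_def chart_inv_image(1)[OF ch e(4)] by auto
 have xe: "x : cube n x e" using cube_center[OF _ e(1)] x openin_subset[OF chart_facts(2)[OF ch]] by blast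
 have gW: "g t0 : W" unfolding W_def chart_inv_image(1)[OF ch e(4)] using c(2) xe by (simp add: x_def)
 obtain d1 where d1: "0<d1" "!!s. abs (s - t0)<d1 ==> s : I & g s : W"
  using integral_curve_near[OF g I(1) t0(1) W gW] by blast
 obtain d2 where d2: "0<d2" "!!s. abs (s - t0)<d2 ==> s : J & h s : W"
  using integral_curve_near[OF h I(2) t0(2) W] gW t0(3) by metis
 define d where "d = min (min d1 d2/2) (1/(4*(n * L + 1)))"
 have nL: "0 <= n * L" using e by simp
 have d: "0<d" "d<d1" "d<d2" using d1 d2 nL by (auto simp: d_def add_nonneg_pos)
 have "d <= 1/(4*(n * L + 1))" by (simp add: d_def)
 hence "d*(4*(n * L + 1)) <= 1" using nL by (simp add: pos_le_divide_eq add_nonneg_pos)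
 hence Ld: "n * L*((t0 + d) - (t0 - d)) <= 1/2" using d by (simp add: algebra_simps)
 have sI: "abs (s - t0)<d1" "abs (s - t0)<d2" if "s : {t0 - d..t0 + d}" for s using that d by (auto simp: abs_less_iff)
 have eq: "snd c (g s) i - snd c (h s) i = 0" if i: "i<n" and s: "s : {t0 - d..t0 + d}" for s i
 proof -
  have "abs (snd c (g s) i - snd c (h s) i) <= 2*0*((t0 + d) - (t0 - d))"
  proof (rule small_Gronwall[where \<delta>="%s i. snd c (g s) i - snd c (h s) i" and ?s0.0=t0 and L=L and n=n, OF _ _ _ _ e(3) Ld _ i s])
   fix i s assume i: "i<n" and s: "s : {t0 - d..t0 + d}"
   note gs = d1(2)[OF sI(1)[OF s]] and hs = d2(2)[OF sI(2)[OF s]]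
   have "((%s. snd c (g s) i - snd c (h s) i) has_real_derivative (wc c j i (snd c (g s)) - wc c j i (snd c (h s)))) (at s)"
    by (rule DERIV_diff; rule integral_curve_deriv[OF _ c(1) _ _ i]) (use g h gs hs Wc in auto)
   thus "((%s. snd c (g s) i - snd c (h s) i) has_real_derivative (wc c j i (snd c (g s)) - wc c j i (snd c (h s)))) (at s within {t0 - d..t0 + d})"
    by (rule has_field_derivative_at_within)
   show "abs (wc c j i (snd c (g s)) - wc c j i (snd c (h s))) <= L*(\<Sum>k<n. abs (snd c (g s) k - snd c (h s) k)) + 0"
    using e(7)[OF j i] gs hs Wc(2) by simp
  qed (use d t0 in auto)
  thus ?thesis by simp
 qed
 have "s : I & s : J & g s = h s" if "abs (s - t0)<d" for s
 proof -
  have s: "s : {t0 - d..t0 + d}" using that by auto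
  note gs = d1(2)[OF sI(1)[OF s]] and hs = d2(2)[OF sI(2)[OF s]]
  have "snd c (g s) = snd c (h s)"
  proof
   fix i show "snd c (g s) i = snd c (h s) i"
   proof (cases "i<n")
    case False
    thus ?thesis using Wc(2)[of "g s"] Wc(2)[of "h s"] gs hs by (simp add: cube_def)
   qed (use eq[OF _ s] in auto)
  qed
  thus ?thesis using gs hs Wc(1) inj_onD[OF chart_facts(3)[OF ch]] by blast
 qed
 thus ?thesis using that d(1) by blast
 qed
qed

text \<open>The set of agreement is closed since the manifold is Hausdorff and open by local
  uniqueness, and the common interval is connected.\<close>

lemma integral_curve_unique:
 assumes g: "integral_curve S n A (Y j) I g" and h: "integral_curve S n A (Y j) J h" and j: "j<q"
  and I: "open I" "is_interval I" "open J" "is_interval J" and 0: "0 : I" "0 : J" "g 0 = h 0"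
  and t: "t : I" "t : J"
 shows "g t = h t"
proof -
 define K where "K = I \<inter> J"
 define E where "E = {t : K. g t = h t}"
 have K: "open K" "connected K" using I is_interval_Int is_interval_connected unfolding K_def by blast+
 have "closedin (top_of_set K) {t : topspace (top_of_set K). g t = h t}"
 proof (rule closedin_continuous_maps_eq)
  show "Hausdorff_space S" using mfd by (simp add: is_manifold_def)
  show "continuous_map (top_of_set K) S g" "continuous_map (top_of_set K) S h"
   using g h unfolding integral_curve_def K_def by (auto intro: continuous_map_from_subtopology_mono)
 qed
 hence c: "closedin (top_of_set K) E" by (simp add: E_def)
 have "open E"
  unfolding open_dist
 proof
  fix t0 assume "t0 : E"
  hence t0: "t0 : I" "t0 : J" "g t0 = h t0" by (auto simp: E_def K_def)
  obtain \<delta> where \<delta>: "0<\<delta>" "!!s. abs (s - t0)<\<delta> ==> s : I & s : J & g s = h s"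
   using integral_curves_agree_near[OF g h I(1,3) t0 j] by blast
  hence "ALL s. dist s t0<\<delta> --> s : E" by (simp add: E_def K_def dist_real_def)
  thus "EX e>0. ALL s. dist s t0<e --> s : E" using \<delta>(1) by blast
 qed
 moreover have "E \<subseteq> K" by (auto simp: E_def)
 ultimately have "openin (top_of_set K) E" using K(1) by (simp add: openin_open_eq)
 with c K(2) have "E = {} \<or> E = K" unfolding connected_clopen by blast
 moreover have "0 : E" using 0 by (auto simp: E_def K_def)
 ultimately have "E = K" by blast
 thus ?thesis using t by (auto simp: E_def K_def)
qed

lemma flow_eq:
 assumes g: "integral_curve S n A (Y j) I g" and j: "j<q" and I: "open I" "is_interval I" "0 : I" "t : I"
 shows "flow S n A (Y j) t (g 0) = g t"
 unfolding flow_def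
proof (rule the_equality)
 show "EX J h. open J & is_interval J & 0 : J & t : J & integral_curve S n A (Y j) J h & h 0 = g 0 & h t = g t"
  using g I by blast
 fix y assume "EX J h. open J & is_interval J & 0 : J & t : J & integral_curve S n A (Y j) J h & h 0 = g 0 & h t = y"
 then obtain J h where h: "open J" "is_interval J" "0 : J" "t : J" "integral_curve S n A (Y j) J h" "h 0 = g 0" "h t = y" by blast
 show "y = g t" using integral_curve_unique[OF g h(5) j I(1,2) h(1,2) I(3) h(3) h(6)[symmetric] I(4) h(4)] h(7) by simp
qed

lemma flow_chart:
 assumes c: "c : A" and j: "j<q" and cu: "!!t. abs t<\<tau> ==> cu t : img c"
  "!!t i. abs t<\<tau> ==> i<n ==> ((%s. cu s i) has_real_derivative wc c j i (cu t)) (at t)" and t: "abs t<\<tau>"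
 shows "flow S n A (Y j) t (chart_inv c (cu 0)) = chart_inv c (cu t)"
proof (rule flow_eq[OF _ j])
 show "integral_curve S n A (Y j) {- \<tau><..<\<tau>} (%t. chart_inv c (cu t))"
  by (rule curve_imp_integral_curve[OF c j]) (use cu in \<open>auto simp: abs_less_iff\<close>)
 show "is_interval {- \<tau><..<\<tau>}" by (rule is_interval_oo)
qed (use t in \<open>auto simp: abs_less_iff\<close>)

text \<open>A derivative at time 0 sees small times only, where the flow coincides with any solution
  found in the chart.\<close>

lemma flow_has_derivative_iff:
 assumes c: "c : A" and j: "j<q" and \<tau>: "0<\<tau>" and cu: "!!t. abs t<\<tau> ==> cu t : img c"
  "!!t i. abs t<\<tau> ==> i<n ==> ((%s. cu s i) has_real_derivative wc c j i (cu t)) (at t)"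
 shows "((%t. f (flow S n A (Y j) t (chart_inv c (cu 0)))) has_real_derivative D) (at 0) \<longleftrightarrow>
  ((%t. f (chart_inv c (cu t))) has_real_derivative D) (at 0)"
proof (rule DERIV_cong_ev)
 have "eventually (%t. t : {- \<tau><..<\<tau>}) (nhds 0)" using \<tau> by (intro eventually_nhds_in_open) auto
 thus "\<forall>\<^sub>F t in nhds 0. f (flow S n A (Y j) t (chart_inv c (cu 0))) = f (chart_inv c (cu t))"
  by eventually_elim (subst flow_chart[OF c j cu], auto simp: abs_less_iff)
qed auto

lemma local_curve:
 assumes c: "c : A" and j: "j<q" and U: "openE n U" "U \<subseteq> img c" and x: "x : U"
 obtains cu \<tau> where "0<\<tau>" "cu 0 = x" "!!t. abs t<\<tau> ==> cu t : U"
  "!!t i. abs t<\<tau> ==> i<n ==> ((%s. cu s i) has_real_derivative wc c j i (cu t)) (at t)"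
proof -
 show ?thesis
 proof (rule C1_local_bounds[where N=q and w="wc c" and w'="wc' c", OF U(1) x pd_subset[OF wc_pd[OF c] U(2)]])
 fix e K L :: real assume e: "0<e" "0 <= K" "0 <= L" "cube n x e \<subseteq> U"
   "!!j i y. j<q ==> i<n ==> y : cube n x e ==> abs (wc c j i y) <= K"
   "!!j i m y. j<q ==> i<n ==> m<n ==> y : cube n x e ==> abs (wc' c j i m y) <= L"
   "!!j i y z. j<q ==> i<n ==> y : cube n x e ==> z : cube n x e ==>
    abs (wc c j i y - wc c j i z) <= L*(\<Sum>k<n. abs (y k - z k))"
 define \<tau> where "\<tau> = min (e/(4*(K + 1))) (1/(2*(n * L + 1)))"
 have nL: "0 <= n * L" using e by simp
 have \<tau>0: "0<\<tau>" using e nL by (simp add: \<tau>_def add_nonneg_pos)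
 have "\<tau> <= e/(4*(K + 1))" "\<tau> <= 1/(2*(n * L + 1))" by (auto simp: \<tau>_def)
 hence "\<tau>*(4*(K + 1)) <= e" "\<tau>*(2*(n * L + 1)) <= 1"
  using e nL by (auto simp: pos_le_divide_eq add_nonneg_pos)
 hence \<tau>: "K * \<tau> <= e/4" "n * L * \<tau> <= 1/2" using \<tau>0 by (auto simp: algebra_simps)
 have x2: "x : cube n x (e/2)" using cube_center[of x n "e/2"] e(1) x openin_subset[OF U(1)] by auto
 show ?thesis
 proof (rule local_solution[where F="%y i. wc c j i y", OF e(1) _ _ \<tau>0 e(2,3) \<tau> x2])
  fix cu assume g: "cu 0 = x" "!!t. abs t<\<tau> ==> cu t : cube n x e"
   "!!t i. abs t<\<tau> ==> i<n ==> ((%s. cu s i) has_real_derivative wc c j i (cu t)) (at t)"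
  show ?thesis by (rule that[OF \<tau>0 g(1) _ g(3)]) (use g(2) e(4) in blast)
 qed (use e(5,7) j in auto)
 qed
qed

end

section \<open>Analyticity along the fields, on the manifold and in a chart\<close>

context spanned_manifold
begin

text \<open>By definition of the class all word derivatives are continuous and differentiable along
  the flows. \<open>flow_derivatives_imp_C1\<close> therefore makes each of them C^1 in the chart,
  with the words extended by one letter as its derivatives.\<close>

lemma word_deriv_dw:
 assumes c: "c : A" and V: "openin S V" "V \<subseteq> fst c" and f: "C_X_omega_r S n A q Y r V f" and al: "al : lists {..<q}"
 shows "dw n (snd c ` V) (wc c) q (word_deriv S n A Y al f o chart_inv c)
  (%j. word_deriv S n A Y (j # al) f o chart_inv c)"
proof (rule dw_local)
 note ch = chart[OF c]
 have cont: "continuous_on (snd c ` V) (word_deriv S n A Y \<beta> f o chart_inv c)" if "\<beta> : lists {..<q}" for \<beta>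
  using f that unfolding C_X_omega_r_def chart_continuous_iff[OF ch V, symmetric] by blast
 show U: "openE n (snd c ` V)" by (rule chart_open_image[OF ch V])
 have sub: "snd c ` V \<subseteq> img c" using V by blast
 have inV: "chart_inv c x : V" if "x : snd c ` V" for x using image_chart_inv[OF ch V(2)] that by blast
 fix x assume x: "x : snd c ` V"
 show "EX e>0. cube n x e \<subseteq> snd c ` V & dw n (cube n x e) (wc c) q (word_deriv S n A Y al f o chart_inv c)
  (%j. word_deriv S n A Y (j # al) f o chart_inv c)"
 proof (rule flow_derivatives_imp_C1[where w'="wc' c", OF U x])
  show "pd n (snd c ` V) (wc c j i) (wc' c j i)" if "j<q" "i<n" for j i
   by (rule pd_subset[OF wc_pd[OF c that] sub])
  show "EX a. ALL i<n. v i = (\<Sum>k<q. a k * wc c k i x)" for v using wc_span[OF c] x sub by blast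
  show "continuous_on (snd c ` V) (word_deriv S n A Y al f o chart_inv c)" by (rule cont[OF al])
  show "continuous_on (snd c ` V) (word_deriv S n A Y (j # al) f o chart_inv c)" if "j<q" for j
   by (rule cont) (use al that in auto)
  fix x j cu and T :: real
  assume x: "x : snd c ` V" and j: "j<q" and T: "0<T" and g: "cu 0 = x" "!!t. abs t<T ==> cu t : snd c ` V"
   "!!t i. abs t<T ==> i<n ==> ((%s. cu s i) has_real_derivative wc c j i (cu t)) (at t)"
  have gi: "cu t : img c" if "abs t<T" for t using g(2)[OF that] sub by blast
  have "(%t. word_deriv S n A Y al f (flow S n A (Y j) t (chart_inv c x))) field_differentiable at 0"
   using f al j inV[OF x] unfolding C_X_omega_r_def by blast
  hence "((%t. word_deriv S n A Y al f (flow S n A (Y j) t (chart_inv c (cu 0)))) has_real_derivative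
    word_deriv S n A Y (j # al) f (chart_inv c x)) (at 0)"
   by (simp add: flow_deriv_def DERIV_deriv_iff_field_differentiable g(1))
  hence "((%t. word_deriv S n A Y al f (chart_inv c (cu t))) has_real_derivative
    word_deriv S n A Y (j # al) f (chart_inv c x)) (at 0)"
   by (subst (asm) flow_has_derivative_iff[where f="word_deriv S n A Y al f" and cu=cu, OF c j T gi g(3)])
  thus "((%t. (word_deriv S n A Y al f o chart_inv c) (cu t)) has_real_derivative
    (word_deriv S n A Y (j # al) f o chart_inv c) x) (at 0)"
   unfolding comp_def .
 qed
qed

lemma word_deriv_bound:
 assumes r: "0<r" and f: "C_X_omega_r S n A q Y r V f"
 obtains C where "0 <= C" "!!al x. al : lists {..<q} ==> x : V ==>
  abs (word_deriv S n A Y al f x) <= C*(1 / r) ^ length al * fact (length al)"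
proof -
 define s where "s k = ennreal (r ^ k / fact k) *
    (\<Sum>al | al : lists {..<q} & length al = k. (SUP x\<in>V. ennreal (abs (word_deriv S n A Y al f x))))" for k
 have "suminf s<\<infinity>" using f unfolding C_X_omega_r_def s_def by blast
 then obtain C where C: "0 <= C" "suminf s = ennreal C" by (cases "suminf s") auto
 show ?thesis
 proof (rule that[OF C(1)])
  fix al x assume al: "al : lists {..<q}" and x: "x : V"
  define k where "k = length al"
  have fin: "finite {al. al : lists {..<q} & length al = k}"
   using finite_words[of q k] by (simp add: words_def)
  have "ennreal (abs (word_deriv S n A Y al f x)) <= (SUP x\<in>V. ennreal (abs (word_deriv S n A Y al f x)))" by (rule SUP_upper[OF x])
  also have "... <= (\<Sum>al | al : lists {..<q} & length al = k. (SUP x\<in>V. ennreal (abs (word_deriv S n A Y al f x))))"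
   by (rule member_le_sum[OF _ _ fin]) (use al in \<open>auto simp: k_def\<close>)
  finally have "ennreal (r ^ k / fact k) * ennreal (abs (word_deriv S n A Y al f x)) <= s k"
   unfolding s_def by (rule mult_left_mono) simp
  also have "... <= suminf s" using sum_le_suminf[of s "{k}"] by simp
  finally have "ennreal (r ^ k / fact k * abs (word_deriv S n A Y al f x)) <= ennreal C"
   using r C(2) by (subst ennreal_mult) auto
  hence "r ^ k / fact k * abs (word_deriv S n A Y al f x) <= C" using C(1) by (simp add: ennreal_le_iff)
  hence "abs (word_deriv S n A Y al f x) <= C*(1 / r) ^ k * fact k"
   using r by (simp add: power_divide field_simps)
  thus "abs (word_deriv S n A Y al f x) <= C*(1 / r) ^ length al * fact (length al)" by (simp add: k_def)
 qed
qed

lemma C_X_omega_imp_analytic: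
 assumes c: "c : A" and V: "openin S V" "V \<subseteq> fst c" and f: "C_X_omega S n A q Y V f"
 shows "an_dw n (snd c ` V) (wc c) q (f o chart_inv c)"
proof -
 note ch = chart[OF c]
 let ?U = "snd c ` V"
 obtain r where r: "0<r" "C_X_omega_r S n A q Y r V f" using f unfolding C_X_omega_def by blast
 obtain C where C: "0 <= C" "!!al x. al : lists {..<q} ==> x : V ==>
  abs (word_deriv S n A Y al f x) <= C*(1 / r) ^ length al * fact (length al)"
  using word_deriv_bound[OF r] by blast
 have inV: "chart_inv c x : V" if "x : ?U" for x using image_chart_inv[OF ch V(2)] that by blast
 have b: "abs ((word_deriv S n A Y al f o chart_inv c) x) <= fps_nth ((fps_deriv ^^ length al) (geom C (1 / r))) 0"
  if "al : lists {..<q}" "x : ?U" for al x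
  using C(2)[OF that(1) inV[OF that(2)]] by (simp add: deriv_geom_0 mult_ac)
 \<comment> \<open>The induction on the depth runs over all words, because each differentiation
   prepends a letter.\<close>
 have "maj ?U q (dw n ?U (wc c) q) k ((fps_deriv ^^ length al) (geom C (1 / r))) (word_deriv S n A Y al f o chart_inv c)"
  if "al : lists {..<q}" for al k
  using that
 proof (induction k arbitrary: al)
  case 0
  show ?case unfolding maj.simps using b[OF 0] by blast
 next
  case (Suc k)
  have "maj ?U q (dw n ?U (wc c) q) k (fps_deriv ((fps_deriv ^^ length al) (geom C (1 / r)))) (word_deriv S n A Y (j # al) f o chart_inv c)"
   if "j<q" for j using Suc.IH[of "j # al"] Suc.prems that by (simp add: comp_def del: word_deriv.simps)
  thus ?case unfolding maj.simps using b[OF Suc.prems] word_deriv_dw[OF c V r(2) Suc.prems] by blast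
 qed
 from this[of "[]"] have "maj ?U q (dw n ?U (wc c) q) k (geom C (1 / r)) (f o chart_inv c)" for k by simp
 thus ?thesis unfolding analytic_wrt_def using C(1) r(1) by (intro exI[of _ C] exI[of _ "1 / r"]) auto
qed

lemma word_deriv_chart:
 assumes c: "c : A" and U: "openE n U" "U \<subseteq> img c"
  and f: "!!k. maj U q (dw n U (wc c) q) k (geom K R) (f o chart_inv c)"
 shows "al : lists {..<q} ==> x : U ==> word_deriv S n A Y al f (chart_inv c x) = foldr (XD n (wc c)) al (f o chart_inv c) x"
  and "al : lists {..<q} ==> x : U ==> j<q ==> ((%t. word_deriv S n A Y al f (flow S n A (Y j) t (chart_inv c x)))
   has_real_derivative foldr (XD n (wc c)) (j # al) (f o chart_inv c) x) (at 0)"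
proof -
 let ?D = "%al. foldr (XD n (wc c)) al (f o chart_inv c)"
 \<comment> \<open>Stated for any g that agrees on U with the operator word, so that it applies to
   \<open>word_deriv\<close> as soon as the induction has identified that function.\<close>
 have step: "((%t. g (flow S n A (Y j) t (chart_inv c x))) has_real_derivative ?D (j # al) x) (at 0)"
  if al: "al : lists {..<q}" and g: "!!x. x : U ==> g (chart_inv c x) = ?D al x" and x: "x : U" and j: "j<q" for g al x j
 proof -
  obtain cu \<tau> where \<tau>: "0<\<tau>" and cu: "cu 0 = x" "!!t. abs t<\<tau> ==> cu t : U"
   "!!t i. abs t<\<tau> ==> i<n ==> ((%s. cu s i) has_real_derivative wc c j i (cu t)) (at t)"
   using local_curve[OF c j U x] by blast
  have gi: "cu t : img c" if "abs t<\<tau>" for t using cu(2)[OF that] U(2) by blast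
  obtain P where P: "pd n U (?D al) P" "ALL j<q. ALL x:U. ?D (j # al) x = (\<Sum>i<n. wc c j i x * P i x)"
   using dw_words(1)[OF U(1) f al] unfolding dw_def by blast
  have ev: "eventually (%t. abs t<\<tau>) (nhds 0)"
   using \<tau> by (auto simp: eventually_nhds_metric dist_real_def intro!: exI[of _ \<tau>])
  have "((%t. ?D al (cu t)) has_real_derivative (\<Sum>i<n. P i (cu 0) * wc c j i (cu 0))) (at 0)"
  proof (rule pd_chain_curve[where cu=cu and s=0, OF P(1) U(1)])
   show "cu 0 : U" using cu(1) x by simp
   show "((%r. cu r i) has_real_derivative wc c j i (cu 0)) (at 0)" if "i<n" for i using cu(3)[of 0 i] that \<tau> by simp
   have "eventually (%t. abs t<\<tau>) (at 0)" using ev by (simp add: eventually_at_filter eventually_mono)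
   thus "\<forall>\<^sub>F t in at 0. cu t : spaceE n"
    by eventually_elim (use cu(2) openin_subset[OF U(1)] in blast)
  qed
  also have "(\<Sum>i<n. P i (cu 0) * wc c j i (cu 0)) = ?D (j # al) x"
   using P(2) j x cu(1) by (simp add: mult.commute)
  finally have "((%t. ?D al (cu t)) has_real_derivative ?D (j # al) x) (at 0)" .
  moreover have "eventually (%t. g (chart_inv c (cu t)) = ?D al (cu t)) (nhds 0)"
   using ev by eventually_elim (rule g[OF cu(2)])
  ultimately have "((%t. g (chart_inv c (cu t))) has_real_derivative ?D (j # al) x) (at 0)"
   by (subst DERIV_cong_ev[OF refl _ refl]) auto
  hence "((%t. g (flow S n A (Y j) t (chart_inv c (cu 0)))) has_real_derivative ?D (j # al) x) (at 0)"
   by (subst flow_has_derivative_iff[where f=g and cu=cu, OF c j \<tau> gi cu(3)])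
  thus ?thesis unfolding cu(1) .
 qed
 have *: "al : lists {..<q} ==> ALL x:U. word_deriv S n A Y al f (chart_inv c x) = ?D al x" for al
 proof (induction al)
  case (Cons j al)
  hence al: "al : lists {..<q}" "j<q" by auto
  have "((%t. word_deriv S n A Y al f (flow S n A (Y j) t (chart_inv c x))) has_real_derivative ?D (j # al) x) (at 0)"
   if "x : U" for x by (rule step[OF al(1) _ that al(2)]) (use Cons.IH[OF al(1)] in blast)
  thus ?case
   unfolding word_deriv.simps flow_deriv_def by (intro ballI DERIV_imp_deriv) blast
 qed simp
 thus "al : lists {..<q} ==> x : U ==> word_deriv S n A Y al f (chart_inv c x) = ?D al x" by blast
 show "((%t. word_deriv S n A Y al f (flow S n A (Y j) t (chart_inv c x))) has_real_derivative ?D (j # al) x) (at 0)"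
  if "al : lists {..<q}" "x : U" "j<q" by (rule step[OF that(1) _ that(2,3)]) (use *[OF that(1)] in blast)
qed

lemma card_words: "card {al. al : lists {..<q} & length al = k} = q ^ k"
 using card_lists_length_eq[of "{..<q}" k] by (simp add: lists_eq_set conj_commute)

lemma analytic_imp_C_X_omega:
 assumes c: "c : A" and U: "openE n U" "U \<subseteq> img c"
  and f: "an_dw n U (wc c) q (f o chart_inv c)"
 shows "C_X_omega S n A q Y (chart_inv c ` U) f"
proof -
 note ch = chart[OF c]
 let ?V = "chart_inv c ` U" and ?D = "%al. foldr (XD n (wc c)) al (f o chart_inv c)"
 note V = chart_open_preimage[OF ch U] chart_inv_image(3)[OF ch U(2)]
 obtain K R where KR: "0 <= K" "0<R" and m: "!!k. maj U q (dw n U (wc c) q) k (geom K R) (f o chart_inv c)"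
  using f unfolding analytic_wrt_def by blast
 note wd = word_deriv_chart[OF c U m]
 have wb: "abs (word_deriv S n A Y al f y) <= K * R ^ length al * fact (length al)" if "al : lists {..<q}" "y : ?V" for al y
  using that(2) wd(1)[OF that(1)] dw_words(2)[OF U(1) m that(1)] by auto
 \<comment> \<open>There are q^k words of length k, so the k-th term of the norm is at most K (r q
   R)^k. This r makes the ratio at most 1/2, also for q = 0.\<close>
 define r where "r = 1/(2*(real q + 1) * R)"
 have r: "0<r" using KR by (simp add: r_def)
 have rq: "r*(real q * R) <= 1/2"
 proof -
  have "r*((real q + 1) * R) = 1/2" using KR(2) unfolding r_def by (simp add: add_pos_nonneg divide_simps)
  moreover have "r*(real q * R) <= r*((real q + 1) * R)" using r KR(2) by (intro mult_left_mono mult_right_mono) auto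
  ultimately show ?thesis by linarith
 qed
 have "C_X_omega_r S n A q Y r ?V f"
  unfolding C_X_omega_r_def
 proof (intro conjI ballI allI impI)
  have "abs (f y) <= K" if "y : ?V" for y using wb[of "[]" y] that by simp
  thus "bounded (f ` ?V)" by (auto simp: bounded_iff)
  fix al assume al: "al : lists {..<q}"
  have "continuous_on U (?D al)" using dw_words(1)[OF U(1) m al] unfolding dw_def pd_def by blast
  hence "continuous_on U (word_deriv S n A Y al f o chart_inv c)"
   by (rule continuous_on_eq) (use wd(1)[OF al] in simp)
  thus "continuous_map (subtopology S ?V) euclideanreal (word_deriv S n A Y al f)"
   unfolding chart_continuous_iff[OF ch V] chart_inv_image(2)[OF ch U(2)] .
  fix j y assume "j<q" "y : ?V"
  thus "(%t. word_deriv S n A Y al f (flow S n A (Y j) t y)) field_differentiable at 0"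
   using wd(2)[OF al] unfolding field_differentiable_def by blast
 next
  have "ennreal (r ^ k / fact k)*(\<Sum>al | al : lists {..<q} & length al = k. (SUP x\<in>?V. ennreal (abs (word_deriv S n A Y al f x))))
    <= ennreal (K*(1/2) ^ k)" for k
  proof -
   have "(\<Sum>al | al : lists {..<q} & length al = k. (SUP x\<in>?V. ennreal (abs (word_deriv S n A Y al f x)))) <=
     (\<Sum>al | al : lists {..<q} & length al = k. ennreal (K * R ^ k * fact k))"
    by (intro sum_mono SUP_least ennreal_leI) (use wb in auto)
   also have "... = ennreal (real (q ^ k)*(K * R ^ k * fact k))"
    using KR by (simp add: card_words ennreal_mult ennreal_of_nat_eq_real_of_nat)
   finally have "ennreal (r ^ k / fact k)*(\<Sum>al | al : lists {..<q} & length al = k. (SUP x\<in>?V. ennreal (abs (word_deriv S n A Y al f x))))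
     <= ennreal (r ^ k / fact k) * ennreal (real (q ^ k)*(K * R ^ k * fact k))" by (rule mult_left_mono) simp
   also have "... = ennreal (r ^ k / fact k*(real (q ^ k)*(K * R ^ k * fact k)))"
    using r KR by (intro ennreal_mult[symmetric]) auto
   also have "r ^ k / fact k*(real (q ^ k)*(K * R ^ k * fact k)) = K*(r*(real q * R)) ^ k"
    by (simp add: power_mult_distrib)
   also have "ennreal ... <= ennreal (K*(1/2) ^ k)"
    using rq r KR by (intro ennreal_leI mult_left_mono power_mono) auto
   finally show ?thesis .
  qed
  hence "(suminf (%k. ennreal (r ^ k / fact k)*(\<Sum>al | al : lists {..<q} & length al = k. (SUP x\<in>?V. ennreal (abs (word_deriv S n A Y al f x))))))
    <= (suminf (%k. ennreal (K*(1/2) ^ k)))" by (intro suminf_le) auto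
  also have "... < \<infinity>"
  proof -
   have "summable (%k. K*(1/2 :: real) ^ k)" by (intro summable_mult summable_geometric) simp
   thus ?thesis using KR by (subst suminf_ennreal2) auto
  qed
  finally show "(suminf (%k. ennreal (r ^ k / fact k)*(\<Sum>al | al : lists {..<q} & length al = k. (SUP x\<in>?V. ennreal (abs (word_deriv S n A Y al f x))))))<\<infinity>" .
 qed
 thus ?thesis unfolding C_X_omega_def using r by blast
qed

end

subsection \<open>Analytic charts\<close>

lemma analytic_partial:
 assumes U: "openE n U" and f: "an_pd n U f" and i: "i<n"
 shows "an_pd n U (partial i f)"
proof -
 interpret ds: derivation_system U n "pd n U" by (rule derivation_pd[OF U])
 obtain K R where KR: "0 <= K" "0<R" and m: "!!k. maj U n (pd n U) k (geom K R) f"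
  using f unfolding analytic_wrt_def by blast
 show ?thesis
 proof (rule analytic_wrtI[where K="K * R" and R="2 * R"])
  show "maj U n (pd n U) k (fps_deriv (geom K R)) (partial i f)" for k
   by (rule ds.mj_operator(2)[where Dp=partial, OF _ m i]) (rule pd_partial[symmetric])
  show "fps_nth (fps_deriv (geom K R)) m <= K * R*(2 * R) ^ m" for m
  proof -
   have "real (Suc m)*(K * R * R ^ m) <= 2 ^ m*(K * R * R ^ m)"
    using Suc_le_two_power KR by (intro mult_right_mono) auto
   thus ?thesis by (simp add: power_mult_distrib mult_ac)
  qed
 qed (use KR in auto)
qed

text \<open>Majorants bound the function on the whole domain, hence the hypothesis of boundedness.
  Taking K >= 1 also covers the derivative 1.\<close>

lemma analytic_coord:
 assumes U: "openE n U" and B: "!!x. x : U ==> abs (x k) <= B"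
 shows "an_pd n U (%x. x k)"
 unfolding analytic_wrt_def
proof (intro exI conjI allI)
 interpret ds: derivation_system U n "pd n U" by (rule derivation_pd[OF U])
 define K where "K = max B 1"
 show "0 <= K" "(0::real)<1" by (auto simp: K_def)
 have b: "abs (x k) <= K" if "x : U" for x using B[OF that] by (simp add: K_def)
 have c: "maj U n (pd n U) j (fps_deriv (geom K 1)) (%_. if i = k then 1 else 0)" for i j
 proof (rule maj_le[OF ds.mj_const[of j "if i = k then 1 else 0"]])
  have K1: "1 <= K" by (simp add: K_def)
  show "fps_le (fps_const (abs (if i = k then 1 else 0))) (fps_deriv (geom K 1))"
   unfolding fps_le_def
  proof
   fix m show "fps_nth (fps_const (abs (if i = k then 1 else 0))) m <= fps_nth (fps_deriv (geom K 1)) m"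
    using K1 by (cases m) auto
  qed
 qed
 fix j show "maj U n (pd n U) j (geom K 1) (%x. x k)"
 proof (cases j)
  case (Suc j')
  have "pd n U (%x. x k) (%i _. if i = k then 1 else 0)" by (rule pd_coord)
  thus ?thesis unfolding Suc maj.simps using b c by (intro conjI exI[of _ "%i _. if i = k then 1 else 0"]) auto
 qed (use b in simp)
qed

lemma analytic_coord_cube: "an_pd n (cube n x e) (%y. y k)"
proof (rule analytic_coord[OF openin_cube])
 fix y assume y: "y : cube n x e"
 show "abs (y k) <= abs (x k) + abs e"
 proof (cases "k<n")
  case True
  hence "abs (y k - x k)<e" using y by (auto simp: cube_def)
  thus ?thesis by linarith
 qed (use y in \<open>auto simp: cube_def\<close>)
qed

lemma pd_analytic_imp_dw:
 assumes U: "openE n U"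
  and w: "!!j i. j<q ==> i<n ==> an_pd n U (w j i)" and f: "an_pd n U f"
 shows "an_dw n U w q f"
 by (rule derivation_system.an_frame[OF derivation_pd[OF U] f, where b=w]) (use dwI w in auto)

text \<open>Here the fields are the old frame and the coordinate fields the new one, so the
  coefficients \<open>\<beta>\<close> must be analytic for the fields.
  \<open>pd_analytic_imp_dw\<close> supplies that.\<close>

lemma dw_analytic_imp_pd:
 assumes U: "openE n U"
  and w: "!!j i. j<q ==> i<n ==> an_pd n U (w j i)"
  and \<beta>: "!!m j. m<n ==> j<q ==> an_pd n U (\<beta> m j)"
  and \<beta>w: "!!m i x. m<n ==> i<n ==> x : U ==> (\<Sum>j<q. \<beta> m j x * w j i x) = (if m = i then 1 else 0)"
  and f: "an_dw n U w q f"
 shows "an_pd n U f"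
proof (rule derivation_system.an_frame[OF derivation_dw[OF U] f, where b=\<beta>])
 show "an_dw n U w q (\<beta> i j)" if "i<n" "j<q" for i j
  by (rule pd_analytic_imp_dw[OF U w \<beta>[OF that]])
 fix f G assume "dw n U w q f G"
 then obtain P where P: "pd n U f P" "ALL j<q. ALL x:U. G j x = (\<Sum>i<n. w j i x * P i x)" unfolding dw_def by blast
 show "pd n U f (%i x. \<Sum>j<q. \<beta> i j x * G j x)"
 proof (rule pd_cong[OF U P(1) refl])
  fix i x assume i: "i<n" and x: "x : U"
  have "(\<Sum>j<q. \<beta> i j x * G j x) = (\<Sum>j<q. \<beta> i j x*(\<Sum>k<n. w j k x * P k x))" using P(2) x by simp
  also have "... = (\<Sum>k<n. (\<Sum>j<q. \<beta> i j x * w j k x) * P k x)"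
   unfolding sum_distrib_left sum_distrib_right by (rule trans[OF sum.swap]) (simp add: mult.assoc)
  also have "... = (\<Sum>k<n. if i = k then P k x else 0)" using \<beta>w[OF i _ x] by (intro sum.cong) auto
  finally show "(\<Sum>j<q. \<beta> i j x * G j x) = P i x" using i by simp
 qed
qed

text \<open>\<open>rel\<close> states that the differential of H maps the fields w1 to w2; the chain
  rule then matches the derivatives.\<close>

lemma dw_pullback:
 assumes f: "dw n V w2 q f G" and V: "openE n V" and U: "openE n U"
  and H: "!!k. k<n ==> pd n U (%x. H x k) (K k)" and HV: "!!x. x : U ==> H x : V"
  and rel: "!!j k x. j<q ==> k<n ==> x : U ==> (\<Sum>i<n. w1 j i x * K k i x) = w2 j k (H x)"
 shows "dw n U w1 q (f o H) (%j. G j o H)"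
proof -
 obtain P where P: "pd n V f P" "ALL j<q. ALL x:V. G j x = (\<Sum>i<n. w2 j i x * P i x)" using f unfolding dw_def by blast
 have "pd n U (f o H) (%i x. \<Sum>k<n. P k (H x) * K k i x)"
  unfolding comp_def by (rule pd_compose[OF P(1) V U H HV])
 moreover have "(G j o H) x = (\<Sum>i<n. w1 j i x*(\<Sum>k<n. P k (H x) * K k i x))" if j: "j<q" and x: "x : U" for j x
 proof -
  have "(\<Sum>i<n. w1 j i x*(\<Sum>k<n. P k (H x) * K k i x)) = (\<Sum>k<n. (\<Sum>i<n. w1 j i x * K k i x) * P k (H x))"
   unfolding sum_distrib_left sum_distrib_right by (rule trans[OF sum.swap]) (simp add: mult_ac)
  also have "... = (\<Sum>k<n. w2 j k (H x) * P k (H x))" using rel[OF j _ x] by (intro sum.cong) auto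
  finally show ?thesis using P(2) j HV[OF x] by simp
 qed
 ultimately show ?thesis unfolding dw_def by blast
qed

lemma analytic_common_cube:
 fixes a b :: nat
 assumes U: "openE n U" and F: "!!j i. j<a ==> i<b ==> real_analytic_on n U (F j i)"
  and W: "openE n W" "W \<subseteq> U" "x : W"
 shows "EX e>0. cube n x e \<subseteq> W & (ALL j<a. ALL i<b. an_pd n (cube n x e) (F j i))"
proof -
 interpret an: func_class n "%U f. an_pd n U f" by (rule func_class_analytic)
 have mono: "an_pd n (cube n x e') f"
  if "an_pd n (cube n x e) f" "e' <= e" for e e' f
  by (rule an.cl_subset[OF that(1) cube_mono[OF that(2)] openin_cube])
 have "EX e>0. ALL j<a. ALL i<b. an_pd n (cube n x e) (F j i)"
 proof (rule ex_common_pos, rule ex_common_pos)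
  fix j i assume "j<a" "i<b"
  thus "EX e>0. an_pd n (cube n x e) (F j i)"
   using real_analytic_imp_analytic[OF U F subsetD[OF W(2,3)]] by blast
 qed (use mono in blast)+
 then obtain e where e: "0<e" "ALL j<a. ALL i<b. an_pd n (cube n x e) (F j i)" by blast
 obtain e' where e': "0<e'" "cube n x e' \<subseteq> W" using open_cubeE[OF W(1,3)] by blast
 have "cube n x (min e e') \<subseteq> W" using e'(2) cube_mono[of "min e e'" e' n x] by auto
 thus ?thesis using e e'(1) mono[of e _ "min e e'"] by (intro exI[of _ "min e e'"]) auto
qed

section \<open>Transition maps and new charts\<close>

context spanned_manifold
begin

abbreviation "ovl c d \<equiv> snd c ` (fst c \<inter> fst d)"

lemma overlap:
 assumes c: "c : A" and d: "d : A" and x: "x : ovl c d"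
 shows "chart_inv c x : fst c" "chart_inv c x : fst d" "snd c (chart_inv c x) = x"
  "in_coords c d id x = snd d (chart_inv c x)" "in_coords c d id x : ovl d c"
  "chart_inv d (in_coords c d id x) = chart_inv c x"
proof -
 obtain y where y: "x = snd c y" "y : fst c" "y : fst d" using x by blast
 hence "chart_inv c x = y" using chart_facts(4)[OF chart[OF c]] by simp
 thus "chart_inv c x : fst c" "chart_inv c x : fst d" "snd c (chart_inv c x) = x"
  "in_coords c d id x = snd d (chart_inv c x)" "in_coords c d id x : ovl d c"
  "chart_inv d (in_coords c d id x) = chart_inv c x"
  using y chart_facts(4)[OF chart[OF d]] by (auto simp: in_coords_def)
qed

lemma wc_transform:
 assumes c: "c : A" and d: "d : A" and x: "x : ovl c d" and j: "j<q" and i: "i<n"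
 shows "wc d j i (in_coords c d id x) = (\<Sum>k<n. wc c j k x * partial k (%x. in_coords c d id x i) x)"
 using transform[OF c d overlap(1,2)[OF c d x] j i] overlap[OF c d x] by (simp add: wc_def mult.commute)

lemma transition_pd:
 assumes c: "c : A" and d: "d : A" and i: "i<n"
 shows "pd n (ovl c d) (%x. in_coords c d id x i) (%k. partial k (%x. in_coords c d id x i))"
 using C_k_on_SucE(1)[of 1 n] transition[OF c d i] by (simp add: numeral_2_eq_2)

text \<open>A coordinate of d is analytic for the fields, and \<open>dw_pullback\<close> carries
  this to c using only derivatives of first order of the transition map. A coframe in c converts it
  to analyticity in the coordinates.\<close>

lemma analytic_transition:
 assumes c: "c : A" and d: "d : A" and rc: "!!j i. j<q ==> i<n ==> real_analytic_on n (img c) (wc c j i)"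
  and rd: "!!j i. j<q ==> i<n ==> real_analytic_on n (img d) (wc d j i)" and m: "m<n"
 shows "real_analytic_on n (ovl c d) (%x. in_coords c d id x m)"
proof (rule real_analytic_on_local[OF open_overlap[OF c d]])
 interpret an: func_class n "%U f. an_pd n U f" by (rule func_class_analytic)
 note cc = chart[OF c] and cd = chart[OF d]
 let ?H = "in_coords c d id"
 fix x assume x: "x : ovl c d"
 have sd: "ovl d c \<subseteq> img d" and sc: "ovl c d \<subseteq> img c" by auto
 have "EX e2>0. cube n (?H x) e2 \<subseteq> ovl d c &
   (ALL j<q. ALL i<n. an_pd n (cube n (?H x) e2) (wc d j i))"
  by (rule analytic_common_cube[where F="wc d", OF chart_facts(2)[OF cd] rd open_overlap[OF d c] sd overlap(5)[OF c d x]])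
 then obtain e2 where e2: "0<e2" "cube n (?H x) e2 \<subseteq> ovl d c"
  and wd: "ALL j<q. ALL i<n. an_pd n (cube n (?H x) e2) (wc d j i)" by blast
 let ?C2 = "cube n (?H x) e2"
 have C2d: "?C2 \<subseteq> img d" using e2 sd by blast
 define V where "V = chart_inv d ` ?C2"
 have V: "openin S V" unfolding V_def by (rule chart_open_preimage[OF cd openin_cube C2d])
 have Vd: "V \<subseteq> fst d" "!!y. y : V ==> snd d y : ?C2" unfolding V_def chart_inv_image(1)[OF cd C2d] by auto
 \<comment> \<open>The points of the overlap that the transition map sends into \<open>?C2\<close>,
   where the fields of d have uniform bounds.\<close>
 define W where "W = snd c ` (V \<inter> fst c)"
 have W: "openE n W" unfolding W_def
  by (rule chart_open_image[OF cc]) (auto intro: openin_Int V chart_facts(1)[OF cc])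
 have Wo: "W \<subseteq> ovl c d" using Vd(1) by (auto simp: W_def)
 have WH: "?H z : ?C2" if zW: "z : W" for z
 proof -
  obtain y where y: "z = snd c y" "y : V" "y : fst c" using zW by (auto simp: W_def)
  thus ?thesis using Vd(2)[OF y(2)] unfolding y(1) in_coords_eq[OF c y(3)] by blast
 qed
 have "?H x : ?C2" by (rule cube_center[OF _ e2(1)]) (use overlap(5)[OF c d x] openin_subset[OF open_overlap[OF d c]] in blast)
 hence "chart_inv c x : V" unfolding V_def chart_inv_image(1)[OF cd C2d] using overlap(2,4)[OF c d x] by simp
 hence xW: "x : W" unfolding W_def using overlap(1,3)[OF c d x] by (intro image_eqI[of _ _ "chart_inv c x"]) auto
 have Wc: "W \<subseteq> img c" using Wo sc by blast
 have "EX e1>0. cube n x e1 \<subseteq> W & (ALL j<q. ALL i<n. an_pd n (cube n x e1) (wc c j i))"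
  by (rule analytic_common_cube[where F="wc c", OF chart_facts(2)[OF cc] rc W Wc xW])
 then obtain e1 where e1: "0<e1" "cube n x e1 \<subseteq> W"
  and w1: "ALL j<q. ALL i<n. an_pd n (cube n x e1) (wc c j i)" by blast
 let ?C1 = "cube n x e1"
 have x1: "x : ?C1" by (rule cube_center[OF _ e1(1)]) (use xW openin_subset[OF W] in blast)
 have "an_dw n ?C2 (wc d) q (%y. y m)"
  by (rule pd_analytic_imp_dw[OF openin_cube _ analytic_coord_cube]) (use wd in blast)
 hence "an_dw n ?C1 (wc c) q ((%y. y m) o ?H)"
 proof (rule analytic_wrt_transport[where \<sigma>="%j. j"])
  show "dw n ?C1 (wc c) q (f o ?H) (%j. G j o ?H)" if f: "dw n ?C2 (wc d) q f G" for f G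
  proof (rule dw_pullback[OF f openin_cube openin_cube])
   show "pd n ?C1 (%x. ?H x k) (%i. partial i (%x. ?H x k))" if "k<n" for k
    by (rule pd_subset[OF transition_pd[OF c d that]]) (use e1 Wo in blast)
   show "?H z : ?C2" if "z : ?C1" for z using WH e1 that by blast
   show "(\<Sum>i<n. wc c j i z * partial i (%x. ?H x k) z) = wc d j k (?H z)" if "j<q" "k<n" "z : ?C1" for j k z
    by (rule wc_transform[OF c d _ that(1,2), symmetric]) (use that e1 Wo in blast)
  qed
  show "?H ` ?C1 \<subseteq> ?C2" using WH e1 by blast
 qed
 hence Hdw: "an_dw n ?C1 (wc c) q (%x. ?H x m)" by (simp add: comp_def)
 have w1': "an_pd n ?C1 (wc c j i)" if "j<q" "i<n" for j i using w1 that by blast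
 show "EX e>0. cube n x e \<subseteq> ovl c d & an_pd n (cube n x e) (%x. ?H x m)"
 proof (rule an.local_coframe[OF openin_cube x1 w1'])
  show "EX a. ALL i<n. v i = (\<Sum>k<q. a k * wc c k i x)" for v by (rule wc_span[OF c]) (use xW Wc in blast)
  fix e0 \<beta> assume e0: "0<e0" "cube n x e0 \<subseteq> ?C1"
   and \<beta>: "!!m j. m<n ==> j<q ==> an_pd n (cube n x e0) (\<beta> m j)"
   and \<beta>w: "!!m i y. m<n ==> i<n ==> y : cube n x e0 ==> (\<Sum>j<q. \<beta> m j y * wc c j i y) = (if m = i then 1 else 0)"
  have "an_pd n (cube n x e0) (%x. ?H x m)"
  proof (rule dw_analytic_imp_pd[where w="wc c" and \<beta>=\<beta>, OF openin_cube])
   show "an_pd n (cube n x e0) (wc c j i)" if "j<q" "i<n" for j i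
    by (rule an.cl_subset[OF w1'[OF that] e0(2) openin_cube])
   show "an_dw n (cube n x e0) (wc c) q (%x. ?H x m)"
    by (rule analytic_dw_subset[OF Hdw e0(2)])
  qed (use \<beta> \<beta>w in auto)
  thus ?thesis using e0 e1 Wo by blast
 qed
qed

text \<open>The C^2 atlas is maximal, so a C^2 parametrisation with C^2 inverse inside a chart gives
  another member. Compatibility with any chart factors through c.\<close>

lemma new_chart:
 assumes c: "c : A" and U: "openE n U" and \<Phi>: "!!t. t : U ==> \<Phi> t : img c"
  and inj: "inj_on \<Phi> U" and C2\<Phi>: "!!i. i<n ==> C_k_on 2 n U (%t. \<Phi> t i)"
  and oi: "openE n (\<Phi> ` U)"
  and C2\<Psi>: "!!i. i<n ==> C_k_on 2 n (\<Phi> ` U) (%y. inv_into U \<Phi> y i)"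
 obtains d where "d : A" "fst d = chart_inv c ` \<Phi> ` U" "snd d ` fst d = U"
  "!!t. t : U ==> chart_inv d t = chart_inv c (\<Phi> t)" "!!t. t : U ==> in_coords d c id t = \<Phi> t"
proof -
 note ch = chart[OF c]
 define V where "V = chart_inv c ` \<Phi> ` U"
 define \<psi> where "\<psi> y = inv_into U \<Phi> (snd c y)" for y
 define d where "d = (V, \<psi>)"
 have sub: "\<Phi> ` U \<subseteq> img c" using \<Phi> by blast
 have V: "openin S V" unfolding V_def by (rule chart_open_preimage[OF ch oi sub])
 have Vc: "V \<subseteq> fst c" unfolding V_def by (rule chart_inv_image(3)[OF ch sub])
 have Vs: "snd c y : \<Phi> ` U" if "y : V" for y using that unfolding V_def chart_inv_image(1)[OF ch sub] by blast
 have \<psi>V: "\<psi> y : U" "\<Phi> (\<psi> y) = snd c y" if "y : V" for y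
  unfolding \<psi>_def by (rule inv_into_into[OF Vs[OF that]], rule f_inv_into_f[OF Vs[OF that]])
 have \<psi>g: "\<psi> (chart_inv c (\<Phi> t)) = t" if "t : U" for t
  using that \<Phi> chart_facts(5)[OF ch] inv_into_f_f[OF inj] by (simp add: \<psi>_def)
 have g\<psi>: "chart_inv c (\<Phi> (\<psi> y)) = y" if "y : V" for y
  using \<psi>V[OF that] chart_facts(4)[OF ch] Vc that by auto
 have \<psi>VU: "\<psi> ` V = U"
 proof
  show "U \<subseteq> \<psi> ` V" using \<psi>g by (force simp: V_def)
 qed (use \<psi>V in auto)
 have Utop: "U \<subseteq> spaceE n" by (rule openin_subset[OF U])
 have itop: "\<Phi> ` U \<subseteq> spaceE n" by (rule openin_subset[OF oi])
 have c\<Phi>: "continuous_on U \<Phi>"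
  by (rule continuous_on_into_Euclidean[of n]) (use C2\<Phi> C_k_on_continuous itop in blast)+
 have c\<Psi>: "continuous_on (\<Phi> ` U) (inv_into U \<Phi>)"
 proof (rule continuous_on_into_Euclidean[of n])
  fix x assume "x : \<Phi> ` U"
  from inv_into_into[OF this] show "inv_into U \<Phi> x : spaceE n" using Utop by blast
 qed (use C2\<Psi> C_k_on_continuous in blast)
 have VT: "V \<subseteq> topspace S" by (rule openin_subset[OF V])
 have "homeomorphic_maps (subtopology S V) (subtopology (Euclidean_space n) U) \<psi> (chart_inv c o \<Phi>)"
  unfolding homeomorphic_maps_def Euclidean_subtopology[OF Utop]
 proof (intro conjI ballI)
  have "continuous_map (subtopology S V) (top_of_set (\<Phi> ` U)) (snd c)"
   unfolding continuous_map_in_subtopology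
   using continuous_map_from_subtopology_mono[OF chart_continuous[OF ch] Vc] Vs by auto
  moreover have "continuous_map (top_of_set (\<Phi> ` U)) (top_of_set U) (inv_into U \<Phi>)"
   unfolding continuous_map_in_subtopology using c\<Psi> by (auto intro: inv_into_into)
  ultimately have "continuous_map (subtopology S V) (top_of_set U) (inv_into U \<Phi> o snd c)"
   by (rule continuous_map_compose)
  thus "continuous_map (subtopology S V) (top_of_set U) \<psi>" by (simp add: \<psi>_def[abs_def] comp_def)
  have "continuous_map (top_of_set U) (top_of_set (img c)) \<Phi>"
   unfolding continuous_map_in_subtopology using c\<Phi> \<Phi> by auto
  from continuous_map_compose[OF this chart_inv_continuous[OF ch]]
  show "continuous_map (top_of_set U) (subtopology S V) (chart_inv c o \<Phi>)"
   unfolding continuous_map_in_subtopology by (auto simp: V_def)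
  show "(chart_inv c o \<Phi>) (\<psi> y) = y" if "y : topspace (subtopology S V)" for y using that g\<psi> by simp
  show "\<psi> ((chart_inv c o \<Phi>) t) = t" if "t : topspace (top_of_set U)" for t using that \<psi>g by simp
 qed
 hence "homeomorphic_map (subtopology S V) (subtopology (Euclidean_space n) U) \<psi>"
  using homeomorphic_map_maps by blast
 hence chd: "is_chart n S d" unfolding is_chart_def d_def using V U \<psi>VU by simp
 have dinv: "chart_inv d t = chart_inv c (\<Phi> t)" if "t : U" for t
 proof -
  have "chart_inv c (\<Phi> t) : fst d" "snd d (chart_inv c (\<Phi> t)) = t" using that \<psi>g by (auto simp: d_def V_def)
  thus ?thesis using chart_facts(4)[OF chd] by metis
 qed
 have od: "snd d ` (fst d \<inter> fst d') \<subseteq> U" for d' :: "'a chart" using \<psi>V by (auto simp: d_def)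
 have "compatible_charts (C_k_on 2) n d d'" if d': "d' : A" for d'
  unfolding compatible_charts_def
 proof (intro allI impI conjI)
  fix i assume i: "i<n"
  have o1: "openE n (snd d ` (fst d \<inter> fst d'))"
   by (rule chart_open_image[OF chd]) (auto intro: openin_Int chart_facts(1)[OF chd] chart_facts(1)[OF chart[OF d']])
  have o2: "openE n (snd d' ` (fst d \<inter> fst d'))"
   by (rule chart_open_image[OF chart[OF d']]) (auto intro: openin_Int chart_facts(1)[OF chd] chart_facts(1)[OF chart[OF d']])
  have "C_k_on 2 n (snd d ` (fst d \<inter> fst d')) (%t. in_coords c d' id (\<Phi> t) i)"
  proof (rule C2_compose[OF transition[OF c d' i] open_overlap[OF c d'] o1])
   show "C_k_on 2 n (snd d ` (fst d \<inter> fst d')) (%t. \<Phi> t k)" if "k<n" for k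
    by (rule C_k_on_subset[OF o1 od C2\<Phi>[OF that]])
   fix t assume "t : snd d ` (fst d \<inter> fst d')"
   then obtain y where y: "t = \<psi> y" "y : V" "y : fst d'" by (auto simp: d_def)
   thus "\<Phi> t : ovl c d'" using \<psi>V(2)[OF y(2)] Vc by auto
  qed
  thus "C_k_on 2 n (snd d ` (fst d \<inter> fst d')) (%x. in_coords d d' id x i)"
  proof (rule C_k_on_cong[OF o1, rotated])
   fix x assume "x : snd d ` (fst d \<inter> fst d')"
   hence "x : U" using od by blast
   thus "in_coords c d' id (\<Phi> x) i = in_coords d d' id x i" using dinv by (simp add: in_coords_def)
  qed
  have "C_k_on 2 n (snd d' ` (fst d \<inter> fst d')) (%x. inv_into U \<Phi> (in_coords d' c id x) i)"
  proof (rule C2_compose[OF C2\<Psi>[OF i] oi o2])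
   show "C_k_on 2 n (snd d' ` (fst d \<inter> fst d')) (%x. in_coords d' c id x k)" if "k<n" for k
    by (rule C_k_on_subset[OF o2 _ transition[OF d' c that]]) (use Vc in \<open>auto simp: d_def\<close>)
   fix x assume "x : snd d' ` (fst d \<inter> fst d')"
   then obtain y where y: "x = snd d' y" "y : V" "y : fst d'" by (auto simp: d_def)
   thus "in_coords d' c id x : \<Phi> ` U" using Vs[OF y(2)] in_coords_eq[OF d' y(3)] by simp
  qed
  thus "C_k_on 2 n (snd d' ` (fst d \<inter> fst d')) (%x. in_coords d' d id x i)"
   by (simp add: in_coords_def d_def \<psi>_def)
 qed
 hence "compatible_charts (C_k_on 2) n d d'" if "d' : A" for d' using that .
 hence dA: "d : A" by (rule maximal[OF chd])
 show ?thesis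
 proof (rule that[OF dA])
  show "in_coords d c id t = \<Phi> t" if "t : U" for t
   using that \<Phi> chart_facts(5)[OF ch] dinv by (simp add: in_coords_def)
 qed (use \<psi>VU dinv in \<open>auto simp: d_def V_def\<close>)
qed

text \<open>\<open>new_chart\<close> for the identity map; the transition to c is the identity, so
  the components of the fields stay the same.\<close>

lemma restrict_chart:
 assumes c: "c : A" and U: "openE n U" "U \<subseteq> img c"
 obtains d where "d : A" "fst d = chart_inv c ` U" "img d = U" "!!t. t : U ==> chart_inv d t = chart_inv c t"
  "!!j i t. j<q ==> i<n ==> t : U ==> wc d j i t = wc c j i t"
proof (rule new_chart[where \<Phi>="%t. t", OF c U(1)])
 have C2: "C_k_on 2 n U (%t. t i)" for i
  unfolding C2_iff[OF U(1)]
  by (rule exI[of _ "%k _. if k = i then 1 else 0"], rule exI[of _ "%_ _ _. 0"])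
   (use pd_coord[of n U i] pd_const[of n U] in simp)
 show "C_k_on 2 n U (%t. t i)" for i by (rule C2)
 have inv: "inv_into U (%t. t) y = y" if "y : U" for y using inv_into_f_f[of "%t. t" U y] that by (simp add: inj_on_def)
 show "C_k_on 2 n ((%t. t) ` U) (%y. inv_into U (%t. t) y i)" for i
  unfolding image_ident by (rule C_k_on_cong[OF U(1) _ C2]) (use inv in auto)
 fix d assume d: "d : A" "fst d = chart_inv c ` (%t. t) ` U" "img d = U" "!!t. t : U ==> chart_inv d t = chart_inv c t"
  "!!t. t : U ==> in_coords d c id t = t"
 show ?thesis
 proof (rule that[OF d(1) _ d(3,4)])
  fix j i t assume j: "j<q" and i: "i<n" and t: "t : U"
  have "fst d \<subseteq> fst c" using d(2) chart_inv_image(3)[OF chart[OF c] U(2)] by simp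
  hence ov: "ovl d c = U" using d(3) by (simp add: inf.absorb1)
  have "partial k (%x. in_coords d c id x i) t = (if k = i then 1 else 0)" if "k<n" for k
  proof -
   have "partial k (%x. in_coords d c id x i) t = partial k (%x. x i) t"
    by (rule partial_cong[OF U(1) _ that t]) (simp add: d(5))
   also have "... = (if k = i then 1 else 0)" by (rule pd_partial[OF pd_coord that t])
   finally show ?thesis .
  qed
  hence "wc c j i t = (\<Sum>k<n. if k = i then wc d j k t else 0)"
   using wc_transform[OF d(1) c _ j i, of t] t d(5) unfolding ov by (simp add: if_distrib[of "%x. _ * x"] cong: if_cong)
  thus "wc d j i t = wc c j i t" using i by simp
 qed (use d(2) in simp)
qed (use U in auto)

text \<open>Uniform bounds on the whole image, as in \<open>C_omega\<close>;
  \<open>real_analytic_on\<close> would give bounds near each point only.\<close>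

definition "an_chart c \<longleftrightarrow> c : A & (ALL j<q. ALL i<n. an_pd n (img c) (wc c j i))"

lemma an_chart_imp_coordinates:
 assumes c: "an_chart c" and x0: "x0 : fst c"
 shows "analytic_coordinates_near S n A q Y x0"
proof -
 have cA: "c : A" using c by (simp add: an_chart_def)
 note ch = chart[OF cA]
 have Utop: "img c \<subseteq> spaceE n" by (rule openin_subset[OF chart_facts(2)[OF ch]])
 have invU: "chart_inv (img c, id) x = x" if "x : img c" for x
  unfolding chart_inv_def using inv_into_f_f[of id "img c" x] that by simp
 have hm: "homeomorphic_maps (subtopology (Euclidean_space n) (img c)) (subtopology S (fst c)) (chart_inv c) (snd c)"
  unfolding homeomorphic_maps_def Euclidean_subtopology[OF Utop] continuous_map_in_subtopology
  using chart_inv_continuous[OF ch] chart_continuous[OF ch] chart_facts(4,5,6,7)[OF ch] by auto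
 have ov: "img c \<inter> {y. chart_inv c y : fst d} = ovl c d" if "d : A" for d
 proof
  show "ovl c d \<subseteq> img c \<inter> {y. chart_inv c y : fst d}" using overlap(2)[OF cA that] by auto
  show "img c \<inter> {y. chart_inv c y : fst d} \<subseteq> ovl c d"
   using chart_facts(5,6)[OF ch] by (auto intro!: image_eqI[of _ _ "chart_inv c _"])
 qed
 show ?thesis
  unfolding analytic_coordinates_near_def
 proof (intro exI conjI allI impI)
  show "openin S (fst c)" "openE n (img c)" by (rule chart_facts[OF ch])+
  show "x0 : fst c" by (rule x0)
  show "diffeo (C_k_on 2) (subtopology (Euclidean_space n) (img c)) n {(img c, id)} (subtopology S (fst c)) n A (chart_inv c) (snd c)"
   unfolding diffeo_def regular_map_def
  proof (intro conjI ballI allI impI hm)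
   show "continuous_map (subtopology (Euclidean_space n) (img c)) (subtopology S (fst c)) (chart_inv c)"
    "continuous_map (subtopology S (fst c)) (subtopology (Euclidean_space n) (img c)) (snd c)"
    using hm unfolding homeomorphic_maps_def by auto
   fix e :: "rn chart" and d i assume e: "e : {(img c, id)}" and d: "d : A" and i: "i<n"
   have set1: "snd e ` {y : topspace (subtopology (Euclidean_space n) (img c)) \<inter> fst e. chart_inv c y : fst d} = ovl c d"
    using e ov[OF d] Utop by auto
   show "C_k_on 2 n (snd e ` {y : topspace (subtopology (Euclidean_space n) (img c)) \<inter> fst e. chart_inv c y : fst d})
     (%x. in_coords e d (chart_inv c) x i)"
    unfolding set1 by (rule C_k_on_cong[OF open_overlap[OF cA d] _ transition[OF cA d i]])
     (use e invU in \<open>auto simp: in_coords_def\<close>)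
  next
   fix d and e :: "rn chart" and i assume d: "d : A" and e: "e : {(img c, id)}" and i: "i<n"
   have set2: "snd d ` {y : topspace (subtopology S (fst c)) \<inter> fst d. snd c y : fst e} = ovl d c"
    using e chart_facts(7)[OF ch] by auto
   show "C_k_on 2 n (snd d ` {y : topspace (subtopology S (fst c)) \<inter> fst d. snd c y : fst e}) (%x. in_coords d e (snd c) x i)"
    unfolding set2 by (rule C_k_on_cong[OF open_overlap[OF d cA] _ transition[OF d cA i]])
     (use e in \<open>auto simp: in_coords_def\<close>)
  qed
  fix j assume j: "j<q"
  show "C_omega n n (img c) (%x i. wc c j i x)"
   by (rule analytic_imp_C_omega[OF chart_facts(2)[OF ch]]) (use c j in \<open>auto simp: an_chart_def\<close>)
  show "F_related (subtopology (Euclidean_space n) (img c)) n {(img c, id)} n A (chart_inv c) (%_ x i. wc c j i x) (Y j)"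
   unfolding F_related_def
  proof (intro ballI allI impI)
   fix e :: "rn chart" and d y i assume e: "e : {(img c, id)}" and d: "d : A"
    and y: "y : topspace (subtopology (Euclidean_space n) (img c)) \<inter> fst e" "chart_inv c y : fst d" and i: "i<n"
   have yo: "y : ovl c d" using y ov[OF d] e by auto
   have "partial k (%x. in_coords e d (chart_inv c) x i) y = partial k (%x. in_coords c d id x i) y" if "k<n" for k
    by (rule partial_cong[OF open_overlap[OF cA d] _ that yo]) (use e invU in \<open>auto simp: in_coords_def\<close>)
   thus "Y j d (chart_inv c y) i = differential n e d (chart_inv c) y (%i. wc c j i y) i"
    using wc_transform[OF cA d yo j i] overlap(6)[OF cA d yo] e
    by (simp add: differential_def wc_def[of d] mult.commute)
  qed
 qed
qed

text \<open>The inverse of the given parametrisation is compatible with all charts, hence belongs to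
  the maximal atlas, and \<open>F_related\<close> identifies the components of the fields in it with
  those of W.\<close>

lemma coordinates_imp_an_chart:
 assumes "analytic_coordinates_near S n A q Y x0"
 shows "EX c. an_chart c & x0 : fst c"
proof -
 obtain V U \<Phi> \<Psi> where V: "openin S V" "x0 : V" and U: "openE n U"
  and diff: "diffeo (C_k_on 2) (subtopology (Euclidean_space n) U) n {(U, id)} (subtopology S V) n A \<Phi> \<Psi>"
  and fields: "!!j. j<q ==> EX W. F_related (subtopology (Euclidean_space n) U) n {(U, id)} n A \<Phi> (%_. W) (Y j) & C_omega n n U W"
  using assms unfolding analytic_coordinates_near_def by blast
 have VT: "V \<subseteq> topspace S" and UT: "U \<subseteq> spaceE n" using V U openin_subset by auto
 define c where "c = (V, \<Psi>)"
 have hm: "homeomorphic_maps (subtopology (Euclidean_space n) U) (subtopology S V) \<Phi> \<Psi>" using diff by (simp add: diffeo_def)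
 have \<Psi>\<Phi>: "\<Psi> (\<Phi> t) = t" "\<Phi> t : V" if "t : U" for t
  using hm that UT unfolding homeomorphic_maps_def continuous_map_in_subtopology by auto
 have \<Phi>\<Psi>: "\<Phi> (\<Psi> y) = y" "\<Psi> y : U" if "y : V" for y
  using hm that VT unfolding homeomorphic_maps_def continuous_map_in_subtopology by auto
 have im: "\<Psi> ` V = U" using \<Psi>\<Phi> \<Phi>\<Psi> by (auto intro!: image_eqI[of _ \<Psi> "\<Phi> _"])
 have chc: "is_chart n S c"
  unfolding is_chart_def c_def using V(1) U im homeomorphic_map_maps homeomorphic_maps_sym hm by fastforce
 have inv: "chart_inv c x = \<Phi> x" if "x : U" for x
  using chart_facts(4)[OF chc, of "\<Phi> x"] \<Psi>\<Phi>[OF that] by (simp add: c_def)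
 have invU: "chart_inv (U, id) x = x" if "x : U" for x
  unfolding chart_inv_def using inv_into_f_f[of id U x] that by simp
 have imgc: "img c = U" using im by (simp add: c_def)
 let ?e = "(U, id) :: rn chart"
 have "compatible_charts (C_k_on 2) n c d" if d: "d : A" for d
  unfolding compatible_charts_def
 proof (intro allI impI conjI)
  fix i assume i: "i<n"
  have o1: "openE n (snd c ` (fst c \<inter> fst d))"
   by (rule chart_open_image[OF chc]) (auto intro: openin_Int chart_facts(1)[OF chc] chart_facts(1)[OF chart[OF d]])
  have o2: "openE n (snd d ` (fst c \<inter> fst d))"
   by (rule chart_open_image[OF chart[OF d]]) (auto intro: openin_Int chart_facts(1)[OF chc] chart_facts(1)[OF chart[OF d]])
  have s1: "snd ?e ` {y : topspace (subtopology (Euclidean_space n) U) \<inter> fst ?e. \<Phi> y : fst d} = snd c ` (fst c \<inter> fst d)"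
  proof -
   have "{y : topspace (subtopology (Euclidean_space n) U) \<inter> U. \<Phi> y : fst d} = {y : U. \<Phi> y : fst d}" using UT by auto
   also have "... = \<Psi> ` (V \<inter> fst d)"
   proof (intro equalityI subsetI)
    fix y assume "y : {y : U. \<Phi> y : fst d}"
    thus "y : \<Psi> ` (V \<inter> fst d)" using \<Psi>\<Phi>[of y] by (intro image_eqI[of _ _ "\<Phi> y"]) auto
   qed (use \<Phi>\<Psi> in auto)
   finally show ?thesis by (simp add: c_def)
  qed
  have "C_k_on 2 n (snd ?e ` {y : topspace (subtopology (Euclidean_space n) U) \<inter> fst ?e. \<Phi> y : fst d})
    (%x. in_coords ?e d \<Phi> x i)"
   using diff d i unfolding diffeo_def regular_map_def by blast
  thus "C_k_on 2 n (snd c ` (fst c \<inter> fst d)) (%x. in_coords c d id x i)"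
   unfolding s1
  proof (rule C_k_on_cong[OF o1, rotated])
   fix x assume "x : snd c ` (fst c \<inter> fst d)"
   hence "x : U" using imgc by auto
   thus "in_coords ?e d \<Phi> x i = in_coords c d id x i" using inv invU by (simp add: in_coords_def)
  qed
  have s2: "snd d ` {y : topspace (subtopology S V) \<inter> fst d. \<Psi> y : fst ?e} = snd d ` (fst c \<inter> fst d)"
  proof -
   have "{y : topspace (subtopology S V) \<inter> fst d. \<Psi> y : U} = V \<inter> fst d" using VT \<Phi>\<Psi> by auto
   thus ?thesis by (simp add: c_def)
  qed
  have "C_k_on 2 n (snd d ` {y : topspace (subtopology S V) \<inter> fst d. \<Psi> y : fst ?e}) (%x. in_coords d ?e \<Psi> x i)"
   using diff d i unfolding diffeo_def regular_map_def by blast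
  hence "C_k_on 2 n (snd d ` (fst c \<inter> fst d)) (%x. in_coords d ?e \<Psi> x i)" unfolding s2 .
  thus "C_k_on 2 n (snd d ` (fst c \<inter> fst d)) (%x. in_coords d c id x i)"
   by (simp add: in_coords_def c_def)
 qed
 hence "compatible_charts (C_k_on 2) n c d" if "d : A" for d using that .
 hence cA: "c : A" by (rule maximal[OF chc])
 have "an_pd n U (wc c j i)" if j: "j<q" and i: "i<n" for j i
 proof -
  obtain W where W: "F_related (subtopology (Euclidean_space n) U) n {(U, id)} n A \<Phi> (%_. W) (Y j)" "C_omega n n U W"
   using fields[OF j] by blast
  have "wc c j i x = W x i" if x: "x : U" for x
  proof -
   have p: "partial k (%x. in_coords (U, id) c \<Phi> x i) x = (if k = i then 1 else 0)" if k: "k<n" for k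
   proof -
    have "partial k (%x. in_coords (U, id) c \<Phi> x i) x = partial k (%x. x i) x"
     by (rule partial_cong[OF U _ k x]) (use invU \<Psi>\<Phi> in \<open>simp add: in_coords_def c_def\<close>)
    also have "... = (if k = i then 1 else 0)" by (rule pd_partial[OF pd_coord k x])
    finally show ?thesis .
   qed
   have "Y j c (\<Phi> x) i = differential n (U, id) c \<Phi> x (W x) i"
    using W(1) cA x UT \<Psi>\<Phi>(2)[OF x] i unfolding F_related_def by (auto simp: c_def)
   also have "... = (\<Sum>k<n. if k = i then W x k else 0)"
    unfolding differential_def using p by (intro sum.cong) auto
   finally show ?thesis using i inv[OF x] by (simp add: wc_def)
  qed
  thus ?thesis
   by (rule derivation_system.an_cong[OF derivation_pd[OF U] C_omega_imp_analytic[OF U W(2) i]])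
 qed
 hence "an_chart c" unfolding an_chart_def imgc using cA by blast
 thus ?thesis using V(2) by (auto simp: c_def)
qed

end

section \<open>Brackets in charts and the passage from (ii.1) to (ii.2) and (ii.3)\<close>

context spanned_manifold
begin

text \<open>Both sides transform by the same Jacobian, so a linear relation demanded in every chart
  has to be checked in one only. The map \<open>s\<close> selects the fields involved.\<close>

lemma combination_transform:
 assumes c: "c : A" and d: "d : A" and y: "y : fst c" "y : fst d" and k: "!!k. k<N ==> s k<q"
  and Z: "!!i. i<n ==> Z d i = (\<Sum>k<n. partial k (%x. in_coords c d id x i) (snd c y) * Z c k)"
  and comb: "!!i. i<n ==> Z c i = (\<Sum>k<N. f k * Y (s k) c y i)" and i: "i<n"
 shows "Z d i = (\<Sum>k<N. f k * Y (s k) d y i)"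
proof -
 have "Z d i = (\<Sum>l<n. \<Sum>k<N. f k*(partial l (%x. in_coords c d id x i) (snd c y) * Y (s k) c y l))"
  unfolding Z[OF i] using comb by (simp add: sum_distrib_left mult_ac)
 also have "... = (\<Sum>k<N. f k*(\<Sum>l<n. partial l (%x. in_coords c d id x i) (snd c y) * Y (s k) c y l))"
  unfolding sum_distrib_left by (rule sum.swap)
 also have "... = (\<Sum>k<N. f k * Y (s k) d y i)" using transform[OF c d y k i] by (intro sum.cong) auto
 finally show ?thesis .
qed

definition "bk c a b i x = (\<Sum>l<n. wc c a l x * wc' c b i l x - wc c b l x * wc' c a i l x)"

lemma lie_bracket_chart: "c : A ==> y : fst c ==> lie_bracket n (Y a) (Y b) c y i = bk c a b i (snd c y)"
 unfolding lie_bracket_def bk_def wc'_def wc_def[abs_def] by (simp add: chart_facts(4)[OF chart])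

text \<open>Differentiating the transformation law produces second derivatives of the transition
  map. They are symmetric and cancel in the commutator.\<close>

lemma bracket_transform:
 assumes c: "c : A" and d: "d : A" and x: "x : ovl c d" and a: "a<q" and b: "b<q" and i: "i<n"
 shows "bk d a b i (in_coords c d id x) = (\<Sum>k<n. partial k (%x. in_coords c d id x i) x * bk c a b k x)"
proof -
 let ?U = "ovl c d" and ?H = "in_coords c d id"
 have U: "openE n ?U" by (rule open_overlap[OF c d])
 define K where "K m k = partial k (%x. ?H x m)" for m k
 have Kpd: "pd n ?U (%x. ?H x m) (K m)" if "m<n" for m unfolding K_def[abs_def] by (rule transition_pd[OF c d that])
 have C2: "C_k_on (Suc (Suc 0)) n ?U (%x. ?H x i)" using transition[OF c d i] by (simp add: numeral_2_eq_2)
 define KK where "KK k l = partial l (K i k)" for k l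
 have KKpd: "pd n ?U (K i k) (KK k)" if "k<n" for k
  unfolding K_def KK_def[abs_def] by (rule C_k_on_SucE(1)[OF C_k_on_SucE(2)[OF C2 that]])
 have sym: "KK k l x = KK l k x" if "k<n" "l<n" for k l
  by (cases "k = l") (use pd_symmetric[OF U Kpd[OF i] KKpd[OF that(1)] KKpd[OF that(2)] that _ x] in auto)
 have wH: "wc d j m (?H z) = (\<Sum>k<n. wc c j k z * K m k z)" if "j<q" "m<n" "z : ?U" for j m z
  unfolding K_def by (rule wc_transform[OF c d that(3,1,2)])
 have sub: "?U \<subseteq> img c" "ovl d c \<subseteq> img d" by auto
 have diff: "(\<Sum>m<n. wc' d j i m (?H x) * K m l x) = (\<Sum>k<n. wc c j k x * KK k l x + wc' c j k l x * K i k x)"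
  if j: "j<q" and l: "l<n" for j l
 proof -
  have p1: "pd n ?U (%z. wc d j i (?H z)) (%l z. \<Sum>m<n. wc' d j i m (?H z) * K m l z)"
   by (rule pd_compose[OF pd_subset[OF wc_pd[OF d j i] sub(2)] open_overlap[OF d c] U Kpd overlap(5)[OF c d]])
  have p2: "pd n ?U (%z. \<Sum>k<n. wc c j k z * K i k z) (%l z. \<Sum>k<n. wc c j k z * KK k l z + wc' c j k l z * K i k z)"
   by (rule pd_sum[OF finite_lessThan], rule pd_mult[OF pd_subset[OF wc_pd[OF c j] sub(1)] KKpd]) auto
  have p3: "pd n ?U (%z. wc d j i (?H z)) (%l z. \<Sum>k<n. wc c j k z * KK k l z + wc' c j k l z * K i k z)"
   by (rule pd_cong[OF U p2]) (use wH[OF j i] in auto)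
  show ?thesis by (rule pd_unique[OF p1 p3 l x])
 qed
 have half: "(\<Sum>m<n. wc d a m (?H x) * wc' d b i m (?H x)) =
   (\<Sum>l<n. \<Sum>k<n. wc c a l x * wc c b k x * KK k l x) + (\<Sum>k<n. K i k x*(\<Sum>l<n. wc c a l x * wc' c b k l x))"
  if a: "a<q" and b: "b<q" for a b
 proof -
  have "(\<Sum>m<n. wc d a m (?H x) * wc' d b i m (?H x)) = (\<Sum>m<n. \<Sum>l<n. wc c a l x*(wc' d b i m (?H x) * K m l x))"
   using wH[OF a _ x] by (simp add: sum_distrib_right sum_distrib_left mult_ac)
  also have "... = (\<Sum>l<n. wc c a l x*(\<Sum>m<n. wc' d b i m (?H x) * K m l x))"
   unfolding sum_distrib_left by (rule sum.swap)
  also have "... = (\<Sum>l<n. wc c a l x*(\<Sum>k<n. wc c b k x * KK k l x + wc' c b k l x * K i k x))"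
   using diff[OF b] by (intro sum.cong) auto
  also have "... = (\<Sum>l<n. \<Sum>k<n. wc c a l x * wc c b k x * KK k l x) + (\<Sum>l<n. \<Sum>k<n. K i k x*(wc c a l x * wc' c b k l x))"
   by (simp add: sum_distrib_left sum.distrib[symmetric] algebra_simps)
  also have "(\<Sum>l<n. \<Sum>k<n. K i k x*(wc c a l x * wc' c b k l x)) = (\<Sum>k<n. K i k x*(\<Sum>l<n. wc c a l x * wc' c b k l x))"
   unfolding sum_distrib_left by (rule sum.swap)
  finally show ?thesis .
 qed
 have "(\<Sum>l<n. \<Sum>k<n. wc c a l x * wc c b k x * KK k l x) = (\<Sum>k<n. \<Sum>l<n. wc c a l x * wc c b k x * KK k l x)" by (rule sum.swap)
 also have "... = (\<Sum>l<n. \<Sum>k<n. wc c b l x * wc c a k x * KK k l x)"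
  using sym by (intro sum.cong) (auto simp: mult_ac)
 finally have hess: "(\<Sum>l<n. \<Sum>k<n. wc c a l x * wc c b k x * KK k l x) = (\<Sum>l<n. \<Sum>k<n. wc c b l x * wc c a k x * KK k l x)" .
 have "bk d a b i (?H x) = (\<Sum>k<n. K i k x*(\<Sum>l<n. wc c a l x * wc' c b k l x)) - (\<Sum>k<n. K i k x*(\<Sum>l<n. wc c b l x * wc' c a k l x))"
  unfolding bk_def sum_subtractf half[OF a b] half[OF b a] hess by simp
 also have "... = (\<Sum>k<n. K i k x * bk c a b k x)"
  unfolding bk_def by (simp add: sum_subtractf right_diff_distrib)
 finally show ?thesis by (simp add: K_def)
qed

lemma field_combination_onI:
 assumes c: "c : A" and V: "V \<subseteq> fst c" and j: "j<q" and N: "N <= q"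
  and comb: "!!y i. y : V ==> i<n ==> wc c j i (snd c y) = (\<Sum>k<N. f k y * wc c k i (snd c y))"
 shows "combination_on n A V (Y j) N f Y"
 unfolding combination_on_def
proof (intro ballI allI impI)
 fix d y i assume d: "d : A" and y: "y : V \<inter> fst d" and i: "i<n"
 have yc: "y : fst c" "y : fst d" using y V by auto
 show "Y j d y i = (\<Sum>k<N. f k y * Y k d y i)"
 proof (rule combination_transform[where Z="%d. Y j d y" and s="%k. k", OF c d yc _ transform[OF c d yc j] _ i])
  show "Y j c y i = (\<Sum>k<N. f k y * Y k c y i)" if "i<n" for i
   using comb[OF _ that, of y] y chart_facts(4)[OF chart[OF c] yc(1)] by (simp add: wc_def)
 qed (use N in auto)
qed

lemma bracket_combination_onI:
 assumes c: "c : A" and V: "V \<subseteq> fst c" and a: "a<q" and b: "b<q" and N: "N <= q"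
  and comb: "!!y i. y : V ==> i<n ==> bk c a b i (snd c y) = (\<Sum>k<N. f k y * wc c k i (snd c y))"
 shows "combination_on n A V (lie_bracket n (Y a) (Y b)) N f Y"
 unfolding combination_on_def
proof (intro ballI allI impI)
 fix d y i assume d: "d : A" and y: "y : V \<inter> fst d" and i: "i<n"
 have yc: "y : fst c" "y : fst d" using y V by auto
 show "lie_bracket n (Y a) (Y b) d y i = (\<Sum>k<N. f k y * Y k d y i)"
 proof (rule combination_transform[where Z="%d. lie_bracket n (Y a) (Y b) d y" and s="%k. k", OF c d yc _ _ _ i])
  show "lie_bracket n (Y a) (Y b) d y i = (\<Sum>k<n. partial k (%x. in_coords c d id x i) (snd c y) * lie_bracket n (Y a) (Y b) c y k)"
   if "i<n" for i
   unfolding lie_bracket_chart[OF c yc(1)] lie_bracket_chart[OF d yc(2)]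
   using bracket_transform[OF c d _ a b that, of "snd c y"] yc in_coords_eq[OF c yc(1)] by auto
  show "lie_bracket n (Y a) (Y b) c y i = (\<Sum>k<N. f k y * Y k c y i)" if "i<n" for i
   using comb[OF _ that, of y] y chart_facts(4)[OF chart[OF c] yc(1)] lie_bracket_chart[OF c yc(1)] by (simp add: wc_def)
 qed (use N in auto)
qed

text \<open>In an analytic chart, analytic fields expand in any local frame with analytic coefficients,
 by Cramer's rule.\<close>

lemma analytic_expansion:
 assumes c: "an_chart c" and x: "x : img c" and s: "!!i. i<n ==> s i<q"
  and det: "fdet n (%i j. wc c (s i) j x) ~= 0"
 obtains e where "0<e" "cube n x e \<subseteq> img c"
  "!!v. (!!i. i<n ==> an_pd n (img c) (v i)) ==>
   EX a. (ALL m<n. an_dw n (cube n x e) (wc c) q (a m)) &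
    (ALL y:cube n x e. ALL i<n. v i y = (\<Sum>m<n. a m y * wc c (s m) i y))"
proof -
 interpret an: func_class n "%U f. an_pd n U f" by (rule func_class_analytic)
 have cA: "c : A" and w: "!!j i. j<q ==> i<n ==> an_pd n (img c) (wc c j i)"
  using c by (auto simp: an_chart_def)
 note U = chart_facts(2)[OF chart[OF cA]]
 show ?thesis
 proof (rule an.local_inverse_matrix[where M="%i j. wc c (s i) j", OF U x _ det])
  show "an_pd n (img c) (wc c (s i) j)" if "i<n" "j<n" for i j by (rule w[OF s[OF that(1)] that(2)])
  fix e I assume e: "0<e" "cube n x e \<subseteq> img c"
   and I: "!!i j. i<n ==> j<n ==> an_pd n (cube n x e) (I i j)"
   and IM: "!!i j y. i<n ==> j<n ==> y : cube n x e ==> (\<Sum>k<n. I i k y * wc c (s k) j y) = (if i = j then 1 else 0)"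
  show ?thesis
  proof (rule that[OF e])
   fix v assume v: "!!i. i<n ==> an_pd n (img c) (v i)"
   define a where "a m y = (\<Sum>j<n. v j y * I j m y)" for m y
   have "an_pd n (cube n x e) (a m)" if "m<n" for m
    unfolding a_def[abs_def]
    by (intro an.cl_sum an.cl_mult openin_cube I that an.cl_subset[OF v e(2) openin_cube]) (use that in auto)
   hence "an_dw n (cube n x e) (wc c) q (a m)" if "m<n" for m
    by (intro pd_analytic_imp_dw openin_cube an.cl_subset[OF w e(2) openin_cube]) (use that in auto)
   moreover have "v i y = (\<Sum>m<n. a m y * wc c (s m) i y)" if y: "y : cube n x e" and i: "i<n" for y i
   proof -
    have "(\<Sum>m<n. a m y * wc c (s m) i y) = (\<Sum>j<n. v j y*(\<Sum>m<n. I j m y * wc c (s m) i y))"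
     unfolding a_def sum_distrib_left sum_distrib_right by (rule trans[OF sum.swap]) (simp add: mult.assoc)
    also have "... = (\<Sum>j<n. if j = i then v j y else 0)" using IM[OF _ i y] by (intro sum.cong) auto
    finally show ?thesis using i by simp
   qed
   ultimately show "EX a. (ALL m<n. an_dw n (cube n x e) (wc c) q (a m)) &
    (ALL y:cube n x e. ALL i<n. v i y = (\<Sum>m<n. a m y * wc c (s m) i y))" by blast
  qed
 qed
qed

lemma bk_analytic:
 assumes c: "an_chart c" and ab: "a<q" "b<q" and i: "i<n"
 shows "an_pd n (img c) (bk c a b i)"
proof -
 interpret an: func_class n "%U f. an_pd n U f" by (rule func_class_analytic)
 have cA: "c : A" and w: "!!j i. j<q ==> i<n ==> an_pd n (img c) (wc c j i)"
  using c by (auto simp: an_chart_def)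
 note U = chart_facts(2)[OF chart[OF cA]]
 interpret ds: derivation_system "img c" n "pd n (img c)" by (rule derivation_pd[OF U])
 have w': "an_pd n (img c) (wc' c j i k)" if "j<q" "i<n" "k<n" for j i k
  unfolding wc'_def by (rule analytic_partial[OF U w[OF that(1,2)] that(3)])
 show ?thesis unfolding bk_def[abs_def]
  by (intro ds.an_sum ds.an_diff ds.an_mult w w' ab i) auto
qed

lemma C_X_omega_chart:
 assumes c: "c : A" and U: "openE n U" "U \<subseteq> img c"
  and a: "an_dw n U (wc c) q a"
 shows "C_X_omega S n A q Y (chart_inv c ` U) (%y. a (snd c y))"
proof (rule analytic_imp_C_X_omega[OF c U])
 show "an_dw n U (wc c) q ((%y. a (snd c y)) o chart_inv c)"
  by (rule derivation_system.an_cong[OF derivation_dw[OF U(1)] a]) (use chart_facts(5)[OF chart[OF c]] U(2) in auto)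
qed

lemma independent_imp_det:
 assumes c: "c : A" and x0: "x0 : fst c" and ind: "independent_at n A x0 n Y"
 shows "fdet n (%i j. wc c i j (snd c x0)) ~= 0"
proof -
 have "fdet n (%i j. wc c j i (snd c x0)) ~= 0"
 proof (rule fdet_nonzero)
  fix v :: "nat => real" assume v: "!!i. i<n ==> (\<Sum>j<n. wc c j i (snd c x0) * v j) = 0"
  have "ALL i<n. (\<Sum>k<n. v k * Y k c x0 i) = 0"
   using v chart_facts(4)[OF chart[OF c] x0] by (simp add: wc_def mult.commute)
  thus "ALL j<n. v j = 0" using ind c x0 unfolding independent_at_def by blast
 qed
 thus ?thesis using fdet_transpose[of n "%i j. wc c i j (snd c x0)"] by simp
qed

lemma det_imp_independent:
 assumes c: "c : A" and x0: "x0 : fst c" and s: "!!i. i<n ==> s i<q"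
  and det: "fdet n (%i j. wc c (s i) j (snd c x0)) ~= 0"
 shows "independent_at n A x0 n (Y o s)"
 unfolding independent_at_def
proof (intro ballI impI allI)
 fix d a k assume d: "d : A" "x0 : fst d" and a: "ALL i<n. (\<Sum>k<n. a k*(Y o s) k d x0 i) = 0" and k: "k<n"
 have ac: "(\<Sum>k<n. wc c (s k) i (snd c x0) * a k) = 0" if i: "i<n" for i
 proof -
  have "(%i. 0) i = (\<Sum>k<n. a k * Y (s k) c x0 i)"
   by (rule combination_transform[where Z="%_ _. 0" and c=d, OF d(1) c d(2) x0 s _ _ i]) (use a in auto)
  thus ?thesis using chart_facts(4)[OF chart[OF c] x0] by (simp add: wc_def mult.commute)
 qed
 have "fdet n (%i j. wc c (s j) i (snd c x0)) * a k = (\<Sum>i<n. fadj n (%i j. wc c (s j) i (snd c x0)) k i*0)"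
  by (rule fdet_solve[OF ac k])
 thus "a k = 0" using det fdet_transpose[of n "%i j. wc c (s i) j (snd c x0)"] by simp
qed

lemma coordinates_imp_basis:
 assumes ind: "independent_at n A x0 n Y" and nq: "n <= q" and co: "analytic_coordinates_near S n A q Y x0"
 shows "analytic_basis_near S n A q Y x0"
proof -
 obtain c where c: "an_chart c" "x0 : fst c" using coordinates_imp_an_chart[OF co] by blast
 have cA: "c : A" using c by (simp add: an_chart_def)
 note ch = chart[OF cA]
 define x where "x = snd c x0"
 have x: "x : img c" using c(2) by (simp add: x_def)
 have s: "i<q" if "i<n" for i using that nq by simp
 have det: "fdet n (%i j. wc c i j x) ~= 0" unfolding x_def by (rule independent_imp_det[OF cA c(2) ind])
 show ?thesis
 proof (rule analytic_expansion[where s="%i. i", OF c(1) x s det])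
  fix e assume e: "0<e" "cube n x e \<subseteq> img c"
   and ex: "!!v. (!!i. i<n ==> an_pd n (img c) (v i)) ==>
   EX a. (ALL m<n. an_dw n (cube n x e) (wc c) q (a m)) &
    (ALL y:cube n x e. ALL i<n. v i y = (\<Sum>m<n. a m y * wc c m i y))"
  define V where "V = chart_inv c ` cube n x e"
  have V: "openin S V" unfolding V_def by (rule chart_open_preimage[OF ch openin_cube e(2)])
  have Vc: "V \<subseteq> fst c" "!!y. y : V ==> snd c y : cube n x e" unfolding V_def chart_inv_image(1)[OF ch e(2)] by auto
  have xe: "x : cube n x e" by (rule cube_center[OF _ e(1)]) (use x openin_subset[OF chart_facts(2)[OF ch]] in blast)
  have x0V: "x0 : V" unfolding V_def chart_inv_image(1)[OF ch e(2)] using c(2) xe by (simp add: x_def)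
  define Q where "Q v a \<longleftrightarrow> (ALL m<n. an_dw n (cube n x e) (wc c) q (a m)) &
    (ALL y:cube n x e. ALL i<n. v i y = (\<Sum>m<n. a m y * wc c m i y))" for v a
  define C where "C i j = (SOME a. Q (bk c i j) a)" for i j
  define B where "B j = (SOME a. Q (wc c j) a)" for j
  have C: "Q (bk c i j) (C i j)" if "i<n" "j<n" for i j
  proof -
   have "EX a. Q (bk c i j) a" unfolding Q_def by (rule ex) (use bk_analytic[OF c(1)] that nq in auto)
   thus ?thesis unfolding C_def by (rule someI_ex[where P="Q (bk c i j)"])
  qed
  have B: "Q (wc c j) (B j)" if "j<q" for j
  proof -
   have "EX a. Q (wc c j) a" unfolding Q_def by (rule ex) (use c(1) that in \<open>auto simp: an_chart_def\<close>)
   thus ?thesis unfolding B_def by (rule someI_ex[where P="Q (wc c j)"])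
  qed
  show ?thesis
   unfolding analytic_basis_near_def
  proof (intro exI[of _ V] exI[of _ "%i j k y. C i j k (snd c y)"] exI[of _ "%j k y. B j k (snd c y)"] conjI allI impI V x0V)
   show "combination_on n A V (lie_bracket n (Y i) (Y j)) n (%k y. C i j k (snd c y)) Y" if "i<n" "j<n" for i j
    by (rule bracket_combination_onI[OF cA Vc(1)]) (use C[OF that] Vc(2) that nq in \<open>auto simp: Q_def\<close>)
   show "C_X_omega S n A q Y V (%y. C i j k (snd c y))" if "i<n" "j<n" "k<n" for i j k
    unfolding V_def by (rule C_X_omega_chart[OF cA openin_cube e(2)]) (use C[OF that(1,2)] that(3) in \<open>auto simp: Q_def\<close>)
   show "combination_on n A V (Y j) n (%k y. B j k (snd c y)) Y" if "n <= j & j<q" for j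
    by (rule field_combination_onI[OF cA Vc(1)]) (use B[of j] Vc(2) that nq in \<open>auto simp: Q_def\<close>)
   show "C_X_omega S n A q Y V (%y. B j k (snd c y))" if "n <= j & j<q" "k<n" for j k
    unfolding V_def by (rule C_X_omega_chart[OF cA openin_cube e(2)]) (use B[of j] that in \<open>auto simp: Q_def\<close>)
  qed
 qed
qed

lemma coordinates_imp_brackets:
 assumes co: "analytic_coordinates_near S n A q Y x0"
 shows "analytic_brackets_near S n A q Y x0"
proof -
 obtain c where c: "an_chart c" "x0 : fst c" using coordinates_imp_an_chart[OF co] by blast
 have cA: "c : A" using c by (simp add: an_chart_def)
 note ch = chart[OF cA]
 define x where "x = snd c x0"
 have x: "x : img c" using c(2) by (simp add: x_def)
 obtain s where s: "!!i. i<n ==> s i<q" and det: "fdet n (%i j. wc c (s i) j x) ~= 0"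
  using spanning_imp_basis[where W="%k i. wc c k i x", OF wc_span[OF cA x]] by blast
 show ?thesis
 proof (rule analytic_expansion[OF c(1) x s det])
  fix e assume e: "0<e" "cube n x e \<subseteq> img c"
   and ex: "!!v. (!!i. i<n ==> an_pd n (img c) (v i)) ==>
   EX a. (ALL m<n. an_dw n (cube n x e) (wc c) q (a m)) &
    (ALL y:cube n x e. ALL i<n. v i y = (\<Sum>m<n. a m y * wc c (s m) i y))"
  define V where "V = chart_inv c ` cube n x e"
  have V: "openin S V" unfolding V_def by (rule chart_open_preimage[OF ch openin_cube e(2)])
  have Vc: "V \<subseteq> fst c" "!!y. y : V ==> snd c y : cube n x e" unfolding V_def chart_inv_image(1)[OF ch e(2)] by auto
  have xe: "x : cube n x e" by (rule cube_center[OF _ e(1)]) (use x openin_subset[OF chart_facts(2)[OF ch]] in blast)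
  have x0V: "x0 : V" unfolding V_def chart_inv_image(1)[OF ch e(2)] using c(2) xe by (simp add: x_def)
  define Q where "Q v a \<longleftrightarrow> (ALL m<n. an_dw n (cube n x e) (wc c) q (a m)) &
    (ALL y:cube n x e. ALL i<n. v i y = (\<Sum>m<n. a m y * wc c (s m) i y))" for v a
  define C where "C i j = (SOME a. Q (bk c i j) a)" for i j
  have C: "Q (bk c i j) (C i j)" if "i<q" "j<q" for i j
  proof -
   have "EX a. Q (bk c i j) a" unfolding Q_def by (rule ex) (use bk_analytic[OF c(1)] that in auto)
   thus ?thesis unfolding C_def by (rule someI_ex[where P="Q (bk c i j)"])
  qed
  \<comment> \<open>Spreads the coefficients for the n selected fields over all q fields, with 0 at
    the fields that were not selected.\<close>
  define D where "D i j k y = (\<Sum>m<n. (if s m = k then C i j m y else 0))" for i j k y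
  have D: "(\<Sum>k<q. D i j k y * W k) = (\<Sum>m<n. C i j m y * W (s m))" for i j y and W :: "nat => real"
  proof -
   have "(\<Sum>k<q. D i j k y * W k) = (\<Sum>m<n. \<Sum>k<q. if s m = k then C i j m y * W k else 0)"
    unfolding D_def sum_distrib_right by (rule trans[OF sum.swap]) (simp add: if_distrib[of "%x. x * _"] cong: if_cong)
   thus ?thesis using s by simp
  qed
  interpret ds: derivation_system "cube n x e" q "dw n (cube n x e) (wc c) q" by (rule derivation_dw[OF openin_cube])
  have Dan: "an_dw n (cube n x e) (wc c) q (D i j k)" if "i<q" "j<q" for i j k
   unfolding D_def[abs_def]
  proof (rule ds.an_sum[OF finite_lessThan])
   fix m assume "m : {..<n}"
   thus "an_dw n (cube n x e) (wc c) q (%y. if s m = k then C i j m y else 0)"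
    using C[OF that] ds.an_const by (cases "s m = k") (auto simp: Q_def)
  qed
  show ?thesis
   unfolding analytic_brackets_near_def
  proof (intro exI[of _ V] exI[of _ "%i j k y. D i j k (snd c y)"] conjI allI impI V x0V)
   show "combination_on n A V (lie_bracket n (Y i) (Y j)) q (%k y. D i j k (snd c y)) Y" if "i<q" "j<q" for i j
    by (rule bracket_combination_onI[OF cA Vc(1)]) (use C[OF that] Vc(2) that D in \<open>auto simp: Q_def\<close>)
   show "C_X_omega S n A q Y V (%y. D i j k (snd c y))" if "i<q" "j<q" "k<q" for i j k
    unfolding V_def by (rule C_X_omega_chart[OF cA openin_cube e(2) Dan[OF that(1,2)]])
  qed
 qed
qed

end

subsection \<open>Canonical coordinates\<close>

lemma analytic_dw_reindex:
 assumes f: "an_dw n U w q f" and s: "!!j. j<N ==> s j<q"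
 shows "an_dw n U (%j. w (s j)) N f"
proof -
 have "an_dw n U (%j. w (s j)) N (f o id)"
 proof (rule analytic_wrt_transport[where \<sigma>=s, OF f])
  show "dw n U (%j. w (s j)) N (g o id) (%j. G (s j) o id)" if "dw n U w q g G" for g G
   using that s unfolding dw_def by auto
 qed (use s in auto)
 thus ?thesis by simp
qed

text \<open>Sums of the individual constants serve the whole finite family; the summand 1 keeps R
  positive if the family is empty.\<close>

lemma analytic_family_majorant:
 fixes p N :: nat
 assumes f: "!!a b k. a<p ==> b<N ==> k<N ==> analytic_wrt U q der (C a b k)"
 obtains K R where "0 <= K" "0<R" "!!a b k j. a<p ==> b<N ==> k<N ==> maj U q der j (geom K R) (C a b k)"
proof -
 define P where "P a b k KR \<longleftrightarrow> 0 <= fst KR & 0<snd KR & (ALL j. maj U q der j (geom (fst KR) (snd KR)) (C a b k))" for a b k KR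
 define KR where "KR a b k = (SOME KR. P a b k KR)" for a b k
 have P: "P a b k (KR a b k)" if "a<p" "b<N" "k<N" for a b k
 proof -
  have "EX KR. P a b k KR" using f[OF that] unfolding analytic_wrt_def P_def by auto
  thus ?thesis unfolding KR_def by (rule someI_ex[where P="P a b k"])
 qed
 define I where "I = {..<p} \<times> {..<N} \<times> {..<N}"
 define K where "K = (\<Sum>(a, b, k)\<in>I. fst (KR a b k))"
 define R where "R = 1 + (\<Sum>(a, b, k)\<in>I. snd (KR a b k))"
 have fin: "finite I" by (simp add: I_def)
 have nn: "0 <= (case i of (a, b, k) => fst (KR a b k))" "0 <= (case i of (a, b, k) => snd (KR a b k))" if "i : I" for i
  using that P by (auto simp: I_def P_def less_imp_le split: prod.split)
 show ?thesis
 proof (rule that[of K R])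
  show "0 <= K" unfolding K_def by (rule sum_nonneg) (rule nn)
  have "0 <= R - 1" unfolding R_def by (simp, rule sum_nonneg) (rule nn)
  thus "0<R" by linarith
  fix a b k j assume *: "a<p" "b<N" "k<N"
  hence i: "(a, b, k) : I" by (simp add: I_def)
  have "fst (KR a b k) <= K" unfolding K_def using member_le_sum[where f="%(a, b, k). fst (KR a b k)", OF i nn(1) fin] by simp
  moreover have "snd (KR a b k) <= R" unfolding R_def using member_le_sum[where f="%(a, b, k). snd (KR a b k)", OF i nn(2) fin] by simp
  ultimately show "maj U q der j (geom K R) (C a b k)"
   using P[OF *] maj_le geom_mono unfolding P_def by (meson less_imp_le)
 qed
qed

context spanned_manifold
begin

text \<open>\<open>exp_chart\<close> carried to the manifold. The list \<open>s\<close> consists of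
  a basis in the case of (ii.2) and of all fields in the case of (ii.3). The radius for a
  transported function f is allowed to depend on f.\<close>

lemma exponential_chart:
 assumes c: "c : A" "x0 : fst c" and s: "!!j. j<N ==> s j<q" and nN: "n <= N"
  and det: "fdet n (%i j. wc c (s i) j (snd c x0)) ~= 0"
  and B: "openE n B" "snd c x0 : B" "B \<subseteq> img c"
  and C: "!!a b k. a<n ==> b<N ==> k<N ==> an_dw n B (%j. wc c (s j)) N (C a b k)"
  and br: "!!a b i y. a<n ==> b<N ==> i<n ==> y : B ==>
   bk c (s a) (s b) i y = (\<Sum>k<N. C a b k y * wc c (s k) i y)"
 obtains d \<tau> where "d : A" "0<\<tau>" "fst d \<subseteq> chart_inv c ` B" "img d = cube n (%_. 0) \<tau>" "chart_inv d (%_. 0) = x0"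
  "!!k i. k<N ==> i<n ==> an_pd n (img d) (wc d (s k) i)"
  "!!f. an_dw n B (%j. wc c (s j)) N f ==> EX \<tau>'>0. \<tau>' <= \<tau> &
    an_pd n (cube n (%_. 0) \<tau>') (%t. f (snd c (chart_inv d t)))"
proof -
 define x where "x = snd c x0"
 define w where "w j = wc c (s j)" for j
 define w' where "w' j = wc' c (s j)" for j
 have x: "x : B" "fdet n (%i j. w i j x) ~= 0" using B det by (simp_all add: x_def w_def)
 have xt: "x : spaceE n" using x openin_subset[OF B(1)] by blast
 have pdB: "pd n B (w j i) (w' j i)" if "j<N" "i<n" for j i
  unfolding w_def w'_def by (rule pd_subset[OF wc_pd[OF c(1) s[OF that(1)] that(2)] B(3)])
 show ?thesis
 proof (rule C1_local_bounds[where N=N and w=w and w'=w', OF B(1) x(1) pdB])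
  fix e K L :: real assume e: "0<e" "0 <= K" "0 <= L" "cube n x e \<subseteq> B"
   "!!j i y. j<N ==> i<n ==> y : cube n x e ==> abs (w j i y) <= K"
   "!!j i m y. j<N ==> i<n ==> m<n ==> y : cube n x e ==> abs (w' j i m y) <= L"
   "!!j i y z. j<N ==> i<n ==> y : cube n x e ==> z : cube n x e ==>
    abs (w j i y - w j i z) <= L*(\<Sum>k<n. abs (y k - z k))"
  have Ccube: "an_dw n (cube n x e) w N (C a b k)" if "a<n" "b<N" "k<N" for a b k
   using analytic_dw_subset[OF C[OF that] e(4)] unfolding w_def[abs_def] .
  show ?thesis
  proof (rule analytic_family_majorant[where C=C, OF Ccube])
   fix Kc Rc :: real assume KR: "0 <= Kc" "0<Rc"
    "!!a b k j. a<n ==> b<N ==> k<N ==> maj (cube n x e) N (dw n (cube n x e) w N) j (geom Kc Rc) (C a b k)"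
   interpret E: exp_basis n N w w' x e K L C Kc Rc
   proof
    show "pd n (cube n x e) (w j i) (w' j i)" if "j<N" "i<n" for j i by (rule pd_subset[OF pdB[OF that] e(4)])
    show "(\<Sum>m<n. w a m y * w' b i m y - w b m y * w' a i m y) = (\<Sum>k<N. C a b k y * w k i y)"
     if "a<n" "b<N" "i<n" "y : cube n x e" for a b i y
     using br[OF that(1-3), of y] e(4) that(4) unfolding bk_def w_def w'_def by blast
   qed (rule nN xt e x KR; assumption)+
   show ?thesis
   proof (rule E.exp_chart)
    fix \<tau> W
    let ?Q = "cube n (%_. 0::real) \<tau>"
    assume \<tau>: "0<\<tau>" and \<Phi>in: "!!t. t : ?Q ==> E.\<Phi> t : cube n x e"
     and pd\<Phi>: "!!k. k<n ==> pd n ?Q (%t. E.\<Phi> t k) (E.D k)"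
     and pdD: "!!k i. k<n ==> i<n ==> EX G. pd n ?Q (E.D k i) G"
     and detD: "!!t. t : ?Q ==> fdet n (%i k. E.D k i t) ~= 0"
     and Wan: "!!k i. k<N ==> i<n ==> an_pd n ?Q (W k i)"
     and WD: "!!k m t. k<N ==> m<n ==> t : ?Q ==> (\<Sum>i<n. W k i t * E.D m i t) = w k m (E.\<Phi> t)"
     and inj: "inj_on E.\<Phi> ?Q"
     and f\<Phi>: "!!f. an_dw n (cube n x e) w N f ==> EX \<tau>'>0. \<tau>' <= \<tau> &
      an_pd n (cube n (%_. 0) \<tau>') (%t. f (E.\<Phi> t))"
    have top: "E.\<Phi> t : spaceE n" if "t : ?Q" for t using \<Phi>in[OF that] cube_subset_topspace by blast
    have \<Phi>B: "E.\<Phi> t : B" if "t : ?Q" for t using \<Phi>in[OF that] e(4) by blast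
    have c\<Phi>: "continuous_on ?Q E.\<Phi>"
     by (rule continuous_on_into_Euclidean[of n]) (use pd\<Phi> top in \<open>auto simp: pd_def\<close>)
    have detD': "fdet n (%k i. E.D k i t) ~= 0" if "t : ?Q" for t
     using detD[OF that] fdet_transpose[of n "%k i. E.D k i t"] by simp
    have C2\<Phi>: "C_k_on 2 n ?Q (%t. E.\<Phi> t k)" if k: "k<n" for k
    proof -
     define H where "H i = (SOME G. pd n ?Q (E.D k i) G)" for i
     have "pd n ?Q (E.D k i) (H i)" if "i<n" for i unfolding H_def by (rule someI_ex[OF pdD[OF k that]])
     thus ?thesis unfolding C2_iff[OF openin_cube] using pd\<Phi>[OF k] by blast
    qed
    have O0: "(%_. 0) : ?Q" by (rule cube_center[OF E.O0_top \<tau>])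
    show ?thesis
    proof (rule new_chart[where \<Phi>=E.\<Phi>, OF c(1) openin_cube _ inj C2\<Phi>])
     show "E.\<Phi> t : img c" if "t : ?Q" for t using \<Phi>B[OF that] B(3) by blast
     show "openE n (E.\<Phi> ` ?Q)"
      by (rule injective_imp_open_image[OF openin_cube openin_cube order_refl c\<Phi> top inj])
     show "C_k_on 2 n (E.\<Phi> ` ?Q) (%y. inv_into ?Q E.\<Phi> y i)" if "i<n" for i
      by (rule injective_imp_inverse_C2[where D=E.D, OF openin_cube pd\<Phi> pdD detD' top inj that])
     fix d assume d: "d : A" "fst d = chart_inv c ` E.\<Phi> ` ?Q" "img d = ?Q"
      "!!t. t : ?Q ==> chart_inv d t = chart_inv c (E.\<Phi> t)" "!!t. t : ?Q ==> in_coords d c id t = E.\<Phi> t"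
     have sub: "fst d \<subseteq> chart_inv c ` B" using d(2) \<Phi>B by auto
     have dc: "fst d \<subseteq> fst c" using sub chart_inv_image(3)[OF chart[OF c(1)] B(3)] by blast
     have ov: "ovl d c = ?Q" using dc d(3) by (simp add: inf.absorb1)
     \<comment> \<open>Both functions solve the linear system whose matrix is the Jacobian of
       \<open>E.\<Phi>\<close>, and its determinant does not vanish.\<close>
     have wW: "wc d (s k) i t = W k i t" if k: "k<N" and i: "i<n" and t: "t : ?Q" for k i t
     proof -
      have "(\<Sum>l<n. E.D m l t * wc d (s k) l t) = w k m (E.\<Phi> t)" if m: "m<n" for m
      proof -
       have "partial l (%x. in_coords d c id x m) t = E.D m l t" if l: "l<n" for l
       proof -
        have "partial l (%x. in_coords d c id x m) t = partial l (%t. E.\<Phi> t m) t"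
         by (rule partial_cong[OF openin_cube _ l t]) (simp add: d(5))
        also have "... = E.D m l t" by (rule pd_partial[OF pd\<Phi>[OF m] l t])
        finally show ?thesis .
       qed
       thus ?thesis
        using wc_transform[OF d(1) c(1) _ s[OF k] m, of t] t d(5)[OF t] unfolding ov w_def by (simp add: mult.commute)
      qed
      from fdet_solve[where m="%m l. E.D m l t" and v="%l. wc d (s k) l t", OF this i]
      have 1: "fdet n (%m l. E.D m l t) * wc d (s k) i t = (\<Sum>m<n. fadj n (%m l. E.D m l t) i m * w k m (E.\<Phi> t))" .
      have "(\<Sum>l<n. E.D m l t * W k l t) = w k m (E.\<Phi> t)" if "m<n" for m
       using WD[OF k that t] by (simp add: mult.commute)
      from fdet_solve[where m="%m l. E.D m l t" and v="%l. W k l t", OF this i]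
      have 2: "fdet n (%m l. E.D m l t) * W k i t = (\<Sum>m<n. fadj n (%m l. E.D m l t) i m * w k m (E.\<Phi> t))" .
      have "fdet n (%m l. E.D m l t) * wc d (s k) i t = fdet n (%m l. E.D m l t) * W k i t"
       by (rule trans[OF 1 2[symmetric]])
      thus ?thesis using detD'[OF t] by (simp only: mult_cancel_left simp_thms)
     qed
     show ?thesis
     proof (rule that[OF d(1) \<tau> sub d(3)])
      show "chart_inv d (%_. 0) = x0"
       using d(4)[OF O0] E.\<Phi>_0 chart_facts(4)[OF chart[OF c(1)] c(2)] by (simp add: x_def)
      show "an_pd n (img d) (wc d (s k) i)" if "k<N" "i<n" for k i
       unfolding d(3) by (rule derivation_system.an_cong[OF derivation_pd[OF openin_cube] Wan[OF that]]) (rule wW[OF that])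
      fix f assume "an_dw n B (%j. wc c (s j)) N f"
      hence "an_dw n (cube n x e) w N f"
       using analytic_dw_subset[OF _ e(4)] unfolding w_def[abs_def] by blast
      from f\<Phi>[OF this] obtain \<tau>' where \<tau>': "0<\<tau>'" "\<tau>' <= \<tau>"
       and fa: "an_pd n (cube n (%_. 0) \<tau>') (%t. f (E.\<Phi> t))" by blast
      have "f (snd c (chart_inv d t)) = f (E.\<Phi> t)" if "t : cube n (%_. 0) \<tau>'" for t
      proof -
       have t: "t : ?Q" using that cube_mono[OF \<tau>'(2)] by blast
       have "E.\<Phi> t : img c" using \<Phi>B[OF t] B(3) by blast
       thus ?thesis using d(4)[OF t] chart_facts(5)[OF chart[OF c(1)]] by simp
      qed
      from derivation_system.an_cong[OF derivation_pd[OF openin_cube] fa this]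
      show "EX \<tau>'>0. \<tau>' <= \<tau> & an_pd n (cube n (%_. 0) \<tau>') (%t. f (snd c (chart_inv d t)))"
       using \<tau>' by blast
     qed
    qed
   qed
  qed
 qed
qed

lemma C_X_omega_subset:
 assumes f: "C_X_omega S n A q Y V f" and V': "V' \<subseteq> V"
 shows "C_X_omega S n A q Y V' f"
proof -
 obtain r where r: "0<r" "C_X_omega_r S n A q Y r V f" using f unfolding C_X_omega_def by blast
 have "suminf (%k. ennreal (r ^ k / fact k)*(\<Sum>al | al : lists {..<q} & length al = k. (SUP x\<in>V'. ennreal (abs (word_deriv S n A Y al f x)))))
   <= suminf (%k. ennreal (r ^ k / fact k)*(\<Sum>al | al : lists {..<q} & length al = k. (SUP x\<in>V. ennreal (abs (word_deriv S n A Y al f x)))))"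
  by (intro suminf_le mult_left_mono sum_mono SUP_subset_mono V') auto
 also have "... < \<infinity>" using r(2) unfolding C_X_omega_r_def by blast
 finally have "C_X_omega_r S n A q Y r V' f"
  using r(2) V' bounded_subset[OF _ image_mono[OF V']] continuous_map_from_subtopology_mono[OF _ V']
  unfolding C_X_omega_r_def by blast
 thus ?thesis unfolding C_X_omega_def using r(1) by blast
qed

lemma C_X_omega_imp_dw:
 assumes c: "c : A" and V: "openin S V" and f: "C_X_omega S n A q Y V f"
 shows "an_dw n (snd c ` (V \<inter> fst c)) (wc c) q (f o chart_inv c)"
 by (rule C_X_omega_imp_analytic[OF c _ _ C_X_omega_subset[OF f]])
  (auto intro: openin_Int V chart_facts(1)[OF chart[OF c]])

lemma bracket_in_chart:
 assumes c: "c : A" and comb: "combination_on n A V (lie_bracket n (Y a) (Y b)) N f Y"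
  and y: "y : snd c ` (V \<inter> fst c)" and i: "i<n"
 shows "bk c a b i y = (\<Sum>k<N. f k (chart_inv c y) * wc c k i y)"
proof -
 obtain z where z: "z : V" "z : fst c" "y = snd c z" using y by blast
 have "lie_bracket n (Y a) (Y b) c z i = (\<Sum>k<N. f k z * Y k c z i)" using comb c z i unfolding combination_on_def by blast
 thus ?thesis using z chart_facts(4)[OF chart[OF c] z(2)] by (simp add: lie_bracket_chart[OF c z(2)] wc_def)
qed

text \<open>The reordering puts a basis first, but all q fields enter the construction; each of them
  is therefore analytic in the new chart.\<close>

lemma brackets_imp_an_chart:
 assumes x0: "x0 : topspace S" and br: "analytic_brackets_near S n A q Y x0"
  and \<sigma>: "bij_betw \<sigma> {..<q} {..<q}" "n <= q" "independent_at n A x0 n (Y o \<sigma>)"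
 shows "EX d. an_chart d & x0 : fst d"
proof -
 obtain V C where V: "openin S V" "x0 : V"
  and comb: "!!i j. i<q ==> j<q ==> combination_on n A V (lie_bracket n (Y i) (Y j)) q (C i j) Y"
  and CX: "!!i j k. i<q ==> j<q ==> k<q ==> C_X_omega S n A q Y V (C i j k)"
  using br unfolding analytic_brackets_near_def by blast
 obtain c where c: "c : A" "x0 : fst c" using cover[OF x0] by blast
 note ch = chart[OF c(1)]
 have s: "\<sigma> j<q" if "j<q" for j using bij_betwE[OF \<sigma>(1)] that by blast
 define B where "B = snd c ` (V \<inter> fst c)"
 have B: "openE n B" "snd c x0 : B" "B \<subseteq> img c"
  unfolding B_def using chart_open_image[OF ch openin_Int[OF V(1) chart_facts(1)[OF ch]]] V(2) c(2) by auto
 have det: "fdet n (%i j. wc c (\<sigma> i) j (snd c x0)) ~= 0"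
 proof -
  have "fdet n (%i j. wc c (\<sigma> j) i (snd c x0)) ~= 0"
  proof (rule fdet_nonzero)
   fix v :: "nat => real" assume v: "!!i. i<n ==> (\<Sum>j<n. wc c (\<sigma> j) i (snd c x0) * v j) = 0"
   have "ALL i<n. (\<Sum>k<n. v k*(Y o \<sigma>) k c x0 i) = 0"
    using v chart_facts(4)[OF ch c(2)] by (simp add: wc_def mult.commute)
   thus "ALL j<n. v j = 0" using \<sigma>(3) c unfolding independent_at_def by blast
  qed
  thus ?thesis using fdet_transpose[of n "%i j. wc c (\<sigma> i) j (snd c x0)"] by simp
 qed
 define C' where "C' a b k = C (\<sigma> a) (\<sigma> b) (\<sigma> k) o chart_inv c" for a b k
 show ?thesis
 proof (rule exponential_chart[where N=q and s=\<sigma> and C=C', OF c s \<sigma>(2) det B])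
  show "an_dw n B (%j. wc c (\<sigma> j)) q (C' a b k)" if "a<n" "b<q" "k<q" for a b k
   unfolding C'_def B_def
   by (rule analytic_dw_reindex[OF C_X_omega_imp_dw[OF c(1) V(1) CX] s]) (use that \<sigma>(2) s in auto)
  show "bk c (\<sigma> a) (\<sigma> b) i y = (\<Sum>k<q. C' a b k y * wc c (\<sigma> k) i y)" if "a<n" "b<q" "i<n" "y : B" for a b i y
  proof -
   have "a<q" using that(1) \<sigma>(2) by simp
   hence "bk c (\<sigma> a) (\<sigma> b) i y = (\<Sum>k<q. C (\<sigma> a) (\<sigma> b) k (chart_inv c y) * wc c k i y)"
    using that(4) unfolding B_def by (intro bracket_in_chart[OF c(1) comb] s that)
   also have "... = (\<Sum>k<q. C' a b k y * wc c (\<sigma> k) i y)"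
    unfolding C'_def comp_def by (rule sum.reindex_bij_betw[OF \<sigma>(1), symmetric])
   finally show ?thesis .
  qed
  fix d \<tau> assume d: "d : A" "0<\<tau>" "img d = cube n (%_. 0) \<tau>" "chart_inv d (%_. 0) = x0"
   and an: "!!k i. k<q ==> i<n ==> an_pd n (img d) (wc d (\<sigma> k) i)"
  have "an_pd n (img d) (wc d j i)" if "j<q" "i<n" for j i
  proof -
   have "j : \<sigma> ` {..<q}" using \<sigma>(1) that(1) by (simp add: bij_betw_def)
   thus ?thesis using an that(2) by auto
  qed
  hence "an_chart d" using d(1) by (simp add: an_chart_def)
  moreover have "x0 : fst d"
   using chart_facts(6)[OF chart[OF d(1)], of "%_. 0"] d(3,4) cube_center[of "%_. 0" n \<tau>] d(2) by (simp add: topspace_Euclidean_space)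
  ultimately show ?thesis by blast
 qed
qed

text \<open>The construction makes the n basis fields analytic. The remaining ones follow from their
  expansions, whose coefficients become analytic in the new coordinates after shrinking the
  cube.\<close>

lemma basis_imp_an_chart:
 assumes x0: "x0 : topspace S" and ba: "analytic_basis_near S n A q Y x0"
  and nq: "n <= q" and ind: "independent_at n A x0 n Y"
 shows "EX d. an_chart d & x0 : fst d"
proof -
 interpret an: func_class n "%U f. an_pd n U f" by (rule func_class_analytic)
 obtain V C b where H: "openin S V & x0 : V &
   (ALL i<n. ALL j<n. combination_on n A V (lie_bracket n (Y i) (Y j)) n (C i j) Y &
     (ALL k<n. C_X_omega S n A q Y V (C i j k))) &
   (ALL j. n <= j & j<q --> combination_on n A V (Y j) n (b j) Y & (ALL k<n. C_X_omega S n A q Y V (b j k)))"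
  using ba unfolding analytic_basis_near_def by (elim exE) (rule that)
 have V: "openin S V" "x0 : V"
  and comb: "!!i j. i<n ==> j<n ==> combination_on n A V (lie_bracket n (Y i) (Y j)) n (C i j) Y"
  and CX: "!!i j k. i<n ==> j<n ==> k<n ==> C_X_omega S n A q Y V (C i j k)"
  and combb: "!!j. n <= j ==> j<q ==> combination_on n A V (Y j) n (b j) Y"
  and bX: "!!j k. n <= j ==> j<q ==> k<n ==> C_X_omega S n A q Y V (b j k)"
  using H by simp_all
 obtain c where c: "c : A" "x0 : fst c" using cover[OF x0] by blast
 note ch = chart[OF c(1)]
 define B where "B = snd c ` (V \<inter> fst c)"
 have B: "openE n B" "snd c x0 : B" "B \<subseteq> img c"
  unfolding B_def using chart_open_image[OF ch openin_Int[OF V(1) chart_facts(1)[OF ch]]] V(2) c(2) by auto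
 have s: "j<q" if "j<n" for j using that nq by simp
 have CB: "an_dw n B (wc c) n (f o chart_inv c)" if "C_X_omega S n A q Y V f" for f
  unfolding B_def using analytic_dw_reindex[where s="%j. j", OF C_X_omega_imp_dw[OF c(1) V(1) that] s] .
 show ?thesis
 proof (rule exponential_chart[where N=n and s="%j. j" and C="%i j k. C i j k o chart_inv c",
    OF c s order_refl independent_imp_det[OF c ind] B])
  show "an_dw n B (wc c) n (C i j k o chart_inv c)" if "i<n" "j<n" "k<n" for i j k
   by (rule CB[OF CX[OF that]])
  show "bk c a b' i y = (\<Sum>k<n. (C a b' k o chart_inv c) y * wc c k i y)" if "a<n" "b'<n" "i<n" "y : B" for a b' i y
   using bracket_in_chart[OF c(1) comb[OF that(1,2)] _ that(3), of y] that(4) by (simp add: B_def)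
  fix d \<tau> assume d: "d : A" "0<\<tau>" "fst d \<subseteq> chart_inv c ` B" "img d = cube n (%_. 0) \<tau>" "chart_inv d (%_. 0) = x0"
   and wan: "!!k i. k<n ==> i<n ==> an_pd n (img d) (wc d k i)"
   and fan: "!!f. an_dw n B (wc c) n f ==> EX \<tau>'>0. \<tau>' <= \<tau> &
    an_pd n (cube n (%_. 0) \<tau>') (%t. f (snd c (chart_inv d t)))"
  note cd = chart[OF d(1)]
  have Bim: "chart_inv c ` B = V \<inter> fst c" unfolding B_def by (rule image_chart_inv[OF ch]) auto
  have dV: "y : V" "y : fst c" if "y : fst d" for y using that d(3) Bim by auto
  \<comment> \<open>The radius depends on the coefficient function; as there are finitely many of
    them, \<open>ex_common_pos\<close> finds a common one.\<close>
  define P where "P f \<tau>' \<longleftrightarrow> \<tau>' <= \<tau> & an_pd n (cube n (%_. 0) \<tau>') (%t. f (chart_inv d t))"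
   for f :: "'a => real" and \<tau>'
  have Pm: "P f \<tau>''" if "P f \<tau>'" "0<\<tau>''" "\<tau>'' <= \<tau>'" for f \<tau>' \<tau>''
   using that an.cl_subset[OF _ cube_mono[OF that(3)] openin_cube] unfolding P_def by fastforce
  have "EX \<tau>'>0. ALL j<q. ALL k<n. n <= j --> P (b j k) \<tau>'"
  proof (intro ex_common_pos)
   fix j k assume j: "j<q" and k: "k<n"
   show "EX \<tau>'>0. n <= j --> P (b j k) \<tau>'"
   proof (cases "n <= j")
    case True
    obtain \<tau>' where \<tau>': "0<\<tau>'" "\<tau>' <= \<tau>" and fa: "an_pd n (cube n (%_. 0) \<tau>')
      (%t. (b j k o chart_inv c) (snd c (chart_inv d t)))"
     using fan[OF CB[OF bX[OF True j k]]] by blast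
    have "b j k (chart_inv d t) = (b j k o chart_inv c) (snd c (chart_inv d t))" if "t : cube n (%_. 0) \<tau>'" for t
    proof -
     have "t : img d" using that cube_mono[OF \<tau>'(2)] d(4) by blast
     hence "chart_inv d t : fst c" using dV chart_facts(6)[OF cd] by blast
     thus ?thesis using chart_facts(4)[OF ch] by simp
    qed
    from derivation_system.an_cong[OF derivation_pd[OF openin_cube] fa this] \<tau>'
    show ?thesis unfolding P_def by blast
   next
    case False
    thus ?thesis by (intro exI[of _ 1]) simp
   qed
  qed (use Pm in blast)+
  then obtain \<tau>1 where \<tau>1: "0<\<tau>1" "!!j k. j<q ==> k<n ==> n <= j ==> P (b j k) \<tau>1" by blast
  define \<tau>2 where "\<tau>2 = min \<tau> \<tau>1"
  have \<tau>2: "0<\<tau>2" "\<tau>2 <= \<tau>" using \<tau>1 d(2) by (auto simp: \<tau>2_def)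
  let ?Q = "cube n (%_. 0::real) \<tau>2"
  have Qd: "?Q \<subseteq> img d" unfolding d(4) by (rule cube_mono[OF \<tau>2(2)])
  have wd: "an_pd n ?Q (wc d j i)" if j: "j<q" and i: "i<n" for j i
  proof (cases "n <= j")
   case False
   hence "j<n" by simp
   thus ?thesis by (rule an.cl_subset[OF wan[OF _ i] Qd openin_cube])
  next
   case True
   have "P (b j k) \<tau>2" if "k<n" for k
    by (rule Pm[OF \<tau>1(2)[OF j that True] \<tau>2(1)]) (simp add: \<tau>2_def)
   hence "an_pd n ?Q (%t. \<Sum>k<n. b j k (chart_inv d t) * wc d k i t)"
    by (intro an.cl_sum an.cl_mult openin_cube finite_lessThan an.cl_subset[OF wan[OF _ i] Qd openin_cube])
     (auto simp: P_def)
   thus ?thesis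
   proof (rule derivation_system.an_cong[OF derivation_pd[OF openin_cube]])
    fix t assume "t : ?Q"
    hence "chart_inv d t : fst d" using chart_facts(6)[OF cd] Qd by blast
    thus "wc d j i t = (\<Sum>k<n. b j k (chart_inv d t) * wc d k i t)"
     using combb[OF True j] d(1) dV(1) i unfolding combination_on_def wc_def by blast
   qed
  qed
  show ?thesis
  proof (rule restrict_chart[OF d(1) openin_cube Qd])
   fix d' assume d': "d' : A" "fst d' = chart_inv d ` ?Q" "img d' = ?Q"
    "!!j i t. j<q ==> i<n ==> t : ?Q ==> wc d' j i t = wc d j i t"
   have "an_pd n (img d') (wc d' j i)" if "j<q" "i<n" for j i
    unfolding d'(3) by (rule derivation_system.an_cong[OF derivation_pd[OF openin_cube] wd[OF that]]) (rule d'(4)[OF that])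
   hence "an_chart d'" using d'(1) by (simp add: an_chart_def)
   moreover have "x0 : fst d'"
    unfolding d'(2) d(5)[symmetric] by (rule imageI, rule cube_center[OF _ \<tau>2(1)]) (simp add: topspace_Euclidean_space)
   ultimately show ?thesis by blast
  qed
 qed
qed

section \<open>Reorderings, equivalence of the local conditions and the global atlas\<close>

lemma good_ordering_exists:
 assumes x0: "x0 : topspace S"
 obtains \<sigma> where "bij_betw \<sigma> {..<q} {..<q}" "n <= q" "independent_at n A x0 n (Y o \<sigma>)"
proof -
 obtain c where c: "c : A" "x0 : fst c" using cover[OF x0] by blast
 have x: "snd c x0 : img c" using c by blast
 obtain s where s: "!!i. i<n ==> s i<q" and det: "fdet n (%i j. wc c (s i) j (snd c x0)) ~= 0"
  using spanning_imp_basis[where W="%k i. wc c k i (snd c x0)", OF wc_span[OF c(1) x]] by blast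
 have inj: "inj_on s {..<n}"
 proof (rule inj_onI)
  fix i j assume "i : {..<n}" "j : {..<n}" "s i = s j"
  thus "i = j" using fdet_rows_distinct[OF det, of i j] by auto
 qed
 obtain \<sigma> where \<sigma>: "bij_betw \<sigma> {..<q} {..<q}" "n <= q" "!!i. i<n ==> \<sigma> i = s i"
  using extend_to_bij[OF inj] s by (metis image_subsetI lessThan_iff)
 have "fdet n (%i j. wc c (\<sigma> i) j (snd c x0)) = fdet n (%i j. wc c (s i) j (snd c x0))"
  by (rule fdet_cong) (simp add: \<sigma>(3))
 hence det\<sigma>: "fdet n (%i j. wc c (\<sigma> i) j (snd c x0)) ~= 0" using det by simp
 have "independent_at n A x0 n (Y o \<sigma>)"
  by (rule det_imp_independent[OF c _ det\<sigma>]) (use \<sigma>(3) s in simp)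
 thus ?thesis using that \<sigma> by blast
qed

lemma permuted:
 assumes \<sigma>: "bij_betw \<sigma> {..<q} {..<q}"
 shows "spanned_manifold S n q A (Y o \<sigma>)"
proof
 have s: "\<sigma> j<q" if "j<q" for j using bij_betwE[OF \<sigma>] that by blast
 show "is_manifold (C_k_on 2) n S A" by (rule mfd)
 show "vector_field (C_k_on 1) S n A ((Y o \<sigma>) j)" if "j<q" for j using vf[OF s[OF that]] by simp
 show "spanning_on n A (topspace S) q (Y o \<sigma>)"
  unfolding spanning_on_def
 proof (intro ballI allI)
  fix c y v assume "c : A" "y : topspace S \<inter> fst c"
  then obtain a where a: "ALL i<n. v i = (\<Sum>k<q. a k * Y k c y i)" using span unfolding spanning_on_def by blast
  have "(\<Sum>k<q. a (\<sigma> k) * Y (\<sigma> k) c y i) = (\<Sum>k<q. a k * Y k c y i)" for i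
   by (rule sum.reindex_bij_betw[OF \<sigma>])
  thus "EX a. ALL i<n. v i = (\<Sum>k<q. a k*(Y o \<sigma>) k c y i)" using a by (intro exI[of _ "a o \<sigma>"]) simp
 qed
qed

lemma coordinates_permuted:
 assumes \<sigma>: "bij_betw \<sigma> {..<q} {..<q}"
 shows "analytic_coordinates_near S n A q (Y o \<sigma>) x0 \<longleftrightarrow> analytic_coordinates_near S n A q Y x0"
proof -
 have "(ALL j<q. P ((Y o \<sigma>) j)) \<longleftrightarrow> (ALL j<q. P (Y j))" for P
  using \<sigma> by (auto simp: bij_betw_def) (metis imageE lessThan_iff)
 from this[of "%X. EX W. F_related (subtopology (Euclidean_space n) _) n {(_, id)} n A _ (%_. W) X & C_omega n n _ W"]
 show ?thesis unfolding analytic_coordinates_near_def by simp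
qed

lemma coordinates_iff_an_chart:
 "analytic_coordinates_near S n A q Y x0 \<longleftrightarrow> (EX c. an_chart c & x0 : fst c)"
 using coordinates_imp_an_chart an_chart_imp_coordinates by blast

lemma coordinates_iff_brackets:
 assumes "x0 : topspace S"
 shows "analytic_coordinates_near S n A q Y x0 \<longleftrightarrow> analytic_brackets_near S n A q Y x0"
 using good_ordering_exists[OF assms] brackets_imp_an_chart[OF assms] coordinates_iff_an_chart coordinates_imp_brackets
 by metis

lemma coordinates_iff_basis:
 assumes "x0 : topspace S" "n <= q" "independent_at n A x0 n Y"
 shows "analytic_coordinates_near S n A q Y x0 \<longleftrightarrow> analytic_basis_near S n A q Y x0"
 using basis_imp_an_chart[OF assms(1) _ assms(2,3)] coordinates_imp_basis[OF assms(3,2)] coordinates_iff_an_chart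
 by blast

lemma atlas_imp_coordinates:
 assumes B: "analytic_atlas_for S n A q Y B" and x0: "x0 : topspace S"
 shows "analytic_coordinates_near S n A q Y x0"
proof -
 interpret an: func_class n "%U f. an_pd n U f" by (rule func_class_analytic)
 obtain c where c: "c : B" "x0 : fst c" using B x0 unfolding analytic_atlas_for_def is_atlas_def by blast
 have cA: "c : A" using B c unfolding analytic_atlas_for_def by blast
 note ch = chart[OF cA]
 have rc: "real_analytic_on n (img c) (wc c j i)" if "j<q" "i<n" for j i
  using B c that unfolding analytic_atlas_for_def regular_components_def wc_def[abs_def] by blast
 have x: "snd c x0 : img c" using c by blast
 have "EX e>0. cube n (snd c x0) e \<subseteq> img c &
   (ALL j<q. ALL i<n. an_pd n (cube n (snd c x0) e) (wc c j i))"
  by (rule analytic_common_cube[where F="wc c", OF chart_facts(2)[OF ch] rc chart_facts(2)[OF ch] order_refl x])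
 then obtain e where e: "0<e" "cube n (snd c x0) e \<subseteq> img c"
  and we: "ALL j<q. ALL i<n. an_pd n (cube n (snd c x0) e) (wc c j i)" by blast
 let ?Q = "cube n (snd c x0) e"
 show ?thesis
 proof (rule restrict_chart[OF cA openin_cube e(2)])
  fix d assume d: "d : A" "fst d = chart_inv c ` ?Q" "img d = ?Q"
   "!!j i t. j<q ==> i<n ==> t : ?Q ==> wc d j i t = wc c j i t"
  have "an_pd n (img d) (wc d j i)" if "j<q" "i<n" for j i
   unfolding d(3) by (rule derivation_system.an_cong[OF derivation_pd[OF openin_cube]]) (use we that d(4) in auto)
  hence dc: "an_chart d" using d(1) by (simp add: an_chart_def)
  have "snd c x0 : ?Q" by (rule cube_center[OF _ e(1)]) (use x openin_subset[OF chart_facts(2)[OF ch]] in blast)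
  hence "x0 : fst d" unfolding d(2) chart_inv_image(1)[OF ch e(2)] using c by blast
  thus ?thesis using an_chart_imp_coordinates[OF dc] by blast
 qed
qed

lemma coordinates_imp_atlas:
 assumes co: "!!x0. x0 : topspace S ==> analytic_coordinates_near S n A q Y x0"
 shows "EX B. analytic_atlas_for S n A q Y B"
proof -
 \<comment> \<open>All charts of the maximal atlas with real analytic components. The local
   conditions make them a cover, and \<open>analytic_transition\<close> makes any two
   compatible.\<close>
 define B where "B = {c : A. ALL j<q. ALL i<n. real_analytic_on n (img c) (wc c j i)}"
 have an: "c : B" if "an_chart c" for c
  using that chart chart_facts(2) analytic_imp_real_analytic unfolding an_chart_def B_def by blast
 have "\<Union> (fst ` B) = topspace S"
 proof
  show "\<Union> (fst ` B) \<subseteq> topspace S" using chart chart_facts(7) by (fastforce simp: B_def)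
  show "topspace S \<subseteq> \<Union> (fst ` B)" using co an coordinates_iff_an_chart by blast
 qed
 moreover have "compatible_charts real_analytic_on n c d" if "c : B" "d : B" for c d
 proof -
  have "real_analytic_on n (ovl d c) (%x. in_coords d c id x i)" if "i<n" for i
   by (rule analytic_transition[OF _ _ _ _ that]) (use \<open>c : B\<close> \<open>d : B\<close> in \<open>auto simp: B_def\<close>)
  moreover have "real_analytic_on n (ovl c d) (%x. in_coords c d id x i)" if "i<n" for i
   by (rule analytic_transition[OF _ _ _ _ that]) (use \<open>c : B\<close> \<open>d : B\<close> in \<open>auto simp: B_def\<close>)
  ultimately show ?thesis unfolding compatible_charts_def by (simp add: Int_commute)
 qed
 ultimately have "is_atlas real_analytic_on n S B" unfolding is_atlas_def using chart by (auto simp: B_def)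
 hence "analytic_atlas_for S n A q Y B"
  unfolding analytic_atlas_for_def regular_components_def by (auto simp: B_def wc_def[abs_def])
 thus ?thesis by blast
qed

lemma atlas_unique:
 assumes B: "analytic_atlas_for S n A q Y B" and B': "analytic_atlas_for S n A q Y B'"
 shows "diffeo real_analytic_on S n B S n B' id id"
proof -
 have rc: "real_analytic_on n (img c) (wc c j i)" "c : A" if "analytic_atlas_for S n A q Y B" "c : B" "j<q" "i<n" for B c j i
  using that unfolding analytic_atlas_for_def regular_components_def wc_def[abs_def] by blast+
 have "regular_map real_analytic_on S n B S n B' id" if B: "analytic_atlas_for S n A q Y B" and B': "analytic_atlas_for S n A q Y B'" for B B'
  unfolding regular_map_def
 proof (intro conjI ballI allI impI)
  show "continuous_map S S id" by simp
  fix c d i assume c: "c : B" and d: "d : B'" and i: "i<n"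
  have cd: "c : A" "d : A" using B B' c d unfolding analytic_atlas_for_def by blast+
  have "snd c ` {y : topspace S \<inter> fst c. id y : fst d} = ovl c d" using chart_facts(7)[OF chart[OF cd(1)]] by auto
  moreover have "real_analytic_on n (ovl c d) (%x. in_coords c d id x i)"
   by (rule analytic_transition[OF cd rc(1)[OF B c] rc(1)[OF B' d] i])
  ultimately show "real_analytic_on n (snd c ` {y : topspace S \<inter> fst c. id y : fst d}) (%x. in_coords c d id x i)" by simp
 qed
 thus ?thesis using assms unfolding diffeo_def by (simp add: homeomorphic_maps_id)
qed

end

theorem theorem3p4:
  fixes T S :: "'a topology" and m n q :: nat and \<AA> A :: "'a chart set"
    and X Y :: "nat \<Rightarrow> 'a vfield" and p :: 'a and M :: "'a set"
  assumes "is_manifold (C_k_on 2) m T \<AA>"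
    and "\<forall>j<q. vector_field (C_k_on 1) T m \<AA> (X j)"
    and "p \<in> topspace T"
    and "openin (sR_topology T m \<AA> q X p) M"
    and "connectedin (sR_topology T m \<AA> q X p) M"
    and "p \<in> M"
    and "S = subtopology (sR_topology T m \<AA> q X p) M"
    and "\<exists>a. (\<forall>i<q. \<forall>j<q. \<forall>k<q. locally_bounded S (a i j k)) \<and>
             (\<forall>i<q. \<forall>j<q. combination_on m \<AA> M (lie_bracket m (X i) (X j)) q (a i j) X)"
    and "canonical_C2_structure T m \<AA> q X S n A Y"
  shows "(\<forall>x0\<in>M.
            good_orderings n A q Y x0 \<noteq> {} \<and>
            (\<forall>Y' \<in> good_orderings n A q Y x0.
               analytic_coordinates_near S n A q Y x0 \<longleftrightarrow> analytic_basis_near S n A q Y' x0) \<and>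
            (analytic_coordinates_near S n A q Y x0 \<longleftrightarrow> analytic_brackets_near S n A q Y x0)) \<and>
         ((\<exists>B. analytic_atlas_for S n A q Y B) \<longleftrightarrow>
            (\<forall>x0\<in>M. analytic_coordinates_near S n A q Y x0)) \<and>
         (\<forall>B B'. analytic_atlas_for S n A q Y B \<and> analytic_atlas_for S n A q Y B' \<longrightarrow>
            diffeo real_analytic_on S n B S n B' id id)"
proof -
 interpret spanned_manifold S n q A Y
  using assms(9) unfolding canonical_C2_structure_def by unfold_locales auto
 have SM: "topspace S = M" using openin_subset[OF assms(4)] unfolding assms(7) by auto
 have good: "good_orderings n A q Y x0 ~= {}" if x0: "x0 : M" for x0
  by (rule good_ordering_exists[of x0]) (use x0 SM in \<open>auto simp: good_orderings_def\<close>)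
 \<comment> \<open>(ii.2) refers to an ordering and (ii.1) is invariant under reordering, so the
   equivalence is proved for the permuted fields and then carried back.\<close>
 have basis: "analytic_coordinates_near S n A q Y x0 \<longleftrightarrow> analytic_basis_near S n A q Y' x0"
  if x0: "x0 : M" and Y': "Y' : good_orderings n A q Y x0" for x0 Y'
 proof -
  obtain \<sigma> where \<sigma>: "bij_betw \<sigma> {..<q} {..<q}" "n <= q" "independent_at n A x0 n (Y o \<sigma>)" "Y' = Y o \<sigma>"
   using Y' unfolding good_orderings_def by blast
  interpret P: spanned_manifold S n q A "Y o \<sigma>" by (rule permuted[OF \<sigma>(1)])
  show ?thesis
   using P.coordinates_iff_basis[OF _ \<sigma>(2,3)] coordinates_permuted[OF \<sigma>(1)] x0 SM \<sigma>(4) by blast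
 qed
 have "(EX B. analytic_atlas_for S n A q Y B) \<longleftrightarrow> (ALL x0:M. analytic_coordinates_near S n A q Y x0)"
  using atlas_imp_coordinates coordinates_imp_atlas SM by blast
 thus ?thesis using good basis coordinates_iff_brackets atlas_unique SM by blast
qed

end
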